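(* Let $d\ge2$ and let $\phi(w)=\sum_{0\le j\le d}\phi_jw^j$ with $\phi_j\ge0$ for $0\le j\le d$ and $\phi_0,\phi_d>0$. Let $Y_{n,k}$ be the number of nodes at level $k$ in a random increasing tree of $n$ nodes from the variety with degree function $\phi$. Let $W_n=\max_kY_{n,k}$ and let $k^*$ be one of the levels with $Y_{n,k^*}=W_n$. Then, as $n\to\infty$ (through sizes $n$ for which the variety contains trees), with $\sigma^2=\frac{d}{d-1}$, $$\mathbb{E}\{W_n\}=\frac{n}{\sqrt{2\pi\sigma^2L_n}}\bigl(1+O(L_n^{-1})\bigr),$$ $$\mathbb{E}\{|W_n-\mathbb{E}\{W_n\}|^s\}=O\bigl(n^sL_n^{-3s/2}\bigr)\qquad(s\ge0),$$ and, for every $B>0$, there is $T_0>1$ such that for $T>T_0$ $$\mathbb{P}\Bigl(\Bigl|k^*-\frac{d}{d-1} L_n\Bigr|\ge T\Bigr)=O(T^{-B}),$$ with implied constant independent of $n$ and $T$.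
   Context: $L_n:=\max\{\log n,1\}$ (natural logarithm). An increasing tree of $n$ nodes is a rooted ordered tree with nodes labeled $1,\dots,n$ whose labels increase along every path down from the root. In the variety with degree function $\phi$, a tree has weight $\prod_v\phi_{\deg(v)}$, where $\deg(v)$ is the number of children of $v$; the total weight $\tau_n$ of the trees of $n$ nodes has exponential generating function $\tau(z)=\sum_{n\ge1}\tau_nz^n/n!$ satisfying $\tau'(z)=\phi(\tau(z))$, $\tau(0)=0$. A random tree of $n$ nodes (for $\tau_n>0$) is chosen with probability equal to its weight divided by $\tau_n$. The root is at level $0$. *)

theory Defs
  imports
    "HOL-Probability.Probability"
    "HOL-Computational_Algebra.Polynomial"
    "HOL-Library.Landau_Symbols"
begin

datatype otree = Node (root_label: nat) (subtrees: "otree list")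

primrec labels :: "otree \<Rightarrow> nat list" where
  "labels (Node a ts) = a # concat (map labels ts)"

fun increasing :: "otree \<Rightarrow> bool" where
  "increasing (Node a ts) \<longleftrightarrow> (\<forall>t\<in>set ts. a < root_label t \<and> increasing t)"

definition inc_trees :: "nat \<Rightarrow> otree set" where
  "inc_trees n = {t. distinct (labels t) \<and> set (labels t) = {1..n} \<and> increasing t}"

text \<open>The degree function is a polynomial; its coefficient of index \<open>j\<close> is the weight of a node
  with \<open>j\<close> children.\<close>

primrec tree_weight :: "real poly \<Rightarrow> otree \<Rightarrow> real" where
  "tree_weight \<phi> (Node a ts) = coeff \<phi> (length ts) * prod_list (map (tree_weight \<phi>) ts)"

definition total_weight :: "real poly \<Rightarrow> nat \<Rightarrow> real" where
  "total_weight \<phi> n = (\<Sum>t\<in>inc_trees n. tree_weight \<phi> t)"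

text \<open>Meaningful only if the coefficients are nonnegative and the total weight is positive;
  see \<open>pmf_random_inc_tree\<close> below.\<close>

definition random_inc_tree :: "real poly \<Rightarrow> nat \<Rightarrow> otree pmf" where
  "random_inc_tree \<phi> n =
     embed_pmf (\<lambda>t. if t \<in> inc_trees n then tree_weight \<phi> t / total_weight \<phi> n else 0)"

fun level_size :: "otree \<Rightarrow> nat \<Rightarrow> nat" where
  "level_size (Node a ts) 0 = 1"
| "level_size (Node a ts) (Suc k) = (\<Sum>t\<leftarrow>ts. level_size t k)"

text \<open>The maximum is over a finite set, by \<open>finite_range_level_size\<close> below.\<close>

definition width :: "otree \<Rightarrow> nat" where
  "width t = Max (range (level_size t))"

definition expected_width :: "real poly \<Rightarrow> nat \<Rightarrow> real" where
  "expected_width \<phi> n =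
     measure_pmf.expectation (random_inc_tree \<phi> n) (\<lambda>t. real (width t))"

definition Lg :: "nat \<Rightarrow> real" where
  "Lg n = max (ln (real n)) 1"

text \<open>The limit \<open>n \<rightarrow> \<infinity>\<close> through the sizes for which the variety contains trees.\<close>

definition sizes_to_infinity :: "real poly \<Rightarrow> nat filter" where
  "sizes_to_infinity \<phi> = inf at_top (principal {n. total_weight \<phi> n > 0})"

lemma finite_bounded_otrees: "finite {t. set (labels t) \<subseteq> {..n} \<and> length (labels t) \<le> m}"
proof (induction m)
  case 0
  have "labels t \<noteq> []" for t by (cases t) auto
  then show ?case by simp
next
  case (Suc m)
  let ?S = "{t. set (labels t) \<subseteq> {..n} \<and> length (labels t) \<le> m}"
  have len: "length ts \<le> length (concat (map labels ts))" for ts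
  proof (induction ts)
    case (Cons t ts)
    then show ?case by (cases t) auto
  qed simp
  have mem: "length (labels t) \<le> length (concat (map labels ts))" if "t \<in> set ts" for t ts
    using that by (induction ts) auto
  have "{t. set (labels t) \<subseteq> {..n} \<and> length (labels t) \<le> Suc m} \<subseteq>
      (\<lambda>(a, ts). Node a ts) ` ({..n} \<times> {ts. set ts \<subseteq> ?S \<and> length ts \<le> m})"
  proof
    fix t assume t: "t \<in> {t. set (labels t) \<subseteq> {..n} \<and> length (labels t) \<le> Suc m}"
    obtain a ts where [simp]: "t = Node a ts" by (cases t)
    have "set ts \<subseteq> ?S"
    proof
      fix u assume u: "u \<in> set ts"
      show "u \<in> ?S" using t u mem[OF u] by auto
    qed
    moreover have "length ts \<le> m" using t len[of ts] by simp
    moreover have "a \<le> n" using t by simp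
    ultimately show "t \<in> (\<lambda>(a, ts). Node a ts) ` ({..n} \<times> {ts. set ts \<subseteq> ?S \<and> length ts \<le> m})"
      by (intro image_eqI[of _ _ "(a, ts)"]) auto
  qed
  moreover have "finite ({..n} \<times> {ts. set ts \<subseteq> ?S \<and> length ts \<le> m})"
    using Suc finite_lists_length_le[of ?S m] by blast
  ultimately show ?case using finite_surj by blast
qed

lemma finite_inc_trees: "finite (inc_trees n)"
proof (rule finite_subset[OF _ finite_bounded_otrees[of n n]])
  show "inc_trees n \<subseteq> {t. set (labels t) \<subseteq> {..n} \<and> length (labels t) \<le> n}"
    by (auto simp: inc_trees_def simp flip: distinct_card)
qed

lemma tree_weight_nonneg:
  assumes "\<And>j. coeff \<phi> j \<ge> 0"
  shows "tree_weight \<phi> t \<ge> 0"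
proof (induction t)
  case (Node a ts)
  then show ?case using assms by (auto intro!: mult_nonneg_nonneg prod_list_nonneg)
qed

lemma pmf_random_inc_tree:
  assumes "\<And>j. coeff \<phi> j \<ge> 0" and "total_weight \<phi> n > 0"
  shows "pmf (random_inc_tree \<phi> n) t =
    (if t \<in> inc_trees n then tree_weight \<phi> t / total_weight \<phi> n else 0)"
  unfolding random_inc_tree_def
proof (rule pmf_embed_pmf)
  let ?f = "\<lambda>t. if t \<in> inc_trees n then tree_weight \<phi> t / total_weight \<phi> n else 0"
  show nn: "0 \<le> ?f t" for t using tree_weight_nonneg[OF assms(1)] assms(2) by simp
  have "(\<integral>\<^sup>+t. ennreal (?f t) \<partial>count_space UNIV) = (\<Sum>t\<in>inc_trees n. ennreal (?f t))"
    by (rule nn_integral_count_space') (use finite_inc_trees in auto)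
  also have "\<dots> = ennreal (\<Sum>t\<in>inc_trees n. ?f t)" by (rule sum_ennreal) (rule nn)
  also have "(\<Sum>t\<in>inc_trees n. ?f t) = 1"
    using assms(2) by (simp add: total_weight_def flip: sum_divide_distrib)
  finally show "(\<integral>\<^sup>+t. ennreal (?f t) \<partial>count_space UNIV) = 1" by simp
qed

lemma level_size_le_length_labels: "level_size t k \<le> length (labels t)"
proof (induction t arbitrary: k)
  case (Node a ts)
  show ?case
  proof (cases k)
    case (Suc l)
    have "(\<Sum>t\<leftarrow>ts. level_size t l) \<le> (\<Sum>t\<leftarrow>ts. length (labels t))"
      using Node by (intro sum_list_mono) auto
    then show ?thesis using Suc by (simp add: length_concat comp_def)
  qed simp
qed

lemma finite_range_level_size: "finite (range (level_size t))"
  by (rule finite_subset[of _ "{..length (labels t)}"]) (auto simp: level_size_le_length_labels)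

end

(* After rescaling phi by rho = int_0^oo dv/phi(v), which changes neither the random trees nor the
   condition tau_n > 0, the dominant singularity of tau is z = 1. Write a = 1/(d-1) and
   sigma^2 = 1 + a. Comparing tau with its values on the real axis gives
   phi(tau(z)) ~ K (1-z)^(-sigma^2) and phi'(tau(z)) ~ sigma^2/(1-z) up to relative errors
   O(|1-z|^a), uniformly in the sector |arg z| <= pi/q of the unit disk, where q is the gcd of the
   degrees j with phi_j > 0. The other sectors follow by rotation, so Cauchy's formula on circles of
   radius 1-1/n suffices to estimate coefficients and no continuation beyond the disk is needed.

   For a tree t let S_t(u) = sum_k Y_k u^k. The branching at the root gives linear recursions for
   the moments E|S(u)|^m, and by induction on m these moments are O(n^(m(1+sigma^2(x-1)))) uniformly
   for u near the unit circle with Re u <= x and x near 1. With lam = sigma^2 log n this says that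
   X(u) = S(u) e^(-lam(u-1))/n has bounded moments of every order in a complex neighbourhood of 1,
   where X(1) = 1. Cauchy's formula in u turns this into X(u) = 1 + (u-1) Xi + (u-1)^2 Q(u) with Xi
   and Q bounded by a random variable A with bounded moments, and the Fourier inversion of
   S(e^(i theta)) gives, simultaneously for all k and with pi the Poisson(lam) probabilities,
     |Y_k/n - pi(k) - Xi (pi(k-1) - pi(k))| <= A lam^(-3/2).
   Since pi is maximal at floor(lam) and decreases quadratically around it, W_n/n differs from
   pi(floor(lam)) by O(A^2 lam^(-3/2)) and |k* - lam| = O(A) unless A is of order lam. Levels of
   order much larger than log n are excluded by E S(1+r) = O(n^(1+sigma^2 r)). *)
theory Submission
  imports Defs "HOL-Complex_Analysis.Complex_Analysis"
begin

section \<open>Trees and forests on a set of labels\<close>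

text \<open>On the unit circle away from 1 the mean E S(u) is small only through cancellation, which
  absolute values would destroy. The mean is therefore solved exactly, as exp(u L(z)) times the
  integral of exp((1-u) L) with L = log \<phi>(\<tau>), and its bound enters an exact identity for
  E|S(u)|^2, in which S and its conjugate still occur without absolute values. From there on
  inequalities suffice. What closes the induction is a contraction: with c_k the coefficients of
  \<phi>'(\<tau>) and p_n = tau_n/n!, the terms c_(n-k) k p_k sum exactly to n(n+1)p_(n+1), and
  replacing k by k^b, b \<ge> 3/2, gains a fixed factor 1-\<delta> against n^b because a positive
  share of the sum comes from k \<le> 3n/4. Hence lower bounds for p_n and c_k along residue classes
  modulo q are needed. Near exponent 1 the gain degenerates, so E|S(u)| is deduced from the second
  moment. The recursion carries a factor |u|^m that must not use up the gain, so the neighbourhood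
  of 1 shrinks as m grows. This does no harm: outside a fixed neighbourhood the Fourier integrand
  only has to be O(lam^(-3/2)), while the moment bounds give exponential decay in lam.\<close>

definition inc_on :: "nat set \<Rightarrow> otree set" where
  "inc_on A = {t. distinct (labels t) \<and> set (labels t) = A \<and> increasing t}"

text \<open>The list of subtrees below a root. Distinctness of the concatenated labels makes the
  trees disjoint and each of them free of repetitions at once; the length is a parameter because it
  selects the coefficient of \<open>\<phi>\<close>.\<close>

definition forests :: "nat set \<Rightarrow> nat \<Rightarrow> otree list set" where
  "forests A j = {ts. length ts = j \<and> distinct (concat (map labels ts)) \<and>
     set (concat (map labels ts)) = A \<and> (\<forall>t\<in>set ts. increasing t)}"

primrec relabel :: "(nat \<Rightarrow> nat) \<Rightarrow> otree \<Rightarrow> otree" where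
  "relabel f (Node a ts) = Node (f a) (map (relabel f) ts)"

text \<open>Asked for arbitrary maps of labels, so that it can be checked by structural induction
  without carrying monotonicity along; weights and level polynomials depend on the shape
  only.\<close>

definition label_invariant :: "(otree \<Rightarrow> 'a) \<Rightarrow> bool" where
  "label_invariant h \<longleftrightarrow> (\<forall>f t. h (relabel f t) = h t)"

lemma inc_trees_eq_inc_on: "inc_trees n = inc_on {1..n}"
  by (simp add: inc_trees_def inc_on_def)

lemma finite_inc_on:
  assumes "finite A" shows "finite (inc_on A)"
proof (rule finite_subset[OF _ finite_bounded_otrees[of "Max A" "card A"]])
  show "inc_on A \<subseteq> {t. set (labels t) \<subseteq> {..Max A} \<and> length (labels t) \<le> card A}"
    using assms by (auto simp: inc_on_def simp flip: distinct_card)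
qed

lemma labels_relabel: "labels (relabel f t) = map f (labels t)"
proof (induction t)
  case (Node a ts)
  then show ?case by (simp add: map_concat comp_def cong: map_cong)
qed

lemma root_label_relabel: "root_label (relabel f t) = f (root_label t)"
  by (cases t) simp

lemma root_label_in_labels: "root_label t \<in> set (labels t)"
  by (cases t) simp

lemma increasing_relabel:
  "strict_mono_on (set (labels t)) f \<Longrightarrow> increasing t \<Longrightarrow> increasing (relabel f t)"
proof (induction t)
  case (Node a ts)
  have "f a < f (root_label t) \<and> increasing (relabel f t)" if t: "t \<in> set ts" for t
  proof
    have sub: "set (labels t) \<subseteq> set (labels (Node a ts))" using t by auto
    show "increasing (relabel f t)"
      using Node t monotone_on_subset[OF Node.prems(1) sub] by auto
    show "f a < f (root_label t)"
      using Node.prems t sub root_label_in_labels[of t] by (auto simp: strict_mono_on_def)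
  qed
  then show ?case by (auto simp: root_label_relabel)
qed

lemma relabel_relabel_id:
  "(\<And>x. x \<in> set (labels t) \<Longrightarrow> g (f x) = x) \<Longrightarrow> relabel g (relabel f t) = t"
proof (induction t)
  case (Node a ts)
  have "map (relabel g \<circ> relabel f) ts = map id ts"
    using Node by (intro map_cong) auto
  then show ?case using Node.prems by simp
qed

lemma relabel_inc_on:
  assumes "strict_mono_on A f" "t \<in> inc_on A"
  shows "relabel f t \<in> inc_on (f ` A)"
proof -
  have "inj_on f A" using assms(1) by (rule strict_mono_on_imp_inj_on)
  moreover have "set (labels t) = A" "distinct (labels t)" "increasing t"
    using assms(2) by (simp_all add: inc_on_def)
  ultimately show ?thesis
    using increasing_relabel[of t f] assms(1) by (simp add: inc_on_def labels_relabel distinct_map)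
qed

text \<open>The increasing enumeration of \<open>A\<close> and its inverse carry increasing trees to
  increasing trees, hence relabelling is a bijection between the two index sets that preserves
  \<open>h\<close>.\<close>

lemma sum_inc_on:
  fixes h :: "otree \<Rightarrow> 'a::comm_monoid_add"
  assumes "finite A" "label_invariant h"
  shows "(\<Sum>t\<in>inc_on A. h t) = (\<Sum>t\<in>inc_trees (card A). h t)"
proof -
  obtain e where e: "bij_betw e {..<card A} A" "strict_mono_on {..<card A} e"
    using ex_bij_betw_strict_mono_card[OF assms(1)] by blast
  \<comment> \<open>\<open>e\<close> counts from 0, tree labels from 1.\<close>
  define f where "f i = e (i - 1)" for i
  let ?N = "{1..card A}"
  have mono: "strict_mono_on ?N f"
    unfolding strict_mono_on_def f_def
    by (intro allI impI strict_mono_onD[OF e(2)]) auto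
  have img: "f ` ?N = A"
  proof -
    have "(\<lambda>i. i - 1) ` ?N = {..<card A}"
      by (auto simp: image_iff intro!: bexI[of _ "Suc _"])
    then have "f ` ?N = e ` {..<card A}" unfolding f_def by (metis image_image)
    then show ?thesis using e(1) by (simp add: bij_betw_def)
  qed
  define g where "g = the_inv_into ?N f"
  have inj: "inj_on f ?N" using mono strict_mono_on_imp_inj_on by blast
  have gf: "g (f x) = x" if "x \<in> ?N" for x
    using that inj by (simp add: g_def the_inv_into_f_f)
  have fg: "f (g y) = y" if "y \<in> A" for y
    using that inj img by (simp add: g_def f_the_inv_into_f)
  have gimg: "g ` A = ?N"
  proof -
    have "g ` f ` ?N = ?N" using gf by (simp add: image_image cong: image_cong_simp)
    then show ?thesis by (simp only: img)
  qed
  have gmono: "strict_mono_on A g"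
    unfolding strict_mono_on_def
  proof (intro allI impI)
    fix r s assume rs: "r \<in> A \<and> s \<in> A \<and> r < s"
    have "g r \<in> ?N" "g s \<in> ?N" using rs gimg by auto
    moreover have "f (g r) < f (g s)" using rs fg by simp
    ultimately show "g r < g s"
      using mono by (metis linorder_cases order_less_asym strict_mono_onD order_less_irrefl)
  qed
  show ?thesis unfolding inc_trees_eq_inc_on
  proof (rule sum.reindex_bij_witness[of _ "relabel f" "relabel g"])
    fix t assume t: "t \<in> inc_on A"
    show "relabel f (relabel g t) = t"
      using t fg by (intro relabel_relabel_id) (auto simp: inc_on_def)
    show "relabel g t \<in> inc_on ?N" using relabel_inc_on[OF gmono t] gimg by simp
    show "h (relabel g t) = h t" using assms(2) by (simp add: label_invariant_def)
  next
    fix t assume t: "t \<in> inc_on ?N"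
    show "relabel g (relabel f t) = t"
      using t gf by (intro relabel_relabel_id) (auto simp: inc_on_def)
    show "relabel f t \<in> inc_on A" using relabel_inc_on[OF mono t] img by simp
  qed
qed

lemma increasing_root_le: "increasing t \<Longrightarrow> x \<in> set (labels t) \<Longrightarrow> root_label t \<le> x"
proof (induction t)
  case (Node a ts)
  show ?case
  proof (cases "x = a")
    case False
    then obtain t where t: "t \<in> set ts" "x \<in> set (labels t)" using Node.prems by auto
    then have "root_label t \<le> x" using Node by auto
    moreover have "a < root_label t" using Node.prems t by auto
    ultimately show ?thesis by simp
  qed simp
qed

text \<open>Labels increase downwards, so the root carries the minimum; conversely every remaining
  label exceeds the minimum, which makes the order condition at the root automatic.\<close>

lemma Node_in_inc_on_iff:
  assumes "finite A" "A \<noteq> {}"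
  shows "Node a ts \<in> inc_on A \<longleftrightarrow> a = Min A \<and> ts \<in> forests (A - {Min A}) (length ts)"
proof
  assume t: "Node a ts \<in> inc_on A"
  have "a = Min A"
    using t increasing_root_le[of "Node a ts"] assms
    by (intro Min_eqI[symmetric]) (auto simp: inc_on_def)
  then show "a = Min A \<and> ts \<in> forests (A - {Min A}) (length ts)"
    using t by (auto simp: inc_on_def forests_def)
next
  assume r: "a = Min A \<and> ts \<in> forests (A - {Min A}) (length ts)"
  have "Min A < root_label t" if "t \<in> set ts" for t
  proof -
    have "root_label t \<in> A - {Min A}"
      using r that root_label_in_labels[of t] by (auto simp: forests_def)
    then show ?thesis using assms by (auto simp: less_le)
  qed
  then show "Node a ts \<in> inc_on A"
    using r insert_Diff[OF Min_in[OF assms]] by (auto simp: inc_on_def forests_def)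
qed

text \<open>Shifting all labels up by one frees the label 0 for a new common root, so a forest is
  recovered from a single increasing tree and finiteness is inherited from trees.\<close>

lemma finite_forests_all:
  assumes "finite A"
  shows "finite (\<Union>j. forests A j)"
proof -
  obtain m where m: "\<forall>x\<in>A. m > x" using assms by (metis finite_nat_set_iff_bounded)
  define B where "B = Suc ` A"
  have "(\<Union>j. forests A j) \<subseteq> subtrees ` relabel (\<lambda>x. x - 1) ` inc_on (insert 0 B)"
  proof safe
    fix j ts assume ts: "ts \<in> forests A j"
    have "Node 0 (map (relabel Suc) ts) \<in> inc_on (insert 0 B)"
    proof -
      have mono: "strict_mono_on X Suc" for X by (simp add: strict_mono_on_def)
      have eq: "concat (map labels (map (relabel Suc) ts)) = map Suc (concat (map labels ts))"
        by (simp add: map_concat labels_relabel comp_def)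
      have lab: "set (concat (map labels (map (relabel Suc) ts))) = B"
        unfolding eq using ts by (auto simp: B_def forests_def)
      have dis: "distinct (concat (map labels (map (relabel Suc) ts)))"
        unfolding eq using ts by (simp add: distinct_map forests_def)
      show ?thesis using ts dis lab unfolding inc_on_def labels.simps
        by (auto simp: forests_def B_def root_label_relabel intro!: increasing_relabel mono)
    qed
    moreover have "ts = subtrees (relabel (\<lambda>x. x - 1) (Node 0 (map (relabel Suc) ts)))"
    proof -
      have "map (relabel (\<lambda>x. x - 1) \<circ> relabel Suc) ts = map id ts"
        by (intro map_cong refl) (simp add: relabel_relabel_id)
      then show ?thesis by simp
    qed
    ultimately show "ts \<in> subtrees ` relabel (\<lambda>x. x - 1) ` inc_on (insert 0 B)" by blast
  qed
  then show ?thesis using finite_inc_on[of "insert 0 B"] assms unfolding B_def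
    by (meson finite_imageI finite_insert finite_subset)
qed

lemma finite_forests: "finite A \<Longrightarrow> finite (forests A j)"
  by (rule finite_subset[OF _ finite_forests_all]) auto

lemma length_le_concat_labels: "length ts \<le> length (concat (map labels ts))"
proof (induction ts)
  case (Cons t ts)
  then show ?case by (cases t) auto
qed simp

text \<open>An increasing tree is its minimal root together with a forest on the other labels; the
  number of children is capped at \<open>card A\<close> because each subtree uses at least one
  label.\<close>

lemma sum_inc_on_root:
  fixes F :: "otree \<Rightarrow> 'a::comm_monoid_add"
  assumes "finite A" "A \<noteq> {}"
  shows "(\<Sum>t\<in>inc_on A. F t) = (\<Sum>j\<le>card A. \<Sum>ts\<in>forests (A - {Min A}) j. F (Node (Min A) ts))"
proof -
  let ?B = "A - {Min A}"
  have fin: "finite ?B" using assms by simp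
  have len: "j \<le> card A" if "ts \<in> forests ?B j" for ts j
  proof -
    have "j \<le> length (concat (map labels ts))"
      using that length_le_concat_labels[of ts] by (simp add: forests_def)
    also have "\<dots> = card ?B" using that by (auto simp: forests_def simp flip: distinct_card)
    also have "\<dots> \<le> card A" using assms by (intro card_mono) auto
    finally show ?thesis .
  qed
  have "(\<Sum>t\<in>inc_on A. F t) = (\<Sum>ts\<in>(\<Union>j\<le>card A. forests ?B j). F (Node (Min A) ts))"
  proof (rule sum.reindex_bij_witness[of _ "Node (Min A)" subtrees])
    fix t assume t: "t \<in> inc_on A"
    obtain a ts where [simp]: "t = Node a ts" by (cases t)
    have *: "a = Min A" "ts \<in> forests ?B (length ts)" using t assms Node_in_inc_on_iff by auto
    show "Node (Min A) (subtrees t) = t" using * by simp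
    show "subtrees t \<in> (\<Union>j\<le>card A. forests ?B j)" using * len by auto
    show "F (Node (Min A) (subtrees t)) = F t" using * by simp
  next
    fix ts assume "ts \<in> (\<Union>j\<le>card A. forests ?B j)"
    then have "ts \<in> forests ?B (length ts)" by (auto simp: forests_def)
    then show "Node (Min A) ts \<in> inc_on A" using assms Node_in_inc_on_iff by auto
  qed simp
  also have "\<dots> = (\<Sum>j\<le>card A. \<Sum>ts\<in>forests ?B j. F (Node (Min A) ts))"
    by (rule sum.UNION_disjoint) (use finite_forests[OF fin] in \<open>auto simp: forests_def\<close>)
  finally show ?thesis .
qed

text \<open>The first tree occupies a subset \<open>B\<close> of the labels and the other trees its
  complement: the set partition behind the product rule for exponential generating
  functions.\<close>

lemma sum_forests_Suc:
  fixes f :: "otree \<Rightarrow> 'a::comm_ring_1"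
  assumes "finite A"
  shows "(\<Sum>ts\<in>forests A (Suc j). f (hd ts) * G (tl ts)) =
    (\<Sum>B\<in>Pow A. (\<Sum>t\<in>inc_on B. f t) * (\<Sum>ts\<in>forests (A - B) j. G ts))"
proof -
  have fin: "finite B" if "B \<in> Pow A" for B using that assms by (auto intro: finite_subset)
  have "(\<Sum>B\<in>Pow A. (\<Sum>t\<in>inc_on B. f t) * (\<Sum>ts\<in>forests (A - B) j. G ts)) =
    (\<Sum>B\<in>Pow A. \<Sum>(t, ts)\<in>inc_on B \<times> forests (A - B) j. f t * G ts)"
    by (simp add: sum_product sum.cartesian_product)
  also have "\<dots> = (\<Sum>(B, t, ts)\<in>(SIGMA B:Pow A. inc_on B \<times> forests (A - B) j). f t * G ts)"
    using assms fin by (subst sum.Sigma) (auto intro!: finite_inc_on finite_forests)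
  finally have eq: "(\<Sum>B\<in>Pow A. (\<Sum>t\<in>inc_on B. f t) * (\<Sum>ts\<in>forests (A - B) j. G ts)) =
    (\<Sum>(B, t, ts)\<in>(SIGMA B:Pow A. inc_on B \<times> forests (A - B) j). f t * G ts)" .
  show ?thesis unfolding eq
  proof (rule sum.reindex_bij_witness[of _ "\<lambda>(B, t, ts). t # ts"
        "\<lambda>ts. (set (labels (hd ts)), hd ts, tl ts)"])
    fix ts assume ts: "ts \<in> forests A (Suc j)"
    then obtain t us where [simp]: "ts = t # us" by (cases ts) (auto simp: forests_def)
    show "(case (set (labels (hd ts)), hd ts, tl ts) of (B, t, ts) \<Rightarrow> t # ts) = ts" by simp
    show "(set (labels (hd ts)), hd ts, tl ts) \<in> (SIGMA B:Pow A. inc_on B \<times> forests (A - B) j)"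
      using ts by (auto simp: forests_def inc_on_def)
    show "(case (set (labels (hd ts)), hd ts, tl ts) of (B, t, ts) \<Rightarrow> f t * G ts) = f (hd ts) * G (tl ts)"
      by simp
  next
    fix p assume p: "p \<in> (SIGMA B:Pow A. inc_on B \<times> forests (A - B) j)"
    obtain B t ts where [simp]: "p = (B, t, ts)" by (cases p)
    have B: "B \<subseteq> A" "set (labels t) = B" "distinct (labels t)" "increasing t" "length ts = j"
      "set (concat (map labels ts)) = A - B" "distinct (concat (map labels ts))" "\<forall>t\<in>set ts. increasing t"
      using p by (auto simp: inc_on_def forests_def)
    then have "set (labels t) \<union> set (concat (map labels ts)) = A" by blast
    then show "(case p of (B, t, ts) \<Rightarrow> t # ts) \<in> forests A (Suc j)"
      using B by (simp add: forests_def)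
    show "(set (labels (hd (case p of (B, t, ts) \<Rightarrow> t # ts))), hd (case p of (B, t, ts) \<Rightarrow> t # ts),
        tl (case p of (B, t, ts) \<Rightarrow> t # ts)) = p"
      using B by simp
  qed
qed

lemma sum_Pow_card:
  fixes f :: "nat \<Rightarrow> 'a::comm_semiring_1"
  assumes "finite A"
  shows "(\<Sum>B\<in>Pow A. f (card B)) = (\<Sum>m\<le>card A. of_nat (card A choose m) * f m)"
proof -
  have "(\<Sum>B\<in>Pow A. f (card B)) = (\<Sum>m\<le>card A. \<Sum>B\<in>{B\<in>Pow A. card B = m}. f (card B))"
    using assms by (intro sum.group[symmetric]) (auto intro: card_mono)
  also have "\<dots> = (\<Sum>m\<le>card A. of_nat (card A choose m) * f m)"
  proof (rule sum.cong[OF refl])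
    fix m
    have "(\<Sum>B\<in>{B\<in>Pow A. card B = m}. f (card B)) = of_nat (card {B\<in>Pow A. card B = m}) * f m"
      by simp
    then show "(\<Sum>B\<in>{B\<in>Pow A. card B = m}. f (card B)) = of_nat (card A choose m) * f m"
      using n_subsets[OF assms, of m] by simp
  qed
  finally show ?thesis .
qed

section \<open>Exponential generating functions\<close>

text \<open>For \<open>h = 1\<close> this is the series \<tau>(z); in general the quotient of the
  n-th coefficients for \<open>h\<close> and for 1 is the expectation of \<open>h\<close>. The value
  type stays open because real and complex statistics both occur.\<close>

definition egf :: "real poly \<Rightarrow> (otree \<Rightarrow> 'a::real_normed_field) \<Rightarrow> 'a fps" where
  "egf \<phi> h = Abs_fps (\<lambda>n. (\<Sum>t\<in>inc_trees n. of_real (tree_weight \<phi> t) * h t) / fact n)"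

lemma label_invariant_weight: "label_invariant (tree_weight \<phi>)"
  unfolding label_invariant_def
proof (intro allI)
  fix f t show "tree_weight \<phi> (relabel f t) = tree_weight \<phi> t"
  proof (induction t)
    case (Node a ts)
    then have "map (tree_weight \<phi> \<circ> relabel f) ts = map (tree_weight \<phi>) ts" by simp
    then show ?case by (simp del: map_eq_conv)
  qed
qed

text \<open>Splitting off the first tree gives a sum over subsets, which after grouping by size is a
  binomial convolution, that is, a product of series. The statistic may depend on the position in
  the forest; this later singles out one or two subtrees.\<close>

lemma sum_forests_prod:
  fixes h :: "nat \<Rightarrow> otree \<Rightarrow> 'a::real_normed_field"
  assumes "finite A" "\<And>i. i < j \<Longrightarrow> label_invariant (h i)"
  shows "(\<Sum>ts\<in>forests A j. \<Prod>i<j. of_real (tree_weight \<phi> (ts ! i)) * h i (ts ! i)) =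
    fact (card A) * fps_nth (\<Prod>i<j. egf \<phi> (h i)) (card A)"
  using assms
proof (induction j arbitrary: A h)
  case 0
  have "forests A 0 = (if A = {} then {[]} else {})" by (auto simp: forests_def)
  then show ?case using 0 by simp
next
  case (Suc j)
  define f where "f t = of_real (tree_weight \<phi> t) * h 0 t" for t
  define G where "G ts = (\<Prod>i<j. of_real (tree_weight \<phi> (ts ! i)) * h (Suc i) (ts ! i))" for ts
  define P where "P = (\<Prod>i<j. egf \<phi> (h (Suc i)))"
  let ?N = "card A"
  have fin: "finite B" if "B \<in> Pow A" for B using that Suc.prems by (auto intro: finite_subset)
  have inv: "label_invariant f"
    using Suc.prems(2)[of 0] label_invariant_weight[of \<phi>] by (auto simp: f_def label_invariant_def)
  have "(\<Sum>ts\<in>forests A (Suc j). \<Prod>i<Suc j. of_real (tree_weight \<phi> (ts ! i)) * h i (ts ! i)) =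
     (\<Sum>ts\<in>forests A (Suc j). f (hd ts) * G (tl ts))"
  proof (rule sum.cong[OF refl])
    fix ts assume "ts \<in> forests A (Suc j)"
    then obtain t us where "ts = t # us" by (cases ts) (auto simp: forests_def)
    then show "(\<Prod>i<Suc j. of_real (tree_weight \<phi> (ts ! i)) * h i (ts ! i)) = f (hd ts) * G (tl ts)"
      unfolding prod.lessThan_Suc_shift by (simp add: f_def G_def)
  qed
  also have "\<dots> = (\<Sum>B\<in>Pow A. (\<Sum>t\<in>inc_on B. f t) * (\<Sum>ts\<in>forests (A - B) j. G ts))"
    by (rule sum_forests_Suc[OF Suc.prems(1)])
  also have "\<dots> = (\<Sum>B\<in>Pow A. fact (card B) * fps_nth (egf \<phi> (h 0)) (card B) *
      (fact (?N - card B) * fps_nth P (?N - card B)))"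
  proof (rule sum.cong[OF refl])
    fix B assume B: "B \<in> Pow A"
    have "(\<Sum>t\<in>inc_on B. f t) = fact (card B) * fps_nth (egf \<phi> (h 0)) (card B)"
      using sum_inc_on[OF fin[OF B] inv] by (simp add: egf_def f_def)
    moreover have "(\<Sum>ts\<in>forests (A - B) j. G ts) = fact (?N - card B) * fps_nth P (?N - card B)"
      unfolding G_def P_def using Suc.prems B fin[OF B]
      by (subst Suc.IH) (auto simp: card_Diff_subset)
    ultimately show "(\<Sum>t\<in>inc_on B. f t) * (\<Sum>ts\<in>forests (A - B) j. G ts) =
      fact (card B) * fps_nth (egf \<phi> (h 0)) (card B) * (fact (?N - card B) * fps_nth P (?N - card B))"
      by simp
  qed
  also have "\<dots> = (\<Sum>m\<le>?N. of_nat (?N choose m) * (fact m * fps_nth (egf \<phi> (h 0)) m *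
      (fact (?N - m) * fps_nth P (?N - m))))"
    by (rule sum_Pow_card[OF Suc.prems(1)])
  also have "\<dots> = (\<Sum>m\<le>?N. fact ?N * (fps_nth (egf \<phi> (h 0)) m * fps_nth P (?N - m)))"
    by (intro sum.cong refl) (simp add: binomial_fact)
  also have "\<dots> = fact ?N * fps_nth (egf \<phi> (h 0) * P) ?N"
    by (simp add: fps_mult_nth sum_distrib_left atLeast0AtMost)
  also have "egf \<phi> (h 0) * P = (\<Prod>i<Suc j. egf \<phi> (h i))"
    unfolding prod.lessThan_Suc_shift P_def by simp
  finally show ?case .
qed

text \<open>The labels start at 2 because 1 belongs to the root. Division by \<open>fact n\<close>
  turns the value into a coefficient of z^n; it is a weighted sum, not a probabilistic
  average.\<close>

definition forest_avg :: "real poly \<Rightarrow> nat \<Rightarrow> nat \<Rightarrow> (otree list \<Rightarrow> 'a::real_normed_field) \<Rightarrow> 'a" where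
  "forest_avg \<phi> n j H =
     (\<Sum>ts\<in>forests {2..Suc n} j. of_real (\<Prod>i<j. tree_weight \<phi> (ts ! i)) * H ts) / fact n"

text \<open>Deleting the root removes one label, which for exponential generating functions is
  differentiation; \<open>coeff \<phi> j\<close> is the weight of the root. For \<open>H = 1\<close>
  this is \<tau>' = \<phi>(\<tau>).\<close>

lemma egf_Suc:
  fixes h :: "otree \<Rightarrow> 'a::real_normed_field"
  assumes "\<And>a ts. h (Node a ts) = H ts"
  shows "of_nat (Suc n) * fps_nth (egf \<phi> h) (Suc n) =
     (\<Sum>j\<le>degree \<phi>. of_real (coeff \<phi> j) * forest_avg \<phi> n j H)"
proof -
  have M: "Min {1..Suc n} = 1" by (intro Min_eqI) auto
  then have A: "{1..Suc n} - {Min {1..Suc n}} = {2..Suc n}" by auto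
  have emp: "forests {2..Suc n} j = {}" if "j > Suc n" for j
  proof -
    have False if ts: "ts \<in> forests {2..Suc n} j" for ts
    proof -
      have "j \<le> length (concat (map labels ts))"
        using ts length_le_concat_labels[of ts] by (simp add: forests_def)
      also have "\<dots> = card {2..Suc n}" using ts
        by (metis (mono_tags, lifting) forests_def distinct_card mem_Collect_eq)
      finally show False using \<open>j > Suc n\<close> by simp
    qed
    then show ?thesis by blast
  qed
  let ?g = "\<lambda>j. \<Sum>ts\<in>forests {2..Suc n} j. of_real (coeff \<phi> j) * (of_real (\<Prod>i<j. tree_weight \<phi> (ts ! i)) * H ts)"
  have "(\<Sum>t\<in>inc_trees (Suc n). of_real (tree_weight \<phi> t) * h t) = (\<Sum>j\<le>Suc n.
      \<Sum>ts\<in>forests {2..Suc n} j. of_real (tree_weight \<phi> (Node (Min {1..Suc n}) ts)) * h (Node (Min {1..Suc n}) ts))"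
    unfolding inc_trees_eq_inc_on
    using sum_inc_on_root[of "{1..Suc n}" "\<lambda>t. of_real (tree_weight \<phi> t) * h t"] unfolding A by simp
  also have "\<dots> = (\<Sum>j\<le>Suc n. ?g j)"
  proof (intro sum.cong refl)
    fix j ts assume "ts \<in> forests {2..Suc n} j"
    then have "length ts = j" by (simp add: forests_def)
    then show "of_real (tree_weight \<phi> (Node (Min {1..Suc n}) ts)) * h (Node (Min {1..Suc n}) ts) =
      of_real (coeff \<phi> j) * (of_real (\<Prod>i<j. tree_weight \<phi> (ts ! i)) * H ts)"
      by (simp add: assms prod.list_conv_set_nth atLeast0LessThan)
  qed
  \<comment> \<open>The two ranges of \<open>j\<close> are compared through a common larger one:
    above \<open>Suc n\<close> there are no forests, above the degree the coefficients
    vanish.\<close>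
  also have "\<dots> = (\<Sum>j\<le>max (Suc n) (degree \<phi>). ?g j)"
    by (rule sum.mono_neutral_left) (auto simp: emp)
  also have "\<dots> = (\<Sum>j\<le>degree \<phi>. ?g j)"
    by (rule sum.mono_neutral_right) (auto simp: coeff_eq_0)
  finally have eq: "(\<Sum>t\<in>inc_trees (Suc n). of_real (tree_weight \<phi> t) * h t) = (\<Sum>j\<le>degree \<phi>. ?g j)" .
  have "(of_nat (Suc n) :: 'a) \<noteq> 0" by (simp only: of_nat_eq_0_iff)
  then have "of_nat (Suc n) * fps_nth (egf \<phi> h) (Suc n) = (\<Sum>j\<le>degree \<phi>. ?g j) / fact n"
    unfolding egf_def fps_nth_Abs_fps eq fact_Suc
    by (simp del: of_nat_Suc sum.atMost_Suc)
  then show ?thesis by (simp add: forest_avg_def sum_distrib_left sum_divide_distrib)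
qed

lemma forest_avg_prod:
  fixes h :: "nat \<Rightarrow> otree \<Rightarrow> 'a::real_normed_field"
  assumes "\<And>i. i < j \<Longrightarrow> label_invariant (h i)"
  shows "forest_avg \<phi> n j (\<lambda>ts. \<Prod>i<j. h i (ts ! i)) = fps_nth (\<Prod>i<j. egf \<phi> (h i)) n"
proof -
  have "forest_avg \<phi> n j (\<lambda>ts. \<Prod>i<j. h i (ts ! i)) =
      (\<Sum>ts\<in>forests {2..Suc n} j. \<Prod>i<j. of_real (tree_weight \<phi> (ts ! i)) * h i (ts ! i)) / fact n"
    by (simp only: forest_avg_def prod.distrib of_real_prod)
  also have "\<dots> = fps_nth (\<Prod>i<j. egf \<phi> (h i)) n"
    by (subst sum_forests_prod) (use assms in simp_all)
  finally show ?thesis .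
qed

lemma forest_avg_sum: "forest_avg \<phi> n j (\<lambda>ts. \<Sum>i\<in>I. H i ts) = (\<Sum>i\<in>I. forest_avg \<phi> n j (H i))"
  by (simp add: forest_avg_def sum_distrib_left sum.swap[of _ "forests _ _"] sum_divide_distrib)

lemma forest_avg_add: "forest_avg \<phi> n j (\<lambda>ts. H ts + H' ts) = forest_avg \<phi> n j H + forest_avg \<phi> n j H'"
  by (simp add: forest_avg_def distrib_left sum.distrib add_divide_distrib)

lemma forest_avg_cmult: "forest_avg \<phi> n j (\<lambda>ts. c * H ts) = c * forest_avg \<phi> n j H"
  by (simp add: forest_avg_def sum_distrib_left mult_ac)

lemma label_invariant_const [simp]: "label_invariant (\<lambda>t. c)"
  by (simp add: label_invariant_def)

lemma forest_avg_one: "forest_avg \<phi> n j (\<lambda>ts. 1) = fps_nth (egf \<phi> (\<lambda>t. 1) ^ j) n"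
  using forest_avg_prod[of j "\<lambda>i t. 1" \<phi> n] by simp

text \<open>With \<open>A\<close> at one position and 1 at the others the product rule leaves one
  factor \<open>egf \<phi> A\<close>. The \<open>j\<close> positions contribute equally, which
  produces the derivative of the monomial of degree \<open>j\<close>.\<close>

lemma forest_avg_single:
  assumes "label_invariant A"
  shows "forest_avg \<phi> n j (\<lambda>ts. \<Sum>i<j. A (ts ! i)) =
     fps_nth (of_nat j * egf \<phi> (\<lambda>t. 1) ^ (j - 1) * egf \<phi> A) n"
proof -
  have "forest_avg \<phi> n j (\<lambda>ts. A (ts ! i)) = fps_nth (egf \<phi> (\<lambda>t. 1) ^ (j - 1) * egf \<phi> A) n"
    if i: "i < j" for i
  proof -
    let ?h = "\<lambda>k. if k = i then A else (\<lambda>t. 1)"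
    have "forest_avg \<phi> n j (\<lambda>ts. A (ts ! i)) = forest_avg \<phi> n j (\<lambda>ts. \<Prod>k<j. ?h k (ts ! k))"
    proof -
      have "(\<Prod>k<j. ?h k (ts ! k)) = (\<Prod>k<j. if k = i then A (ts ! k) else 1)" for ts
        by (intro prod.cong) auto
      then show ?thesis using i by simp
    qed
    also have "\<dots> = fps_nth (\<Prod>k<j. egf \<phi> (?h k)) n"
      using assms by (intro forest_avg_prod) auto
    also have "(\<Prod>k<j. egf \<phi> (?h k)) = egf \<phi> A * (\<Prod>k\<in>{..<j}-{i}. egf \<phi> (\<lambda>t. 1))"
      using i by (subst prod.remove[of _ i]) auto
    also have "\<dots> = egf \<phi> (\<lambda>t. 1) ^ (j - 1) * egf \<phi> A" using i by (simp add: mult.commute)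
    finally show ?thesis .
  qed
  then have "forest_avg \<phi> n j (\<lambda>ts. \<Sum>i<j. A (ts ! i)) =
     of_nat j * fps_nth (egf \<phi> (\<lambda>t. 1) ^ (j - 1) * egf \<phi> A) n"
    by (simp add: forest_avg_sum)
  then show ?thesis by (simp only: mult.assoc fps_of_nat[symmetric] fps_mult_left_const_nth)
qed

lemma forest_avg_two:
  fixes A B :: "otree \<Rightarrow> 'a::real_normed_field"
  assumes "label_invariant A" "label_invariant B" and i: "i < j" and k: "k < j" "k \<noteq> i"
  shows "forest_avg \<phi> n j (\<lambda>ts. A (ts ! i) * B (ts ! k)) =
     fps_nth (egf \<phi> (\<lambda>t. 1) ^ (j - 2) * egf \<phi> A * egf \<phi> B) n"
proof -
  define h where "h l = (if l = i then A else if l = k then B else (\<lambda>t. 1))" for l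
  have hi: "h i = A" by (simp add: h_def)
  have hk: "h k = B" using k(2) by (simp add: h_def)
  have ho: "h l = (\<lambda>t. 1)" if "l \<in> {..<j}-{i}-{k}" for l using that by (simp add: h_def)
  have inv: "label_invariant (h l)" for l
    using assms(1,2) by (simp add: h_def)
  have rem: "(\<Prod>l<j. g l) = g i * (g k * (\<Prod>l\<in>{..<j}-{i}-{k}. g l))" for g :: "nat \<Rightarrow> 'b::comm_monoid_mult"
    using prod.remove[of "{..<j}" i g] prod.remove[of "{..<j}-{i}" k g] i k by simp
  have "(\<Prod>l\<in>{..<j}-{i}-{k}. h l (ts ! l)) = 1" for ts
    by (intro prod.neutral ballI) (simp add: ho)
  then have "forest_avg \<phi> n j (\<lambda>ts. A (ts ! i) * B (ts ! k)) = forest_avg \<phi> n j (\<lambda>ts. \<Prod>l<j. h l (ts ! l))"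
    by (simp only: rem hi hk mult_1_right)
  also have "\<dots> = fps_nth (\<Prod>l<j. egf \<phi> (h l)) n"
    by (intro forest_avg_prod inv)
  also have "(\<Prod>l<j. egf \<phi> (h l)) = egf \<phi> A * (egf \<phi> B * (\<Prod>l\<in>{..<j}-{i}-{k}. egf \<phi> (h l)))"
    by (simp only: rem hi hk)
  also have "(\<Prod>l\<in>{..<j}-{i}-{k}. egf \<phi> (h l)) = (\<Prod>l\<in>{..<j}-{i}-{k}. egf \<phi> (\<lambda>t. 1))"
    by (intro prod.cong refl) (simp only: ho)
  also have "\<dots> = egf \<phi> (\<lambda>t. 1) ^ card ({..<j}-{i}-{k})" by (rule prod_constant)
  also have "card ({..<j}-{i}-{k}) = j - 2" using i k by (simp add: card_Diff_singleton)
  finally show ?thesis by (simp only: mult_ac)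
qed

text \<open>Two different positions carry separate factors; the \<open>j * (j - 1)\<close> ordered
  pairs are the source of \<phi>'' in the moment recursions.\<close>

lemma forest_avg_pair:
  fixes A B :: "otree \<Rightarrow> 'a::real_normed_field"
  assumes "label_invariant A" "label_invariant B"
  shows "forest_avg \<phi> n j (\<lambda>ts. \<Sum>i<j. \<Sum>k\<in>{..<j}-{i}. A (ts ! i) * B (ts ! k)) =
     fps_nth (of_nat (j * (j - 1)) * egf \<phi> (\<lambda>t. 1) ^ (j - 2) * egf \<phi> A * egf \<phi> B) n"
proof -
  let ?r = "fps_nth (egf \<phi> (\<lambda>t. 1) ^ (j - 2) * egf \<phi> A * egf \<phi> B) n"
  have "forest_avg \<phi> n j (\<lambda>ts. \<Sum>i<j. \<Sum>k\<in>{..<j}-{i}. A (ts ! i) * B (ts ! k)) =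
     (\<Sum>i<j. \<Sum>k\<in>{..<j}-{i}. forest_avg \<phi> n j (\<lambda>ts. A (ts ! i) * B (ts ! k)))"
    by (simp only: forest_avg_sum)
  also have "\<dots> = (\<Sum>i<j. \<Sum>k\<in>{..<j}-{i}. ?r)"
    by (intro sum.cong refl forest_avg_two assms) auto
  also have "\<dots> = (\<Sum>i<j. of_nat (j - 1) * ?r)"
    by (intro sum.cong refl) simp
  also have "\<dots> = of_nat (j * (j - 1)) * ?r"
    by (simp only: sum_constant card_lessThan of_nat_mult mult.assoc)
  finally show ?thesis by (simp only: mult.assoc fps_of_nat[symmetric] fps_mult_left_const_nth)
qed

section \<open>Recursions for the level polynomial and its moments\<close>

text \<open>The composite P(f) as a finite sum of powers: it makes sense for every constant term of
  \<open>f\<close>, and for real and complex series alike.\<close>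

definition poly_fps :: "real poly \<Rightarrow> 'a::real_normed_field fps \<Rightarrow> 'a fps" where
  "poly_fps P f = (\<Sum>j\<le>degree P. fps_const (of_real (coeff P j)) * f ^ j)"

lemma poly_fps_ge:
  assumes "degree P \<le> N"
  shows "poly_fps P f = (\<Sum>j\<le>N. fps_const (of_real (coeff P j)) * f ^ j)"
  unfolding poly_fps_def using assms
  by (intro sum.mono_neutral_left) (auto simp: coeff_eq_0)

lemma poly_fps_pderiv:
  "poly_fps (pderiv P) f = (\<Sum>j\<le>degree P. fps_const (of_real (coeff P j)) * (of_nat j * f ^ (j - 1)))"
proof -
  have "(\<Sum>j\<le>degree P. fps_const (of_real (coeff P j)) * (of_nat j * f ^ (j - 1))) =
      (\<Sum>j\<le>Suc (degree P). fps_const (of_real (coeff P j)) * (of_nat j * f ^ (j - 1)))"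
    by (intro sum.mono_neutral_left) (auto simp: coeff_eq_0)
  also have "\<dots> = (\<Sum>j\<le>degree P. fps_const (of_real (coeff P (Suc j))) * (of_nat (Suc j) * f ^ j))"
    by (subst sum.atMost_Suc_shift) simp
  also have "\<dots> = (\<Sum>j\<le>degree P. fps_const (of_real (coeff (pderiv P) j)) * f ^ j)"
    by (intro sum.cong refl)
       (simp only: coeff_pderiv of_real_mult of_real_of_nat_eq fps_of_nat[symmetric] fps_const_mult mult_ac
         flip: mult.assoc)
  also have "\<dots> = poly_fps (pderiv P) f"
    by (rule poly_fps_ge[symmetric]) (simp add: degree_pderiv)
  finally show ?thesis ..
qed

lemma poly_fps_pderiv2:
  "poly_fps (pderiv (pderiv P)) f =
     (\<Sum>j\<le>degree P. fps_const (of_real (coeff P j)) * (of_nat (j * (j - 1)) * f ^ (j - 2)))"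
proof -
  have "poly_fps (pderiv (pderiv P)) f =
    (\<Sum>j\<le>degree (pderiv P). fps_const (of_real (coeff (pderiv P) j)) * (of_nat j * f ^ (j - 1)))"
    by (rule poly_fps_pderiv)
  also have "\<dots> = (\<Sum>j\<le>degree P. fps_const (of_real (coeff (pderiv P) j)) * (of_nat j * f ^ (j - 1)))"
    by (intro sum.mono_neutral_left) (auto simp: coeff_eq_0 degree_pderiv)
  also have "\<dots> = (\<Sum>j\<le>degree P. fps_const (of_real (coeff P (Suc j))) * (of_nat (Suc j * j) * f ^ (Suc j - 2)))"
    by (intro sum.cong refl)
       (simp add: coeff_pderiv of_real_mult fps_of_nat[symmetric] mult_ac del: of_nat_Suc,
        simp add: algebra_simps)
  also have "\<dots> = (\<Sum>j\<le>Suc (degree P). fps_const (of_real (coeff P j)) * (of_nat (j * (j - 1)) * f ^ (j - 2)))"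
    by (subst sum.atMost_Suc_shift) simp
  also have "\<dots> = (\<Sum>j\<le>degree P. fps_const (of_real (coeff P j)) * (of_nat (j * (j - 1)) * f ^ (j - 2)))"
    by (intro sum.mono_neutral_right) (auto simp: coeff_eq_0)
  finally show ?thesis .
qed

text \<open>The generating polynomial S_t(u) of the level sizes, in the form given by the branching
  at the root.\<close>

primrec level_poly :: "complex \<Rightarrow> otree \<Rightarrow> complex" where
  "level_poly u (Node a ts) = 1 + u * sum_list (map (level_poly u) ts)"

lemma label_invariant_level_poly: "label_invariant (level_poly u)"
  unfolding label_invariant_def
proof (intro allI)
  fix f t show "level_poly u (relabel f t) = level_poly u t"
  proof (induction t)
    case (Node a ts)
    then have "map (level_poly u \<circ> relabel f) ts = map (level_poly u) ts" by simp
    then show ?case by (simp del: map_eq_conv)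
  qed
qed

lemma level_poly_Node: "level_poly u (Node a ts) = 1 + u * (\<Sum>i<length ts. level_poly u (ts ! i))"
  by (simp add: sum_list_sum_nth atLeast0LessThan)

lemma level_size_ge: "length (labels t) \<le> k \<Longrightarrow> level_size t k = 0"
proof (induction t arbitrary: k)
  case (Node a ts)
  then obtain l where l: "k = Suc l" by (cases k) auto
  have "level_size t l = 0" if "t \<in> set ts" for t
  proof (rule Node.IH[OF that])
    have "length (labels t) \<le> length (concat (map labels ts))"
      using that by (auto simp: length_concat comp_def intro!: member_le_sum_list)
    then show "length (labels t) \<le> l" using Node.prems l by simp
  qed
  then show ?case by (simp add: l)
qed

lemma level_poly_eq:
  "length (labels t) \<le> N \<Longrightarrow> level_poly u t = (\<Sum>k<N. of_nat (level_size t k) * u ^ k)"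
proof (induction t arbitrary: N)
  case (Node a ts)
  then obtain M where M: "N = Suc M" by (cases N) auto
  have *: "level_poly u t = (\<Sum>k<M. of_nat (level_size t k) * u ^ k)" if "t \<in> set ts" for t
  proof (rule Node.IH[OF that])
    have "length (labels t) \<le> length (concat (map labels ts))"
      using that by (auto simp: length_concat comp_def intro!: member_le_sum_list)
    then show "length (labels t) \<le> M" using Node.prems M by simp
  qed
  have "sum_list (map (level_poly u) ts) = (\<Sum>t\<leftarrow>ts. \<Sum>k<M. of_nat (level_size t k) * u ^ k)"
    using * by (intro arg_cong[of _ _ sum_list] map_cong) auto
  also have "\<dots> = (\<Sum>k<M. \<Sum>t\<leftarrow>ts. of_nat (level_size t k) * u ^ k)"
    by (induction ts) (simp_all add: sum.distrib)
  also have "\<dots> = (\<Sum>k<M. of_nat (level_size (Node a ts) (Suc k)) * u ^ k)"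
  proof (intro sum.cong refl)
    fix k show "(\<Sum>t\<leftarrow>ts. of_nat (level_size t k) * u ^ k) = of_nat (level_size (Node a ts) (Suc k)) * u ^ k"
      by (induction ts) (simp_all add: distrib_right)
  qed
  finally show ?case
    unfolding M by (subst sum.lessThan_Suc_shift) (simp add: sum_distrib_left mult_ac del: level_size.simps(2))
qed

lemma level_poly_one: "level_poly 1 t = of_nat (length (labels t))"
proof (induction t)
  case (Node a ts)
  then have "sum_list (map (level_poly 1) ts) = (\<Sum>t\<leftarrow>ts. of_nat (length (labels t)))"
    by (intro arg_cong[of _ _ sum_list] map_cong) auto
  also have "\<dots> = of_nat (length (concat (map labels ts)))"
    by (induction ts) auto
  finally show ?case by simp
qed

lemma forest_avg_cong:
  "(\<And>ts. ts \<in> forests {2..Suc n} j \<Longrightarrow> H ts = H' ts) \<Longrightarrow> forest_avg \<phi> n j H = forest_avg \<phi> n j H'"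
  unfolding forest_avg_def by (intro arg_cong2[of _ _ _ _ "(/)"] sum.cong) auto

lemma egf_Suc_nth:
  fixes h :: "otree \<Rightarrow> 'a::real_normed_field"
  assumes "\<And>a ts. h (Node a ts) = H (length ts) (\<lambda>i. ts ! i)"
  shows "of_nat (Suc n) * fps_nth (egf \<phi> h) (Suc n) =
     (\<Sum>j\<le>degree \<phi>. of_real (coeff \<phi> j) * forest_avg \<phi> n j (\<lambda>ts. H j (\<lambda>i. ts ! i)))"
proof -
  have "of_nat (Suc n) * fps_nth (egf \<phi> h) (Suc n) =
     (\<Sum>j\<le>degree \<phi>. of_real (coeff \<phi> j) * forest_avg \<phi> n j (\<lambda>ts. H (length ts) (\<lambda>i. ts ! i)))"
    by (rule egf_Suc) (rule assms)
  also have "\<dots> = (\<Sum>j\<le>degree \<phi>. of_real (coeff \<phi> j) * forest_avg \<phi> n j (\<lambda>ts. H j (\<lambda>i. ts ! i)))"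
    by (intro sum.cong refl arg_cong2[of _ _ _ _ "(*)"] forest_avg_cong) (auto simp: forests_def)
  finally show ?thesis .
qed

lemma egf_one_rec:
  "of_nat (Suc n) * fps_nth (egf \<phi> (\<lambda>t. 1 :: 'a::real_normed_field)) (Suc n) =
     fps_nth (poly_fps \<phi> (egf \<phi> (\<lambda>t. 1))) n"
  by (subst egf_Suc_nth[where H = "\<lambda>_ _. 1"])
     (simp_all only: forest_avg_one poly_fps_def fps_sum_nth fps_mult_left_const_nth)

lemma egf_level_poly_rec:
  "of_nat (Suc n) * fps_nth (egf \<phi> (level_poly u)) (Suc n) =
     fps_nth (poly_fps \<phi> (egf \<phi> (\<lambda>t. 1)) +
       fps_const u * (poly_fps (pderiv \<phi>) (egf \<phi> (\<lambda>t. 1)) * egf \<phi> (level_poly u))) n"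
proof -
  have "forest_avg \<phi> n j (\<lambda>ts. 1 + u * (\<Sum>i<j. level_poly u (ts ! i))) =
     fps_nth (egf \<phi> (\<lambda>t. 1) ^ j + fps_const u * (of_nat j * egf \<phi> (\<lambda>t. 1) ^ (j - 1) * egf \<phi> (level_poly u))) n" for j
    by (simp only: forest_avg_add forest_avg_cmult forest_avg_one fps_add_nth fps_mult_left_const_nth
        forest_avg_single[OF label_invariant_level_poly])
  then have "of_nat (Suc n) * fps_nth (egf \<phi> (level_poly u)) (Suc n) =
    (\<Sum>j\<le>degree \<phi>. of_real (coeff \<phi> j) * fps_nth (egf \<phi> (\<lambda>t. 1) ^ j + fps_const u *
      (of_nat j * egf \<phi> (\<lambda>t. 1) ^ (j - 1) * egf \<phi> (level_poly u))) n)"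
    by (subst egf_Suc_nth[where H = "\<lambda>j x. 1 + u * (\<Sum>i<j. level_poly u (x i))"])
       (simp_all only: level_poly_Node)
  also have "\<dots> = fps_nth (\<Sum>j\<le>degree \<phi>. fps_const (of_real (coeff \<phi> j)) * (egf \<phi> (\<lambda>t. 1) ^ j + fps_const u *
      (of_nat j * egf \<phi> (\<lambda>t. 1) ^ (j - 1) * egf \<phi> (level_poly u)))) n"
    by (simp only: fps_sum_nth fps_mult_left_const_nth)
  also have "(\<Sum>j\<le>degree \<phi>. fps_const (of_real (coeff \<phi> j)) * (egf \<phi> (\<lambda>t. 1) ^ j + fps_const u *
      (of_nat j * egf \<phi> (\<lambda>t. 1) ^ (j - 1) * egf \<phi> (level_poly u)))) = poly_fps \<phi> (egf \<phi> (\<lambda>t. 1)) +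
       fps_const u * (poly_fps (pderiv \<phi>) (egf \<phi> (\<lambda>t. 1)) * egf \<phi> (level_poly u))"
    unfolding poly_fps_pderiv unfolding poly_fps_def
    by (simp only: distrib_left sum.distrib sum_distrib_left sum_distrib_right mult_ac)
  finally show ?thesis .
qed

text \<open>Diagonal terms are separated from products over two different children because only the
  latter factor over independent subtrees. Conjugates are kept so that no absolute value of a single
  subtree value appears in the linear and mixed terms.\<close>

lemma norm_one_plus_sum_sq:
  fixes x :: "nat \<Rightarrow> complex"
  shows "complex_of_real ((norm (1 + u * (\<Sum>i<j. x i)))\<^sup>2) =
    1 + u * (\<Sum>i<j. x i) + cnj u * (\<Sum>i<j. cnj (x i)) +
    of_real ((norm u)\<^sup>2) * ((\<Sum>i<j. of_real ((norm (x i))\<^sup>2)) + (\<Sum>i<j. \<Sum>k\<in>{..<j}-{i}. x i * cnj (x k)))"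
proof -
  have "(\<Sum>i<j. x i) * (\<Sum>k<j. cnj (x k)) = (\<Sum>i<j. \<Sum>k<j. x i * cnj (x k))"
    by (rule sum_product)
  also have "\<dots> = (\<Sum>i<j. x i * cnj (x i) + (\<Sum>k\<in>{..<j}-{i}. x i * cnj (x k)))"
    by (intro sum.cong refl) (simp add: sum.remove)
  also have "\<dots> = (\<Sum>i<j. of_real ((norm (x i))\<^sup>2)) + (\<Sum>i<j. \<Sum>k\<in>{..<j}-{i}. x i * cnj (x k))"
    by (simp only: sum.distrib complex_norm_square)
  finally have eq: "(\<Sum>i<j. x i) * (\<Sum>k<j. cnj (x k)) = \<dots>" .
  show ?thesis unfolding eq[symmetric]
    by (simp only: complex_norm_square) (simp add: algebra_simps)
qed

text \<open>An identity, not an estimate: in the linear and mixed terms the level polynomial and its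
  conjugate enter through \<open>M\<close> and \<open>M'\<close>, so bounds for the complex mean
  apply there. The factor \<open>(norm u)\<^sup>2\<close> in front of the term with \<open>V\<close>
  is what the contraction has to absorb.\<close>

lemma egf_square_rec:
  fixes \<phi> u defines "T \<equiv> egf \<phi> (\<lambda>t. 1 :: complex)" and "M \<equiv> egf \<phi> (level_poly u)"
    and "M' \<equiv> egf \<phi> (\<lambda>t. cnj (level_poly u t))"
    and "V \<equiv> egf \<phi> (\<lambda>t. complex_of_real ((norm (level_poly u t))\<^sup>2))"
  shows "of_nat (Suc n) * fps_nth V (Suc n) =
     fps_nth (poly_fps \<phi> T + fps_const u * (poly_fps (pderiv \<phi>) T * M) +
       fps_const (cnj u) * (poly_fps (pderiv \<phi>) T * M') +
       fps_const (of_real ((norm u)\<^sup>2)) * (poly_fps (pderiv \<phi>) T * V +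
         poly_fps (pderiv (pderiv \<phi>)) T * (M * M'))) n"
proof -
  let ?A = "\<lambda>j. T ^ j + fps_const u * (of_nat j * T ^ (j - 1) * M) +
      fps_const (cnj u) * (of_nat j * T ^ (j - 1) * M') +
      fps_const (of_real ((norm u)\<^sup>2)) * (of_nat j * T ^ (j - 1) * V + of_nat (j * (j - 1)) * T ^ (j - 2) * M * M')"
  have inv: "label_invariant (\<lambda>t. cnj (level_poly u t))"
    "label_invariant (\<lambda>t. complex_of_real ((norm (level_poly u t))\<^sup>2))"
    using label_invariant_level_poly[of u] by (auto simp: label_invariant_def)
  have avg: "forest_avg \<phi> n j (\<lambda>ts. 1 + u * (\<Sum>i<j. level_poly u (ts ! i)) + cnj u * (\<Sum>i<j. cnj (level_poly u (ts ! i))) +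
    of_real ((norm u)\<^sup>2) * ((\<Sum>i<j. of_real ((norm (level_poly u (ts ! i)))\<^sup>2)) +
      (\<Sum>i<j. \<Sum>k\<in>{..<j}-{i}. level_poly u (ts ! i) * cnj (level_poly u (ts ! k))))) = fps_nth (?A j) n" for j
    unfolding T_def M_def M'_def V_def
    by (simp only: forest_avg_add forest_avg_cmult forest_avg_one fps_add_nth fps_mult_left_const_nth
        forest_avg_single[OF label_invariant_level_poly] forest_avg_single[OF inv(1)]
        forest_avg_single[OF inv(2)] forest_avg_pair[OF label_invariant_level_poly inv(1)])
  have "of_nat (Suc n) * fps_nth V (Suc n) = (\<Sum>j\<le>degree \<phi>. of_real (coeff \<phi> j) *
      forest_avg \<phi> n j (\<lambda>ts. 1 + u * (\<Sum>i<j. level_poly u (ts ! i)) + cnj u * (\<Sum>i<j. cnj (level_poly u (ts ! i))) +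
    of_real ((norm u)\<^sup>2) * ((\<Sum>i<j. of_real ((norm (level_poly u (ts ! i)))\<^sup>2)) +
      (\<Sum>i<j. \<Sum>k\<in>{..<j}-{i}. level_poly u (ts ! i) * cnj (level_poly u (ts ! k))))))"
    unfolding V_def
    by (subst egf_Suc_nth[where H = "\<lambda>j x. 1 + u * (\<Sum>i<j. level_poly u (x i)) + cnj u * (\<Sum>i<j. cnj (level_poly u (x i))) +
      of_real ((norm u)\<^sup>2) * ((\<Sum>i<j. of_real ((norm (level_poly u (x i)))\<^sup>2)) +
      (\<Sum>i<j. \<Sum>k\<in>{..<j}-{i}. level_poly u (x i) * cnj (level_poly u (x k))))"])
       (simp_all only: level_poly_Node norm_one_plus_sum_sq)
  also have "\<dots> = (\<Sum>j\<le>degree \<phi>. of_real (coeff \<phi> j) * fps_nth (?A j) n)"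
    by (simp only: avg)
  also have "\<dots> = fps_nth (\<Sum>j\<le>degree \<phi>. fps_const (of_real (coeff \<phi> j)) * ?A j) n"
    by (simp only: fps_sum_nth fps_mult_left_const_nth)
  also have "(\<Sum>j\<le>degree \<phi>. fps_const (of_real (coeff \<phi> j)) * ?A j) = poly_fps \<phi> T + fps_const u * (poly_fps (pderiv \<phi>) T * M) +
       fps_const (cnj u) * (poly_fps (pderiv \<phi>) T * M') +
       fps_const (of_real ((norm u)\<^sup>2)) * (poly_fps (pderiv \<phi>) T * V +
         poly_fps (pderiv (pderiv \<phi>)) T * (M * M'))"
    unfolding poly_fps_pderiv2 unfolding poly_fps_pderiv unfolding poly_fps_def
    by (simp only: distrib_left sum.distrib sum_distrib_left sum_distrib_right mult_ac)
  finally show ?thesis .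
qed

section \<open>Inequalities for powers of sums over subtrees\<close>

lemma power_diff_le:
  fixes a b :: real
  assumes "0 \<le> a" "a \<le> b"
  shows "b ^ m - a ^ m \<le> real m * (b - a) * b ^ (m - 1)"
proof (induction m)
  case (Suc m)
  have "b ^ Suc m - a ^ Suc m = b * (b ^ m - a ^ m) + (b - a) * a ^ m" by (simp add: algebra_simps)
  also have "\<dots> \<le> b * (real m * (b - a) * b ^ (m - 1)) + (b - a) * b ^ m"
    using assms Suc by (intro add_mono mult_left_mono power_mono) auto
  also have "b * (real m * (b - a) * b ^ (m - 1)) = real m * (b - a) * b ^ m"
    by (cases m) (simp_all add: mult_ac)
  finally show ?case by (simp add: algebra_simps)
qed simp

text \<open>Comparison with the largest summand x_i: the sum exceeds it by the rest r and is at most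
  \<open>card I\<close> times x_i, so the difference of the m-th powers is controlled by products
  x_i^(m-1) x_k. The point is the coefficient 1 of the pure powers; convexity alone would put a
  power of \<open>card I\<close> there and destroy the contraction.\<close>

lemma sum_power_le:
  fixes x :: "'i \<Rightarrow> real"
  assumes "finite I" "\<And>i. i \<in> I \<Longrightarrow> x i \<ge> 0" "m \<ge> 1"
  shows "(\<Sum>i\<in>I. x i) ^ m \<le> (\<Sum>i\<in>I. x i ^ m) +
    real m * real (card I) ^ (m - 1) * (\<Sum>i\<in>I. \<Sum>k\<in>I-{i}. x i ^ (m - 1) * x k)"
proof (cases "I = {}")
  case True
  then show ?thesis using assms(3) by (simp add: power_0_left)
next
  case False
  then have "Max (x ` I) \<in> x ` I" using assms(1) by (intro Max_in) auto
  then obtain i where mi: "i \<in> I" "x i = Max (x ` I)" by (metis imageE)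
  have i: "i \<in> I" "\<And>k. k \<in> I \<Longrightarrow> x k \<le> x i" using mi assms(1) by auto
  define b where "b = (\<Sum>i\<in>I. x i)"
  define r where "r = (\<Sum>k\<in>I-{i}. x k)"
  have b: "b = x i + r" unfolding b_def r_def using assms(1) i(1) by (rule sum.remove)
  have r0: "r \<ge> 0" using assms by (auto simp: r_def intro!: sum_nonneg)
  have bx: "b \<le> real (card I) * x i"
    unfolding b_def using i sum_bounded_above[of I x "x i"] by simp
  have xi: "x i \<ge> 0" using i assms by auto
  have "b ^ m - x i ^ m \<le> real m * r * b ^ (m - 1)"
    using power_diff_le[of "x i" b m] xi r0 b by simp
  also have "\<dots> \<le> real m * r * (real (card I) * x i) ^ (m - 1)"
    using bx xi r0 b by (intro mult_left_mono power_mono) auto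
  also have "\<dots> = real m * real (card I) ^ (m - 1) * (\<Sum>k\<in>I-{i}. x i ^ (m - 1) * x k)"
    by (simp add: r_def power_mult_distrib sum_distrib_left mult_ac)
  also have "\<dots> \<le> real m * real (card I) ^ (m - 1) * (\<Sum>i\<in>I. \<Sum>k\<in>I-{i}. x i ^ (m - 1) * x k)"
    using i assms by (intro mult_left_mono member_le_sum sum_nonneg mult_nonneg_nonneg) auto
  finally have "b ^ m \<le> x i ^ m + \<dots>" by simp
  moreover have "x i ^ m \<le> (\<Sum>i\<in>I. x i ^ m)"
    using i assms by (intro member_le_sum) auto
  ultimately show ?thesis by (simp add: b_def)
qed

text \<open>The 1 coming from the root is treated as one more summand, with index \<open>j\<close>.
  The coefficient \<open>c ^ m\<close> of the pure powers stays exact, whereas lower-order terms may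
  carry a crude constant.\<close>

lemma one_plus_sum_power_le:
  fixes x :: "nat \<Rightarrow> real"
  assumes "\<And>i. i < j \<Longrightarrow> x i \<ge> 0" "c \<ge> 0" "j \<le> d" "m \<ge> 1"
  shows "(1 + c * (\<Sum>i<j. x i)) ^ m \<le> c ^ m * (\<Sum>i<j. x i ^ m) +
    real m * real (Suc d) ^ (m - 1) * (1 + c) ^ m * (1 + (\<Sum>i<j. x i) + (\<Sum>i<j. x i ^ (m - 1)) +
      (\<Sum>i<j. \<Sum>k\<in>{..<j}-{i}. x i ^ (m - 1) * x k))"
proof -
  define y where "y i = (if i = j then 1 else c * x i)" for i
  define K where "K = real m * real (Suc d) ^ (m - 1)"
  define P where "P = (\<Sum>i<j. \<Sum>k\<in>{..<j}-{i}. x i ^ (m - 1) * x k)"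
  define S where "S = (\<Sum>i<j. x i)"
  define S' where "S' = (\<Sum>i<j. x i ^ (m - 1))"
  have nn: "S \<ge> 0" "S' \<ge> 0" "P \<ge> 0"
    using assms by (auto simp: S_def S'_def P_def intro!: sum_nonneg)
  have ins: "{..<Suc j} = insert j {..<j}" by auto
  have sy: "(\<Sum>i<Suc j. y i) = 1 + c * S"
    by (simp add: y_def S_def sum_distrib_left)
  have sym: "(\<Sum>i<Suc j. y i ^ m) = 1 + c ^ m * (\<Sum>i<j. x i ^ m)"
    by (simp add: y_def power_mult_distrib sum_distrib_left)
  have pairs: "(\<Sum>i<Suc j. \<Sum>k\<in>{..<Suc j}-{i}. y i ^ (m - 1) * y k) = c * S + c ^ (m - 1) * S' + c ^ m * P"
  proof -
    have 1: "(\<Sum>k\<in>{..<Suc j}-{j}. y j ^ (m - 1) * y k) = c * S"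
    proof -
      have "{..<Suc j}-{j} = {..<j}" by auto
      then show ?thesis by (simp add: y_def S_def sum_distrib_left)
    qed
    have 2: "(\<Sum>k\<in>{..<Suc j}-{i}. y i ^ (m - 1) * y k) = c ^ (m - 1) * x i ^ (m - 1) +
        c ^ m * (\<Sum>k\<in>{..<j}-{i}. x i ^ (m - 1) * x k)" if i: "i < j" for i
    proof -
      have "{..<Suc j}-{i} = insert j ({..<j}-{i})" using i by auto
      then have "(\<Sum>k\<in>{..<Suc j}-{i}. y i ^ (m - 1) * y k) = y i ^ (m - 1) * y j + (\<Sum>k\<in>{..<j}-{i}. y i ^ (m - 1) * y k)"
        by simp
      also have "(\<Sum>k\<in>{..<j}-{i}. y i ^ (m - 1) * y k) = (\<Sum>k\<in>{..<j}-{i}. c ^ m * (x i ^ (m - 1) * x k))"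
      proof (intro sum.cong refl)
        fix k assume "k \<in> {..<j}-{i}"
        moreover have "c ^ m = c ^ (m - 1) * c" using assms(4) by (cases m) auto
        ultimately show "y i ^ (m - 1) * y k = c ^ m * (x i ^ (m - 1) * x k)"
          using i by (simp add: y_def power_mult_distrib)
      qed
      also have "y i ^ (m - 1) * y j = c ^ (m - 1) * x i ^ (m - 1)"
        using i by (simp add: y_def power_mult_distrib)
      finally show ?thesis by (simp add: sum_distrib_left)
    qed
    have "(\<Sum>i<j. \<Sum>k\<in>{..<Suc j}-{i}. y i ^ (m - 1) * y k) = (\<Sum>i<j. c ^ (m - 1) * x i ^ (m - 1) +
        c ^ m * (\<Sum>k\<in>{..<j}-{i}. x i ^ (m - 1) * x k))"
      by (intro sum.cong refl 2) auto
    also have "\<dots> = c ^ (m - 1) * S' + c ^ m * P"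
      by (simp only: sum.distrib S'_def P_def sum_distrib_left)
    finally have "(\<Sum>i<j. \<Sum>k\<in>{..<Suc j}-{i}. y i ^ (m - 1) * y k) = c ^ (m - 1) * S' + c ^ m * P" .
    then show ?thesis using 1 by simp
  qed
  have "(1 + c * S) ^ m \<le> 1 + c ^ m * (\<Sum>i<j. x i ^ m) + real m * real (Suc j) ^ (m - 1) * (c * S + c ^ (m - 1) * S' + c ^ m * P)"
    using sum_power_le[of "{..<Suc j}" y m] assms unfolding pairs sy sym by (simp add: y_def)
  also have "\<dots> \<le> 1 + c ^ m * (\<Sum>i<j. x i ^ m) + K * ((1 + c) ^ m * S + (1 + c) ^ m * S' + (1 + c) ^ m * P)"
  proof -
    have "c \<le> (1 + c) ^ m" using assms self_le_power[of "1 + c" m] by simp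
    moreover have "c ^ (m - 1) \<le> (1 + c) ^ m"
      using assms power_mono[of c "1 + c" "m - 1"] power_increasing[of "m - 1" m "1 + c"] by simp
    moreover have "c ^ m \<le> (1 + c) ^ m" using assms by (intro power_mono) auto
    moreover have "real m * real (Suc j) ^ (m - 1) \<le> K"
      unfolding K_def using assms by (intro mult_left_mono power_mono) auto
    ultimately show ?thesis using nn assms
      by (intro add_left_mono mult_mono add_mono mult_right_mono) (auto simp: K_def)
  qed
  also have "\<dots> \<le> c ^ m * (\<Sum>i<j. x i ^ m) + K * (1 + c) ^ m * (1 + S + S' + P)"
  proof -
    \<comment> \<open>The isolated 1, the m-th power of the root's own summand, is absorbed into the
      error term.\<close>
    have "1 * 1 \<le> K * (1 + c) ^ m"
    proof (intro mult_mono)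
      have "1 * 1 \<le> real m * real (Suc d) ^ (m - 1)"
        using assms(4) by (intro mult_mono) (auto intro: one_le_power)
      then show "1 \<le> K" by (simp add: K_def)
      then show "0 \<le> K" by simp
    qed (use assms in \<open>auto intro: one_le_power\<close>)
    then show ?thesis by (simp add: algebra_simps)
  qed
  finally show ?thesis by (simp only: S_def S'_def P_def K_def)
qed

lemma forest_avg_mono:
  assumes "\<And>j. coeff \<phi> j \<ge> 0" "\<And>ts. ts \<in> forests {2..Suc n} j \<Longrightarrow> H ts \<le> (H' ts :: real)"
  shows "forest_avg \<phi> n j H \<le> forest_avg \<phi> n j H'"
  unfolding forest_avg_def using assms
  by (intro divide_right_mono sum_mono mult_left_mono)
     (auto intro!: prod_nonneg tree_weight_nonneg)

lemma poly_fps_combine: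
  fixes a K T V V1 V2 :: "real fps"
  shows "(\<Sum>j\<le>degree \<phi>. fps_const (coeff \<phi> j) * (a * (of_nat j * T ^ (j - 1) * V) + K * (T ^ j +
     of_nat j * T ^ (j - 1) * V1 + of_nat j * T ^ (j - 1) * V2 +
     of_nat (j * (j - 1)) * T ^ (j - 2) * V2 * V1))) =
    a * (poly_fps (pderiv \<phi>) T * V) + K * (poly_fps \<phi> T + poly_fps (pderiv \<phi>) T * V1 +
      poly_fps (pderiv \<phi>) T * V2 + poly_fps (pderiv (pderiv \<phi>)) T * (V2 * V1))"
  unfolding poly_fps_pderiv2 unfolding poly_fps_pderiv unfolding poly_fps_def
  by (simp only: distrib_left sum.distrib sum_distrib_left sum_distrib_right mult_ac of_real_eq_id id_apply)

text \<open>Here absolute values are taken at once. For m \<ge> 2 the top moment occurs only in the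
  first term, with the factor |u|^m and the same kernel \<phi>'(\<tau>) as for the mean; all other
  terms involve moments of order at most m - 1.\<close>

lemma egf_power_rec:
  fixes \<phi> u m defines "T \<equiv> egf \<phi> (\<lambda>t. 1 :: real)" and "V \<equiv> \<lambda>m. egf \<phi> (\<lambda>t. (norm (level_poly u t)) ^ m)"
  assumes "m \<ge> 1" "\<And>j. coeff \<phi> j \<ge> 0"
  shows "real (Suc n) * fps_nth (V m) (Suc n) \<le>
     fps_nth (fps_const (norm u ^ m) * (poly_fps (pderiv \<phi>) T * V m) +
       fps_const (real m * real (Suc (degree \<phi>)) ^ (m - 1) * (1 + norm u) ^ m) *
       (poly_fps \<phi> T + poly_fps (pderiv \<phi>) T * V 1 + poly_fps (pderiv \<phi>) T * V (m - 1) +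
         poly_fps (pderiv (pderiv \<phi>)) T * (V (m - 1) * V 1))) n"
proof -
  let ?c = "norm u"
  let ?K = "real m * real (Suc (degree \<phi>)) ^ (m - 1) * (1 + norm u) ^ m"
  let ?x = "\<lambda>ts i. norm (level_poly u (ts ! i))"
  let ?A = "\<lambda>j. fps_const (?c ^ m) * (of_nat j * T ^ (j - 1) * V m) + fps_const ?K * (T ^ j +
     of_nat j * T ^ (j - 1) * V 1 + of_nat j * T ^ (j - 1) * V (m - 1) +
     of_nat (j * (j - 1)) * T ^ (j - 2) * V (m - 1) * V 1)"
  have inv: "label_invariant (\<lambda>t. norm (level_poly u t) ^ k)" for k
    using label_invariant_level_poly[of u] by (auto simp: label_invariant_def)
  have inv1: "label_invariant (\<lambda>t. norm (level_poly u t))" using inv[of 1] by simp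
  have avg: "forest_avg \<phi> n j (\<lambda>ts. ?c ^ m * (\<Sum>i<j. ?x ts i ^ m) + ?K * (1 + (\<Sum>i<j. ?x ts i) +
    (\<Sum>i<j. ?x ts i ^ (m - 1)) + (\<Sum>i<j. \<Sum>k\<in>{..<j}-{i}. ?x ts i ^ (m - 1) * ?x ts k))) = fps_nth (?A j) n" for j
    unfolding T_def V_def power_one_right
    by (simp only: forest_avg_add forest_avg_cmult forest_avg_one fps_add_nth fps_mult_left_const_nth
        forest_avg_single[OF inv] forest_avg_single[OF inv1] forest_avg_pair[OF inv inv1])
  have "real (Suc n) * fps_nth (V m) (Suc n) = (\<Sum>j\<le>degree \<phi>. coeff \<phi> j *
      forest_avg \<phi> n j (\<lambda>ts. norm (1 + u * (\<Sum>i<j. level_poly u (ts ! i))) ^ m))"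
    unfolding V_def
    by (subst egf_Suc_nth[where H = "\<lambda>j x. norm (1 + u * (\<Sum>i<j. level_poly u (x i))) ^ m"])
       (simp_all only: level_poly_Node of_real_eq_id id_apply)
  also have "\<dots> \<le> (\<Sum>j\<le>degree \<phi>. coeff \<phi> j * fps_nth (?A j) n)"
    unfolding avg[symmetric]
  proof (intro sum_mono mult_left_mono assms forest_avg_mono)
    fix j and ts :: "otree list" assume j: "j \<in> {..degree \<phi>}"
    have "norm (1 + u * (\<Sum>i<j. level_poly u (ts ! i))) \<le> 1 + ?c * (\<Sum>i<j. ?x ts i)"
      by (rule order.trans[OF norm_triangle_ineq])
         (auto simp: norm_mult intro!: mult_left_mono norm_sum)
    then have "norm (1 + u * (\<Sum>i<j. level_poly u (ts ! i))) ^ m \<le> (1 + ?c * (\<Sum>i<j. ?x ts i)) ^ m"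
      by (intro power_mono) auto
    also have "\<dots> \<le> ?c ^ m * (\<Sum>i<j. ?x ts i ^ m) + ?K * (1 + (\<Sum>i<j. ?x ts i) +
      (\<Sum>i<j. ?x ts i ^ (m - 1)) + (\<Sum>i<j. \<Sum>k\<in>{..<j}-{i}. ?x ts i ^ (m - 1) * ?x ts k))"
      using j assms by (intro one_plus_sum_power_le) auto
    finally show "norm (1 + u * (\<Sum>i<j. level_poly u (ts ! i))) ^ m \<le> ?c ^ m * (\<Sum>i<j. ?x ts i ^ m) + ?K * (1 + (\<Sum>i<j. ?x ts i) +
      (\<Sum>i<j. ?x ts i ^ (m - 1)) + (\<Sum>i<j. \<Sum>k\<in>{..<j}-{i}. ?x ts i ^ (m - 1) * ?x ts k))" .
  qed
  also have "\<dots> = fps_nth (\<Sum>j\<le>degree \<phi>. fps_const (coeff \<phi> j) * ?A j) n"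
    by (simp only: fps_sum_nth fps_mult_left_const_nth of_real_eq_id id_apply)
  also have "(\<Sum>j\<le>degree \<phi>. fps_const (coeff \<phi> j) * ?A j) = fps_const (norm u ^ m) * (poly_fps (pderiv \<phi>) T * V m) +
       fps_const ?K * (poly_fps \<phi> T + poly_fps (pderiv \<phi>) T * V 1 + poly_fps (pderiv \<phi>) T * V (m - 1) +
         poly_fps (pderiv (pderiv \<phi>)) T * (V (m - 1) * V 1))"
    by (rule poly_fps_combine)
  finally show ?thesis .
qed

section \<open>The generating function on the unit disk\<close>

definition cpoly :: "real poly \<Rightarrow> complex \<Rightarrow> complex" where
  "cpoly P w = (\<Sum>j\<le>degree P. of_real (coeff P j) * w ^ j)"

lemma cpoly_of_real: "cpoly P (of_real x) = of_real (poly P x)"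
  by (simp add: cpoly_def poly_altdef)

lemma cpoly_deriv [derivative_intros]: "(cpoly P has_field_derivative cpoly (pderiv P) w) (at w)"
proof -
  have eq: "cpoly P = poly (map_poly complex_of_real P)" for P
    by (rule ext) (simp add: cpoly_def poly_altdef coeff_map_poly degree_map_poly)
  have "pderiv (map_poly complex_of_real P) = map_poly complex_of_real (pderiv P)"
    by (rule poly_eqI) (simp add: coeff_pderiv coeff_map_poly)
  then show ?thesis unfolding eq using poly_DERIV[of "map_poly complex_of_real P" w] by simp
qed

lemma cpoly_deriv_chain [derivative_intros]:
  "(f has_field_derivative f') (at z within S) \<Longrightarrow>
    ((\<lambda>z. cpoly P (f z)) has_field_derivative cpoly (pderiv P) (f z) * f') (at z within S)"
  by (rule DERIV_chain2[OF cpoly_deriv])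

lemma norm_cpoly_le:
  assumes "\<And>j. coeff P j \<ge> 0" "norm w \<le> x"
  shows "norm (cpoly P w) \<le> poly P x"
proof -
  have "norm (cpoly P w) \<le> (\<Sum>j\<le>degree P. norm (of_real (coeff P j) * w ^ j))"
    unfolding cpoly_def by (rule norm_sum)
  also have "\<dots> \<le> (\<Sum>j\<le>degree P. coeff P j * x ^ j)"
    using assms by (intro sum_mono) (auto simp: norm_mult norm_power intro!: mult_left_mono power_mono)
  finally show ?thesis by (simp add: poly_altdef)
qed

lemma poly_mono_nonneg:
  fixes x y :: real
  assumes "\<And>j. coeff P j \<ge> 0" "0 \<le> x" "x \<le> y"
  shows "poly P x \<le> poly P y"
  unfolding poly_altdef using assms by (intro sum_mono mult_left_mono power_mono) auto

lemma fps_nth_power_nonneg: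
  fixes f :: "real fps"
  shows "(\<And>n. fps_nth f n \<ge> 0) \<Longrightarrow> fps_nth (f ^ j) n \<ge> 0"
  by (induction j arbitrary: n) (auto simp: fps_mult_nth intro!: sum_nonneg)

lemma fps_nth_power_of_real:
  "fps_nth (Abs_fps (\<lambda>n. complex_of_real (p n)) ^ j) n = of_real (fps_nth (Abs_fps p ^ j) n)"
  by (induction j arbitrary: n) (auto simp: fps_mult_nth)

lemma fps_nth_poly_fps_of_real:
  "fps_nth (poly_fps P (Abs_fps (\<lambda>n. complex_of_real (p n)))) n = of_real (fps_nth (poly_fps P (Abs_fps p)) n)"
  by (simp add: poly_fps_def fps_sum_nth fps_nth_power_of_real)

lemma fps_conv_radius_sum_ge:
  assumes "finite I" "\<And>i. i \<in> I \<Longrightarrow> fps_conv_radius (f i) \<ge> r"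
  shows "fps_conv_radius (\<Sum>i\<in>I. f i) \<ge> r"
  using assms
proof (induction I rule: finite_induct)
  case (insert x I)
  then show ?case using order.trans[OF _ fps_conv_radius_add[of "f x" "sum f I"]] by simp
qed simp

lemma eval_fps_sum:
  assumes "finite I" "\<And>i. i \<in> I \<Longrightarrow> norm z < fps_conv_radius (f i)"
  shows "eval_fps (\<Sum>i\<in>I. f i) z = (\<Sum>i\<in>I. eval_fps (f i) z)"
  using assms
proof (induction I rule: finite_induct)
  case (insert x I)
  show ?case
  proof (cases "I = {}")
    case False
    have "Min ((\<lambda>i. fps_conv_radius (f i)) ` I) \<le> fps_conv_radius (\<Sum>i\<in>I. f i)"
      using insert by (intro fps_conv_radius_sum_ge) auto
    moreover have "norm z < Min ((\<lambda>i. fps_conv_radius (f i)) ` I)"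
      using insert False by (subst Min_gr_iff) auto
    ultimately have "norm z < fps_conv_radius (\<Sum>i\<in>I. f i)" by simp
    then show ?thesis using insert by (simp add: eval_fps_add)
  qed (use insert in auto)
qed simp

lemma fps_conv_radius_poly_fps: "fps_conv_radius f \<ge> r \<Longrightarrow> fps_conv_radius (poly_fps P f) \<ge> r"
  unfolding poly_fps_def
proof (intro fps_conv_radius_sum_ge)
  fix j assume r: "r \<le> fps_conv_radius f"
  have "r \<le> fps_conv_radius (f ^ j)" using r fps_conv_radius_power[of f j] by (rule order.trans)
  also have "\<dots> \<le> fps_conv_radius (fps_const (of_real (coeff P j)) * f ^ j)"
    using fps_conv_radius_mult[of "fps_const (of_real (coeff P j))" "f ^ j"] by simp
  finally show "r \<le> fps_conv_radius (fps_const (of_real (coeff P j)) * f ^ j)" .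
qed simp

lemma eval_poly_fps:
  assumes "norm z < fps_conv_radius f"
  shows "eval_fps (poly_fps P f) z = cpoly P (eval_fps f z)"
proof -
  have 1: "norm z < fps_conv_radius (f ^ j)" for j
    using assms fps_conv_radius_power[of f j] by simp
  have 2: "norm z < fps_conv_radius (fps_const (of_real (coeff P j)) * f ^ j)" for j
    using 1[of j] fps_conv_radius_mult[of "fps_const (of_real (coeff P j))" "f ^ j"] by simp
  show ?thesis unfolding poly_fps_def cpoly_def
    using 1 2 assms by (simp add: eval_fps_sum eval_fps_mult eval_fps_power)
qed

text \<open>\<open>F w = \<integral>\<^sub>0\<^sup>w dv/\<phi>(v)\<close> inverts the generating function on the positive axis; \<open>F_lim\<close> normalizes its
  radius of convergence to 1.\<close>

locale inc_series =
  fixes \<phi> :: "real poly" and p :: "nat \<Rightarrow> real" and d :: nat and F :: "real \<Rightarrow> real"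
  assumes d: "d \<ge> 2" and deg: "degree \<phi> = d" and coeff_nonneg: "coeff \<phi> j \<ge> 0"
    and coeff_0: "coeff \<phi> 0 > 0"
    and p_0: "p 0 = 0"
    and p_rec: "real (Suc n) * p (Suc n) = fps_nth (poly_fps \<phi> (Abs_fps p)) n"
    and F_deriv: "w \<ge> 0 \<Longrightarrow> (F has_real_derivative 1 / poly \<phi> w) (at w)"
    and F_0: "F 0 = 0" and F_lim: "(F \<longlongrightarrow> 1) at_top"
begin

lemma coeff_d: "coeff \<phi> d > 0"
  using coeff_nonneg[of d] d deg leading_coeff_0_iff[of \<phi>] by (auto simp: less_le)

lemma poly_pos: "w \<ge> 0 \<Longrightarrow> poly \<phi> w > 0"
proof -
  assume w: "w \<ge> 0"
  have "0 < coeff \<phi> 0" by (rule coeff_0)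
  also have "\<dots> = poly \<phi> 0" by (simp add: poly_0_coeff_0)
  also have "\<dots> \<le> poly \<phi> w" using w by (intro poly_mono_nonneg coeff_nonneg) auto
  finally show ?thesis .
qed

lemma F_less: "0 \<le> x \<Longrightarrow> x < y \<Longrightarrow> F x < F y"
  by (rule DERIV_pos_imp_increasing[of x y F]) (auto intro!: exI F_deriv poly_pos)

lemma F_le: "0 \<le> x \<Longrightarrow> x \<le> y \<Longrightarrow> F x \<le> F y"
  using F_less[of x y] by (cases "x = y") auto

lemma F_le_iff: "0 \<le> x \<Longrightarrow> 0 \<le> y \<Longrightarrow> F x \<le> F y \<longleftrightarrow> x \<le> y"
  using F_le[of x y] F_less[of y x] by force

lemma F_ex: "x < 1 \<Longrightarrow> \<exists>w\<ge>0. F w > x"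
  using eventually_conj[OF order_tendstoD(1)[OF F_lim, of x] eventually_ge_at_top[of 0]]
  by (auto simp: eventually_at_top_linorder)

text \<open>The coefficient of z^m in a power of the series involves only p_0, ..., p_m, so the
  recursion builds \<open>p (Suc m)\<close> from nonnegative data; the truncation \<open>?f\<close>
  makes this dependence explicit.\<close>

lemma p_nonneg: "p n \<ge> 0"
proof (induction n rule: less_induct)
  case (less n)
  show ?case
  proof (cases n)
    case 0
    then show ?thesis by (simp add: p_0)
  next
    case (Suc m)
    let ?f = "Abs_fps (\<lambda>i. if i \<le> m then p i else 0)"
    have "fps_nth (?f ^ j) i = fps_nth (Abs_fps p ^ j) i" if "i \<le> m" for i j
      using that
    proof (induction j arbitrary: i)
      case (Suc j)
      show ?case unfolding power_Suc fps_mult_nth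
        using Suc by (intro sum.cong refl arg_cong2[of _ _ _ _ "(*)"]) auto
    qed simp
    moreover have "fps_nth (?f ^ j) m \<ge> 0" for j
      by (rule fps_nth_power_nonneg) (use less Suc in auto)
    ultimately have "fps_nth (Abs_fps p ^ j) m \<ge> 0" for j by simp
    then have "real (Suc m) * p (Suc m) \<ge> 0"
      unfolding p_rec poly_fps_def using coeff_nonneg by (simp add: fps_sum_nth sum_nonneg)
    then show ?thesis using Suc by (simp add: zero_le_mult_iff)
  qed
qed

text \<open>With nonnegative terms the truncation of a product is dominated by the product of the
  truncations. The range below \<open>N\<close> on the left against \<open>N\<close> inclusive on
  the right is the shift caused by differentiating a polynomial of degree \<open>N\<close>.\<close>

lemma partial_power_le:
  assumes "x \<ge> 0"
  shows "(\<Sum>n<N. fps_nth (Abs_fps p ^ j) n * x ^ n) \<le> (\<Sum>n\<le>N. p n * x ^ n) ^ j"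
proof (induction j)
  case 0
  then show ?case by (cases N) (simp_all add: sum.lessThan_Suc_shift del: sum.lessThan_Suc)
next
  case (Suc j)
  have nn: "fps_nth (Abs_fps p ^ j) n \<ge> 0" for n j using p_nonneg by (intro fps_nth_power_nonneg) auto
  have "(\<Sum>n<N. fps_nth (Abs_fps p ^ Suc j) n * x ^ n) =
     (\<Sum>n<N. \<Sum>i\<le>n. (p i * x ^ i) * (fps_nth (Abs_fps p ^ j) (n - i) * x ^ (n - i)))"
  proof (intro sum.cong refl)
    fix n
    have "fps_nth (Abs_fps p ^ Suc j) n * x ^ n = (\<Sum>i\<le>n. p i * fps_nth (Abs_fps p ^ j) (n - i) * x ^ n)"
      by (simp add: fps_mult_nth sum_distrib_right atLeast0AtMost)
    also have "\<dots> = (\<Sum>i\<le>n. (p i * x ^ i) * (fps_nth (Abs_fps p ^ j) (n - i) * x ^ (n - i)))"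
    proof (intro sum.cong refl)
      fix i assume "i \<in> {..n}"
      then have "x ^ n = x ^ i * x ^ (n - i)" by (simp add: power_add[symmetric])
      then show "p i * fps_nth (Abs_fps p ^ j) (n - i) * x ^ n =
          (p i * x ^ i) * (fps_nth (Abs_fps p ^ j) (n - i) * x ^ (n - i))" by simp
    qed
    finally show "fps_nth (Abs_fps p ^ Suc j) n * x ^ n =
        (\<Sum>i\<le>n. (p i * x ^ i) * (fps_nth (Abs_fps p ^ j) (n - i) * x ^ (n - i)))" .
  qed
  also have "\<dots> = (\<Sum>(n, i)\<in>(SIGMA n:{..<N}. {..n}). (p i * x ^ i) * (fps_nth (Abs_fps p ^ j) (n - i) * x ^ (n - i)))"
    by (rule sum.Sigma) auto
  also have "\<dots> = (\<Sum>(i, m)\<in>(\<lambda>(n, i). (i, n - i)) ` (SIGMA n:{..<N}. {..n}).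
      (p i * x ^ i) * (fps_nth (Abs_fps p ^ j) m * x ^ m))"
    by (subst sum.reindex) (auto simp: inj_on_def intro!: sum.cong)
  also have "\<dots> \<le> (\<Sum>(i, m)\<in>{..N} \<times> {..<N}. (p i * x ^ i) * (fps_nth (Abs_fps p ^ j) m * x ^ m))"
    using assms nn p_nonneg by (intro sum_mono2) auto
  also have "\<dots> = (\<Sum>i\<le>N. p i * x ^ i) * (\<Sum>m<N. fps_nth (Abs_fps p ^ j) m * x ^ m)"
    by (simp add: sum_product sum.cartesian_product)
  also have "\<dots> \<le> (\<Sum>i\<le>N. p i * x ^ i) * (\<Sum>n\<le>N. p n * x ^ n) ^ j"
    using assms p_nonneg by (intro mult_left_mono Suc sum_nonneg) auto
  finally show ?case by simp
qed

text \<open>The truncations t satisfy the differential inequality t' \<le> \<phi>(t), so F(t) has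
  slope at most 1. This bounds the partial sums before any convergence is known.\<close>

lemma F_partial_sum_le:
  assumes "0 \<le> x"
  shows "F (\<Sum>n\<le>N. p n * x ^ n) \<le> x"
proof -
  define t where "t x = (\<Sum>n\<le>N. p n * x ^ n)" for x
  define t' where "t' x = (\<Sum>n<N. real (Suc n) * p (Suc n) * x ^ n)" for x
  have t_nn: "t x \<ge> 0" if "x \<ge> 0" for x using that p_nonneg by (auto simp: t_def intro!: sum_nonneg)
  have der: "(t has_real_derivative t' x) (at x)" for x
  proof -
    have "(t has_real_derivative (\<Sum>n\<le>N. p n * (real n * x ^ (n - 1)))) (at x)"
      unfolding t_def by (auto intro!: derivative_eq_intros sum.cong simp: mult_ac)
    also have "(\<Sum>n\<le>N. p n * (real n * x ^ (n - 1))) = t' x"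
      unfolding t'_def by (cases N)
        (simp_all add: sum.atMost_Suc_shift lessThan_Suc_atMost mult_ac del: sum.atMost_Suc of_nat_Suc)
    finally show ?thesis .
  qed
  have t'_le: "t' x \<le> poly \<phi> (t x)" if x: "x \<ge> 0" for x
  proof -
    have "t' x = (\<Sum>n<N. \<Sum>j\<le>d. coeff \<phi> j * (fps_nth (Abs_fps p ^ j) n * x ^ n))"
      unfolding t'_def p_rec poly_fps_def
      by (intro sum.cong refl) (simp add: fps_sum_nth deg sum_distrib_right mult.assoc)
    also have "\<dots> = (\<Sum>j\<le>d. coeff \<phi> j * (\<Sum>n<N. fps_nth (Abs_fps p ^ j) n * x ^ n))"
      by (subst sum.swap) (simp add: sum_distrib_left)
    also have "\<dots> \<le> (\<Sum>j\<le>d. coeff \<phi> j * t x ^ j)"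
      unfolding t_def by (intro sum_mono mult_left_mono partial_power_le x coeff_nonneg)
    finally show ?thesis by (simp add: poly_altdef deg)
  qed
  have "F (t x) - x \<le> F (t 0) - 0"
  proof (rule DERIV_nonpos_imp_nonincreasing[OF assms])
    fix y assume y: "0 \<le> y" "y \<le> x"
    have "((\<lambda>x. F (t x) - x) has_real_derivative 1 / poly \<phi> (t y) * t' y - 1) (at y)"
      by (auto intro!: derivative_eq_intros DERIV_chain2[OF F_deriv der] t_nn y)
    moreover have "1 / poly \<phi> (t y) * t' y - 1 \<le> 0"
      using t'_le[OF y(1)] poly_pos[OF t_nn[OF y(1)]] by simp
    ultimately show "\<exists>z. ((\<lambda>x. F (t x) - x) has_real_derivative z) (at y) \<and> z \<le> 0" by blast
  qed
  moreover have "t 0 = 0" unfolding t_def by (simp add: p_0 power_0_left if_distrib cong: if_cong)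
  ultimately show ?thesis by (simp add: F_0 t_def)
qed

lemma summable_p:
  assumes "0 \<le> x" "x < 1"
  shows "summable (\<lambda>n. p n * x ^ n)"
proof -
  obtain w where w: "w \<ge> 0" "F w > x" using F_ex[OF assms(2)] by blast
  have "(\<Sum>n<N. p n * x ^ n) \<le> w" for N
  proof -
    have "(\<Sum>n<N. p n * x ^ n) \<le> (\<Sum>n\<le>N. p n * x ^ n)"
      using assms p_nonneg by (intro sum_mono2) auto
    also have "\<dots> \<le> w"
    proof (subst F_le_iff[symmetric])
      show "F (\<Sum>n\<le>N. p n * x ^ n) \<le> F w" using F_partial_sum_le[OF assms(1), of N] w by simp
    qed (use w assms p_nonneg in \<open>auto intro!: sum_nonneg\<close>)
    finally show ?thesis .
  qed
  then show ?thesis using assms p_nonneg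
    by (intro summableI_nonneg_bounded[where x = w]) auto
qed

definition T :: "complex fps" where "T = Abs_fps (\<lambda>n. of_real (p n))"
definition \<tau> :: "complex \<Rightarrow> complex" where "\<tau> = eval_fps T"
definition t :: "real \<Rightarrow> real" where "t x = (\<Sum>n. p n * x ^ n)"

lemma conv_radius_T: "fps_conv_radius T \<ge> 1"
  unfolding fps_conv_radius_def
proof (rule conv_radius_geI_ex')
  fix r :: real assume r: "0 < r" "ereal r < 1"
  have "summable (\<lambda>n. complex_of_real (p n * r ^ n))"
    using summable_p[of r] r by (intro summable_of_real) auto
  then show "summable (\<lambda>n. fps_nth T n * of_real r ^ n)" by (simp add: T_def)
qed

lemma conv_radius_poly_T: "fps_conv_radius (poly_fps P T) \<ge> 1"
  by (intro fps_conv_radius_poly_fps conv_radius_T)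

lemma less_conv_radius: "norm z < 1 \<Longrightarrow> fps_conv_radius f \<ge> 1 \<Longrightarrow> ereal (norm z) < fps_conv_radius f"
  by (metis ereal_less(3) less_le_trans)

lemma eval_poly_T: "norm z < 1 \<Longrightarrow> eval_fps (poly_fps P T) z = cpoly P (\<tau> z)"
  unfolding \<tau>_def by (intro eval_poly_fps less_conv_radius conv_radius_T)

lemma deriv_T: "fps_deriv T = poly_fps \<phi> T"
proof (rule fps_ext)
  fix n
  have "fps_nth (fps_deriv T) n = complex_of_real (real (Suc n) * p (Suc n))"
    by (simp add: T_def)
  then show "fps_nth (fps_deriv T) n = fps_nth (poly_fps \<phi> T) n"
    unfolding p_rec T_def fps_nth_poly_fps_of_real .
qed

lemma \<tau>_deriv [derivative_intros]:
  assumes "norm z < 1"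
  shows "(\<tau> has_field_derivative cpoly \<phi> (\<tau> z)) (at z within S)"
proof -
  have "(eval_fps T has_field_derivative eval_fps (fps_deriv T) z) (at z within S)"
    by (intro has_field_derivative_eval_fps less_conv_radius assms conv_radius_T)
  then show ?thesis using eval_poly_T[OF assms] by (simp add: deriv_T \<tau>_def)
qed

lemma \<tau>_0: "\<tau> 0 = 0" by (simp add: \<tau>_def eval_fps_at_0 T_def p_0)

lemma \<tau>_of_real: "0 \<le> x \<Longrightarrow> x < 1 \<Longrightarrow> \<tau> (of_real x) = of_real (t x)"
  using suminf_of_real[OF summable_p[of x], where 'a = complex] by (simp add: \<tau>_def t_def eval_fps_def T_def)

lemma t_nonneg: "0 \<le> x \<Longrightarrow> x < 1 \<Longrightarrow> t x \<ge> 0"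
  unfolding t_def using p_nonneg by (intro suminf_nonneg summable_p) auto

lemma norm_\<tau>_le:
  assumes "norm z < 1" shows "norm (\<tau> z) \<le> t (norm z)"
proof -
  have "summable (\<lambda>n. norm (of_real (p n) * z ^ n))"
    using summable_p[of "norm z"] assms p_nonneg by (simp add: norm_mult norm_power)
  then have "norm (\<tau> z) \<le> (\<Sum>n. norm (of_real (p n) * z ^ n))"
    unfolding \<tau>_def eval_fps_def T_def fps_nth_Abs_fps by (rule summable_norm)
  also have "\<dots> = t (norm z)" using p_nonneg by (simp add: t_def norm_mult norm_power)
  finally show ?thesis .
qed

lemma t_deriv:
  assumes "0 \<le> x" "x < 1"
  shows "(t has_real_derivative poly \<phi> (t x)) (at x within {0..})"
proof -
  have "((\<lambda>y. \<tau> (complex_of_real y)) has_vector_derivative cpoly \<phi> (\<tau> (of_real x))) (at x within {0..})"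
    using \<tau>_deriv[of "of_real x" UNIV] assms
    by (intro has_vector_derivative_real_field) auto
  then have "((\<lambda>y. Re (\<tau> (complex_of_real y))) has_vector_derivative Re (cpoly \<phi> (\<tau> (of_real x)))) (at x within {0..})"
    by (rule bounded_linear.has_vector_derivative[OF bounded_linear_Re])
  moreover have "Re (cpoly \<phi> (\<tau> (of_real x))) = poly \<phi> (t x)"
    using assms by (simp add: \<tau>_of_real cpoly_of_real)
  ultimately have "((\<lambda>y. Re (\<tau> (complex_of_real y))) has_real_derivative poly \<phi> (t x)) (at x within {0..})"
    by (simp add: has_real_derivative_iff_has_vector_derivative)
  then show ?thesis
  proof (rule has_field_derivative_transform_within[where d = "1 - x"])
    fix y assume "y \<in> {0..}" "dist y x < 1 - x"
    then show "Re (\<tau> (complex_of_real y)) = t y"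
      by (subst \<tau>_of_real) (auto simp: dist_real_def)
  qed (use assms in auto)
qed

lemma F_t:
  assumes "0 \<le> x" "x < 1" shows "F (t x) = x"
proof -
  have "F (t x) - x = F (t 0) - 0"
  proof (cases "x = 0")
    case False
    have "\<exists>c. \<forall>y\<in>{0..x}. F (t y) - y = c"
    proof (rule has_field_derivative_zero_constant)
      fix y assume y: "y \<in> {0..x}"
      have "(t has_real_derivative poly \<phi> (t y)) (at y within {0..x})"
        by (rule has_field_derivative_subset[OF t_deriv]) (use y assms in auto)
      then have "((\<lambda>x. F (t x) - x) has_real_derivative 1 / poly \<phi> (t y) * poly \<phi> (t y) - 1) (at y within {0..x})"
        using y assms by (auto intro!: derivative_eq_intros DERIV_chain2[OF F_deriv] t_nonneg)
      then show "((\<lambda>x. F (t x) - x) has_real_derivative 0) (at y within {0..x})"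
        using poly_pos[OF t_nonneg[of y]] y assms by simp
    qed simp
    then obtain c where "\<And>y. y \<in> {0..x} \<Longrightarrow> F (t y) - y = c" by blast
    from this[of 0] this[of x] show ?thesis using assms by simp
  qed simp
  moreover have "t 0 = 0"
    using \<tau>_of_real[of 0] by (simp add: \<tau>_0)
  ultimately show ?thesis by (simp add: F_0)
qed

lemma t_mono: "0 \<le> x \<Longrightarrow> x \<le> y \<Longrightarrow> y < 1 \<Longrightarrow> t x \<le> t y"
  using F_le_iff[of "t x" "t y"] F_t[of x] F_t[of y] t_nonneg[of x] t_nonneg[of y] by auto

text \<open>On a ray |\<tau>| grows at most at the rate \<phi>(|\<tau>|), so F(|\<tau>|) grows with
  slope at most 1. A deficit against the positive axis at the radius \<open>r0\<close> therefore
  persists up to the boundary.\<close>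

lemma \<tau>_comparison:
  assumes z: "norm \<zeta> = 1" and r: "0 \<le> r0" "r0 \<le> r" "r < 1"
  shows "F (norm (\<tau> (of_real r * \<zeta>))) \<le> F (norm (\<tau> (of_real r0 * \<zeta>))) + (r - r0)"
proof -
  define a where "a s = norm (\<tau> (of_real s * \<zeta>))" for s
  define g where "g s = poly \<phi> (a s)" for s
  have ns: "norm (of_real s * \<zeta>) < 1" if "s \<in> {r0..r}" for s
    using that r z by (simp add: norm_mult)
  have der: "((\<lambda>s. \<tau> (of_real s * \<zeta>)) has_vector_derivative cpoly \<phi> (\<tau> (of_real s * \<zeta>)) * \<zeta>) (at s within S)"
    if "s \<in> {r0..r}" for s S
  proof -
    have "((\<lambda>w. \<tau> (w * \<zeta>)) has_field_derivative cpoly \<phi> (\<tau> (of_real s * \<zeta>)) * \<zeta>) (at (of_real s))"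
      by (rule DERIV_chain2[OF \<tau>_deriv]) (use ns[OF that] in \<open>auto intro!: derivative_eq_intros\<close>)
    then show ?thesis by (rule has_vector_derivative_real_field)
  qed
  have "continuous_on {r0..r} (\<lambda>s. \<tau> (of_real s * \<zeta>))"
    using der has_vector_derivative_continuous by (fastforce simp: continuous_on_eq_continuous_within)
  then have cont: "continuous_on {r0..r} g"
    unfolding g_def a_def by (intro continuous_intros)
  \<comment> \<open>|\<tau>| need not be differentiable at zeros of \<tau>; the integral of its
    growth bound is differentiable and dominates it.\<close>
  define A where "A x = a r0 + integral {r0..x} g" for x
  have g_nn: "g s \<ge> 0" for s unfolding g_def a_def using poly_pos[of "norm (\<tau> (of_real s * \<zeta>))"] by simp
  have A': "(A has_real_derivative g x) (at x within {r0..r})" if "x \<in> {r0..r}" for x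
    unfolding A_def using integral_has_real_derivative[OF cont that] by (auto intro!: derivative_eq_intros)
  have aA: "a x \<le> A x" if x: "x \<in> {r0..r}" for x
  proof -
    have "((\<lambda>s. cpoly \<phi> (\<tau> (of_real s * \<zeta>)) * \<zeta>) has_integral \<tau> (of_real x * \<zeta>) - \<tau> (of_real r0 * \<zeta>)) {r0..x}"
      using x by (intro fundamental_theorem_of_calculus der) auto
    moreover have int: "g integrable_on {r0..x}"
      using cont x by (intro integrable_continuous_real) (auto intro: continuous_on_subset)
    moreover have "norm (cpoly \<phi> (\<tau> (of_real s * \<zeta>)) * \<zeta>) \<le> g s" for s
      using norm_cpoly_le[OF coeff_nonneg order.refl] z by (simp add: norm_mult g_def a_def)
    ultimately have "norm (\<tau> (of_real x * \<zeta>) - \<tau> (of_real r0 * \<zeta>)) \<le> integral {r0..x} g"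
      by (metis (no_types, lifting) integral_norm_bound_integral has_integral_integrable integral_unique)
    moreover have "a x \<le> a r0 + norm (\<tau> (of_real x * \<zeta>) - \<tau> (of_real r0 * \<zeta>))"
      unfolding a_def by (simp add: norm_triangle_sub)
    ultimately show ?thesis by (simp add: A_def)
  qed
  have a_nn: "a s \<ge> 0" for s by (simp add: a_def)
  have A_nn: "A x \<ge> 0" if "r0 \<le> x" "x \<le> r" for x using aA[of x] a_nn[of x] that by simp
  have "F (A r) - r \<le> F (A r0) - r0"
  proof (rule DERIV_nonpos_imp_decreasing_open[OF r(2)])
    fix x assume x: "r0 < x" "x < r"
    have "(A has_real_derivative g x) (at x)" using A'[of x] x by (simp add: at_within_Icc_at)
    then have "((\<lambda>x. F (A x) - x) has_real_derivative 1 / poly \<phi> (A x) * g x - 1) (at x)"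
      by (auto intro!: derivative_eq_intros DERIV_chain2[OF F_deriv] A_nn less_imp_le[OF x(1)] less_imp_le[OF x(2)])
    moreover have "g x \<le> poly \<phi> (A x)"
      unfolding g_def using x by (intro poly_mono_nonneg coeff_nonneg a_nn aA) auto
    then have "1 / poly \<phi> (A x) * g x - 1 \<le> 0" using poly_pos[of "A x"] A_nn[of x] x by simp
    ultimately show "\<exists>y. ((\<lambda>x. F (A x) - x) has_real_derivative y) (at x) \<and> y \<le> 0" by blast
  next
    have contA: "continuous_on {r0..r} A" by (rule DERIV_continuous_on[OF A'])
    have contF: "continuous_on {0..} F"
      by (auto intro!: continuous_at_imp_continuous_on DERIV_isCont F_deriv)
    have "continuous_on {r0..r} (\<lambda>x. F (A x))"
      by (rule continuous_on_compose2[OF contF contA]) (use A_nn in auto)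
    then show "continuous_on {r0..r} (\<lambda>x. F (A x) - x)"
      by (intro continuous_on_diff continuous_on_id)
  qed
  moreover have "A r0 = a r0" by (simp add: A_def)
  moreover have "F (a r) \<le> F (A r)" using aA[of r] a_nn r by (intro F_le) auto
  ultimately show ?thesis by (simp add: a_def)
qed

end

section \<open>Auxiliary facts on polynomials, roots of unity and continuity\<close>

lemma cpoly_mult: "cpoly (P * Q) w = cpoly P w * cpoly Q w"
proof -
  have eq: "cpoly P = poly (map_poly complex_of_real P)" for P
    by (rule ext) (simp add: cpoly_def poly_altdef coeff_map_poly degree_map_poly)
  have "map_poly complex_of_real (P * Q) = map_poly complex_of_real P * map_poly complex_of_real Q"
    by (rule poly_eqI) (simp add: coeff_map_poly coeff_mult)
  then show ?thesis unfolding eq by simp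
qed

lemma cpoly_lead:
  assumes "degree P = e"
  shows "\<exists>C\<ge>0. \<forall>w. norm w \<ge> 1 \<longrightarrow> norm (cpoly P w / w ^ e - of_real (coeff P e)) \<le> C / norm w"
proof (intro exI[of _ "\<Sum>j<e. \<bar>coeff P j\<bar>"] conjI allI impI)
  fix w :: complex assume w: "norm w \<ge> 1"
  then have [simp]: "w \<noteq> 0" by auto
  have "cpoly P w = (\<Sum>j<e. of_real (coeff P j) * w ^ j) + of_real (coeff P e) * w ^ e"
    unfolding cpoly_def assms by (simp add: lessThan_Suc_atMost[symmetric])
  then have "cpoly P w / w ^ e - of_real (coeff P e) = (\<Sum>j<e. of_real (coeff P j) * w ^ j / w ^ e)"
    by (simp add: add_divide_distrib sum_divide_distrib)
  also have "norm \<dots> \<le> (\<Sum>j<e. \<bar>coeff P j\<bar> * (1 / norm w))"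
  proof (rule sum_norm_le)
    fix j assume "j \<in> {..<e}"
    then have j: "j < e" by simp
    have "norm w ^ j * norm w = norm w ^ Suc j" by simp
    also have "\<dots> \<le> norm w ^ e" using j w by (intro power_increasing) auto
    finally have "norm w ^ j / norm w ^ e \<le> 1 / norm w" using w by (simp add: field_simps)
    then have "\<bar>coeff P j\<bar> * (norm w ^ j / norm w ^ e) \<le> \<bar>coeff P j\<bar> * (1 / norm w)"
      by (intro mult_left_mono) auto
    then show "norm (of_real (coeff P j) * w ^ j / w ^ e) \<le> \<bar>coeff P j\<bar> * (1 / norm w)"
      by (simp add: norm_mult norm_divide norm_power)
  qed
  finally show "norm (cpoly P w / w ^ e - of_real (coeff P e)) \<le> (\<Sum>j<e. \<bar>coeff P j\<bar>) / norm w"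
    by (simp add: sum_distrib_right sum_divide_distrib)
qed (simp add: sum_nonneg)

lemma power_Gcd_eq_1:
  fixes \<zeta> :: complex
  assumes "finite A" "\<And>j. j \<in> A \<Longrightarrow> \<zeta> ^ j = 1" "\<zeta> \<noteq> 0"
  shows "\<zeta> ^ (Gcd A :: nat) = 1"
  using assms
proof (induction A rule: finite_induct)
  case (insert a A)
  have g: "\<zeta> ^ Gcd A = 1" and a: "\<zeta> ^ a = 1" using insert by auto
  show ?case
  proof (cases "a = 0")
    case False
    obtain x y where xy: "a * x = Gcd A * y + gcd a (Gcd A)" using bezout_nat[OF False] by blast
    have "1 = \<zeta> ^ (a * x)" using a by (simp add: power_mult)
    also have "\<dots> = \<zeta> ^ gcd a (Gcd A)" unfolding xy using g by (simp add: power_add power_mult)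
    finally show ?thesis by simp
  qed (use g in simp)
qed simp

text \<open>A continuity argument: at the first point where u drops to 3/2 B all earlier values
  exceed 3/2 B, so the implication applies and yields 2B. The premise of \<open>step\<close> leaves
  out the point 0, hence at \<open>s = 0\<close> it is an unconditional initial bound.\<close>

lemma bootstrap_lower_bound:
  fixes u :: "real \<Rightarrow> real"
  assumes cont: "continuous_on {0..1} u" and B: "B > 0"
    and step: "\<And>s. s \<in> {0..1} \<Longrightarrow> (\<And>s'. s' \<in> {0..s} \<Longrightarrow> s' \<noteq> 0 \<Longrightarrow> u s' \<ge> B) \<Longrightarrow> u s \<ge> 2 * B"
    and s: "s \<in> {0..1}"
  shows "u s \<ge> 2 * B"
proof (rule ccontr)
  assume neg: "\<not> u s \<ge> 2 * B"
  define S where "S = {s \<in> {0..1}. u s \<le> 3/2 * B}"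
  have "S \<noteq> {}"
  proof
    assume "S = {}"
    then have "u s' > 3/2 * B" if "s' \<in> {0..1}" for s' using that by (force simp: S_def)
    then have "u s' \<ge> B" if "s' \<in> {0..1}" for s' using that B by force
    then show False using step[OF s] s neg by auto
  qed
  moreover have "closed S" unfolding S_def
    by (rule continuous_on_closed_Collect_le[OF cont continuous_on_const]) auto
  moreover have "bounded S"
    by (rule bounded_subset[OF bounded_closed_interval[of 0 1]]) (auto simp: S_def)
  ultimately obtain m where m: "m \<in> S" "\<And>s. s \<in> S \<Longrightarrow> m \<le> s"
    using compact_attains_inf[of S] by (auto simp: compact_eq_bounded_closed)
  have low: "u s' > 3/2 * B" if "s' \<in> {0..<m}" for s'
    using that m by (force simp: S_def)
  have "u 0 \<ge> 2 * B" by (rule step) auto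
  then have "m \<noteq> 0" using m(1) B by (auto simp: S_def)
  then have m0: "m > 0" using m by (simp add: S_def)
  have "u m \<ge> 3/2 * B"
  proof (rule tendsto_lowerbound)
    have "m \<in> {0..1}" using m(1) by (simp add: S_def)
    then have "(u \<longlongrightarrow> u m) (at m within {0..1})"
      using cont by (simp add: continuous_on_def)
    then show "(u \<longlongrightarrow> u m) (at m within {0..<m})"
      by (rule tendsto_within_subset) (use \<open>m \<in> {0..1}\<close> in auto)
    show "\<forall>\<^sub>F s in at m within {0..<m}. 3/2 * B \<le> u s"
      using low by (auto simp: eventually_at_filter intro!: always_eventually less_imp_le)
    show "at m within {0..<m} \<noteq> bot"
      using m0 by (simp add: at_within_eq_bot_iff trivial_limit_within islimpt_Ico)
  qed
  then have "u s' \<ge> B" if "s' \<in> {0..m}" for s'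
    using low[of s'] that B by (cases "s' = m") force+
  then have "u m \<ge> 2 * B" using m(1) by (intro step) (auto simp: S_def)
  then show False using m(1) B by (simp add: S_def)
qed

section \<open>Periods, and boundedness of \<tau> away from the singular direction\<close>

context inc_series
begin

definition per :: nat where "per = Gcd {j. coeff \<phi> j \<noteq> 0}"

lemma per_dvd: "coeff \<phi> j \<noteq> 0 \<Longrightarrow> per dvd j"
  by (simp add: per_def Gcd_dvd)

lemma per_pos: "per > 0"
proof -
  have "per dvd d" using coeff_d by (intro per_dvd) auto
  then show ?thesis using d by (auto intro: Nat.gr0I)
qed

lemma p_1: "p 1 = coeff \<phi> 0"
proof -
  have "p 1 = (\<Sum>j\<le>d. coeff \<phi> j * (p 0) ^ j)"
    using p_rec[of 0] by (simp add: poly_fps_def fps_sum_nth deg fps_power_zeroth)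
  also have "\<dots> = (\<Sum>j\<le>d. if j = 0 then coeff \<phi> 0 else 0)" by (intro sum.cong) (auto simp: p_0)
  finally show ?thesis by simp
qed

lemma fps_nth_power_T_nonneg: "fps_nth (Abs_fps p ^ j) n \<ge> 0"
  by (rule fps_nth_power_nonneg) (simp add: p_nonneg)

text \<open>A root with \<open>j\<close> leaves as its children already has positive weight.\<close>

lemma p_Suc_pos:
  assumes "coeff \<phi> j \<noteq> 0" shows "p (Suc j) > 0"
proof -
  have "0 < coeff \<phi> j * p 1 ^ j"
    unfolding p_1 using assms coeff_nonneg[of j] coeff_0 by (intro mult_pos_pos zero_less_power) auto
  also have "p 1 ^ j = fps_nth (Abs_fps p ^ j) j"
    using startsby_zero_power_nth_same[of "Abs_fps p" j] by (simp add: p_0)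
  also have "coeff \<phi> j * fps_nth (Abs_fps p ^ j) j \<le> (\<Sum>i\<le>d. coeff \<phi> i * fps_nth (Abs_fps p ^ i) j)"
    using assms le_degree[of \<phi> j] deg coeff_nonneg fps_nth_power_T_nonneg
    by (intro member_le_sum mult_nonneg_nonneg) auto
  also have "\<dots> = real (Suc j) * p (Suc j)"
    unfolding p_rec poly_fps_def by (simp add: fps_sum_nth deg)
  finally show ?thesis by (simp add: zero_less_mult_iff)
qed

text \<open>The strict triangle inequality: after rotating the value of \<tau> onto the positive
  axis, equality would force all terms with \<open>p n > 0\<close> to share one argument. The
  indices 1 and \<open>Suc j\<close> occur, and comparing them gives
  \<open>\<zeta> ^ j = 1\<close>.\<close>

lemma norm_\<tau>_less:
  assumes r: "0 < r" "r < 1" and z: "norm \<zeta> = 1" and j: "coeff \<phi> j \<noteq> 0" "\<zeta> ^ j \<noteq> 1"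
  shows "norm (\<tau> (of_real r * \<zeta>)) < t r"
proof -
  let ?z = "of_real r * \<zeta>"
  obtain e where e: "norm e = 1" "e * \<tau> ?z = of_real (norm (\<tau> ?z))"
  proof (cases "\<tau> ?z = 0")
    case True
    then show ?thesis using that[of 1] by simp
  next
    case False
    have "cnj (sgn (\<tau> ?z)) * \<tau> ?z = of_real (norm (\<tau> ?z))"
      using complex_norm_square[of "\<tau> ?z"] False
      by (simp add: sgn_div_norm scaleR_conv_of_real field_simps power2_eq_square)
    then show ?thesis using that[of "cnj (sgn (\<tau> ?z))"] False by (simp add: norm_sgn)
  qed
  define f where "f n = p n * r ^ n * (1 - Re (e * \<zeta> ^ n))" for n
  have Re_le: "Re (e * \<zeta> ^ n) \<le> 1" for n
    using complex_Re_le_cmod[of "e * \<zeta> ^ n"] e z by (simp add: norm_mult norm_power)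
  have "(\<lambda>n. e * (of_real (p n) * ?z ^ n)) sums (e * \<tau> ?z)"
    unfolding \<tau>_def using r z less_conv_radius[OF _ conv_radius_T, of ?z]
    by (intro sums_mult) (use sums_eval_fps[of ?z T] in \<open>simp add: T_def norm_mult\<close>)
  then have "(\<lambda>n. Re (e * (of_real (p n) * ?z ^ n))) sums norm (\<tau> ?z)"
    unfolding e by (auto dest: sums_Re)
  moreover have "(\<lambda>n. p n * r ^ n) sums t r"
    unfolding t_def using r by (intro summable_sums summable_p) auto
  ultimately have "(\<lambda>n. p n * r ^ n - Re (e * (of_real (p n) * ?z ^ n))) sums (t r - norm (\<tau> ?z))"
    by (intro sums_diff)
  moreover have "p n * r ^ n - Re (e * (of_real (p n) * ?z ^ n)) = f n" for n
  proof -
    have "e * (of_real (p n) * ?z ^ n) = of_real (p n * r ^ n) * (e * \<zeta> ^ n)"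
      by (simp add: power_mult_distrib mult_ac)
    then show ?thesis by (simp add: f_def algebra_simps)
  qed
  ultimately have sums: "f sums (t r - norm (\<tau> ?z))" by simp
  have nn: "f n \<ge> 0" for n unfolding f_def using Re_le[of n] r p_nonneg by simp
  have "\<exists>n. f n > 0"
  proof (rule ccontr)
    assume "\<nexists>n. f n > 0"
    then have f0: "f n = 0" for n using nn[of n] by (meson antisym not_le)
    have eq1: "e * \<zeta> ^ n = 1" if "p n > 0" for n
    proof -
      have "Re (e * \<zeta> ^ n) = 1" using f0[of n] that r by (simp add: f_def)
      moreover have "norm (e * \<zeta> ^ n) = 1" using e z by (simp add: norm_mult norm_power)
      ultimately show ?thesis by (simp add: complex_eq_iff cmod_def)
    qed
    have "e * \<zeta> ^ 1 = 1" using eq1[of 1] p_1 coeff_0 by simp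
    moreover have "e * \<zeta> ^ Suc j = 1" using eq1[of "Suc j"] p_Suc_pos j by simp
    ultimately have "\<zeta> ^ j = 1" by (simp add: mult.assoc[symmetric])
    then show False using j by simp
  qed
  then obtain n where "f n > 0" by blast
  then have "0 < suminf f" using sums nn by (intro suminf_pos2) (auto simp: sums_iff)
  then show ?thesis using sums by (simp add: sums_iff)
qed

text \<open>If the powers at all nonzero coefficients were 1, so would be the power with exponent
  \<open>per\<close>; but |\<open>per * \<theta>\<close>| lies in (0, pi].\<close>

lemma aperiodic:
  assumes "0 < \<bar>\<theta>\<bar>" "\<bar>\<theta>\<bar> \<le> pi / per"
  shows "\<exists>j. coeff \<phi> j \<noteq> 0 \<and> cis \<theta> ^ j \<noteq> 1"
proof (rule ccontr)
  assume "\<not> ?thesis"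
  moreover have "finite {j. coeff \<phi> j \<noteq> 0}"
    by (rule finite_subset[of _ "{..d}"]) (use deg in \<open>auto simp: coeff_eq_0 not_less[symmetric]\<close>)
  ultimately have "cis \<theta> ^ per = 1" unfolding per_def by (intro power_Gcd_eq_1) auto
  then have "cos (per * \<theta>) = 1" by (simp add: Complex.DeMoivre complex_eq_iff)
  then have c: "cos \<bar>per * \<theta>\<bar> = 1" by simp
  have "0 < \<bar>per * \<theta>\<bar>" "\<bar>per * \<theta>\<bar> \<le> pi"
    using assms per_pos by (auto simp: abs_mult field_simps)
  then have "cos \<bar>per * \<theta>\<bar> < cos 0" by (intro cos_monotone_0_pi) auto
  then show False using c by simp
qed

text \<open>At the radius 1/2 compactness gives a deficit uniform in the angle: F(|\<tau>|) is below
  F(t(1/2)) = 1/2 by a fixed amount. The remaining radius is less than 1/2, so F(|\<tau>|) stays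
  below a fixed number smaller than 1, that is, |\<tau>| stays bounded.\<close>

lemma \<tau>_bounded_away:
  assumes \<eta>: "\<eta> > 0"
  shows "\<exists>C. \<forall>r \<theta>. 0 \<le> r \<and> r < 1 \<and> \<eta> \<le> \<bar>\<theta>\<bar> \<and> \<bar>\<theta>\<bar> \<le> pi / per \<longrightarrow> norm (\<tau> (of_real r * cis \<theta>)) \<le> C"
proof (cases "\<eta> \<le> pi / per")
  case True
  define K where "K = {-pi / per..-\<eta>} \<union> {\<eta>..pi / per}"
  define g where "g \<theta> = norm (\<tau> (of_real (1/2) * cis \<theta>))" for \<theta>
  have "continuous_on (ball 0 1) \<tau>"
    by (intro continuous_at_imp_continuous_on ballI DERIV_isCont[OF \<tau>_deriv]) auto
  moreover have "continuous_on K (\<lambda>\<theta>. of_real (1/2) * cis \<theta>)" by (intro continuous_intros)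
  ultimately have "continuous_on K (\<lambda>\<theta>. \<tau> (of_real (1/2) * cis \<theta>))"
    by (rule continuous_on_compose2) (auto simp: norm_mult)
  then have "continuous_on K g" unfolding g_def by (rule continuous_on_norm)
  moreover have "compact K" "K \<noteq> {}" using True by (auto simp: K_def compact_Un)
  ultimately obtain \<theta>0 where th: "\<theta>0 \<in> K" "\<And>\<theta>. \<theta> \<in> K \<Longrightarrow> g \<theta> \<le> g \<theta>0"
    using continuous_attains_sup[of K g] by auto
  have "g \<theta>0 < t (1/2)"
  proof -
    have "0 < \<bar>\<theta>0\<bar>" "\<bar>\<theta>0\<bar> \<le> pi / per" using th(1) \<eta> by (auto simp: K_def)
    then obtain j where "coeff \<phi> j \<noteq> 0" "cis \<theta>0 ^ j \<noteq> 1" using aperiodic by blast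
    then show ?thesis unfolding g_def by (intro norm_\<tau>_less) auto
  qed
  moreover have g_nn: "g \<theta> \<ge> 0" for \<theta> by (simp add: g_def)
  ultimately have "F (g \<theta>0) < F (t (1/2))" by (intro F_less) auto
  then have "F (g \<theta>0) + 1/2 < 1" by (simp add: F_t)
  then obtain w where w: "w \<ge> 0" "F w > F (g \<theta>0) + 1/2" using F_ex by blast
  show ?thesis
  proof (intro exI[of _ "max w (t (1/2))"] allI impI)
    fix r \<theta> :: real assume a: "0 \<le> r \<and> r < 1 \<and> \<eta> \<le> \<bar>\<theta>\<bar> \<and> \<bar>\<theta>\<bar> \<le> pi / per"
    show "norm (\<tau> (of_real r * cis \<theta>)) \<le> max w (t (1/2))"
    proof (cases "r \<le> 1/2")
      case True
      have "norm (\<tau> (of_real r * cis \<theta>)) \<le> t r"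
        using norm_\<tau>_le[of "of_real r * cis \<theta>"] a by (simp add: norm_mult)
      also have "\<dots> \<le> t (1/2)" using True a by (intro t_mono) auto
      finally show ?thesis by simp
    next
      case False
      have K: "\<theta> \<in> K" using a by (auto simp: K_def abs_if split: if_splits)
      have "F (norm (\<tau> (of_real r * cis \<theta>))) \<le> F (g \<theta>) + (r - 1/2)"
        unfolding g_def using \<tau>_comparison[of "cis \<theta>" "1/2" r] False a by simp
      also have "\<dots> \<le> F (g \<theta>0) + 1/2" using F_le[OF g_nn th(2)[OF K]] a by simp
      also have "\<dots> \<le> F w" using w by simp
      finally show ?thesis using F_le_iff w by (simp add: max.coboundedI1)
    qed
  qed
next
  case False
  then show ?thesis by (intro exI[of _ 0]) auto
qed

subsection \<open>The dominant singularity\<close>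

text \<open>\<open>\<tau>\<close> blows up like \<open>(1 - z) powr (-\<alpha>)\<close>; its power \<open>V\<close> satisfies \<open>V z \<approx> \<kappa> (1 - z)\<close> near 1.\<close>

definition \<kappa> :: real where "\<kappa> = (d - 1) * coeff \<phi> d"
definition \<alpha> :: real where "\<alpha> = 1 / (d - 1)"
definition V :: "complex \<Rightarrow> complex" where "V z = 1 / \<tau> z ^ (d - 1)"

lemma \<kappa>_pos: "\<kappa> > 0" using d coeff_d by (simp add: \<kappa>_def)
lemma \<alpha>_pos: "\<alpha> > 0" and \<alpha>_le_1: "\<alpha> \<le> 1" using d by (auto simp: \<alpha>_def field_simps)

lemma V_deriv:
  assumes "norm z < 1" "\<tau> z \<noteq> 0"
  shows "(V has_field_derivative - of_real (real (d - 1)) * (cpoly \<phi> (\<tau> z) / \<tau> z ^ d)) (at z within S)"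
proof -
  obtain e where e: "d = Suc (Suc e)" using d by (metis Suc_le_D numeral_2_eq_2 Suc_le_mono)
  have "((\<lambda>z. 1 / \<tau> z ^ (d - 1)) has_field_derivative
     - (of_nat (d - 1) * (cpoly \<phi> (\<tau> z) * \<tau> z ^ (d - 1 - 1))) / (\<tau> z ^ (d - 1) * \<tau> z ^ (d - 1))) (at z within S)"
    by (rule derivative_eq_intros \<tau>_deriv assms refl | use assms in simp)+
  then show ?thesis unfolding V_def
    by (rule back_subst[of "\<lambda>x. (_ has_field_derivative x) _"])
       (use assms in \<open>simp add: e field_simps\<close>)
qed

text \<open>V' = -(d-1) \<phi>(\<tau>)/\<tau>^d, and \<phi>(w)/w^d is its leading coefficient up to
  O(1/|w|).\<close>

lemma V_deriv_approx: "\<exists>C\<ge>0. \<forall>z S. norm z < 1 \<longrightarrow> norm (\<tau> z) \<ge> 1 \<longrightarrow>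
   (\<exists>D. (V has_field_derivative D) (at z within S) \<and> norm (D + of_real \<kappa>) \<le> C / norm (\<tau> z))"
proof -
  obtain C where C: "C \<ge> 0" "\<And>w. norm w \<ge> 1 \<Longrightarrow> norm (cpoly \<phi> w / w ^ d - of_real (coeff \<phi> d)) \<le> C / norm w"
    using cpoly_lead[OF deg] by blast
  show ?thesis
  proof (intro exI[of _ "real (d - 1) * C"] conjI allI impI)
    fix z S assume z: "norm z < 1" "norm (\<tau> z) \<ge> 1"
    have tz: "\<tau> z \<noteq> 0" using z(2) by auto
    let ?D = "- of_real (real (d - 1)) * (cpoly \<phi> (\<tau> z) / \<tau> z ^ d)"
    have "?D + of_real \<kappa> = - of_real (real (d - 1)) * (cpoly \<phi> (\<tau> z) / \<tau> z ^ d - of_real (coeff \<phi> d))"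
      using d by (simp add: \<kappa>_def algebra_simps)
    then have "norm (?D + of_real \<kappa>) = real (d - 1) * norm (cpoly \<phi> (\<tau> z) / \<tau> z ^ d - of_real (coeff \<phi> d))"
      by (simp only: norm_mult norm_minus_cancel norm_of_real abs_of_nat)
    also have "\<dots> \<le> real (d - 1) * (C / norm (\<tau> z))" by (intro mult_left_mono C z) auto
    finally show "\<exists>D. (V has_field_derivative D) (at z within S) \<and> norm (D + of_real \<kappa>) \<le> real (d - 1) * C / norm (\<tau> z)"
      using V_deriv[OF z(1) tz, of S] by (intro exI[of _ ?D] conjI) auto
  qed (use C in simp)
qed

lemma t_ge: "B \<ge> 0 \<Longrightarrow> F B \<le> x \<Longrightarrow> 0 \<le> x \<Longrightarrow> x < 1 \<Longrightarrow> t x \<ge> B"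
  using F_le_iff[of B "t x"] F_t[of x] t_nonneg[of x] by simp

lemma F_less_1: "B \<ge> 0 \<Longrightarrow> F B < 1"
proof -
  assume B: "B \<ge> 0"
  have "F B < F (B + 1)" using B by (intro F_less) auto
  moreover have "F (B + 1) \<le> 1"
  proof (rule tendsto_lowerbound[OF F_lim])
    show "\<forall>\<^sub>F x in at_top. F (B + 1) \<le> F x"
      using eventually_ge_at_top[of "B + 1"] by eventually_elim (use B in \<open>auto intro: F_le\<close>)
  qed simp
  ultimately show ?thesis by simp
qed

lemma F_nonneg: "B \<ge> 0 \<Longrightarrow> F B \<ge> 0" using F_le[of 0 B] F_0 by simp

lemma V_at_1: "((\<lambda>x. V (of_real x)) \<longlongrightarrow> 0) (at_left 1)"
proof (rule tendstoI)
  fix e :: real assume e: "e > 0"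
  define B where "B = max 1 (2 / e)"
  have B: "B \<ge> 1" "1 / B < e" using e by (auto simp: B_def field_simps max_def)
  have ev: "\<forall>\<^sub>F x in at_left 1. x \<in> {max 0 (F B)<..<1}"
    using F_less_1[of B] B by (intro eventually_at_left_real) auto
  show "\<forall>\<^sub>F x in at_left 1. dist (V (of_real x)) 0 < e"
    using ev
  proof eventually_elim
    case (elim x)
    then have tx: "t x \<ge> B" using B by (intro t_ge) auto
    have "B \<le> t x ^ (d - 1)" using tx B d self_le_power[of "t x" "d - 1"] by simp
    then have "1 / t x ^ (d - 1) \<le> 1 / B" using B by (intro divide_left_mono) auto
    then show ?case using B tx elim by (simp add: V_def \<tau>_of_real norm_divide norm_power)
  qed
qed

text \<open>The function V w + \<kappa> w has derivative at most \<epsilon> along the path from 1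
  that follows the real axis to \<open>Re z\<close> and then goes vertically to z. Each of the two
  legs has length at most |1-z|, whence the factor 2.\<close>

lemma V_approx_along:
  assumes z: "norm z < 1" "0 \<le> Re z"
    and ax: "\<And>x. Re z \<le> x \<Longrightarrow> x < 1 \<Longrightarrow>
        \<exists>D. (V has_field_derivative D) (at (of_real x)) \<and> norm (D + of_real \<kappa>) \<le> \<epsilon>"
    and seg: "\<And>w. w \<in> closed_segment (of_real (Re z)) z \<Longrightarrow>
        \<exists>D. (V has_field_derivative D) (at w) \<and> norm (D + of_real \<kappa>) \<le> \<epsilon>"
  shows "norm (V z - of_real \<kappa> * (1 - z)) \<le> 2 * \<epsilon> * norm (1 - z)"
proof -
  define G where "G w = V w + of_real \<kappa> * w" for w
  define x where "x = Re z"
  have lip: "norm (G v - G w) \<le> \<epsilon> * norm (v - w)"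
    if "\<And>u. u \<in> closed_segment w v \<Longrightarrow> \<exists>D. (V has_field_derivative D) (at u) \<and> norm (D + of_real \<kappa>) \<le> \<epsilon>" for v w
  proof -
    from that obtain D where D: "\<And>u. u \<in> closed_segment w v \<Longrightarrow> (V has_field_derivative D u) (at u)"
      "\<And>u. u \<in> closed_segment w v \<Longrightarrow> norm (D u + of_real \<kappa>) \<le> \<epsilon>" by metis
    show ?thesis
    proof (rule field_differentiable_bound[of "closed_segment w v" G "\<lambda>u. D u + of_real \<kappa>"])
      fix u assume u: "u \<in> closed_segment w v"
      show "(G has_field_derivative D u + of_real \<kappa>) (at u within closed_segment w v)"
        unfolding G_def using D(1)[OF u] by (auto intro!: derivative_eq_intros intro: has_field_derivative_at_within)
    qed (use D in auto)
  qed
  have x1: "x < 1" using abs_Re_le_cmod[of z] z by (simp add: x_def)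
  have "norm (G (of_real x) - of_real \<kappa>) \<le> \<epsilon> * (1 - x)"
  proof (rule tendsto_le)
    have "((\<lambda>y. norm (G (of_real x) - G (of_real y))) \<longlongrightarrow> norm (G (of_real x) - (0 + of_real \<kappa> * of_real 1))) (at_left 1)"
      unfolding G_def[of "of_real _"] by (intro tendsto_intros V_at_1)
    then show "((\<lambda>y. norm (G (of_real x) - G (of_real y))) \<longlongrightarrow> norm (G (of_real x) - of_real \<kappa>)) (at_left 1)"
      by simp
    show "((\<lambda>y. \<epsilon> * (y - x)) \<longlongrightarrow> \<epsilon> * (1 - x)) (at_left 1)" by (intro tendsto_intros)
    show "\<forall>\<^sub>F y in at_left 1. norm (G (of_real x) - G (of_real y)) \<le> \<epsilon> * (y - x)"
      using eventually_at_left_real[OF x1]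
    proof eventually_elim
      case (elim y)
      have "norm (G (of_real y) - G (of_real x)) \<le> \<epsilon> * norm (complex_of_real y - of_real x)"
        using elim ax by (intro lip) (auto simp: closed_segment_of_real closed_segment_eq_real_ivl x_def)
      also have "norm (complex_of_real y - of_real x) = y - x"
        using elim by (simp flip: of_real_diff)
      finally show ?case by (simp add: norm_minus_commute)
    qed
  qed simp
  moreover have "norm (G z - G (of_real x)) \<le> \<epsilon> * norm (z - of_real x)"
    using seg by (intro lip) (auto simp: x_def)
  moreover have "\<epsilon> \<ge> 0"
  proof -
    obtain D :: complex where "norm (D + of_real \<kappa>) \<le> \<epsilon>" using ax[of x] x1 by (auto simp: x_def)
    then show ?thesis using norm_ge_zero order.trans by blast
  qed
  moreover have "norm (z - of_real x) \<le> norm (1 - z)" "1 - x \<le> norm (1 - z)"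
    using abs_Im_le_cmod[of "1 - z"] complex_Re_le_cmod[of "1 - z"] by (auto simp: x_def cmod_def)
  ultimately have "norm (G (of_real x) - of_real \<kappa>) + norm (G z - G (of_real x)) \<le> \<epsilon> * norm (1 - z) + \<epsilon> * norm (1 - z)"
    by (intro add_mono) (auto intro: order.trans mult_left_mono)
  moreover have "V z - of_real \<kappa> * (1 - z) = (G (of_real x) - of_real \<kappa>) + (G z - G (of_real x))"
    by (simp add: G_def algebra_simps)
  ultimately show ?thesis using norm_triangle_ineq[of "G (of_real x) - of_real \<kappa>" "G z - G (of_real x)"]
    by simp
qed

end

lemma norm_power_diff_le:
  fixes a b :: complex
  assumes "norm a \<le> M" "norm b \<le> M"
  shows "norm (a ^ k - b ^ k) \<le> real k * M ^ (k - 1) * norm (a - b)"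
proof (induction k)
  case (Suc k)
  have M: "M \<ge> 0" using assms norm_ge_zero order.trans by blast
  have "a ^ Suc k - b ^ Suc k = a * (a ^ k - b ^ k) + (a - b) * b ^ k" by (simp add: algebra_simps)
  also have "norm \<dots> \<le> norm a * norm (a ^ k - b ^ k) + norm (a - b) * norm b ^ k"
    by (rule order.trans[OF norm_triangle_ineq]) (simp add: norm_mult norm_power)
  also have "\<dots> \<le> M * (real k * M ^ (k - 1) * norm (a - b)) + norm (a - b) * M ^ k"
    using assms Suc M by (intro add_mono mult_mono power_mono) auto
  also have "M * (real k * M ^ (k - 1) * norm (a - b)) = real k * M ^ k * norm (a - b)"
    by (cases k) auto
  finally show ?case by (simp add: algebra_simps)
qed simp

context inc_series
begin

lemma norm_one_minus_pos: "norm z < 1 \<Longrightarrow> norm (1 - z) > 0" for z :: complex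
  by auto

text \<open>The approximation of V' needs |\<tau>| large, which is known only on the real axis.
  Moving vertically from there it is recovered by a bootstrap: as long as |\<tau>| \<ge> B on the
  way, V is close to \<kappa>(1-z), hence small, hence |\<tau>| is even at least 2B.\<close>

lemma near_one_aux: "\<exists>\<eta>. 0 < \<eta> \<and> \<eta> \<le> 1 \<and> (\<forall>z. norm z < 1 \<longrightarrow> norm (1 - z) < \<eta> \<longrightarrow>
    norm (\<tau> z) \<ge> 1 \<and> norm (V z - of_real \<kappa> * (1 - z)) \<le> \<kappa> / 2 * norm (1 - z))"
proof -
  obtain C1 where C1: "C1 \<ge> 0" "\<And>z S. norm z < 1 \<Longrightarrow> norm (\<tau> z) \<ge> 1 \<Longrightarrow>
      \<exists>D. (V has_field_derivative D) (at z within S) \<and> norm (D + of_real \<kappa>) \<le> C1 / norm (\<tau> z)"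
    using V_deriv_approx by blast
  \<comment> \<open>Makes |V' + \<kappa>| \<le> \<kappa>/4 wherever |\<tau>| \<ge> B; the two legs
    of the path turn this into the \<kappa>/2 of the claim.\<close>
  define B where "B = max 1 (4 * C1 / \<kappa>)"
  have B: "B \<ge> 1" "C1 / B \<le> \<kappa> / 4"
    using \<kappa>_pos C1 by (auto simp: B_def field_simps max_def)
  have step: "\<exists>D. (V has_field_derivative D) (at z) \<and> norm (D + of_real \<kappa>) \<le> \<kappa> / 4"
    if z: "norm z < 1" "norm (\<tau> z) \<ge> B" for z
  proof -
    obtain D where D: "(V has_field_derivative D) (at z)" "norm (D + of_real \<kappa>) \<le> C1 / norm (\<tau> z)"
      using C1(2)[OF z(1) order.trans[OF B(1) z(2)], of UNIV] by blast
    have "C1 / norm (\<tau> z) \<le> C1 / B" using z B(1) C1(1) by (intro divide_left_mono mult_pos_pos) linarith+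
    then have "norm (D + of_real \<kappa>) \<le> \<kappa> / 4" using D(2) B(2) by linarith
    then show ?thesis using D(1) by blast
  qed
  \<comment> \<open>The first entry puts \<open>t\<close> above 2B on the last piece of length
    \<eta> of the real axis before 1; the second makes the bound 2 \<kappa> \<eta> for |V| small
    enough to give |\<tau>| \<ge> 2B off the axis.\<close>
  define \<eta> where "\<eta> = min (1 - F (2 * B)) (1 / (2 * \<kappa> * (2 * B) ^ (d - 1)))"
  have \<eta>: "0 < \<eta>" "\<eta> \<le> 1" "\<eta> \<le> 1 - F (2 * B)" "\<eta> \<le> 1 / (2 * \<kappa> * (2 * B) ^ (d - 1))"
  proof -
    have "1 - F (2 * B) > 0" "1 / (2 * \<kappa> * (2 * B) ^ (d - 1)) > 0" "1 - F (2 * B) \<le> 1"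
      using F_less_1[of "2 * B"] F_nonneg[of "2 * B"] B(1) \<kappa>_pos by auto
    then show "0 < \<eta>" "\<eta> \<le> 1" "\<eta> \<le> 1 - F (2 * B)" "\<eta> \<le> 1 / (2 * \<kappa> * (2 * B) ^ (d - 1))"
      unfolding \<eta>_def by linarith+
  qed
  show ?thesis
  proof (intro exI[of _ \<eta>] conjI \<eta> allI impI)
    fix z :: complex assume z: "norm z < 1" "norm (1 - z) < \<eta>"
    define x where "x = Re z"
    have x: "1 - \<eta> < x" "x < 1" "0 \<le> x"
      using complex_Re_le_cmod[of "1 - z"] z abs_Re_le_cmod[of z] \<eta> by (auto simp: x_def)
    define w where "w s = of_real x + of_real s * (z - of_real x)" for s
    have Re_w: "Re (w s) = x" for s by (simp add: w_def x_def)
    have Im_w: "Im (w s) = s * Im z" for s by (simp add: w_def)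
    have w1: "norm (w s) < 1" "norm (1 - w s) < \<eta>" if "s \<in> {0..1}" for s
    proof -
      have s: "(s * Im z)\<^sup>2 \<le> (Im z)\<^sup>2"
        using that by (simp add: power_mult_distrib mult_left_le_one_le power_le_one)
      have "norm (w s) \<le> norm z" unfolding cmod_def Re_w Im_w using s by (simp add: x_def)
      then show "norm (w s) < 1" using z by simp
      have "norm (1 - w s) \<le> norm (1 - z)" unfolding cmod_def using s by (simp add: Re_w Im_w x_def)
      then show "norm (1 - w s) < \<eta>" using z by simp
    qed
    have real: "norm (\<tau> (of_real y)) \<ge> 2 * B" if "x \<le> y" "y < 1" for y
    proof -
      have "2 * B \<le> t y" using that x \<eta> B by (intro t_ge) auto
      then show ?thesis using that x B by (simp add: \<tau>_of_real)
    qed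
    have approx: "norm (V (w s) - of_real \<kappa> * (1 - w s)) \<le> \<kappa> / 2 * norm (1 - w s)"
      if s: "s \<in> {0..1}" and low: "\<And>s'. s' \<in> {0..s} \<Longrightarrow> s' \<noteq> 0 \<Longrightarrow> norm (\<tau> (w s')) \<ge> B" for s
    proof -
      have "norm (V (w s) - of_real \<kappa> * (1 - w s)) \<le> 2 * (\<kappa> / 4) * norm (1 - w s)"
      proof (rule V_approx_along)
        fix y assume "Re (w s) \<le> y" "y < 1"
        then show "\<exists>D. (V has_field_derivative D) (at (complex_of_real y)) \<and> norm (D + of_real \<kappa>) \<le> \<kappa> / 4"
          using real[of y] B x unfolding Re_w by (intro step) auto
      next
        fix v assume "v \<in> closed_segment (of_real (Re (w s))) (w s)"
        then obtain q where q: "0 \<le> q" "q \<le> 1" "v = (1 - q) *\<^sub>R of_real x + q *\<^sub>R w s"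
          by (auto simp: in_segment Re_w)
        have v: "v = w (q * s)" unfolding q(3) w_def by (simp add: scaleR_conv_of_real algebra_simps)
        have qs: "q * s \<in> {0..s}" using q s by (auto simp: mult_left_le_one_le)
        have "norm (\<tau> v) \<ge> B"
        proof (cases "q * s = 0")
          case True
          then have "v = of_real x" by (simp add: v w_def)
          then show ?thesis using real[of x] x B by simp
        qed (use low[OF qs] v in auto)
        then show "\<exists>D. (V has_field_derivative D) (at v) \<and> norm (D + of_real \<kappa>) \<le> \<kappa> / 4"
          using w1[of "q * s"] qs s by (intro step) (auto simp: v)
      qed (use w1 s x in \<open>auto simp: Re_w\<close>)
      then show ?thesis by simp
    qed
    have big: "norm (\<tau> (w s)) \<ge> 2 * B" if s: "s \<in> {0..1}" for s
    proof (rule bootstrap_lower_bound[OF _ _ _ s, where u = "\<lambda>s. norm (\<tau> (w s))"])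
      have "continuous_on (ball 0 1) \<tau>"
        by (intro continuous_at_imp_continuous_on ballI DERIV_isCont[OF \<tau>_deriv]) auto
      moreover have "continuous_on {0..1} w" unfolding w_def by (intro continuous_intros)
      ultimately have "continuous_on {0..1} (\<lambda>s. \<tau> (w s))"
        by (rule continuous_on_compose2) (use w1 in auto)
      then show "continuous_on {0..1} (\<lambda>s. norm (\<tau> (w s)))" by (rule continuous_on_norm)
    next
      fix s assume s: "s \<in> {0..1}" and low: "\<And>s'. s' \<in> {0..s} \<Longrightarrow> s' \<noteq> 0 \<Longrightarrow> norm (\<tau> (w s')) \<ge> B"
      show "norm (\<tau> (w s)) \<ge> 2 * B"
      proof (cases "s = 0")
        case True
        then show ?thesis using real[of x] x by (simp add: w_def)
      next
        case False
        have nz: "norm (\<tau> (w s)) > 0" using low[of s] s False B by auto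
        have "norm (V (w s)) \<le> norm (V (w s) - of_real \<kappa> * (1 - w s)) + norm (of_real \<kappa> * (1 - w s))"
          using norm_triangle_ineq[of "V (w s) - of_real \<kappa> * (1 - w s)" "of_real \<kappa> * (1 - w s)"] by simp
        also have "\<dots> \<le> \<kappa> / 2 * norm (1 - w s) + \<kappa> * norm (1 - w s)"
          using approx[OF s low] \<kappa>_pos by (simp add: norm_mult)
        also have "\<dots> \<le> 2 * \<kappa> * \<eta>"
        proof -
          have "3 * norm (1 - w s) \<le> 4 * \<eta>"
            using w1(2)[OF s] norm_ge_zero[of "1 - w s"] by linarith
          then show ?thesis using \<kappa>_pos by (simp add: field_simps)
        qed
        also have "\<dots> \<le> 1 / (2 * B) ^ (d - 1)"
          using mult_left_mono[OF \<eta>(4), of "2 * \<kappa>"] \<kappa>_pos by simp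
        finally have "1 / norm (\<tau> (w s)) ^ (d - 1) \<le> 1 / (2 * B) ^ (d - 1)"
          by (simp add: V_def norm_divide norm_power)
        then have "(2 * B) ^ (d - 1) \<le> norm (\<tau> (w s)) ^ (d - 1)"
          using nz B by (simp add: field_simps)
        then show ?thesis
        proof (rule contrapos_pp)
          assume "\<not> 2 * B \<le> norm (\<tau> (w s))"
          then show "\<not> (2 * B) ^ (d - 1) \<le> norm (\<tau> (w s)) ^ (d - 1)"
            using d unfolding not_le by (intro power_strict_mono) auto
        qed
      qed
    qed (use B in auto)
    have w_1: "w 1 = z" by (simp add: w_def)
    show "norm (\<tau> z) \<ge> 1" using big[of 1] B by (simp add: w_1)
    show "norm (V z - of_real \<kappa> * (1 - z)) \<le> \<kappa> / 2 * norm (1 - z)"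
    proof -
      have "norm (\<tau> (w s')) \<ge> B" if "s' \<in> {0..1}" for s' using big[OF that] B by linarith
      then show ?thesis using approx[of 1] by (simp add: w_1)
    qed
  qed
qed

text \<open>One radius, fixed for all later expansions at 1.\<close>

definition \<eta> :: real where "\<eta> = (SOME \<eta>. 0 < \<eta> \<and> \<eta> \<le> 1 \<and> (\<forall>z. norm z < 1 \<longrightarrow> norm (1 - z) < \<eta> \<longrightarrow>
    norm (\<tau> z) \<ge> 1 \<and> norm (V z - of_real \<kappa> * (1 - z)) \<le> \<kappa> / 2 * norm (1 - z)))"

lemma \<eta>_pos: "0 < \<eta>" and \<eta>_le_1: "\<eta> \<le> 1"
  and near_one_\<tau>: "norm z < 1 \<Longrightarrow> norm (1 - z) < \<eta> \<Longrightarrow> norm (\<tau> z) \<ge> 1"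
  and near_one_V: "norm z < 1 \<Longrightarrow> norm (1 - z) < \<eta> \<Longrightarrow>
        norm (V z - of_real \<kappa> * (1 - z)) \<le> \<kappa> / 2 * norm (1 - z)"
  using someI_ex[OF near_one_aux] unfolding \<eta>_def[symmetric] by blast+

lemma
  assumes z: "norm z < 1" "norm (1 - z) < \<eta>"
  shows norm_V_le: "norm (V z) \<le> 2 * \<kappa> * norm (1 - z)"
    and norm_V_ge: "norm (V z) \<ge> \<kappa> / 2 * norm (1 - z)"
proof -
  let ?x = "norm (V z - of_real \<kappa> * (1 - z))" and ?k = "\<kappa> * norm (1 - z)"
  have "norm (of_real \<kappa> * (1 - z)) = ?k" using \<kappa>_pos by (simp add: norm_mult)
  then have "norm (V z) \<le> ?x + ?k" "?k \<le> ?x + norm (V z)"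
    using norm_triangle_ineq[of "V z - of_real \<kappa> * (1 - z)" "of_real \<kappa> * (1 - z)"]
      norm_triangle_ineq[of "of_real \<kappa> * (1 - z) - V z" "V z"] by (simp_all add: norm_minus_commute)
  moreover have "?x \<le> ?k / 2" "0 \<le> ?k" using near_one_V[OF z] \<kappa>_pos by auto
  ultimately have "norm (V z) \<le> 2 * ?k" "norm (V z) \<ge> ?k / 2" by linarith+
  then show "norm (V z) \<le> 2 * \<kappa> * norm (1 - z)" "norm (V z) \<ge> \<kappa> / 2 * norm (1 - z)" by simp_all
qed

text \<open>By definition of V, 1/|\<tau>| = |V|^\<alpha>, since \<alpha>(d-1) = 1.\<close>

lemma inverse_norm_\<tau>:
  assumes "norm z < 1" "norm (1 - z) < \<eta>"
  shows "1 / norm (\<tau> z) \<le> (2 * \<kappa>) powr \<alpha> * norm (1 - z) powr \<alpha>"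
proof -
  have t: "norm (\<tau> z) \<ge> 1" using near_one_\<tau>[OF assms] .
  have "1 / norm (\<tau> z) = (1 / norm (\<tau> z) ^ (d - 1)) powr \<alpha>"
  proof -
    have "real (d - 1) * \<alpha> = 1" using d by (simp add: \<alpha>_def)
    then have "(norm (\<tau> z) ^ (d - 1)) powr \<alpha> = norm (\<tau> z)"
      using t by (simp only: powr_realpow[symmetric] powr_powr) simp
    then show ?thesis using t by (simp add: powr_divide)
  qed
  also have "1 / norm (\<tau> z) ^ (d - 1) = norm (V z)" by (simp add: V_def norm_divide norm_power)
  also have "norm (V z) powr \<alpha> \<le> (2 * \<kappa> * norm (1 - z)) powr \<alpha>"
    using norm_V_le[OF assms] \<alpha>_pos by (intro powr_mono2) auto
  finally show ?thesis using \<kappa>_pos by (simp add: powr_mult)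
qed

text \<open>A second pass along the same path: the crude upper bound for |V| already gives
  1/|\<tau>| = O(|1-z|^\<alpha>), and with it the error of V' improves from a constant to that
  order.\<close>

lemma V_near: "\<exists>C\<ge>0. \<forall>z. norm z < 1 \<longrightarrow> norm (1 - z) < \<eta> \<longrightarrow>
   norm (V z - of_real \<kappa> * (1 - z)) \<le> C * norm (1 - z) powr (1 + \<alpha>)"
proof -
  obtain C1 where C1: "C1 \<ge> 0" "\<And>z S. norm z < 1 \<Longrightarrow> norm (\<tau> z) \<ge> 1 \<Longrightarrow>
      \<exists>D. (V has_field_derivative D) (at z within S) \<and> norm (D + of_real \<kappa>) \<le> C1 / norm (\<tau> z)"
    using V_deriv_approx by blast
  let ?K = "C1 * (2 * \<kappa>) powr \<alpha>"
  show ?thesis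
  proof (intro exI[of _ "2 * ?K"] conjI allI impI)
    fix z :: complex assume z: "norm z < 1" "norm (1 - z) < \<eta>"
    have step: "\<exists>D. (V has_field_derivative D) (at w) \<and> norm (D + of_real \<kappa>) \<le> ?K * norm (1 - z) powr \<alpha>"
      if w: "norm w < 1" "norm (1 - w) \<le> norm (1 - z)" for w
    proof -
      have w\<eta>: "norm (1 - w) < \<eta>" using w z by simp
      obtain D where D: "(V has_field_derivative D) (at w)" "norm (D + of_real \<kappa>) \<le> C1 / norm (\<tau> w)"
        using C1(2)[OF w(1) near_one_\<tau>[OF w(1) w\<eta>]] by blast
      have "C1 / norm (\<tau> w) \<le> C1 * ((2 * \<kappa>) powr \<alpha> * norm (1 - w) powr \<alpha>)"
        using mult_left_mono[OF inverse_norm_\<tau>[OF w(1) w\<eta>] C1(1)] by simp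
      also have "\<dots> \<le> C1 * ((2 * \<kappa>) powr \<alpha> * norm (1 - z) powr \<alpha>)"
        using w C1 \<alpha>_pos by (intro mult_left_mono powr_mono2) auto
      finally show ?thesis using D by (intro exI[of _ D]) auto
    qed
    have re: "0 \<le> Re z" "Re z < 1"
      using complex_Re_le_cmod[of "1 - z"] z \<eta>_le_1 abs_Re_le_cmod[of z] by auto
    have "norm (V z - of_real \<kappa> * (1 - z)) \<le> 2 * (?K * norm (1 - z) powr \<alpha>) * norm (1 - z)"
    proof (rule V_approx_along[OF z(1) re(1)])
      fix x assume x: "Re z \<le> x" "x < 1"
      have "1 - complex_of_real x = of_real (1 - x)" by simp
      then have "norm (1 - complex_of_real x) = 1 - x" using x by (simp only: norm_of_real)
      also have "\<dots> \<le> norm (1 - z)" using x complex_Re_le_cmod[of "1 - z"] by simp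
      finally show "\<exists>D. (V has_field_derivative D) (at (complex_of_real x)) \<and> norm (D + of_real \<kappa>) \<le> ?K * norm (1 - z) powr \<alpha>"
        using x re by (intro step) auto
    next
      fix v assume "v \<in> closed_segment (of_real (Re z)) z"
      then obtain q where q: "0 \<le> q" "q \<le> 1" "v = (1 - q) *\<^sub>R of_real (Re z) + q *\<^sub>R z"
        by (auto simp: in_segment)
      have v: "Re v = Re z" "Im v = q * Im z" by (simp_all add: q(3) algebra_simps)
      have s: "(q * Im z)\<^sup>2 \<le> (Im z)\<^sup>2"
        using q by (simp add: power_mult_distrib mult_left_le_one_le power_le_one)
      have "norm v \<le> norm z" "norm (1 - v) \<le> norm (1 - z)" unfolding cmod_def using s by (simp_all add: v)
      then show "\<exists>D. (V has_field_derivative D) (at v) \<and> norm (D + of_real \<kappa>) \<le> ?K * norm (1 - z) powr \<alpha>"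
        using z by (intro step) auto
    qed
    then show "norm (V z - of_real \<kappa> * (1 - z)) \<le> 2 * ?K * norm (1 - z) powr (1 + \<alpha>)"
      using norm_one_minus_pos[OF z(1)] by (simp add: powr_add mult_ac)
  qed (use C1 in simp)
qed

text \<open>1/V is \<tau>^(d-1), so for degree k(d-1) the leading term of P(\<tau>) is
  \<open>lead_coeff P\<close> divided by V^k. The lower terms of P cost a relative error 1/|\<tau>|,
  replacing V by \<kappa>(1-z) one of order |1-z|^\<alpha>; both have the same size.\<close>

lemma poly_near:
  assumes P: "degree P = k * (d - 1)" and k: "k \<ge> 1"
  shows "\<exists>C\<ge>0. \<forall>z. norm z < 1 \<longrightarrow> norm (1 - z) < \<eta> \<longrightarrow>
     norm (cpoly P (\<tau> z) - of_real (lead_coeff P / \<kappa> ^ k) / (1 - z) ^ k) \<le> C * norm (1 - z) powr (\<alpha> - real k)"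
proof -
  obtain C0 where C0: "C0 \<ge> 0" "\<And>w. norm w \<ge> 1 \<Longrightarrow>
      norm (cpoly P w / w ^ (k * (d - 1)) - of_real (coeff P (k * (d - 1)))) \<le> C0 / norm w"
    using cpoly_lead[OF P] by blast
  obtain C1 where C1: "C1 \<ge> 0" "\<And>z. norm z < 1 \<Longrightarrow> norm (1 - z) < \<eta> \<Longrightarrow>
      norm (V z - of_real \<kappa> * (1 - z)) \<le> C1 * norm (1 - z) powr (1 + \<alpha>)"
    using V_near by blast
  let ?b = "lead_coeff P"
  define K1 where "K1 = \<bar>?b\<bar> * (real k * (2 / \<kappa>) ^ (k - 1) * (C1 * (2 / \<kappa>\<^sup>2)))"
  define K2 where "K2 = C0 * (2 * \<kappa>) powr \<alpha> * (2 / \<kappa>) ^ k"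
  have K: "K1 \<ge> 0" "K2 \<ge> 0" using C0 C1 \<kappa>_pos by (auto simp: K1_def K2_def)
  show ?thesis
  proof (intro exI[of _ "K1 + K2"] conjI allI impI)
    fix z :: complex assume z: "norm z < 1" "norm (1 - z) < \<eta>"
    define \<rho> where "\<rho> = norm (1 - z)"
    have \<rho>: "\<rho> > 0" using norm_one_minus_pos[OF z(1)] by (simp add: \<rho>_def)
    have nz: "1 - z \<noteq> 0" using \<rho> by (auto simp: \<rho>_def)
    have Vge: "norm (V z) \<ge> \<kappa> / 2 * \<rho>" using norm_V_ge[OF z] by (simp add: \<rho>_def)
    then have Vpos: "norm (V z) > 0" using \<kappa>_pos \<rho> by (smt (verit) mult_pos_pos divide_pos_pos)
    have Vnz: "V z \<noteq> 0" using Vpos by auto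
    have tnz: "\<tau> z \<noteq> 0" using near_one_\<tau>[OF z] by auto
    \<comment> \<open>\<open>A\<close> is the exact value and \<open>E\<close> its model. Both are
      at most 2/(\<kappa>|1-z|), so the difference of their k-th powers reduces to
      \<open>A - E\<close>.\<close>
    define A where "A = 1 / V z"
    define E where "E = 1 / (of_real \<kappa> * (1 - z))"
    have A: "norm A \<le> 2 / \<kappa> / \<rho>"
      unfolding A_def norm_divide using Vge \<kappa>_pos \<rho> Vpos by (simp add: field_simps)
    have En: "norm E = 1 / (\<kappa> * \<rho>)"
      unfolding E_def using \<kappa>_pos by (simp add: norm_divide norm_mult \<rho>_def)
    have E: "norm E \<le> 2 / \<kappa> / \<rho>" unfolding En using \<kappa>_pos \<rho> by (simp add: field_simps)
    have AE: "norm (A - E) \<le> C1 * (2 / \<kappa>\<^sup>2) * \<rho> powr (\<alpha> - 1)"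
    proof -
      have "A - E = (of_real \<kappa> * (1 - z) - V z) * (A * E)"
        unfolding A_def E_def using Vnz nz \<kappa>_pos by (simp add: field_simps)
      then have "norm (A - E) = norm (V z - of_real \<kappa> * (1 - z)) * (norm A * norm E)"
        by (simp add: norm_mult norm_minus_commute)
      also have "\<dots> \<le> (C1 * \<rho> powr (1 + \<alpha>)) * ((2 / \<kappa> / \<rho>) * (1 / (\<kappa> * \<rho>)))"
        unfolding En using C1(1) C1(2)[OF z] A \<rho> \<kappa>_pos by (intro mult_mono) (auto simp: \<rho>_def)
      also have "\<dots> = C1 * (2 / \<kappa>\<^sup>2) * (\<rho> powr (1 + \<alpha>) / \<rho>\<^sup>2)"
        using \<rho> by (simp add: field_simps power2_eq_square)
      also have "\<rho> powr (1 + \<alpha>) / \<rho>\<^sup>2 = \<rho> powr (\<alpha> - 1)"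
      proof -
        have "\<rho>\<^sup>2 = \<rho> powr 2" using \<rho> by simp
        then have "\<rho> powr (1 + \<alpha>) / \<rho>\<^sup>2 = \<rho> powr (1 + \<alpha> - 2)" by (simp only: powr_diff)
        then show ?thesis by simp
      qed
      finally show ?thesis .
    qed
    have k1: "\<rho> powr (\<alpha> - 1) / \<rho> ^ (k - 1) = \<rho> powr (\<alpha> - real k)"
    proof -
      have "\<rho> ^ (k - 1) = \<rho> powr (real k - 1)"
        using powr_realpow[OF \<rho>, of "k - 1"] k by (simp add: of_nat_diff)
      then have "\<rho> powr (\<alpha> - 1) / \<rho> ^ (k - 1) = \<rho> powr (\<alpha> - 1 - (real k - 1))" by (simp only: powr_diff)
      then show ?thesis by simp
    qed
    have main: "norm (A ^ k - E ^ k) \<le> real k * (2 / \<kappa>) ^ (k - 1) * (C1 * (2 / \<kappa>\<^sup>2)) * \<rho> powr (\<alpha> - real k)"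
    proof -
      have "norm (A ^ k - E ^ k) \<le> real k * (2 / \<kappa> / \<rho>) ^ (k - 1) * norm (A - E)"
        by (rule norm_power_diff_le[OF A E])
      also have "\<dots> \<le> real k * (2 / \<kappa> / \<rho>) ^ (k - 1) * (C1 * (2 / \<kappa>\<^sup>2) * \<rho> powr (\<alpha> - 1))"
        using \<kappa>_pos \<rho> by (intro mult_left_mono AE) auto
      also have "\<dots> = real k * (2 / \<kappa>) ^ (k - 1) * (C1 * (2 / \<kappa>\<^sup>2)) * (\<rho> powr (\<alpha> - 1) / \<rho> ^ (k - 1))"
        by (simp add: power_divide power_mult_distrib mult_ac)
      finally show ?thesis unfolding k1 .
    qed
    have Ak: "A ^ k = \<tau> z ^ (k * (d - 1))"
      by (simp add: A_def V_def power_mult mult.commute[of k])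
    define R where "R = cpoly P (\<tau> z) / \<tau> z ^ (k * (d - 1)) - of_real ?b"
    have R: "norm R \<le> C0 * (2 * \<kappa>) powr \<alpha> * \<rho> powr \<alpha>"
    proof -
      have "norm R \<le> C0 * (1 / norm (\<tau> z))"
        using C0(2)[OF near_one_\<tau>[OF z]] by (simp add: R_def P)
      also have "\<dots> \<le> C0 * ((2 * \<kappa>) powr \<alpha> * \<rho> powr \<alpha>)"
        unfolding \<rho>_def by (intro mult_left_mono inverse_norm_\<tau> z C0)
      finally show ?thesis by simp
    qed
    have "cpoly P (\<tau> z) - of_real (?b / \<kappa> ^ k) / (1 - z) ^ k = of_real ?b * (A ^ k - E ^ k) + R * A ^ k"
    proof -
      have "of_real (?b / \<kappa> ^ k) / (1 - z) ^ k = of_real ?b * E ^ k"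
        by (simp add: E_def power_divide power_mult_distrib)
      moreover have "cpoly P (\<tau> z) = (R + of_real ?b) * A ^ k"
        using tnz by (simp add: R_def Ak)
      ultimately show ?thesis by (simp add: algebra_simps)
    qed
    also have "norm \<dots> \<le> \<bar>?b\<bar> * norm (A ^ k - E ^ k) + norm R * norm A ^ k"
      by (rule order.trans[OF norm_triangle_ineq]) (simp add: norm_mult norm_power)
    also have "\<dots> \<le> K1 * \<rho> powr (\<alpha> - real k) + K2 * \<rho> powr (\<alpha> - real k)"
    proof (intro add_mono)
      show "\<bar>?b\<bar> * norm (A ^ k - E ^ k) \<le> K1 * \<rho> powr (\<alpha> - real k)"
        unfolding K1_def using mult_left_mono[OF main, of "\<bar>?b\<bar>"] by (simp add: mult_ac)
      have "norm R * norm A ^ k \<le> (C0 * (2 * \<kappa>) powr \<alpha> * \<rho> powr \<alpha>) * (2 / \<kappa> / \<rho>) ^ k"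
        using R A by (intro mult_mono power_mono) (auto simp: C0)
      also have "\<dots> = K2 * (\<rho> powr \<alpha> / \<rho> ^ k)" by (simp add: K2_def power_divide power_mult_distrib mult_ac)
      also have "\<rho> powr \<alpha> / \<rho> ^ k = \<rho> powr (\<alpha> - real k)"
        using \<rho> by (simp add: powr_diff powr_realpow)
      finally show "norm R * norm A ^ k \<le> K2 * \<rho> powr (\<alpha> - real k)" .
    qed
    finally show "norm (cpoly P (\<tau> z) - of_real (?b / \<kappa> ^ k) / (1 - z) ^ k) \<le> (K1 + K2) * norm (1 - z) powr (\<alpha> - real k)"
      by (simp add: \<rho>_def distrib_right)
  qed (use K in simp)
qed

definition \<sigma>2 :: real where "\<sigma>2 = 1 + \<alpha>"

lemma \<sigma>2_eq: "\<sigma>2 = d / (d - 1)"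
  using d by (simp add: \<sigma>2_def \<alpha>_def field_simps)

lemma Q_near: "\<exists>C\<ge>0. \<forall>z. norm z < 1 \<longrightarrow> norm (1 - z) < \<eta> \<longrightarrow>
     norm (cpoly (pderiv \<phi>) (\<tau> z) - of_real \<sigma>2 / (1 - z)) \<le> C * norm (1 - z) powr (\<alpha> - 1)"
proof -
  have "lead_coeff (pderiv \<phi>) = d * coeff \<phi> d"
    using d by (simp add: degree_pderiv deg coeff_pderiv)
  then have "lead_coeff (pderiv \<phi>) / \<kappa> ^ 1 = \<sigma>2"
    using coeff_d d by (simp add: \<kappa>_def \<sigma>2_eq)
  then show ?thesis using poly_near[of "pderiv \<phi>" 1] by (simp add: degree_pderiv deg)
qed

text \<open>\<phi>''(\<tau>)\<phi>(\<tau>) is the derivative of \<phi>'(\<tau>(z)). The degree of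
  \<phi>''\<phi> is 2(d-1), and its leading coefficient over \<kappa>^2 is again d/(d-1).\<close>

lemma Q'_near: "\<exists>C\<ge>0. \<forall>z. norm z < 1 \<longrightarrow> norm (1 - z) < \<eta> \<longrightarrow>
     norm (cpoly (pderiv (pderiv \<phi>) * \<phi>) (\<tau> z) - of_real \<sigma>2 / (1 - z)\<^sup>2) \<le> C * norm (1 - z) powr (\<alpha> - 2)"
proof -
  have l: "lead_coeff (pderiv (pderiv \<phi>)) = (d - 1) * (d * coeff \<phi> d)"
  proof -
    obtain e where "d = Suc (Suc e)" using d by (metis Suc_le_D numeral_2_eq_2 Suc_le_mono)
    then show ?thesis by (simp add: degree_pderiv deg coeff_pderiv)
  qed
  then have nz: "pderiv (pderiv \<phi>) \<noteq> 0" "\<phi> \<noteq> 0" using d coeff_d by auto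
  then have dg: "degree (pderiv (pderiv \<phi>) * \<phi>) = 2 * (d - 1)"
    using d by (simp add: degree_mult_eq degree_pderiv deg)
  have "lead_coeff (pderiv (pderiv \<phi>) * \<phi>) / \<kappa> ^ 2 = \<sigma>2"
  proof -
    define x c where "x = real (d - 1)" and "c = coeff \<phi> d"
    have "x > 0" "c > 0" using d coeff_d by (auto simp: x_def c_def)
    then show ?thesis unfolding lead_coeff_mult l \<kappa>_def \<sigma>2_eq deg x_def[symmetric] c_def[symmetric]
      by (simp add: power2_eq_square)
  qed
  then show ?thesis using poly_near[OF dg] by simp
qed

end

lemma norm_exp_diff_le:
  fixes a b :: complex
  assumes "norm a \<le> M" "norm b \<le> M"
  shows "norm (exp a - exp b) \<le> exp M * norm (a - b)"
proof (rule field_differentiable_bound[of "cball 0 M"])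
  fix z :: complex assume "z \<in> cball 0 M"
  then have "Re z \<le> M" using complex_Re_le_cmod[of z] by simp
  then show "norm (exp z) \<le> exp M" by (simp add: norm_exp_eq_Re)
qed (use assms in \<open>auto intro!: derivative_eq_intros\<close>)

lemma norm_exp_Ln_powr:
  assumes "norm z < 1"
  shows "norm (exp (- of_real s * Ln (1 - z))) = norm (1 - z) powr (- s)"
proof -
  have "1 - z \<noteq> 0" using assms by auto
  then show ?thesis by (simp add: norm_exp_eq_Re powr_def)
qed

section \<open>The logarithm of \<phi>(\<tau>) and expansions in the whole sector\<close>

context inc_series
begin

definition sector :: "complex set" where
  "sector = {of_real r * cis \<theta> |r \<theta>. 0 \<le> r \<and> r < 1 \<and> \<bar>\<theta>\<bar> \<le> pi / per}"

lemma sector_norm: "z \<in> sector \<Longrightarrow> norm z < 1"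
  by (auto simp: sector_def norm_mult)

lemma sector_scale: "z \<in> sector \<Longrightarrow> 0 \<le> s \<Longrightarrow> s \<le> 1 \<Longrightarrow> of_real s * z \<in> sector"
  unfolding sector_def
proof clarify
  fix r \<theta> :: real assume a: "0 \<le> s" "s \<le> 1" "0 \<le> r" "r < 1" "\<bar>\<theta>\<bar> \<le> pi / per"
  have "s * r < 1" using a mult_left_le_one_le[of r s] by simp
  then show "\<exists>r' \<theta>'. of_real s * (of_real r * cis \<theta>) = of_real r' * cis \<theta>' \<and> 0 \<le> r' \<and> r' < 1 \<and> \<bar>\<theta>'\<bar> \<le> pi / per"
    using a by (intro exI[of _ "s * r"] exI[of _ \<theta>]) (auto simp: mult.assoc)
qed

lemma norm_one_minus_polar_le:
  assumes "0 \<le> r" "r \<le> 1"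
  shows "norm (1 - of_real r * cis \<theta>) \<le> (1 - r) + \<bar>\<theta>\<bar>"
proof -
  have "1 - of_real r * cis \<theta> = of_real (1 - r) + of_real r * (1 - cis \<theta>)" by (simp add: algebra_simps)
  also have "norm \<dots> \<le> norm (complex_of_real (1 - r)) + norm (of_real r * (1 - cis \<theta>))"
    by (rule norm_triangle_ineq)
  also have "\<dots> = (1 - r) + r * norm (1 - cis \<theta>)"
    using assms by (simp only: norm_mult norm_of_real)
  also have "norm (1 - cis \<theta>) = 2 * \<bar>sin (\<theta> / 2)\<bar>"
    using dist_exp_i_1[of \<theta>] by (simp add: norm_minus_commute cis_conv_exp)
  also have "r * (2 * \<bar>sin (\<theta> / 2)\<bar>) \<le> 1 * (2 * \<bar>\<theta> / 2\<bar>)"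
    using assms abs_sin_le_one[of "\<theta> / 2"] by (intro mult_mono abs_sin_x_le_abs_x) auto
  finally show ?thesis by simp
qed

text \<open>A point of the sector at distance at least \<eta> from 1 has angle at least \<eta>/2 or
  radius at most 1-\<eta>/2, and both conditions pass to the segment towards 0. The bound on the
  whole segment serves to integrate \<phi>'(\<tau>) from 0.\<close>

lemma sector_away: "\<exists>C\<ge>0. \<forall>z\<in>sector. norm (1 - z) \<ge> \<eta> \<longrightarrow>
    (\<forall>s. 0 \<le> s \<longrightarrow> s \<le> 1 \<longrightarrow> norm (\<tau> (of_real s * z)) \<le> C)"
proof -
  obtain C where C: "\<And>r \<theta>. 0 \<le> r \<Longrightarrow> r < 1 \<Longrightarrow> \<eta> / 2 \<le> \<bar>\<theta>\<bar> \<Longrightarrow> \<bar>\<theta>\<bar> \<le> pi / per \<Longrightarrow>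
      norm (\<tau> (of_real r * cis \<theta>)) \<le> C"
    using \<tau>_bounded_away[of "\<eta> / 2"] \<eta>_pos by auto
  have t: "t (1 - \<eta> / 2) \<ge> 0" using \<eta>_pos \<eta>_le_1 by (intro t_nonneg) auto
  show ?thesis
  proof (intro exI[of _ "max C (t (1 - \<eta> / 2))"] conjI ballI allI impI)
    fix z and s :: real assume z: "z \<in> sector" "\<eta> \<le> norm (1 - z)" and s: "0 \<le> s" "s \<le> 1"
    obtain r \<theta> where r: "z = of_real r * cis \<theta>" "0 \<le> r" "r < 1" "\<bar>\<theta>\<bar> \<le> pi / per"
      using z by (auto simp: sector_def)
    have sr: "s * r \<le> r" "0 \<le> s * r" using s r by (auto simp: mult_left_le_one_le)
    have eq: "of_real s * z = of_real (s * r) * cis \<theta>" by (simp add: r)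
    consider "\<eta> / 2 \<le> \<bar>\<theta>\<bar>" | "r \<le> 1 - \<eta> / 2"
      using norm_one_minus_polar_le[of r \<theta>] r z by force
    then show "norm (\<tau> (of_real s * z)) \<le> max C (t (1 - \<eta> / 2))"
    proof cases
      case 1
      then show ?thesis unfolding eq using C[of "s * r" \<theta>] sr r by (auto simp: max_def)
    next
      case 2
      have "norm (of_real s * z) = s * r" using sr r s by (simp add: norm_mult)
      then have "norm (\<tau> (of_real s * z)) \<le> t (s * r)"
        using norm_\<tau>_le[of "of_real s * z"] sr r by simp
      also have "\<dots> \<le> t (1 - \<eta> / 2)" using sr 2 \<eta>_pos by (intro t_mono) auto
      finally show ?thesis by simp
    qed
  qed (use t in auto)
qed

lemma \<tau>_holomorphic: "\<tau> holomorphic_on ball 0 1"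
  unfolding holomorphic_on_def using \<tau>_deriv by (force simp: field_differentiable_def)

lemma cpoly_holomorphic: "cpoly P holomorphic_on A"
  unfolding holomorphic_on_def using cpoly_deriv
  by (meson field_differentiable_at_within field_differentiable_def)

text \<open>Since \<tau>' = \<phi>(\<tau>), the logarithmic derivative of \<phi>(\<tau>(z)) is
  \<phi>'(\<tau>(z)). Taking a primitive of the latter yields a logarithm on the disk without
  knowing beforehand that \<phi>(\<tau>) has no zeros.\<close>

lemma L_ex: "\<exists>L. L 0 = complex_of_real (ln (coeff \<phi> 0)) \<and>
   (\<forall>z. norm z < 1 \<longrightarrow> (L has_field_derivative cpoly (pderiv \<phi>) (\<tau> z)) (at z))"
proof -
  have "(\<lambda>z. cpoly (pderiv \<phi>) (\<tau> z)) holomorphic_on ball 0 1"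
    using holomorphic_on_compose[OF \<tau>_holomorphic cpoly_holomorphic] by (simp add: o_def)
  then obtain g where g: "\<And>x. x \<in> ball 0 1 \<Longrightarrow> (g has_field_derivative cpoly (pderiv \<phi>) (\<tau> x)) (at x within ball 0 1)"
    using holomorphic_convex_primitive'[of "ball 0 1"] by auto
  have "(g has_field_derivative cpoly (pderiv \<phi>) (\<tau> z)) (at z)" if "norm z < 1" for z
    using g[of z] that by (simp add: at_within_open[of _ "ball 0 1"])
  then show ?thesis
    by (intro exI[of _ "\<lambda>z. g z - g 0 + of_real (ln (coeff \<phi> 0))"]) (auto intro!: derivative_eq_intros)
qed

definition L :: "complex \<Rightarrow> complex" where
  "L = (SOME L. L 0 = complex_of_real (ln (coeff \<phi> 0)) \<and>
   (\<forall>z. norm z < 1 \<longrightarrow> (L has_field_derivative cpoly (pderiv \<phi>) (\<tau> z)) (at z)))"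

lemma L_0: "L 0 = of_real (ln (coeff \<phi> 0))"
  and L_deriv: "norm z < 1 \<Longrightarrow> (L has_field_derivative cpoly (pderiv \<phi>) (\<tau> z)) (at z)"
  using someI_ex[OF L_ex] unfolding L_def[symmetric] by blast+

lemma exp_L:
  assumes "norm z < 1" shows "exp (L z) = cpoly \<phi> (\<tau> z)"
proof -
  have "\<exists>c. \<forall>x\<in>ball 0 1. cpoly \<phi> (\<tau> x) * exp (- L x) = c"
  proof (rule has_field_derivative_zero_constant)
    fix x :: complex assume "x \<in> ball 0 1"
    then have x: "norm x < 1" by simp
    have "((\<lambda>x. cpoly \<phi> (\<tau> x) * exp (- L x)) has_field_derivative 0) (at x)"
      by (rule derivative_eq_intros L_deriv[OF x] \<tau>_deriv[OF x] refl)+ (simp add: algebra_simps)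
    then show "((\<lambda>x. cpoly \<phi> (\<tau> x) * exp (- L x)) has_field_derivative 0) (at x within ball 0 1)"
      by (rule has_field_derivative_at_within)
  qed auto
  then obtain c where c: "\<And>x. norm x < 1 \<Longrightarrow> cpoly \<phi> (\<tau> x) * exp (- L x) = c" by auto
  have "cpoly \<phi> 0 = of_real (coeff \<phi> 0)"
    using cpoly_of_real[of \<phi> 0] by (simp add: poly_0_coeff_0)
  moreover have "exp (complex_of_real (ln (coeff \<phi> 0))) = of_real (coeff \<phi> 0)"
    using coeff_0 by (simp add: exp_of_real)
  ultimately have "c = 1"
    using c[of 0] coeff_0 by (simp add: \<tau>_0 L_0 exp_minus)
  then show ?thesis using c[OF assms] by (simp add: exp_minus field_simps)
qed

text \<open>The logarithm of \<phi>(\<tau>(z)) times (1-z) to the power \<open>\<sigma>2\<close>;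
  the exponential of its limit at 1 is the constant K of the singular expansion.\<close>

definition h :: "complex \<Rightarrow> complex" where "h z = L z + of_real \<sigma>2 * Ln (1 - z)"

lemma one_minus_not_nonpos: "norm z < 1 \<Longrightarrow> 1 - z \<notin> \<real>\<^sub>\<le>\<^sub>0" for z :: complex
  using complex_Re_le_cmod[of z] by (auto simp: complex_nonpos_Reals_iff)

lemma h_deriv:
  assumes "norm z < 1"
  shows "(h has_field_derivative cpoly (pderiv \<phi>) (\<tau> z) - of_real \<sigma>2 / (1 - z)) (at z within S)"
proof -
  have "(h has_field_derivative cpoly (pderiv \<phi>) (\<tau> z) + of_real \<sigma>2 * (inverse (1 - z) * (-1))) (at z)"
    unfolding h_def
    by (rule derivative_eq_intros L_deriv[OF assms] DERIV_chain2[OF has_field_derivative_Ln] refl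
        one_minus_not_nonpos[OF assms])+ simp
  then show ?thesis by (auto simp: divide_inverse intro: has_field_derivative_at_within)
qed

text \<open>h' = O(|1-z|^(\<alpha>-1)) is integrable at 1, so h has a limit along the real axis. A
  general z is joined to the real point at the same distance from 1 by a chord that keeps at least
  half that distance.\<close>

lemma h_limit: "\<exists>l C. C \<ge> 0 \<and> (\<forall>z. norm z < 1 \<longrightarrow> norm (1 - z) < \<eta> \<longrightarrow>
    norm (h z - l) \<le> C * norm (1 - z) powr \<alpha>)"
proof -
  obtain C where C: "C \<ge> 0" "\<And>z. norm z < 1 \<Longrightarrow> norm (1 - z) < \<eta> \<Longrightarrow>
     norm (cpoly (pderiv \<phi>) (\<tau> z) - of_real \<sigma>2 / (1 - z)) \<le> C * norm (1 - z) powr (\<alpha> - 1)"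
    using Q_near by blast
  have radial: "norm (h (of_real y) - h (of_real x)) \<le> C / \<alpha> * (1 - x) powr \<alpha>"
    if xy: "1 - \<eta> < x" "x \<le> y" "y < 1" for x y :: real
  proof (cases "x = y")
    case False
    then have "x < y" using xy by simp
    have n1: "norm (complex_of_real s) < 1" "norm (1 - complex_of_real s) = 1 - s" if "x \<le> s" "s \<le> y" for s
    proof -
      have "1 - complex_of_real s = of_real (1 - s)" by simp
      then show "norm (1 - complex_of_real s) = 1 - s" using that xy by (simp only: norm_of_real)
      show "norm (complex_of_real s) < 1" using that xy \<eta>_le_1 by simp
    qed
    have hv: "((\<lambda>s. h (of_real s)) has_vector_derivative cpoly (pderiv \<phi>) (\<tau> (of_real s)) - of_real \<sigma>2 / (1 - of_real s)) (at s within S)"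
      if "x \<le> s" "s \<le> y" for s S
      using h_deriv[OF n1(1)[OF that]] by (intro has_vector_derivative_real_field) auto
    have "norm (h (of_real y) - h (of_real x)) \<le> - (C / \<alpha>) * (1 - y) powr \<alpha> - (- (C / \<alpha>) * (1 - x) powr \<alpha>)"
    proof (rule differentiable_bound_general[OF \<open>x < y\<close>])
      show "continuous_on {x..y} (\<lambda>s. h (complex_of_real s))"
        using hv has_vector_derivative_continuous by (fastforce simp: continuous_on_eq_continuous_within)
      show "continuous_on {x..y} (\<lambda>s. - (C / \<alpha>) * (1 - s) powr \<alpha>)"
        using xy by (intro continuous_intros) auto
    next
      fix s assume s: "x < s" "s < y"
      show "((\<lambda>s. h (of_real s)) has_vector_derivative cpoly (pderiv \<phi>) (\<tau> (of_real s)) - of_real \<sigma>2 / (1 - of_real s)) (at s)"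
        using s by (intro hv) auto
      have "((\<lambda>s. - (C / \<alpha>) * (1 - s) powr \<alpha>) has_real_derivative C * (1 - s) powr (\<alpha> - 1)) (at s)"
        using s xy \<alpha>_pos by (auto intro!: derivative_eq_intros simp: field_simps)
      then show "((\<lambda>s. - (C / \<alpha>) * (1 - s) powr \<alpha>) has_vector_derivative C * (1 - s) powr (\<alpha> - 1)) (at s)"
        by (simp add: has_real_derivative_iff_has_vector_derivative)
      show "norm (cpoly (pderiv \<phi>) (\<tau> (of_real s)) - of_real \<sigma>2 / (1 - of_real s)) \<le> C * (1 - s) powr (\<alpha> - 1)"
        using C(2)[of "of_real s"] n1[of s] s xy by simp
    qed
    also have "\<dots> \<le> C / \<alpha> * (1 - x) powr \<alpha>" using C \<alpha>_pos by simp
    finally show ?thesis .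
  qed (use C \<alpha>_pos in simp)
  define x where "x n = 1 - \<eta> / real (n + 2)" for n
  have x: "1 - \<eta> < x n" "x n < 1" for n
    using \<eta>_pos by (auto simp: x_def field_simps intro: add_pos_nonneg)
  have xlim: "x \<longlonglongrightarrow> 1"
  proof -
    have "(\<lambda>n. \<eta> / real (n + 2)) \<longlonglongrightarrow> 0"
      using LIMSEQ_ignore_initial_segment[OF lim_const_over_n[of \<eta>], of 2] by simp
    then have "(\<lambda>n. 1 - \<eta> / real (n + 2)) \<longlonglongrightarrow> 1 - 0" by (intro tendsto_intros)
    then show ?thesis by (simp add: x_def[abs_def])
  qed
  have xmono: "x m \<le> x n" if "m \<le> n" for m n
    using that \<eta>_pos by (auto simp: x_def intro!: divide_left_mono)
  have "Cauchy (\<lambda>n. h (of_real (x n)))"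
  proof (rule CauchyI)
    fix e :: real assume e: "e > 0"
    have "(\<lambda>n. C / \<alpha> * (1 - x n) powr \<alpha>) \<longlonglongrightarrow> C / \<alpha> * 0"
      using xlim x \<alpha>_pos
      by (intro tendsto_mult tendsto_const tendsto_zero_powrI[where b = \<alpha>] tendsto_eq_intros)
         (auto intro!: tendsto_eq_intros always_eventually less_imp_le)
    then have "\<forall>\<^sub>F n in sequentially. C / \<alpha> * (1 - x n) powr \<alpha> < e"
      using e by (intro order_tendstoD(2)) auto
    then obtain M where M: "C / \<alpha> * (1 - x M) powr \<alpha> < e" by (auto simp: eventually_sequentially)
    have 1: "norm (h (of_real (x n)) - h (of_real (x M))) < e / 1" if "n \<ge> M" for n
      using radial[OF x(1) xmono[OF that] x(2)] M by simp
    have "\<exists>M. \<forall>n\<ge>M. norm (h (of_real (x n)) - h (of_real (x M))) < e" using 1 by auto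
    have 2: "norm (h (of_real (x n)) - h (of_real (x m))) < e" if "m \<ge> M" "n \<ge> m" for m n
    proof -
      have "norm (h (of_real (x n)) - h (of_real (x m))) \<le> C / \<alpha> * (1 - x m) powr \<alpha>"
        by (intro radial x xmono that)
      also have "\<dots> \<le> C / \<alpha> * (1 - x M) powr \<alpha>"
        using xmono[OF that(1)] x[of m] C \<alpha>_pos by (intro mult_left_mono powr_mono2) auto
      finally show ?thesis using M by simp
    qed
    show "\<exists>M. \<forall>m\<ge>M. \<forall>n\<ge>M. norm (h (of_real (x m)) - h (of_real (x n))) < e"
    proof (intro exI[of _ M] allI impI)
      fix m n assume "M \<le> m" "M \<le> n"
      then show "norm (h (of_real (x m)) - h (of_real (x n))) < e"
        using 2[of m n] 2[of n m] by (cases "m \<le> n") (auto simp: norm_minus_commute)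
    qed
  qed
  then obtain l where l: "(\<lambda>n. h (of_real (x n))) \<longlonglongrightarrow> l"
    using Cauchy_convergent convergent_def by blast
  have lim: "norm (h (of_real y) - l) \<le> C / \<alpha> * (1 - y) powr \<alpha>" if y: "1 - \<eta> < y" "y < 1" for y
  proof (rule tendsto_upperbound)
    show "(\<lambda>n. norm (h (of_real y) - h (of_real (x n)))) \<longlonglongrightarrow> norm (h (of_real y) - l)"
      by (intro tendsto_intros l)
    have "\<forall>\<^sub>F n in sequentially. y < x n" by (rule order_tendstoD(1)[OF xlim y(2)])
    then show "\<forall>\<^sub>F n in sequentially. norm (h (of_real y) - h (of_real (x n))) \<le> C / \<alpha> * (1 - y) powr \<alpha>"
    proof eventually_elim
      case (elim n)
      then show ?case using radial[of y "x n"] y x[of n] by (simp add: norm_minus_commute)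
    qed
  qed simp
  show ?thesis
  proof (intro exI[of _ l] exI[of _ "C / \<alpha> + C * 4"] conjI allI impI)
    fix z :: complex assume z: "norm z < 1" "norm (1 - z) < \<eta>"
    define \<rho> where "\<rho> = norm (1 - z)"
    have \<rho>: "\<rho> > 0" "\<rho> < \<eta>" using norm_one_minus_pos[OF z(1)] z by (auto simp: \<rho>_def)
    have re: "Re (1 - z) > 0" using complex_Re_le_cmod[of z] z by simp
    have seg: "norm (h z - h (of_real (1 - \<rho>))) \<le> C * (\<rho> / 2) powr (\<alpha> - 1) * norm (z - of_real (1 - \<rho>))"
    proof (rule field_differentiable_bound[of "closed_segment (of_real (1 - \<rho>)) z"])
      fix w assume w: "w \<in> closed_segment (complex_of_real (1 - \<rho>)) z"
      then obtain q where q: "0 \<le> q" "q \<le> 1" "w = (1 - q) *\<^sub>R of_real (1 - \<rho>) + q *\<^sub>R z"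
        by (auto simp: in_segment)
      have "convex (ball 0 1 :: complex set)" by simp
      moreover have "norm (complex_of_real (1 - \<rho>)) < 1"
        unfolding norm_of_real using \<rho> \<eta>_le_1 by simp
      ultimately have "closed_segment (of_real (1 - \<rho>)) z \<subseteq> ball 0 1"
        using z by (intro closed_segment_subset) simp_all
      then have w1: "norm w < 1" using w by auto
      have eq: "1 - w = (1 - q) *\<^sub>R of_real \<rho> + q *\<^sub>R (1 - z)"
        unfolding q(3) by (simp add: scaleR_conv_of_real algebra_simps)
      have "norm (1 - w) \<le> norm ((1 - q) *\<^sub>R complex_of_real \<rho>) + norm (q *\<^sub>R (1 - z))"
        unfolding eq by (rule norm_triangle_ineq)
      also have "\<dots> = \<bar>1 - q\<bar> * \<bar>\<rho>\<bar> + \<bar>q\<bar> * \<rho>"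
        by (simp only: norm_scaleR norm_of_real \<rho>_def)
      also have "\<dots> = \<rho>" using q(1,2) \<rho> by (simp add: algebra_simps)
      finally have up: "norm (1 - w) < \<eta>" using \<rho> by simp
      \<comment> \<open>Seen from 1 both ends of the chord have modulus \<rho> and positive real
        part, and one of them is real, so nothing cancels: the end with weight at least 1/2 already
        contributes \<rho>/2.\<close>
      have low: "norm (1 - w) \<ge> \<rho> / 2"
      proof (cases "q \<le> 1 / 2")
        case True
        have "\<rho> / 2 \<le> (1 - q) * \<rho>" using True \<rho> by (simp add: field_simps)
        also have "\<dots> \<le> Re (1 - w)" unfolding eq using re q by simp
        also have "\<dots> \<le> norm (1 - w)" by (rule complex_Re_le_cmod)
        finally show ?thesis .
      next
        case False
        have "(\<rho> / 2)\<^sup>2 \<le> (q * \<rho>)\<^sup>2" using False \<rho> by (intro power_mono) auto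
        also have "\<dots> = (q * Re (1 - z))\<^sup>2 + (q * Im (1 - z))\<^sup>2"
          by (simp add: \<rho>_def power_mult_distrib cmod_power2 distrib_left)
        also have "\<dots> \<le> (Re (1 - w))\<^sup>2 + (Im (1 - w))\<^sup>2"
        proof (rule add_mono)
          show "(q * Re (1 - z))\<^sup>2 \<le> (Re (1 - w))\<^sup>2"
            unfolding eq using re q(1,2) \<rho> by (intro power_mono) auto
          show "(q * Im (1 - z))\<^sup>2 \<le> (Im (1 - w))\<^sup>2" unfolding eq by simp
        qed
        also have "\<dots> = (norm (1 - w))\<^sup>2" by (simp add: cmod_power2)
        finally show ?thesis by (rule power2_le_imp_le) simp
      qed
      show "(h has_field_derivative cpoly (pderiv \<phi>) (\<tau> w) - of_real \<sigma>2 / (1 - w)) (at w within closed_segment (of_real (1 - \<rho>)) z)"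
        by (rule h_deriv[OF w1])
      have "norm (cpoly (pderiv \<phi>) (\<tau> w) - of_real \<sigma>2 / (1 - w)) \<le> C * norm (1 - w) powr (\<alpha> - 1)"
        by (rule C(2)[OF w1 up])
      also have "\<dots> \<le> C * (\<rho> / 2) powr (\<alpha> - 1)"
        using low \<rho> \<alpha>_le_1 C by (intro mult_left_mono powr_mono2') auto
      finally show "norm (cpoly (pderiv \<phi>) (\<tau> w) - of_real \<sigma>2 / (1 - w)) \<le> C * (\<rho> / 2) powr (\<alpha> - 1)" .
    qed auto
    have "norm (z - of_real (1 - \<rho>)) = norm (of_real \<rho> - (1 - z))" by (simp add: algebra_simps)
    also have "\<dots> \<le> \<rho> + \<rho>" using norm_triangle_ineq4[of "of_real \<rho>" "1 - z"] \<rho> by (simp add: \<rho>_def)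
    finally have "C * (\<rho> / 2) powr (\<alpha> - 1) * norm (z - of_real (1 - \<rho>)) \<le> C * (\<rho> / 2) powr (\<alpha> - 1) * (2 * \<rho>)"
      using C by (intro mult_left_mono) auto
    also have "\<dots> = C * (2 * (2 powr (1 - \<alpha>) * (\<rho> powr (\<alpha> - 1) * \<rho>)))"
      using \<rho> by (simp add: powr_divide powr_diff)
    also have "\<rho> powr (\<alpha> - 1) * \<rho> = \<rho> powr \<alpha>" using \<rho> by (simp add: powr_diff)
    also have "C * (2 * (2 powr (1 - \<alpha>) * \<rho> powr \<alpha>)) \<le> C * (2 * (2 powr 1 * \<rho> powr \<alpha>))"
      using C \<alpha>_pos by (intro mult_left_mono mult_right_mono powr_mono) auto
    finally have "norm (h z - h (of_real (1 - \<rho>))) \<le> C * 4 * \<rho> powr \<alpha>" using seg by simp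
    moreover have "norm (h (of_real (1 - \<rho>)) - l) \<le> C / \<alpha> * \<rho> powr \<alpha>"
      using lim[of "1 - \<rho>"] \<rho> by simp
    moreover have "norm (h z - l) \<le> norm (h z - h (of_real (1 - \<rho>))) + norm (h (of_real (1 - \<rho>)) - l)"
      using norm_triangle_ineq[of "h z - h (of_real (1 - \<rho>))" "h (of_real (1 - \<rho>)) - l"] by simp
    ultimately show "norm (h z - l) \<le> (C / \<alpha> + C * 4) * norm (1 - z) powr \<alpha>"
      by (simp add: \<rho>_def distrib_right)
  qed (use C \<alpha>_pos in auto)
qed

text \<open>Near 1 this is the limit of \<open>h\<close>, the imaginary part of \<open>Ln\<close>
  being bounded by pi. Elsewhere \<tau> is bounded along the whole segment from 0, hence so is the
  integral of \<phi>'(\<tau>).\<close>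

lemma L_sector: "\<exists>C\<ge>0. \<forall>z\<in>sector. norm (L z + of_real (\<sigma>2 * ln (norm (1 - z)))) \<le> C"
proof -
  obtain l C where C: "C \<ge> 0" "\<And>z. norm z < 1 \<Longrightarrow> norm (1 - z) < \<eta> \<Longrightarrow> norm (h z - l) \<le> C * norm (1 - z) powr \<alpha>"
    using h_limit by blast
  obtain B where B: "B \<ge> 0" "\<And>z s. z \<in> sector \<Longrightarrow> norm (1 - z) \<ge> \<eta> \<Longrightarrow> 0 \<le> s \<Longrightarrow> s \<le> 1 \<Longrightarrow>
      norm (\<tau> (of_real s * z)) \<le> B"
    using sector_away by blast
  have s2: "\<sigma>2 \<ge> 0" using \<alpha>_pos by (simp add: \<sigma>2_def)
  define C1 where "C1 = norm l + C + \<sigma>2 * pi"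
  define C2 where "C2 = norm (L 0) + poly (pderiv \<phi>) B + \<sigma>2 * (ln 2 + \<bar>ln \<eta>\<bar>)"
  have pd: "coeff (pderiv \<phi>) j \<ge> 0" for j using coeff_nonneg by (simp add: coeff_pderiv)
  have pdB: "poly (pderiv \<phi>) B \<ge> 0" unfolding poly_altdef using pd B by (intro sum_nonneg) auto
  show ?thesis
  proof (intro exI[of _ "max C1 C2"] conjI ballI)
    have "0 \<le> C1" unfolding C1_def using C(1) s2 by (intro add_nonneg_nonneg mult_nonneg_nonneg) auto
    then show "0 \<le> max C1 C2" by simp
    fix z assume z: "z \<in> sector"
    have z1: "norm z < 1" by (rule sector_norm[OF z])
    have n1: "norm (1 - z) > 0" using norm_one_minus_pos[OF z1] .
    show "norm (L z + of_real (\<sigma>2 * ln (norm (1 - z)))) \<le> max C1 C2"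
    proof (cases "norm (1 - z) < \<eta>")
      case True
      have nz: "1 - z \<noteq> 0" using n1 by auto
      have "L z + of_real (\<sigma>2 * ln (norm (1 - z))) = (h z - l) + l - \<i> * of_real (\<sigma>2 * Im (Ln (1 - z)))"
        unfolding h_def using nz by (simp add: complex_eq_iff)
      also have "norm \<dots> \<le> norm (h z - l) + norm l + norm (\<i> * of_real (\<sigma>2 * Im (Ln (1 - z))))"
        by (metis (no_types, lifting) add.commute add_mono_thms_linordered_semiring(2) norm_triangle_ineq norm_triangle_le_diff order.trans order_refl)
      also have "norm (h z - l) \<le> C"
      proof -
        have "norm (1 - z) powr \<alpha> \<le> 1 powr \<alpha>"
          using True \<eta>_le_1 \<alpha>_pos by (intro powr_mono2) auto
        then show ?thesis using C(2)[OF z1 True] mult_left_mono[of "norm (1 - z) powr \<alpha>" 1 C] C(1) by simp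
      qed
      also have "norm (\<i> * complex_of_real (\<sigma>2 * Im (Ln (1 - z)))) \<le> \<sigma>2 * pi"
      proof -
        have "\<bar>Im (Ln (1 - z))\<bar> \<le> pi" using mpi_less_Im_Ln[OF nz] Im_Ln_le_pi[OF nz] by linarith
        then show ?thesis using s2 by (simp add: norm_mult abs_mult mult_left_mono)
      qed
      finally show ?thesis by (simp add: C1_def)
    next
      case False
      have "norm (L z - L 0) \<le> poly (pderiv \<phi>) B * norm (z - 0)"
      proof (rule field_differentiable_bound[of "closed_segment 0 z"])
        fix w assume "w \<in> closed_segment 0 z"
        then obtain q where q: "0 \<le> q" "q \<le> 1" "w = of_real q * z"
          by (auto simp: in_segment scaleR_conv_of_real)
        have w1: "norm w < 1" using sector_norm[OF sector_scale[OF z q(1,2)]] q by simp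
        show "(L has_field_derivative cpoly (pderiv \<phi>) (\<tau> w)) (at w within closed_segment 0 z)"
          using L_deriv[OF w1] by (rule has_field_derivative_at_within)
        show "norm (cpoly (pderiv \<phi>) (\<tau> w)) \<le> poly (pderiv \<phi>) B"
          unfolding q(3) using B(2)[OF z _ q(1,2)] False by (intro norm_cpoly_le pd) auto
      qed auto
      also have "\<dots> \<le> poly (pderiv \<phi>) B * 1" using z1 pdB by (intro mult_left_mono) auto
      finally have "norm (L z) \<le> norm (L 0) + poly (pderiv \<phi>) B"
        using norm_triangle_sub[of "L z" "L 0"] by simp
      moreover have "\<bar>ln (norm (1 - z))\<bar> \<le> ln 2 + \<bar>ln \<eta>\<bar>"
      proof -
        have "norm (1 - z) \<le> 2" using norm_triangle_ineq4[of 1 z] z1 by simp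
        then have "ln (norm (1 - z)) \<le> ln 2" using n1 by (subst ln_le_cancel_iff) auto
        moreover have "ln \<eta> \<le> ln (norm (1 - z))" using False \<eta>_pos n1 by (subst ln_le_cancel_iff) auto
        moreover have "ln (2::real) \<ge> 0" by simp
        ultimately show ?thesis by linarith
      qed
      then have "norm (complex_of_real (\<sigma>2 * ln (norm (1 - z)))) \<le> \<sigma>2 * (ln 2 + \<bar>ln \<eta>\<bar>)"
        using s2 by (simp only: norm_of_real abs_mult) (simp add: mult_left_mono)
      ultimately show ?thesis
        using norm_triangle_ineq[of "L z" "of_real (\<sigma>2 * ln (norm (1 - z)))"] by (simp add: C2_def)
    qed
  qed
qed

text \<open>Away from 1 both functions are bounded, and |1-z| \<le> 2 everywhere, so a bound by a
  negative power of |1-z| costs only a constant there.\<close>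

lemma sector_extend:
  assumes near: "\<exists>C\<ge>0. \<forall>z. norm z < 1 \<longrightarrow> norm (1 - z) < \<eta> \<longrightarrow> norm (cpoly P (\<tau> z) - G z) \<le> C * norm (1 - z) powr (- s)"
    and G: "\<And>z. norm z < 1 \<Longrightarrow> norm (G z) \<le> K * norm (1 - z) powr (- s')" and s: "s \<ge> 0" "s' \<ge> 0" and K: "K \<ge> 0"
    and P: "\<And>j. coeff P j \<ge> 0"
  shows "\<exists>C\<ge>0. \<forall>z\<in>sector. norm (cpoly P (\<tau> z) - G z) \<le> C * norm (1 - z) powr (- s)"
proof -
  obtain C where C: "C \<ge> 0" "\<And>z. norm z < 1 \<Longrightarrow> norm (1 - z) < \<eta> \<Longrightarrow> norm (cpoly P (\<tau> z) - G z) \<le> C * norm (1 - z) powr (- s)"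
    using near by blast
  obtain B where B: "B \<ge> 0" "\<And>z s. z \<in> sector \<Longrightarrow> norm (1 - z) \<ge> \<eta> \<Longrightarrow> 0 \<le> s \<Longrightarrow> s \<le> 1 \<Longrightarrow>
      norm (\<tau> (of_real s * z)) \<le> B"
    using sector_away by blast
  define C2 where "C2 = (poly P B + K * \<eta> powr (- s')) * 2 powr s"
  show ?thesis
  proof (intro exI[of _ "max C C2"] conjI ballI)
    show "0 \<le> max C C2" using C by auto
    fix z assume z: "z \<in> sector"
    have z1: "norm z < 1" by (rule sector_norm[OF z])
    have n1: "norm (1 - z) > 0" using norm_one_minus_pos[OF z1] .
    show "norm (cpoly P (\<tau> z) - G z) \<le> max C C2 * norm (1 - z) powr (- s)"
    proof (cases "norm (1 - z) < \<eta>")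
      case True
      have "norm (cpoly P (\<tau> z) - G z) \<le> C * norm (1 - z) powr (- s)" by (rule C(2)[OF z1 True])
      also have "\<dots> \<le> max C C2 * norm (1 - z) powr (- s)" by (intro mult_right_mono) auto
      finally show ?thesis .
    next
      case False
      have nn: "poly P B \<ge> 0" unfolding poly_altdef using P B by (intro sum_nonneg) auto
      have "norm (cpoly P (\<tau> z) - G z) \<le> norm (cpoly P (\<tau> z)) + norm (G z)" by (rule norm_triangle_ineq4)
      also have "norm (cpoly P (\<tau> z)) \<le> poly P B"
        using B(2)[OF z _, of 1] False by (intro norm_cpoly_le P) auto
      also have "norm (G z) \<le> K * \<eta> powr (- s')"
      proof -
        have "norm (1 - z) powr (- s') \<le> \<eta> powr (- s')"
          using False \<eta>_pos s by (intro powr_mono2') auto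
        then show ?thesis using G[OF z1] K mult_left_mono order.trans by blast
      qed
      finally have "norm (cpoly P (\<tau> z) - G z) \<le> (poly P B + K * \<eta> powr (- s')) * 1" by simp
      also have "\<dots> \<le> (poly P B + K * \<eta> powr (- s')) * (2 powr s * norm (1 - z) powr (- s))"
      proof (intro mult_left_mono)
        have "norm (1 - z) \<le> 2" using norm_triangle_ineq4[of 1 z] z1 by simp
        then have "norm (1 - z) powr s \<le> 2 powr s" using s by (intro powr_mono2) auto
        then show "1 \<le> 2 powr s * norm (1 - z) powr (- s)"
          using n1 by (simp add: powr_minus field_simps)
      qed (use nn K in auto)
      also have "\<dots> \<le> max C C2 * norm (1 - z) powr (- s)"
        unfolding C2_def mult.assoc[symmetric] by (intro mult_right_mono) auto
      finally show ?thesis .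
    qed
  qed
qed

text \<open>\<phi>(\<tau>) is exp(h) times (1-z) to the power \<open>- \<sigma>2\<close>, and h = l
  + O(|1-z|^\<alpha>). The error has exponent \<open>\<sigma>2\<close> - \<alpha> = 1, and K =
  exp(l) cannot vanish.\<close>

lemma R_sector: "\<exists>K C. K \<noteq> 0 \<and> C \<ge> 0 \<and> (\<forall>z\<in>sector.
    norm (cpoly \<phi> (\<tau> z) - K * exp (- of_real \<sigma>2 * Ln (1 - z))) \<le> C * norm (1 - z) powr (- 1))"
proof -
  obtain l C where C: "C \<ge> 0" "\<And>z. norm z < 1 \<Longrightarrow> norm (1 - z) < \<eta> \<Longrightarrow> norm (h z - l) \<le> C * norm (1 - z) powr \<alpha>"
    using h_limit by blast
  have s2: "\<sigma>2 \<ge> 0" using \<alpha>_pos by (simp add: \<sigma>2_def)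
  have "\<exists>C\<ge>0. \<forall>z\<in>sector. norm (cpoly \<phi> (\<tau> z) - exp l * exp (- of_real \<sigma>2 * Ln (1 - z))) \<le> C * norm (1 - z) powr (- 1)"
  proof (rule sector_extend[where K = "norm (exp l)" and s' = \<sigma>2])
    show "\<exists>C\<ge>0. \<forall>z. norm z < 1 \<longrightarrow> norm (1 - z) < \<eta> \<longrightarrow>
      norm (cpoly \<phi> (\<tau> z) - exp l * exp (- of_real \<sigma>2 * Ln (1 - z))) \<le> C * norm (1 - z) powr (- 1)"
    proof (intro exI[of _ "exp (norm l + C) * C"] conjI allI impI)
      fix z :: complex assume z: "norm z < 1" "norm (1 - z) < \<eta>"
      have "norm (1 - z) powr \<alpha> \<le> 1 powr \<alpha>"
        using z \<eta>_le_1 \<alpha>_pos by (intro powr_mono2) auto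
      then have "norm (h z - l) \<le> C"
        using C(2)[OF z] mult_left_mono[of "norm (1 - z) powr \<alpha>" 1 C] C(1) by simp
      then have "norm (h z) \<le> norm l + C" using norm_triangle_sub[of "h z" l] by simp
      then have "norm (exp (h z) - exp l) \<le> exp (norm l + C) * norm (h z - l)"
        using C(1) by (intro norm_exp_diff_le) auto
      also have "\<dots> \<le> exp (norm l + C) * (C * norm (1 - z) powr \<alpha>)"
        by (intro mult_left_mono C(2)[OF z]) auto
      finally have e: "norm (exp (h z) - exp l) \<le> exp (norm l + C) * C * norm (1 - z) powr \<alpha>" by simp
      have "cpoly \<phi> (\<tau> z) = exp (h z) * exp (- of_real \<sigma>2 * Ln (1 - z))"
        unfolding exp_L[OF z(1), symmetric] by (simp add: h_def flip: exp_add)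
      then have "norm (cpoly \<phi> (\<tau> z) - exp l * exp (- of_real \<sigma>2 * Ln (1 - z))) =
          norm (exp (h z) - exp l) * norm (1 - z) powr (- \<sigma>2)"
        by (simp only: norm_exp_Ln_powr[OF z(1), symmetric] norm_mult[symmetric] left_diff_distrib)
      also have "\<dots> \<le> exp (norm l + C) * C * norm (1 - z) powr \<alpha> * norm (1 - z) powr (- \<sigma>2)"
        by (intro mult_right_mono e) auto
      also have "\<dots> = exp (norm l + C) * C * norm (1 - z) powr (- 1)"
        by (simp add: \<sigma>2_def mult.assoc flip: powr_add)
      finally show "norm (cpoly \<phi> (\<tau> z) - exp l * exp (- of_real \<sigma>2 * Ln (1 - z))) \<le>
        exp (norm l + C) * C * norm (1 - z) powr (- 1)" .
    qed (use C in auto)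
    fix z :: complex assume "norm z < 1"
    then show "norm (exp l * exp (- of_real \<sigma>2 * Ln (1 - z))) \<le> norm (exp l) * norm (1 - z) powr (- \<sigma>2)"
      unfolding norm_mult by (simp only: norm_exp_Ln_powr order.refl)
  qed (use s2 coeff_nonneg in auto)
  then show ?thesis by (metis exp_not_eq_zero)
qed

lemma Q'_sector: "\<exists>C\<ge>0. \<forall>z\<in>sector.
    norm (cpoly (pderiv (pderiv \<phi>) * \<phi>) (\<tau> z) - of_real \<sigma>2 / (1 - z)\<^sup>2) \<le> C * norm (1 - z) powr (- (2 - \<alpha>))"
proof (rule sector_extend[where K = \<sigma>2 and s' = 2])
  show "\<exists>C\<ge>0. \<forall>z. norm z < 1 \<longrightarrow> norm (1 - z) < \<eta> \<longrightarrow>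
     norm (cpoly (pderiv (pderiv \<phi>) * \<phi>) (\<tau> z) - of_real \<sigma>2 / (1 - z)\<^sup>2) \<le> C * norm (1 - z) powr (- (2 - \<alpha>))"
    using Q'_near by simp
  have s2: "\<sigma>2 \<ge> 0" using \<alpha>_pos by (simp add: \<sigma>2_def)
  then show "0 \<le> \<sigma>2" .
  fix z :: complex assume "norm z < 1"
  then have "norm (1 - z) > 0" by (rule norm_one_minus_pos)
  then show "norm (of_real \<sigma>2 / (1 - z)\<^sup>2) \<le> \<sigma>2 * norm (1 - z) powr (- 2)"
    using s2 by (simp add: norm_mult norm_inverse norm_power powr_minus divide_inverse)
next
  fix j
  show "coeff (pderiv (pderiv \<phi>) * \<phi>) j \<ge> 0"
    unfolding coeff_mult using coeff_nonneg by (intro sum_nonneg mult_nonneg_nonneg) (auto simp: coeff_pderiv)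
qed (use \<alpha>_le_1 in auto)

end

section \<open>Coefficients and boundary behaviour\<close>

text \<open>A q-th part of the circle suffices for orthogonality when q divides k, because the
  primitive takes equal values at both ends.\<close>

lemma has_integral_cis:
  fixes k :: int and q :: nat
  assumes "q > 0" "int q dvd k"
  shows "((\<lambda>\<theta>. cis (of_int k * \<theta>)) has_integral (if k = 0 then of_real (2 * pi / q) else 0)) {- pi / q..pi / q}"
proof (cases "k = 0")
  case True
  show ?thesis
    using True assms has_integral_const_real[of "1 :: complex" "- pi / q" "pi / q"]
    by (simp add: scaleR_conv_of_real)
next
  case False
  define c where "c = \<i> * of_int k"
  have c: "c \<noteq> 0" "exp (c * of_real \<theta>) = cis (of_int k * \<theta>)" for \<theta>
    using False by (simp_all add: c_def cis_conv_exp mult_ac)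
  define G where "G \<theta> = cis (of_int k * \<theta>) / c" for \<theta>
  have "((\<lambda>\<theta>. cis (of_int k * \<theta>)) has_integral (G (pi / q) - G (- pi / q))) {- pi / q..pi / q}"
  proof (rule fundamental_theorem_of_calculus)
    fix \<theta> :: real
    have "((\<lambda>\<theta>. exp (c * \<theta>) / c) has_field_derivative exp (c * of_real \<theta>)) (at (of_real \<theta>))"
      using c(1) by (auto intro!: derivative_eq_intros)
    then have "((\<lambda>\<theta>. exp (c * of_real \<theta>) / c) has_vector_derivative exp (c * of_real \<theta>)) (at \<theta> within {- pi / q..pi / q})"
      by (rule has_vector_derivative_real_field)
    then show "(G has_vector_derivative cis (of_int k * \<theta>)) (at \<theta> within {- pi / q..pi / q})"
      by (simp add: G_def[abs_def] c)
  qed (use assms in \<open>auto simp: field_simps\<close>)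
  moreover have "G (pi / q) = G (- pi / q)"
  proof -
    obtain m where m: "k = int q * m" using assms by (auto elim: dvdE)
    have "cis (of_int k * (pi / q)) = cis (of_int k * (- pi / q)) * cis (2 * pi * of_int m)"
      unfolding cis_mult using assms by (intro arg_cong[of _ _ cis]) (simp add: m field_simps)
    then show ?thesis by (simp add: G_def)
  qed
  ultimately show ?thesis using False by simp
qed

text \<open>Cauchy's formula on one sector: all nonzero coefficients lie in the residue class of
  \<open>n\<close> modulo \<open>q\<close>, so the \<open>q\<close> rotated sectors contribute
  equally.\<close>

lemma sector_coeff:
  fixes f :: "complex fps"
  assumes q: "q > 0" and cls: "\<And>j. fps_nth f j \<noteq> 0 \<Longrightarrow> int q dvd int j - int n"
    and r: "0 < r" "ereal r < fps_conv_radius f"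
  shows "((\<lambda>\<theta>. eval_fps f (of_real r * cis \<theta>) * cis (- (n * \<theta>))) has_integral
    of_real (2 * pi / q * r ^ n) * fps_nth f n) {- pi / q..pi / q}"
proof -
  let ?I = "{- pi / q..pi / q}"
  define g where "g j \<theta> = fps_nth f j * of_real (r ^ j) * cis (of_int (int j - int n) * \<theta>)" for j and \<theta> :: real
  have sm: "summable (\<lambda>j. norm (fps_nth f j) * r ^ j)"
    using norm_summable_fps[of "of_real r" f] r by (simp add: norm_mult norm_power)
  have "uniform_limit ?I (\<lambda>N \<theta>. \<Sum>j<N. g j \<theta>) (\<lambda>\<theta>. \<Sum>j. g j \<theta>) sequentially"
    by (rule Weierstrass_m_test[OF _ sm]) (use r in \<open>auto simp: g_def norm_mult norm_power\<close>)
  moreover have "(\<Sum>j. g j \<theta>) = eval_fps f (of_real r * cis \<theta>) * cis (- (n * \<theta>))" for \<theta> :: real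
  proof -
    have "(\<lambda>j. fps_nth f j * (of_real r * cis \<theta>) ^ j * cis (- (n * \<theta>))) sums (eval_fps f (of_real r * cis \<theta>) * cis (- (n * \<theta>)))"
      using r by (intro sums_mult2 sums_eval_fps) (simp add: norm_mult)
    moreover have "fps_nth f j * (of_real r * cis \<theta>) ^ j * cis (- (n * \<theta>)) = g j \<theta>" for j
    proof -
      have "cis (of_int (int j - int n) * \<theta>) = cis \<theta> ^ j * cis (- (n * \<theta>))"
        by (simp add: Complex.DeMoivre cis_mult algebra_simps)
      then show ?thesis by (simp add: g_def power_mult_distrib)
    qed
    ultimately show ?thesis by (simp add: sums_iff)
  qed
  ultimately have ul: "uniform_limit ?I (\<lambda>N \<theta>. \<Sum>j<N. g j \<theta>)
      (\<lambda>\<theta>. eval_fps f (of_real r * cis \<theta>) * cis (- (n * \<theta>))) sequentially" by simp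
  have gi: "(g j has_integral (if j = n then of_real (2 * pi / q * r ^ n) * fps_nth f n else 0)) ?I" for j
  proof (cases "fps_nth f j = 0")
    case True
    then show ?thesis by (auto simp: g_def[abs_def])
  next
    case False
    have "(g j has_integral fps_nth f j * of_real (r ^ j) *
        (if int j - int n = 0 then of_real (2 * pi / q) else 0)) ?I"
      unfolding g_def by (intro has_integral_mult_right has_integral_cis q cls[OF False])
    then show ?thesis by (cases "j = n") (simp_all add: mult_ac)
  qed
  have si: "((\<lambda>\<theta>. \<Sum>j<N. g j \<theta>) has_integral (\<Sum>j<N. if j = n then of_real (2 * pi / q * r ^ n) * fps_nth f n else 0)) ?I" for N
    by (intro has_integral_sum gi) auto
  have cont: "continuous_on ?I (\<lambda>\<theta>. \<Sum>j<N. g j \<theta>)" for N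
    unfolding g_def by (intro continuous_intros)
  obtain I J where IJ: "\<And>N. ((\<lambda>\<theta>. \<Sum>j<N. g j \<theta>) has_integral I N) ?I"
    "((\<lambda>\<theta>. eval_fps f (of_real r * cis \<theta>) * cis (- (n * \<theta>))) has_integral J) ?I" "I \<longlonglongrightarrow> J"
    using uniform_limit_integral[OF ul cont] by auto
  have "I N = of_real (2 * pi / q * r ^ n) * fps_nth f n" if "N > n" for N
    using has_integral_unique[OF IJ(1)[of N] si[of N]] that by simp
  then have "\<forall>\<^sub>F N in sequentially. I N = of_real (2 * pi / q * r ^ n) * fps_nth f n"
    by (rule eventually_mono[OF eventually_gt_at_top[of n]])
  then have "I \<longlonglongrightarrow> of_real (2 * pi / q * r ^ n) * fps_nth f n"
    by (rule tendsto_eventually)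
  then have "J = of_real (2 * pi / q * r ^ n) * fps_nth f n"
    using IJ(3) LIMSEQ_unique by blast
  then show ?thesis using IJ(2) by simp
qed

text \<open>The sine is concave on [0, pi/2] and lies above its chord.\<close>

lemma sin_ge_linear:
  fixes x :: real
  assumes "0 \<le> x" "x \<le> pi / 2"
  shows "2 * x / pi \<le> sin x"
proof -
  have "convex_on {0..pi/2} (\<lambda>x. - sin x)"
  proof (rule f''_ge0_imp_convex)
    fix x :: real assume x: "x \<in> {0..pi/2}"
    show "((\<lambda>x. - sin x) has_real_derivative - cos x) (at x)"
      "((\<lambda>x. - cos x) has_real_derivative sin x) (at x)" by (auto intro!: derivative_eq_intros)
    show "sin x \<ge> 0" using x by (intro sin_ge_zero) auto
  qed auto
  then have "- sin ((1 - 2 * x / pi) * 0 + (2 * x / pi) * (pi / 2)) \<le> (1 - 2 * x / pi) * (- sin 0) + (2 * x / pi) * (- sin (pi / 2))"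
    using assms convex_onD[of "{0..pi/2}" "\<lambda>x. - sin x" "2 * x / pi" 0 "pi / 2"] by (simp add: field_simps)
  then show ?thesis by simp
qed

text \<open>Half-angle formula and the chord bound for the sine; 8 replaces pi^2/2 through pi <
  4.\<close>

lemma cos_le_quadratic:
  fixes \<theta> :: real
  assumes "\<bar>\<theta>\<bar> \<le> pi"
  shows "cos \<theta> \<le> 1 - \<theta>\<^sup>2 / 8"
proof -
  have "2 * (\<bar>\<theta>\<bar> / 2) / pi \<le> sin (\<bar>\<theta>\<bar> / 2)" using assms by (intro sin_ge_linear) auto
  then have s: "\<bar>\<theta>\<bar> / pi \<le> sin (\<bar>\<theta>\<bar> / 2)" by simp
  have "\<bar>\<theta>\<bar> / 4 \<le> \<bar>\<theta>\<bar> / pi" using pi_less_4 by (intro divide_left_mono) auto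
  then have "(\<bar>\<theta>\<bar> / 4)\<^sup>2 \<le> (sin (\<bar>\<theta>\<bar> / 2))\<^sup>2"
    using s by (intro power_mono) linarith+
  moreover have "cos \<theta> = 1 - 2 * (sin (\<bar>\<theta>\<bar> / 2))\<^sup>2"
    using cos_double_sin[of "\<bar>\<theta>\<bar> / 2"] by simp
  ultimately show ?thesis by (simp add: power2_eq_square field_simps)
qed

lemma norm_one_minus_polar_sq:
  "(norm (1 - of_real r * cis \<theta>))\<^sup>2 = (1 - r)\<^sup>2 + 2 * r * (1 - cos \<theta>)"
proof -
  have "(norm (1 - of_real r * cis \<theta>))\<^sup>2 = (1 - r * cos \<theta>)\<^sup>2 + (r * sin \<theta>)\<^sup>2"
    by (simp add: cmod_power2)
  also have "\<dots> = 1 - 2 * r * cos \<theta> + r\<^sup>2 * ((sin \<theta>)\<^sup>2 + (cos \<theta>)\<^sup>2)"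
  proof -
    have "(1 - r * c)\<^sup>2 + (r * s)\<^sup>2 = 1 - 2 * r * c + r\<^sup>2 * (s\<^sup>2 + c\<^sup>2)" for c s
      by (simp add: power2_eq_square algebra_simps)
    then show ?thesis by blast
  qed
  finally show ?thesis by (simp add: power2_eq_square algebra_simps)
qed

lemma norm_one_minus_polar_ge:
  assumes "1 / 2 \<le> r" "r \<le> 1" "\<bar>\<theta>\<bar> \<le> pi"
  shows "((1 - r) + \<bar>\<theta>\<bar>) / 4 \<le> norm (1 - of_real r * cis \<theta>)"
proof (rule power2_le_imp_le)
  have "(((1 - r) + \<bar>\<theta>\<bar>) / 4)\<^sup>2 \<le> 2 * ((1 - r)\<^sup>2 + \<theta>\<^sup>2) / 16"
    using sum_squares_bound[of "1 - r" "\<bar>\<theta>\<bar>"] by (simp add: power2_eq_square field_simps)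
  also have "\<dots> \<le> (1 - r)\<^sup>2 + 1 * (\<theta>\<^sup>2 / 8)" by simp
  also have "\<dots> \<le> (1 - r)\<^sup>2 + 2 * r * (1 - cos \<theta>)"
    using assms cos_le_quadratic[OF assms(3)] by (intro add_left_mono mult_mono) auto
  finally show "(((1 - r) + \<bar>\<theta>\<bar>) / 4)\<^sup>2 \<le> (norm (1 - of_real r * cis \<theta>))\<^sup>2"
    by (simp only: norm_one_minus_polar_sq)
qed simp

lemma has_integral_powr_abs:
  fixes \<delta> s a :: real
  assumes "\<delta> > 0" "s > 1" "a \<ge> 0"
  shows "((\<lambda>\<theta>. (\<delta> + \<bar>\<theta>\<bar>) powr (- s)) has_integral 2 * ((\<delta> powr (1 - s) - (\<delta> + a) powr (1 - s)) / (s - 1))) {- a..a}"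
proof -
  let ?J = "(\<delta> powr (1 - s) - (\<delta> + a) powr (1 - s)) / (s - 1)"
  have 1: "((\<lambda>\<theta>. (\<delta> + \<theta>) powr (- s)) has_integral
      (- ((\<delta> + a) powr (1 - s)) / (s - 1) - (- ((\<delta> + 0) powr (1 - s)) / (s - 1)))) {0..a}"
  proof (rule fundamental_theorem_of_calculus[OF assms(3)])
    fix x assume x: "x \<in> {0..a}"
    have "((\<lambda>x. - ((\<delta> + x) powr (1 - s)) / (s - 1)) has_real_derivative
        - ((1 - s) * (\<delta> + x) powr (1 - s - 1)) / (s - 1)) (at x within {0..a})"
      using x assms by (auto intro!: derivative_eq_intros)
    also have "- ((1 - s) * (\<delta> + x) powr (1 - s - 1)) / (s - 1) = (\<delta> + x) powr (- s)"
    proof -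
      have "- ((1 - s) * X) / (s - 1) = X" for X using assms by (simp add: field_simps)
      moreover have "1 - s - 1 = - s" by simp
      ultimately show ?thesis by (simp only:)
    qed
    finally show "((\<lambda>x. - ((\<delta> + x) powr (1 - s)) / (s - 1)) has_vector_derivative (\<delta> + x) powr (- s)) (at x within {0..a})"
      by (simp only: has_real_derivative_iff_has_vector_derivative)
  qed
  then have right: "((\<lambda>\<theta>. (\<delta> + \<bar>\<theta>\<bar>) powr (- s)) has_integral ?J) {0..a}"
    by (rule has_integral_eq_rhs[OF has_integral_eq, rotated]) (simp_all add: diff_divide_distrib)
  have "((\<lambda>\<theta>. (\<delta> + \<bar>- \<theta>\<bar>) powr (- s)) has_integral ?J) {- a..- 0}"
    by (rule has_integral_reflect_real[THEN iffD2, OF right])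
  then have "((\<lambda>\<theta>. (\<delta> + \<bar>\<theta>\<bar>) powr (- s)) has_integral ?J + ?J) {- a..a}"
    using assms by (intro has_integral_combine[OF _ _ _ right]) auto
  then show ?thesis by simp
qed

text \<open>The losses in the coefficient estimate: e^2 from the radius 1-1/n, 4^s from comparing
  |1-z| with 1/n + |\<theta>|, and q/(pi(s-1)) from the integral over one sector.\<close>

definition coeff_const :: "nat \<Rightarrow> real \<Rightarrow> real" where
  "coeff_const q s = q * exp 2 * 4 powr s / (pi * (s - 1))"

lemma one_minus_inverse_power:
  assumes "n \<ge> 2" shows "(1 - 1 / real n) ^ n \<ge> exp (- 2)"
proof -
  have n: "real n \<ge> 2" using assms by simp
  then have "0 \<le> 1 / real n" "1 / real n \<le> 1 / 2" by (auto simp: field_simps)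
  then have "- (1 / n) - 2 * (1 / n)\<^sup>2 \<le> ln (1 - 1 / n)" by (rule ln_one_minus_pos_lower_bound)
  then have "n * (- (1 / n) - 2 * (1 / n)\<^sup>2) \<le> n * ln (1 - 1 / n)" by (intro mult_left_mono) auto
  moreover have "n * (- (1 / n) - 2 * (1 / n)\<^sup>2) = - 1 - 2 / n"
    using n by (simp add: power2_eq_square field_simps)
  moreover have "2 / real n \<le> 1" using n by (simp add: field_simps)
  ultimately have "- 2 \<le> n * ln (1 - 1 / n)" by linarith
  then have "exp (- 2) \<le> exp (n * ln (1 - 1 / n))" by simp
  also have "\<dots> = (1 - 1 / real n) ^ n" using n by (simp add: exp_of_nat_mult)
  finally show ?thesis .
qed

lemma coeff_upper_aux:
  fixes g :: "real \<Rightarrow> complex" and n q :: nat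
  assumes q: "q > 0" and n: "n \<ge> 2" and s: "s > 1" and C: "C \<ge> 0"
    and I: "(g has_integral J) {- pi / q..pi / q}"
    and bound: "\<And>\<theta>. \<bar>\<theta>\<bar> \<le> pi / q \<Longrightarrow> norm (g \<theta>) \<le> C * norm (1 - of_real (1 - 1 / n) * cis \<theta>) powr (- s)"
  shows "norm J \<le> C * (4 powr s * 2 / (s - 1) * n powr (s - 1))"
proof -
  define \<delta> where "\<delta> = 1 / real n"
  have \<delta>: "\<delta> > 0" "\<delta> \<le> 1 / 2" using n by (auto simp: \<delta>_def field_simps)
  have pq: "pi / q \<le> pi" using q by (simp add: field_simps)
  have int: "((\<lambda>\<theta>. C * (4 powr s * (\<delta> + \<bar>\<theta>\<bar>) powr (- s))) has_integral
      C * (4 powr s * (2 * ((\<delta> powr (1 - s) - (\<delta> + pi / q) powr (1 - s)) / (s - 1))))) {- pi / q..pi / q}"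
    using has_integral_powr_abs[OF \<delta>(1) s, of "pi / q"] by (intro has_integral_mult_right) auto
  have "norm J \<le> C * (4 powr s * (2 * ((\<delta> powr (1 - s) - (\<delta> + pi / q) powr (1 - s)) / (s - 1))))"
  proof (subst integral_unique[OF I, symmetric], subst integral_unique[OF int, symmetric], rule integral_norm_bound_integral)
    fix \<theta> assume "\<theta> \<in> {- pi / q..pi / q}"
    then have th: "\<bar>\<theta>\<bar> \<le> pi / q" by auto
    have "(\<delta> + \<bar>\<theta>\<bar>) / 4 \<le> norm (1 - of_real (1 - \<delta>) * cis \<theta>)"
      using norm_one_minus_polar_ge[of "1 - \<delta>" \<theta>] \<delta> th pq by simp
    then have "norm (1 - of_real (1 - \<delta>) * cis \<theta>) powr (- s) \<le> ((\<delta> + \<bar>\<theta>\<bar>) / 4) powr (- s)"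
      using \<delta> s by (intro powr_mono2') auto
    also have "\<dots> = 4 powr s * (\<delta> + \<bar>\<theta>\<bar>) powr (- s)"
      using \<delta> by (simp add: powr_divide powr_minus field_simps)
    finally show "norm (g \<theta>) \<le> C * (4 powr s * (\<delta> + \<bar>\<theta>\<bar>) powr (- s))"
      using bound[OF th] C unfolding \<delta>_def[symmetric] by (meson mult_left_mono order.trans)
  qed (use I int in auto)
  also have "\<dots> \<le> C * (4 powr s * (2 * (\<delta> powr (1 - s) / (s - 1))))"
    using s C by (intro mult_left_mono divide_right_mono) auto
  also have "\<delta> powr (1 - s) = n powr (s - 1)"
    using n by (simp add: \<delta>_def powr_divide powr_diff)
  finally show ?thesis by (simp add: mult_ac)
qed

text \<open>At radius 1-1/n the factor z^n costs only a constant, while the integral of |1-z|^(-s)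
  with s > 1 is concentrated on angles of order 1/n and has order n^(s-1).\<close>

lemma coeff_upper:
  fixes f :: "complex fps"
  assumes q: "q > 0" and cls: "\<And>j. fps_nth f j \<noteq> 0 \<Longrightarrow> int q dvd int j - int n"
    and rad: "fps_conv_radius f \<ge> 1" and n: "n \<ge> 2" and s: "s > 1" and C: "C \<ge> 0"
    and bound: "\<And>\<theta>. \<bar>\<theta>\<bar> \<le> pi / q \<Longrightarrow>
      norm (eval_fps f (of_real (1 - 1 / n) * cis \<theta>)) \<le> C * norm (1 - of_real (1 - 1 / n) * cis \<theta>) powr (- s)"
  shows "norm (fps_nth f n) \<le> C * coeff_const q s * n powr (s - 1)"
proof -
  define r where "r = 1 - 1 / real n"
  have r: "0 < r" "r < 1" using n by (auto simp: r_def field_simps)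
  then have "ereal r < fps_conv_radius f" using rad by (metis ereal_less(3) less_le_trans)
  then have I: "((\<lambda>\<theta>. eval_fps f (of_real r * cis \<theta>) * cis (- (n * \<theta>))) has_integral
    of_real (2 * pi / q * r ^ n) * fps_nth f n) {- pi / q..pi / q}"
    by (intro sector_coeff q cls r)
  have "norm (complex_of_real (2 * pi / q * r ^ n) * fps_nth f n) \<le> C * (4 powr s * 2 / (s - 1) * n powr (s - 1))"
    using bound by (intro coeff_upper_aux[OF q n s C I]) (auto simp: norm_mult r_def)
  then have "2 * pi / q * r ^ n * norm (fps_nth f n) \<le> C * (4 powr s * 2 / (s - 1) * n powr (s - 1))"
    using r by (simp add: norm_mult norm_power norm_divide)
  moreover have "2 * pi / q * exp (- 2) * norm (fps_nth f n) \<le> 2 * pi / q * r ^ n * norm (fps_nth f n)"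
    using one_minus_inverse_power[OF n] by (intro mult_right_mono mult_left_mono) (auto simp: r_def)
  ultimately have "2 * pi / q * exp (- 2) * norm (fps_nth f n) \<le> C * (4 powr s * 2 / (s - 1) * n powr (s - 1))"
    by linarith
  then show ?thesis using q s unfolding coeff_const_def by (simp add: exp_minus field_simps)
qed

lemma one_plus_powr_le:
  fixes x a :: real
  assumes "0 \<le> x" "0 \<le> a" "a \<le> 1"
  shows "(1 + x) powr a \<le> 1 + a * x"
proof -
  have "1 + a * 0 - (1 + 0) powr a \<le> 1 + a * x - (1 + x) powr a"
  proof (rule DERIV_nonneg_imp_nondecreasing[OF assms(1)])
    fix y assume y: "0 \<le> y" "y \<le> x"
    have "((\<lambda>x. 1 + a * x - (1 + x) powr a) has_real_derivative a - a * (1 + y) powr (a - 1)) (at y)"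
      using y by (auto intro!: derivative_eq_intros)
    moreover have "(1 + y) powr (a - 1) \<le> 1" using powr_mono[of "a - 1" 0 "1 + y"] y assms by simp
    then have "a - a * (1 + y) powr (a - 1) \<ge> 0" using assms mult_left_mono[of "(1 + y) powr (a - 1)" 1 a] by simp
    ultimately show "\<exists>z. ((\<lambda>x. 1 + a * x - (1 + x) powr a) has_real_derivative z) (at y) \<and> 0 \<le> z" by blast
  qed
  then show ?thesis by simp
qed

text \<open>Consecutive values on the right have ratio 1 + (b-1)/(n+1), which for an exponent b-1
  between 0 and 1 dominates (1 + 1/(n+1))^(b-1).\<close>

lemma pochhammer_ge_powr:
  fixes b :: real
  assumes "1 \<le> b" "b \<le> 2"
  shows "real (Suc n) powr (b - 1) \<le> pochhammer b n / fact n"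
proof (induction n)
  case (Suc n)
  have "real (Suc (Suc n)) powr (b - 1) = real (Suc n) powr (b - 1) * (1 + 1 / real (Suc n)) powr (b - 1)"
  proof -
    have "real (Suc (Suc n)) = real (Suc n) * (1 + 1 / real (Suc n))" by (simp add: field_simps)
    then show ?thesis by (simp only: powr_mult)
  qed
  also have "\<dots> \<le> pochhammer b n / fact n * (1 + (b - 1) * (1 / real (Suc n)))"
    using Suc assms by (intro mult_mono one_plus_powr_le) (auto intro!: divide_nonneg_nonneg pochhammer_nonneg)
  also have "\<dots> = pochhammer b (Suc n) / fact (Suc n)"
    by (simp add: pochhammer_Suc field_simps del: of_nat_Suc) (simp add: algebra_simps)
  finally show ?case .
qed simp

definition binomial_fps :: "real \<Rightarrow> complex fps" where
  "binomial_fps b = Abs_fps (\<lambda>n. of_real (pochhammer b n / fact n))"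

lemma binomial_fps_sums:
  assumes "norm z < 1"
  shows "(\<lambda>n. fps_nth (binomial_fps b) n * z ^ n) sums exp (- of_real b * Ln (1 - z))"
proof -
  have "(\<lambda>n. ((- complex_of_real b) gchoose n) * (- z) ^ n) sums (1 + (- z)) powr (- of_real b)"
    using assms by (intro gen_binomial_complex) auto
  moreover have "((- complex_of_real b) gchoose n) * (- z) ^ n = fps_nth (binomial_fps b) n * z ^ n" for n
  proof -
    have "((- complex_of_real b) gchoose n) = (-1) ^ n * of_real (pochhammer b n / fact n)"
      by (simp add: gbinomial_pochhammer pochhammer_of_real)
    moreover have "(- z) ^ n = (-1) ^ n * z ^ n" by (rule power_minus)
    ultimately show ?thesis by (simp add: binomial_fps_def mult_ac flip: power_mult_distrib mult.assoc)
  qed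
  moreover have "1 - z \<noteq> 0" using assms by auto
  ultimately show ?thesis by (simp add: powr_def)
qed

lemma conv_radius_binomial_fps: "fps_conv_radius (binomial_fps b) \<ge> 1"
  unfolding fps_conv_radius_def
proof (rule conv_radius_geI_ex')
  fix r :: real assume r: "0 < r" "ereal r < 1"
  then show "summable (\<lambda>n. fps_nth (binomial_fps b) n * of_real r ^ n)"
    using binomial_fps_sums[of "of_real r" b] by (auto simp: sums_iff)
qed

lemma eval_binomial_fps: "norm z < 1 \<Longrightarrow> eval_fps (binomial_fps b) z = exp (- of_real b * Ln (1 - z))"
  using binomial_fps_sums[of z b] by (simp add: eval_fps_def sums_iff)

text \<open>Comparison with the coefficients of \<open>K (1 - z)\<^sup>-\<^sup>b\<close>: the sector of angle \<open>2\<pi>/q\<close> around \<open>1\<close>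
  contributes one \<open>q\<close>-th of the Cauchy integral, and outside of it \<open>(1 - z)\<^sup>-\<^sup>b\<close> is bounded.\<close>

lemma coeff_lower:
  fixes f :: "complex fps"
  assumes q: "q > 0" and rad: "fps_conv_radius f \<ge> 1"
    and b: "1 < s" "s < b" "b \<le> 2" and K: "K \<noteq> 0" and C: "C \<ge> 0"
    and bound: "\<And>r \<theta>. 0 \<le> r \<Longrightarrow> r < 1 \<Longrightarrow> \<bar>\<theta>\<bar> \<le> pi / q \<Longrightarrow>
      norm (eval_fps f (of_real r * cis \<theta>) - K * exp (- of_real b * Ln (1 - of_real r * cis \<theta>)))
        \<le> C * norm (1 - of_real r * cis \<theta>) powr (- s)"
  shows "\<exists>c>0. \<exists>n0. \<forall>n\<ge>n0. (\<forall>j. fps_nth f j \<noteq> 0 \<longrightarrow> int q dvd int j - int n) \<longrightarrow>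
      norm (fps_nth f n) \<ge> c * real n powr (b - 1)"
proof -
  \<comment> \<open>Outside the sector |1-z| is at least pi/(4q), so \<open>D\<close> bounds the
    model function there.\<close>
  define D where "D = norm K * (pi / (4 * q)) powr (- b)"
  define E where "E = (D + C) * (4 powr b * 2 / (s - 1))"
  \<comment> \<open>\<open>f\<close> is integrated over one sector and the model over the full
    circle; dividing the coefficient of \<open>f\<close> by \<open>q\<close> makes the two
    comparable.\<close>
  have "\<exists>E\<ge>0. \<forall>n\<ge>2. (\<forall>j. fps_nth f j \<noteq> 0 \<longrightarrow> int q dvd int j - int n) \<longrightarrow>
     2 * pi * (1 - 1 / real n) ^ n * norm (fps_nth f n / of_nat q - K * fps_nth (binomial_fps b) n) \<le> E * n powr (s - 1)"
  proof (intro exI[of _ "C * (4 powr s * 2 / (s - 1)) + 2 * pi * D"] conjI allI impI)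
    show "0 \<le> C * (4 powr s * 2 / (s - 1)) + 2 * pi * D" using C b(1) by (auto simp: D_def)
    fix n :: nat assume n: "n \<ge> 2" and cls: "\<forall>j. fps_nth f j \<noteq> 0 \<longrightarrow> int q dvd int j - int n"
    define r where "r = 1 - 1 / real n"
    have r: "0 < r" "r < 1" "1/2 \<le> r" using n by (auto simp: r_def field_simps)
    have rf: "ereal r < fps_conv_radius f" "ereal r < fps_conv_radius (binomial_fps b)"
      using r rad conv_radius_binomial_fps[of b] by (metis ereal_less(3) less_le_trans)+
    define z where "z \<theta> = of_real r * cis \<theta>" for \<theta> :: real
    have z1: "norm (z \<theta>) < 1" for \<theta> using r by (simp add: z_def norm_mult)
    define A where "A \<theta> = K * exp (- of_real b * Ln (1 - z \<theta>)) * cis (- (n * \<theta>))" for \<theta> :: real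
    define e where "e \<theta> = eval_fps f (z \<theta>) * cis (- (n * \<theta>))" for \<theta> :: real
    have If: "(e has_integral of_real (2 * pi / q * r ^ n) * fps_nth f n) {- pi / q..pi / q}"
      unfolding e_def z_def using cls by (intro sector_coeff q r rf) auto
    have "((\<lambda>\<theta>. K * (eval_fps (binomial_fps b) (of_real r * cis \<theta>) * cis (- (n * \<theta>)))) has_integral
      K * (of_real (2 * pi / 1 * r ^ n) * fps_nth (binomial_fps b) n)) {- pi / 1..pi / 1}"
      using sector_coeff[of 1 "binomial_fps b" n r] r rf by (intro has_integral_mult_right) auto
    then have IA: "(A has_integral K * (of_real (2 * pi * r ^ n) * fps_nth (binomial_fps b) n)) {- pi..pi}"
      using eval_binomial_fps[OF z1, of b] by (simp add: A_def[abs_def] z_def mult_ac)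
    have pq: "pi / q \<le> pi" using q by (simp add: field_simps)
    have sub: "{- pi / q..pi / q} \<subseteq> {- pi..pi}" using pq by auto
    have Ie': "((\<lambda>\<theta>. if \<theta> \<in> {- pi / q..pi / q} then e \<theta> else 0) has_integral of_real (2 * pi / q * r ^ n) * fps_nth f n) {- pi..pi}"
      using If by (subst has_integral_restrict[OF sub])
    have total: "((\<lambda>\<theta>. (if \<theta> \<in> {- pi / q..pi / q} then e \<theta> else 0) - A \<theta>) has_integral
      (of_real (2 * pi / q * r ^ n) * fps_nth f n - K * (of_real (2 * pi * r ^ n) * fps_nth (binomial_fps b) n))) {- pi..pi}"
      by (intro has_integral_diff Ie' IA)
    define W where "W \<theta> = C * (4 powr s * (1 / n + \<bar>\<theta>\<bar>) powr (- s)) + D" for \<theta> :: real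
    have "((\<lambda>\<theta>. (1 / n + \<bar>\<theta>\<bar>) powr (- s)) has_integral 2 * (((1 / n) powr (1 - s) - (1 / n + pi) powr (1 - s)) / (s - 1))) {- pi..pi}"
      using n b by (intro has_integral_powr_abs) auto
    then have "(W has_integral C * (4 powr s * (2 * (((1 / n) powr (1 - s) - (1 / n + pi) powr (1 - s)) / (s - 1)))) + 2 * pi * D) {- pi..pi}"
      unfolding W_def using has_integral_const_real[of D "- pi" pi]
      by (intro has_integral_add has_integral_mult_right) (simp_all add: mult_ac)
    note IW = this
    have "norm (of_real (2 * pi / q * r ^ n) * fps_nth f n - K * (of_real (2 * pi * r ^ n) * fps_nth (binomial_fps b) n))
       \<le> C * (4 powr s * (2 * (((1 / n) powr (1 - s) - (1 / n + pi) powr (1 - s)) / (s - 1)))) + 2 * pi * D"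
    proof (subst integral_unique[OF total, symmetric], subst integral_unique[OF IW, symmetric], rule integral_norm_bound_integral)
      fix \<theta> assume th: "\<theta> \<in> {- pi..pi}"
      have low: "(1 / n + \<bar>\<theta>\<bar>) / 4 \<le> norm (1 - z \<theta>)"
        using norm_one_minus_polar_ge[of r \<theta>] r th unfolding z_def by (auto simp: r_def)
      have npos: "1 / n + \<bar>\<theta>\<bar> > 0" using n by (simp add: add_pos_nonneg)
      have D0: "D \<ge> 0" by (simp add: D_def)
      show "norm ((if \<theta> \<in> {- pi / q..pi / q} then e \<theta> else 0) - A \<theta>) \<le> W \<theta>"
      proof (cases "\<theta> \<in> {- pi / q..pi / q}")
        case True
        then have th': "\<bar>\<theta>\<bar> \<le> pi / q" by auto
        have "e \<theta> - A \<theta> = (eval_fps f (z \<theta>) - K * exp (- of_real b * Ln (1 - z \<theta>))) * cis (- (n * \<theta>))"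
          by (simp add: e_def A_def algebra_simps)
        then have "norm (e \<theta> - A \<theta>) \<le> C * norm (1 - z \<theta>) powr (- s)"
          using bound[of r \<theta>] r th' by (simp add: norm_mult z_def)
        also have "norm (1 - z \<theta>) powr (- s) \<le> ((1 / n + \<bar>\<theta>\<bar>) / 4) powr (- s)"
          using low npos b by (intro powr_mono2') auto
        also have "((1 / n + \<bar>\<theta>\<bar>) / 4) powr (- s) = 4 powr s * (1 / n + \<bar>\<theta>\<bar>) powr (- s)"
          using npos by (simp add: powr_divide powr_minus field_simps)
        finally show ?thesis using True D0 C by (simp add: W_def mult_left_mono)
      next
        case False
        then have "pi / q \<le> \<bar>\<theta>\<bar>" by auto
        also have "\<bar>\<theta>\<bar> \<le> 1 / n + \<bar>\<theta>\<bar>" by simp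
        finally have "(pi / q) / 4 \<le> (1 / n + \<bar>\<theta>\<bar>) / 4" by (rule divide_right_mono) simp
        then have "pi / (4 * q) \<le> (1 / n + \<bar>\<theta>\<bar>) / 4" by simp
        then have "pi / (4 * q) \<le> norm (1 - z \<theta>)" using low by linarith
        then have "norm (1 - z \<theta>) powr (- b) \<le> (pi / (4 * q)) powr (- b)"
          using q b by (intro powr_mono2') auto
        then have "norm (A \<theta>) \<le> D"
          unfolding A_def D_def norm_mult norm_exp_Ln_powr[OF z1] by (simp add: mult_left_mono)
        moreover have "C * (4 powr s * (1 / n + \<bar>\<theta>\<bar>) powr (- s)) \<ge> 0" using C by simp
        ultimately show ?thesis unfolding W_def if_not_P[OF False] by simp
      qed
    qed (use total IW in auto)
    also have "\<dots> \<le> C * (4 powr s * (2 * ((1 / n) powr (1 - s) / (s - 1)))) + 2 * pi * D"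
      using b C by (intro add_right_mono mult_left_mono divide_right_mono) auto
    also have "(1 / n) powr (1 - s) = n powr (s - 1)"
      using n by (simp add: powr_divide powr_diff)
    also have "C * (4 powr s * (2 * (n powr (s - 1) / (s - 1)))) + 2 * pi * D \<le>
        (C * (4 powr s * 2 / (s - 1)) + 2 * pi * D) * n powr (s - 1)"
    proof -
      have "1 \<le> n powr (s - 1)" using n b by (intro ge_one_powr_ge_zero) auto
      then have "2 * pi * D * 1 \<le> 2 * pi * D * n powr (s - 1)" by (intro mult_left_mono) (auto simp: D_def)
      then show ?thesis by (simp add: algebra_simps)
    qed
    also have "of_real (2 * pi / q * r ^ n) * fps_nth f n - K * (of_real (2 * pi * r ^ n) * fps_nth (binomial_fps b) n)
      = of_real (2 * pi * r ^ n) * (fps_nth f n / of_nat q - K * fps_nth (binomial_fps b) n)"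
      by (simp add: algebra_simps)
    finally show "2 * pi * (1 - 1 / real n) ^ n * norm (fps_nth f n / of_nat q - K * fps_nth (binomial_fps b) n) \<le>
      (C * (4 powr s * 2 / (s - 1)) + 2 * pi * D) * n powr (s - 1)"
      using r by (simp only: norm_mult norm_of_real) (simp add: r_def[symmetric])
  qed
  then obtain E where E: "E \<ge> 0" "\<And>n. n \<ge> 2 \<Longrightarrow> (\<And>j. fps_nth f j \<noteq> 0 \<Longrightarrow> int q dvd int j - int n) \<Longrightarrow>
     2 * pi * (1 - 1 / real n) ^ n * norm (fps_nth f n / of_nat q - K * fps_nth (binomial_fps b) n) \<le> E * n powr (s - 1)"
    by blast
  define E' where "E' = E * exp 2 / (2 * pi)"
  \<comment> \<open>The error n^(s-1) is of smaller order than n^(b-1); beyond \<open>n0\<close> it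
    uses up at most half of the main term.\<close>
  have "(\<lambda>n. real n powr (s - b)) \<longlonglongrightarrow> 0"
    using b by (intro tendsto_neg_powr filterlim_real_sequentially) auto
  then have "(\<lambda>n. E' * real n powr (s - b)) \<longlonglongrightarrow> E' * 0" by (intro tendsto_mult tendsto_const)
  then have "\<forall>\<^sub>F n in sequentially. E' * real n powr (s - b) < norm K / 2"
    using K by (intro order_tendstoD(2)) auto
  then obtain n0 where n0: "\<And>n. n \<ge> n0 \<Longrightarrow> E' * real n powr (s - b) < norm K / 2"
    by (auto simp: eventually_sequentially)
  show ?thesis
  proof (intro exI[of _ "norm K / 2 * q"] conjI exI[of _ "max n0 2"] allI impI)
    show "norm K / 2 * q > 0" using K q by simp
    fix n assume n: "n \<ge> max n0 2" and cls: "\<forall>j. fps_nth f j \<noteq> 0 \<longrightarrow> int q dvd int j - int n"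
    let ?x = "norm (fps_nth f n / of_nat q - K * fps_nth (binomial_fps b) n)"
    have "2 * pi * exp (- 2) * ?x \<le> 2 * pi * (1 - 1 / real n) ^ n * ?x"
      using one_minus_inverse_power[of n] n by (intro mult_right_mono mult_left_mono) auto
    also have "\<dots> \<le> E * n powr (s - 1)" using E(2)[of n] n cls by auto
    finally have "?x \<le> E' * n powr (s - 1)" by (simp add: E'_def exp_minus field_simps)
    also have "\<dots> = E' * n powr (s - b) * n powr (b - 1)" using n by (simp flip: powr_add)
    also have "\<dots> \<le> norm K / 2 * n powr (b - 1)" using n0[of n] n by (intro mult_right_mono) auto
    finally have x: "?x \<le> norm K / 2 * n powr (b - 1)" .
    have "norm K * n powr (b - 1) \<le> norm K * (pochhammer b n / fact n)"
      using pochhammer_ge_powr[of b n] b powr_mono2[of "b - 1" "real n" "real (Suc n)"] by (intro mult_left_mono) auto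
    also have "\<dots> = norm (K * fps_nth (binomial_fps b) n)"
      using b by (simp add: norm_mult binomial_fps_def pochhammer_nonneg norm_divide)
    also have "\<dots> \<le> norm (fps_nth f n / of_nat q) + ?x"
      using norm_triangle_ineq4[of "fps_nth f n / of_nat q" "fps_nth f n / of_nat q - K * fps_nth (binomial_fps b) n"] by simp
    finally have "norm K / 2 * n powr (b - 1) \<le> norm (fps_nth f n / of_nat q)" using x by simp
    then show "norm K / 2 * q * real n powr (b - 1) \<le> norm (fps_nth f n)"
      using q by (simp add: norm_divide field_simps)
  qed
qed

lemma int_dvd_add_cancel:
  fixes a b c e :: int
  assumes "q dvd a - c" "q dvd b - e"
  shows "q dvd (a + b) - (c + e)"
  using dvd_add[OF assms] by (simp add: algebra_simps)

lemma holomorphic_on_disk_if_deriv: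
  assumes "\<And>z. norm z < 1 \<Longrightarrow> (f has_field_derivative f' z) (at z)"
  shows "f holomorphic_on ball 0 1"
  unfolding holomorphic_on_def field_differentiable_def
proof
  fix z :: complex assume "z \<in> ball 0 1"
  then have "(f has_field_derivative f' z) (at z)" by (intro assms) simp
  then show "\<exists>f'. (f has_field_derivative f') (at z within ball 0 1)"
    using has_field_derivative_at_within by blast
qed

section \<open>Growth of the coefficients of \<tau> and \<phi>'(\<tau>) along residue
  classes\<close>

context inc_series
begin

text \<open>The cutoff \<open>n\<close> lets it be used inside the strong induction for
  \<open>p_class\<close>, where the class is known only for smaller indices.\<close>

lemma power_class_upto:
  assumes "\<And>i. i \<le> n \<Longrightarrow> p i \<noteq> 0 \<Longrightarrow> int per dvd int i - 1"
  shows "m \<le> n \<Longrightarrow> fps_nth (Abs_fps p ^ j) m \<noteq> 0 \<Longrightarrow> int per dvd int m - int j"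
proof (induction j arbitrary: m)
  case 0
  then show ?case by (cases m) auto
next
  case (Suc j)
  then obtain i where i: "i \<le> m" "p i \<noteq> 0" "fps_nth (Abs_fps p ^ j) (m - i) \<noteq> 0"
    by (auto simp: fps_mult_nth elim!: sum.not_neutral_contains_not_neutral)
  have "int per dvd int i - 1" using i Suc.prems by (intro assms) auto
  moreover have "int per dvd int (m - i) - int j" using i Suc.prems by (intro Suc.IH) auto
  ultimately have "int per dvd (int i + int (m - i)) - (1 + int j)" by (rule int_dvd_add_cancel)
  then show ?case using i by (simp add: of_nat_diff)
qed

lemma p_class: "p n \<noteq> 0 \<Longrightarrow> int per dvd int n - 1"
proof (induction n rule: less_induct)
  case (less n)
  then obtain m where m: "n = Suc m" using p_0 by (cases n) auto
  have "fps_nth (poly_fps \<phi> (Abs_fps p)) m \<noteq> 0" using p_rec[of m] less.prems m by auto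
  then obtain j where j: "coeff \<phi> j \<noteq> 0" "fps_nth (Abs_fps p ^ j) m \<noteq> 0"
    by (auto simp: poly_fps_def fps_sum_nth elim!: sum.not_neutral_contains_not_neutral)
  have "int per dvd int m - int j"
    by (rule power_class_upto[OF _ _ j(2), of m]) (use less m in auto)
  moreover have "int per dvd int j" using per_dvd[OF j(1)] by simp
  ultimately have "int per dvd (int m - int j) + int j" by (rule dvd_add)
  then have "int per dvd int m" by simp
  then show ?case by (simp add: m)
qed

lemma poly_class:
  assumes "\<And>j. coeff P j \<noteq> 0 \<Longrightarrow> int per dvd int j - e" "fps_nth (poly_fps P T) n \<noteq> 0"
  shows "int per dvd int n - e"
proof -
  have "fps_nth (poly_fps P (Abs_fps p)) n \<noteq> 0"
    using assms(2) unfolding T_def fps_nth_poly_fps_of_real by simp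
  then obtain j where j: "coeff P j \<noteq> 0" "fps_nth (Abs_fps p ^ j) n \<noteq> 0"
    by (auto simp: poly_fps_def fps_sum_nth elim!: sum.not_neutral_contains_not_neutral)
  have "int per dvd int n - int j"
    by (rule power_class_upto[OF _ _ j(2), of n]) (use p_class in auto)
  then have "int per dvd (int n - int j) + (int j - e)" using assms(1)[OF j(1)] by (rule dvd_add)
  then show ?thesis by simp
qed

lemma class_diff: "int per dvd int i - e \<Longrightarrow> int per dvd int j - e \<Longrightarrow> int per dvd int i - int j"
  using dvd_diff[of "int per" "int i - e" "int j - e"] by simp

lemma sectorI: "0 \<le> r \<Longrightarrow> r < 1 \<Longrightarrow> \<bar>\<theta>\<bar> \<le> pi / per \<Longrightarrow> of_real r * cis \<theta> \<in> sector"
  by (auto simp: sector_def)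

lemma \<phi>_class: "coeff \<phi> j \<noteq> 0 \<Longrightarrow> int per dvd int j - 0"
  using per_dvd by simp

lemma \<phi>'_class: "coeff (pderiv \<phi>) j \<noteq> 0 \<Longrightarrow> int per dvd int j - (- 1)"
proof -
  assume "coeff (pderiv \<phi>) j \<noteq> 0"
  then have "coeff \<phi> (Suc j) \<noteq> 0" by (auto simp: coeff_pderiv)
  then show ?thesis using \<phi>_class[of "Suc j"] by (simp add: algebra_simps)
qed

lemma \<phi>''\<phi>_class:
  assumes "coeff (pderiv (pderiv \<phi>) * \<phi>) j \<noteq> 0" shows "int per dvd int j - (- 2)"
proof -
  obtain i where i: "i \<le> j" "coeff (pderiv (pderiv \<phi>)) i \<noteq> 0" "coeff \<phi> (j - i) \<noteq> 0"
    using assms by (auto simp: coeff_mult elim!: sum.not_neutral_contains_not_neutral)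
  have "int per dvd int (Suc (Suc i)) - 0" using i by (intro \<phi>_class) (auto simp: coeff_pderiv)
  then have "int per dvd (int (Suc (Suc i)) + int (j - i)) - (0 + 0)"
    using \<phi>_class[OF i(3)] by (rule int_dvd_add_cancel)
  then show ?thesis using i by (simp add: of_nat_diff algebra_simps)
qed

text \<open>The bound on L makes \<phi>(\<tau>) = O(|1-z|^(-\<open>\<sigma>2\<close>)) in the
  sector, and (n+1) p_(n+1) is a coefficient of \<phi>(\<tau>). The coefficient estimate starts at
  index 2, so n = 1 and n = 2 go into the constant.\<close>

lemma p_upper: "\<exists>C>0. \<forall>n\<ge>1. p n \<le> C * n powr (\<alpha> - 1)"
proof -
  obtain C where C: "C \<ge> 0" "\<And>z. z \<in> sector \<Longrightarrow> norm (L z + of_real (\<sigma>2 * ln (norm (1 - z)))) \<le> C"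
    using L_sector by blast
  have s: "\<sigma>2 > 1" using \<alpha>_pos by (simp add: \<sigma>2_def)
  define C' where "C' = exp C * coeff_const per \<sigma>2"
  have C': "C' \<ge> 0" using s by (simp add: C'_def coeff_const_def)
  have R: "norm (cpoly \<phi> (\<tau> z)) \<le> exp C * norm (1 - z) powr (- \<sigma>2)" if z: "z \<in> sector" for z
  proof -
    have n1: "norm (1 - z) > 0" using norm_one_minus_pos[OF sector_norm[OF z]] .
    have "Re (L z) + \<sigma>2 * ln (norm (1 - z)) \<le> C"
      using C(2)[OF z] complex_Re_le_cmod[of "L z + of_real (\<sigma>2 * ln (norm (1 - z)))"] by simp
    then have "exp (Re (L z)) \<le> exp (C + (- \<sigma>2) * ln (norm (1 - z)))" by simp
    also have "\<dots> = exp C * norm (1 - z) powr (- \<sigma>2)" unfolding exp_add powr_def using n1 by simp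
    finally show ?thesis using exp_L[OF sector_norm[OF z]] by (metis norm_exp_eq_Re)
  qed
  have main: "norm (fps_nth (poly_fps \<phi> T) n) \<le> C' * n powr \<alpha>" if n: "n \<ge> 2" for n
  proof (cases "fps_nth (poly_fps \<phi> T) n = 0")
    case False
    have "norm (fps_nth (poly_fps \<phi> T) n) \<le> exp C * coeff_const per \<sigma>2 * n powr (\<sigma>2 - 1)"
    proof (rule coeff_upper[OF per_pos _ conv_radius_poly_T n s])
      show "int per dvd int j - int n" if "fps_nth (poly_fps \<phi> T) j \<noteq> 0" for j
        using poly_class[OF \<phi>_class that] poly_class[OF \<phi>_class False] by (rule class_diff)
      fix \<theta> :: real assume th: "\<bar>\<theta>\<bar> \<le> pi / per"
      have z: "of_real (1 - 1 / n) * cis \<theta> \<in> sector" using n th by (intro sectorI) auto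
      show "norm (eval_fps (poly_fps \<phi> T) (of_real (1 - 1 / n) * cis \<theta>))
          \<le> exp C * norm (1 - of_real (1 - 1 / n) * cis \<theta>) powr (- \<sigma>2)"
        unfolding eval_poly_T[OF sector_norm[OF z]] by (rule R[OF z])
    qed simp
    then show ?thesis by (simp add: C'_def \<sigma>2_def)
  qed (use C' in simp)
  show ?thesis
  proof (intro exI[of _ "C' + 1 + p 1 + 2 * p 2"] conjI allI impI)
    show "C' + 1 + p 1 + 2 * p 2 > 0" using C' p_nonneg[of 1] p_nonneg[of 2] by linarith
    fix n :: nat assume n: "n \<ge> 1"
    consider "n = 1" | "n = 2" | "n \<ge> 3" using n by linarith
    then show "p n \<le> (C' + 1 + p 1 + 2 * p 2) * n powr (\<alpha> - 1)"
    proof cases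
      case 1
      then show ?thesis using C' p_nonneg[of 2] by simp
    next
      case 2
      have "2 powr (- 1) \<le> 2 powr (\<alpha> - 1)" using \<alpha>_pos by (intro powr_mono) auto
      then have "1 / 2 \<le> 2 powr (\<alpha> - 1)" by (simp add: powr_minus)
      then have "2 * p 2 * (1 / 2) \<le> (C' + 1 + p 1 + 2 * p 2) * 2 powr (\<alpha> - 1)"
        using C' p_nonneg[of 1] p_nonneg[of 2] by (intro mult_mono) auto
      then show ?thesis using 2 by simp
    next
      case 3
      then obtain m where m: "n = Suc m" "m \<ge> 2" by (cases n) auto
      have "fps_nth (poly_fps \<phi> T) m = of_real (real n * p n)"
        unfolding m T_def fps_nth_poly_fps_of_real p_rec ..
      then have "real n * p n \<le> C' * m powr \<alpha>" using main[OF m(2)] p_nonneg[of n] by (simp add: norm_mult)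
      also have "\<dots> \<le> C' * n powr \<alpha>" using C' \<alpha>_pos m by (intro mult_left_mono powr_mono2) auto
      also have "n powr \<alpha> = n * n powr (\<alpha> - 1)" using n by (simp add: powr_diff)
      finally have "real n * p n \<le> real n * (C' * n powr (\<alpha> - 1))" by (simp add: mult_ac)
      then have "p n \<le> C' * n powr (\<alpha> - 1)" using n by simp
      also have "\<dots> \<le> (C' + 1 + p 1 + 2 * p 2) * n powr (\<alpha> - 1)"
        using p_nonneg[of 1] p_nonneg[of 2] by (intro mult_right_mono) auto
      finally show ?thesis .
    qed
  qed
qed

text \<open>Moves error exponents strictly between 1 and the main exponent, as the coefficient
  comparison demands; on |1-z| \<le> 2 this costs a factor 2.\<close>

lemma powr_exponent_le:
  fixes x :: real
  assumes "0 < x" "x \<le> 2" "s \<le> s'" "s' \<le> s + 1"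
  shows "x powr (- s) \<le> 2 * x powr (- s')"
proof -
  have "x powr (- s) = x powr (s' - s) * x powr (- s')" by (subst powr_add[symmetric]) simp
  also have "x powr (s' - s) \<le> 2 powr (s' - s)" using assms by (intro powr_mono2) auto
  also have "2 powr (s' - s) \<le> (2 :: real) powr 1" using assms by (intro powr_mono) auto
  finally show ?thesis by (simp add: mult_right_mono)
qed

lemma norm_one_minus_le_2: "norm z < 1 \<Longrightarrow> norm (1 - z) \<le> 2" for z :: complex
  using norm_triangle_ineq4[of 1 z] by simp

lemma p_lower: "\<exists>c>0. \<exists>n0. \<forall>n\<ge>n0. int per dvd int n - 1 \<longrightarrow> p n \<ge> c * n powr (\<alpha> - 1)"
proof -
  obtain K C where KC: "K \<noteq> 0" "C \<ge> 0" "\<And>z. z \<in> sector \<Longrightarrow>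
     norm (cpoly \<phi> (\<tau> z) - K * exp (- of_real \<sigma>2 * Ln (1 - z))) \<le> C * norm (1 - z) powr (- 1)"
    using R_sector by blast
  have "\<exists>c>0. \<exists>n0. \<forall>n\<ge>n0. (\<forall>j. fps_nth (poly_fps \<phi> T) j \<noteq> 0 \<longrightarrow> int per dvd int j - int n) \<longrightarrow>
      norm (fps_nth (poly_fps \<phi> T) n) \<ge> c * real n powr (\<sigma>2 - 1)"
  proof (rule coeff_lower[OF per_pos conv_radius_poly_T _ _ _ KC(1), of "1 + \<alpha> / 2" \<sigma>2 "2 * C"])
    fix r \<theta> :: real assume a: "0 \<le> r" "r < 1" "\<bar>\<theta>\<bar> \<le> pi / per"
    define z where "z = of_real r * cis \<theta>"
    have z: "z \<in> sector" unfolding z_def using a by (rule sectorI)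
    have z1: "norm z < 1" using sector_norm[OF z] .
    have "norm (cpoly \<phi> (\<tau> z) - K * exp (- of_real \<sigma>2 * Ln (1 - z))) \<le> C * norm (1 - z) powr (- 1)"
      by (rule KC(3)[OF z])
    also have "\<dots> \<le> C * (2 * norm (1 - z) powr (- (1 + \<alpha> / 2)))"
      using norm_one_minus_pos[OF z1] norm_one_minus_le_2[OF z1] \<alpha>_pos \<alpha>_le_1 KC(2)
      by (intro mult_left_mono powr_exponent_le) auto
    finally show "norm (eval_fps (poly_fps \<phi> T) (of_real r * cis \<theta>) -
        K * exp (- of_real \<sigma>2 * Ln (1 - of_real r * cis \<theta>))) \<le>
        2 * C * norm (1 - of_real r * cis \<theta>) powr (- (1 + \<alpha> / 2))"
      unfolding z_def[symmetric] eval_poly_T[OF z1] by simp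
  qed (use \<alpha>_pos \<alpha>_le_1 KC(2) in \<open>auto simp: \<sigma>2_def\<close>)
  then obtain c n0 where c: "c > 0" "\<And>n. n \<ge> n0 \<Longrightarrow> (\<And>j. fps_nth (poly_fps \<phi> T) j \<noteq> 0 \<Longrightarrow> int per dvd int j - int n) \<Longrightarrow>
      norm (fps_nth (poly_fps \<phi> T) n) \<ge> c * real n powr \<alpha>" by (auto simp: \<sigma>2_def)
  show ?thesis
  proof (intro exI[of _ "c / 2"] exI[of _ "Suc (max n0 1)"] conjI allI impI)
    show "c / 2 > 0" using c by simp
    fix n assume n: "n \<ge> Suc (max n0 1)" and cls: "int per dvd int n - 1"
    obtain m where m: "n = Suc m" "m \<ge> n0" "m \<ge> 1" using n by (cases n) auto
    have "norm (fps_nth (poly_fps \<phi> T) m) \<ge> c * real m powr \<alpha>"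
    proof (rule c(2)[OF m(2)])
      fix j assume nz: "fps_nth (poly_fps \<phi> T) j \<noteq> 0"
      have "int per dvd int j - 0" by (rule poly_class[OF \<phi>_class nz])
      moreover have "int per dvd int m - 0" using cls m by simp
      ultimately show "int per dvd int j - int m" by (rule class_diff)
    qed
    moreover have "fps_nth (poly_fps \<phi> T) m = of_real (real n * p n)"
      unfolding m T_def fps_nth_poly_fps_of_real p_rec ..
    ultimately have "c * real m powr \<alpha> \<le> real n * p n" using p_nonneg[of n] by (simp add: norm_mult)
    moreover have "(real n / 2) powr \<alpha> \<le> real m powr \<alpha>" using m \<alpha>_pos by (intro powr_mono2) auto
    moreover have "real n powr \<alpha> / 2 \<le> (real n / 2) powr \<alpha>"
    proof -
      have "2 powr \<alpha> \<le> (2 :: real) powr 1" using \<alpha>_le_1 by (intro powr_mono) auto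
      then have "real n powr \<alpha> / 2 \<le> real n powr \<alpha> / 2 powr \<alpha>" by (intro divide_left_mono) auto
      then show ?thesis by (simp add: powr_divide)
    qed
    ultimately have "c * (real n powr \<alpha> / 2) \<le> real n * p n"
      using c(1) by (meson mult_le_cancel_left_pos order.trans)
    also have "real n powr \<alpha> = n * n powr (\<alpha> - 1)" using m by (simp add: powr_diff)
    finally have "real n * (c / 2 * n powr (\<alpha> - 1)) \<le> real n * p n" by (simp add: mult_ac)
    then show "c / 2 * n powr (\<alpha> - 1) \<le> p n" using m by simp
  qed
qed

text \<open>Only finitely many sizes lie below the range of the asymptotic bound; the minimum of
  their positive quotients and of \<open>c\<close> serves all.\<close>

lemma p_lower_pos: "\<exists>c>0. \<forall>n. p n > 0 \<longrightarrow> p n \<ge> c * n powr (\<alpha> - 1)"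
proof -
  obtain c n0 where c: "c > 0" "\<And>n. n \<ge> n0 \<Longrightarrow> int per dvd int n - 1 \<Longrightarrow> p n \<ge> c * n powr (\<alpha> - 1)"
    using p_lower by blast
  define A where "A = insert c ((\<lambda>n. p n / n powr (\<alpha> - 1)) ` {n. n < n0 \<and> p n > 0})"
  have A: "finite A" "A \<noteq> {}" by (auto simp: A_def)
  have pos: "x > 0" if "x \<in> A" for x
  proof (cases "x = c")
    case False
    then obtain n where n: "x = p n / n powr (\<alpha> - 1)" "p n > 0" using \<open>x \<in> A\<close> by (auto simp: A_def)
    then have "n \<noteq> 0" using p_0 by (metis less_irrefl)
    then show ?thesis using n by simp
  qed (use c in simp)
  show ?thesis
  proof (intro exI[of _ "Min A"] conjI allI impI)
    show "Min A > 0" using A pos by (subst Min_gr_iff) auto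
    fix n assume n: "p n > 0"
    then have n1: "n \<ge> 1" using p_0 by (cases n) auto
    show "Min A * n powr (\<alpha> - 1) \<le> p n"
    proof (cases "n < n0")
      case True
      then have "Min A \<le> p n / n powr (\<alpha> - 1)" using A n by (intro Min_le) (auto simp: A_def)
      then show ?thesis using n1 by (simp add: field_simps)
    next
      case False
      have "Min A * n powr (\<alpha> - 1) \<le> c * n powr (\<alpha> - 1)"
        using A by (intro mult_right_mono Min_le) (auto simp: A_def)
      also have "\<dots> \<le> p n" using False n p_class[of n] by (intro c) auto
      finally show ?thesis .
    qed
  qed
qed

lemma deriv_poly_T: "fps_deriv (poly_fps (pderiv \<phi>) T) = poly_fps (pderiv (pderiv \<phi>) * \<phi>) T"
proof (rule eval_fps_eqD)
  have r: "0 < fps_conv_radius (poly_fps P T)" for P using less_conv_radius[OF _ conv_radius_poly_T, of 0] by (simp add: zero_ereal_def)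
  then show "0 < fps_conv_radius (fps_deriv (poly_fps (pderiv \<phi>) T))"
    using fps_conv_radius_deriv[of "poly_fps (pderiv \<phi>) T"] less_le_trans by blast
  show "0 < fps_conv_radius (poly_fps (pderiv (pderiv \<phi>) * \<phi>) T)" by (rule r)
  have "eval_fps (fps_deriv (poly_fps (pderiv \<phi>) T)) z = eval_fps (poly_fps (pderiv (pderiv \<phi>) * \<phi>) T) z"
    if z: "z \<in> ball 0 1" for z
  proof -
    have z1: "norm z < 1" using z by simp
    have "(eval_fps (poly_fps (pderiv \<phi>) T) has_field_derivative eval_fps (fps_deriv (poly_fps (pderiv \<phi>) T)) z) (at z)"
      by (intro has_field_derivative_eval_fps less_conv_radius z1 conv_radius_poly_T)
    moreover have "((\<lambda>z. cpoly (pderiv \<phi>) (\<tau> z)) has_field_derivative cpoly (pderiv (pderiv \<phi>)) (\<tau> z) * cpoly \<phi> (\<tau> z)) (at z)"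
      by (intro derivative_intros z1)
    then have "(eval_fps (poly_fps (pderiv \<phi>) T) has_field_derivative cpoly (pderiv (pderiv \<phi>)) (\<tau> z) * cpoly \<phi> (\<tau> z)) (at z)"
    proof (rule has_field_derivative_transform_within_open[OF _ open_ball z])
      fix w assume "w \<in> ball (0 :: complex) 1"
      then show "cpoly (pderiv \<phi>) (\<tau> w) = eval_fps (poly_fps (pderiv \<phi>) T) w" by (simp add: eval_poly_T)
    qed
    ultimately have "eval_fps (fps_deriv (poly_fps (pderiv \<phi>) T)) z = cpoly (pderiv (pderiv \<phi>)) (\<tau> z) * cpoly \<phi> (\<tau> z)"
      by (rule DERIV_unique)
    then show ?thesis by (simp add: eval_poly_T[OF z1] cpoly_mult)
  qed
  then show "\<forall>\<^sub>F z in nhds 0. eval_fps (fps_deriv (poly_fps (pderiv \<phi>) T)) z = eval_fps (poly_fps (pderiv (pderiv \<phi>) * \<phi>) T) z"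
    by (intro eventually_nhds[THEN iffD2] exI[of _ "ball 0 1"]) auto
qed

text \<open>Coefficients of \<phi>'(\<tau>), the kernel through which every moment recursion
  acts.\<close>

definition c :: "nat \<Rightarrow> real" where "c k = fps_nth (poly_fps (pderiv \<phi>) (Abs_fps p)) k"

lemma c_nonneg: "c k \<ge> 0"
  unfolding c_def poly_fps_def fps_sum_nth
  using coeff_nonneg fps_nth_power_T_nonneg by (auto intro!: sum_nonneg mult_nonneg_nonneg simp: coeff_pderiv)

text \<open>The main term \<open>\<sigma>2\<close>/(1-z) of \<phi>'(\<tau>) has exponent 1, too
  small for the coefficient comparison. Its derivative \<phi>''(\<tau>)\<phi>(\<tau>), with main
  term \<open>\<sigma>2\<close>/(1-z)^2, is treated instead, and its coefficients are k c_k.\<close>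

lemma c_lower: "\<exists>c0>0. \<exists>k0. \<forall>k\<ge>k0. int per dvd int k + 1 \<longrightarrow> c k \<ge> c0"
proof -
  obtain C where C: "C \<ge> 0" "\<And>z. z \<in> sector \<Longrightarrow>
    norm (cpoly (pderiv (pderiv \<phi>) * \<phi>) (\<tau> z) - of_real \<sigma>2 / (1 - z)\<^sup>2) \<le> C * norm (1 - z) powr (- (2 - \<alpha>))"
    using Q'_sector by blast
  let ?f = "poly_fps (pderiv (pderiv \<phi>) * \<phi>) T"
  have s2: "complex_of_real \<sigma>2 \<noteq> 0" using \<alpha>_pos by (simp only: of_real_eq_0_iff) (simp add: \<sigma>2_def)
  have "\<exists>c>0. \<exists>n0. \<forall>n\<ge>n0. (\<forall>j. fps_nth ?f j \<noteq> 0 \<longrightarrow> int per dvd int j - int n) \<longrightarrow>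
      norm (fps_nth ?f n) \<ge> c * real n powr (2 - 1)"
  proof (rule coeff_lower[OF per_pos conv_radius_poly_T _ _ _ s2, of "2 - \<alpha> / 2" 2 "2 * C"])
    fix r \<theta> :: real assume a: "0 \<le> r" "r < 1" "\<bar>\<theta>\<bar> \<le> pi / per"
    define z where "z = of_real r * cis \<theta>"
    have z: "z \<in> sector" unfolding z_def using a by (rule sectorI)
    have z1: "norm z < 1" using sector_norm[OF z] .
    have nz: "1 - z \<noteq> 0" using norm_one_minus_pos[OF z1] by auto
    have e: "exp (- of_real 2 * Ln (1 - z)) = 1 / (1 - z)\<^sup>2"
    proof -
      have "exp (- of_real 2 * Ln (1 - z)) = exp (- (Ln (1 - z) + Ln (1 - z)))" by simp
      also have "\<dots> = 1 / (1 - z)\<^sup>2" unfolding exp_minus exp_add using nz by (simp add: power2_eq_square field_simps)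
      finally show ?thesis .
    qed
    have "norm (cpoly (pderiv (pderiv \<phi>) * \<phi>) (\<tau> z) - of_real \<sigma>2 / (1 - z)\<^sup>2) \<le> C * norm (1 - z) powr (- (2 - \<alpha>))"
      by (rule C(2)[OF z])
    also have "\<dots> \<le> C * (2 * norm (1 - z) powr (- (2 - \<alpha> / 2)))"
      using norm_one_minus_pos[OF z1] norm_one_minus_le_2[OF z1] \<alpha>_pos \<alpha>_le_1 C(1)
      by (intro mult_left_mono powr_exponent_le) auto
    finally show "norm (eval_fps ?f (of_real r * cis \<theta>) -
        of_real \<sigma>2 * exp (- of_real 2 * Ln (1 - of_real r * cis \<theta>))) \<le>
        2 * C * norm (1 - of_real r * cis \<theta>) powr (- (2 - \<alpha> / 2))"
      unfolding z_def[symmetric] eval_poly_T[OF z1] e by simp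
  qed (use \<alpha>_pos \<alpha>_le_1 C(1) in auto)
  then obtain c0 n0 where c0: "c0 > 0" "\<And>n. n \<ge> n0 \<Longrightarrow> (\<And>j. fps_nth ?f j \<noteq> 0 \<Longrightarrow> int per dvd int j - int n) \<Longrightarrow>
      norm (fps_nth ?f n) \<ge> c0 * real n powr 1" by auto
  show ?thesis
  proof (intro exI[of _ "c0 / 2"] exI[of _ "Suc (max n0 1)"] conjI allI impI)
    show "c0 / 2 > 0" using c0 by simp
    fix k assume k: "k \<ge> Suc (max n0 1)" and cls: "int per dvd int k + 1"
    obtain m where m: "k = Suc m" "m \<ge> n0" "m \<ge> 1" using k by (cases k) auto
    have "norm (fps_nth ?f m) \<ge> c0 * real m powr 1"
    proof (rule c0(2)[OF m(2)])
      fix j assume nz: "fps_nth ?f j \<noteq> 0"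
      have "int per dvd int j - (- 2)" by (rule poly_class[OF \<phi>''\<phi>_class nz])
      moreover have "int per dvd int m - (- 2)" using cls m by (simp add: algebra_simps)
      ultimately show "int per dvd int j - int m" by (rule class_diff)
    qed
    moreover have "fps_nth ?f m = of_nat (Suc m) * of_real (c (Suc m))"
      unfolding deriv_poly_T[symmetric] unfolding c_def T_def by (simp only: fps_deriv_nth fps_nth_poly_fps_of_real Suc_eq_plus1)
    ultimately have "c0 * real m \<le> real k * c k"
      using c_nonneg[of k] m by (simp add: norm_mult del: of_nat_Suc)
    moreover have "c0 * (real k / 2) \<le> c0 * real m" using m c0 by (intro mult_left_mono) auto
    ultimately have "real k * (c0 / 2) \<le> real k * c k" by (simp add: mult.commute[of c0])
    then show "c0 / 2 \<le> c k" using m by simp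
  qed
qed

text \<open>The equation N' = \<phi>(\<tau>) + u \<phi>'(\<tau>) N with N(0) = 0 is solved by exp(u
  L(z)) times the integral of exp((1-u) L) from 0 to z; this bounds the integrand at w = q z. With
  \<Lambda> = -log|1-.| its size is governed by Re u \<Lambda>(z) + (1 - Re u) \<Lambda>(w), which
  is regrouped around x0: \<Lambda>(w) \<le> \<Lambda>(z) + 1 takes care of x0 - Re u, and
  \<Lambda>(w) \<le> -log(1-q) gives the integrable power of 1-q.\<close>

lemma pairing_bound:
  assumes C: "C \<ge> 0" "\<And>z. z \<in> sector \<Longrightarrow> norm (L z + of_real (\<sigma>2 * ln (norm (1 - z)))) \<le> C"
    and u: "norm u \<le> 2" "Re u \<le> x0" "\<bar>x0 - 1\<bar> \<le> 1 / 4"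
    and z: "z \<in> sector" and q: "0 \<le> q" "q < 1"
  shows "norm (exp (u * L z) * exp ((1 - u) * L (of_real q * z))) \<le>
    exp (5 * C + 9) * norm (1 - z) powr (- (\<sigma>2 * x0)) * (1 - q) powr (- (1 / 2))"
proof -
  define w where "w = of_real q * z"
  have w: "w \<in> sector" unfolding w_def using z q by (intro sector_scale) auto
  define \<Lambda> where "\<Lambda> z = - ln (norm (1 - z))" for z :: complex
  define E where "E z = L z - of_real (\<sigma>2 * \<Lambda> z)" for z
  have E: "norm (E z) \<le> C" "norm (E w) \<le> C" using C(2)[OF z] C(2)[OF w] by (simp_all add: E_def \<Lambda>_def)
  have s: "\<sigma>2 \<ge> 1" "\<sigma>2 \<le> 2" using \<alpha>_pos \<alpha>_le_1 by (auto simp: \<sigma>2_def)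
  have z1: "norm z < 1" "norm w < 1" using sector_norm z w by auto
  have n1: "norm (1 - z) > 0" "norm (1 - w) > 0" using norm_one_minus_pos z1 by auto
  have ln2: "ln (2::real) \<le> 1" using ln_le_minus_one[of "2::real"] by simp
  have wq: "norm (1 - w) \<ge> 1 - q"
  proof -
    have "norm w \<le> q" using q z1 by (simp add: w_def norm_mult mult_left_le)
    then show ?thesis using norm_triangle_ineq2[of 1 w] by simp
  qed
  have zw: "norm (1 - z) \<le> 2 * norm (1 - w)"
  proof -
    have "1 - z = (1 - w) - of_real (1 - q) * z" by (simp add: w_def algebra_simps)
    also have "norm \<dots> \<le> norm (1 - w) + norm (of_real (1 - q) * z)" by (rule norm_triangle_ineq4)
    also have "norm (of_real (1 - q) * z) \<le> 1 - q"
      using q z1 unfolding norm_mult norm_of_real by (simp add: mult_left_le)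
    finally show ?thesis using wq by simp
  qed
  have \<Lambda>1: "\<Lambda> w - \<Lambda> z \<le> 1"
  proof -
    have "ln (norm (1 - z)) \<le> ln (2 * norm (1 - w))" using zw n1 by (subst ln_le_cancel_iff) auto
    also have "\<dots> = ln 2 + ln (norm (1 - w))" using n1 by (intro ln_mult_pos) auto
    finally show ?thesis using ln2 by (simp add: \<Lambda>_def)
  qed
  have \<Lambda>2: "\<Lambda> w \<le> - ln (1 - q)" using wq q n1 by (simp add: \<Lambda>_def)
  have \<Lambda>3: "- \<Lambda> w \<le> 1"
  proof -
    have "ln (norm (1 - w)) \<le> ln 2" using norm_one_minus_le_2[OF z1(2)] n1 by (subst ln_le_cancel_iff) auto
    then show ?thesis using ln2 by (simp add: \<Lambda>_def)
  qed
  have lq: "0 \<le> - ln (1 - q)" using q by simp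
  \<comment> \<open>From \<open>\<sigma>2\<close> \<le> 2 and |x0 - 1| \<le> 1/4 the exponent is at
    most 1/2; any value below 1 keeps the singularity at q = 1 integrable.\<close>
  have s1: "\<sigma>2 * ((1 - x0) * \<Lambda> w) \<le> 1 / 2 * (- ln (1 - q)) + 1"
  proof (cases "x0 \<le> 1")
    case True
    have "\<sigma>2 * (1 - x0) \<le> 2 * (1 / 4)" using s u True by (intro mult_mono) auto
    then have "\<sigma>2 * (1 - x0) * (- ln (1 - q)) \<le> 1 / 2 * (- ln (1 - q))" using lq by (intro mult_right_mono) auto
    moreover have "\<sigma>2 * (1 - x0) * \<Lambda> w \<le> \<sigma>2 * (1 - x0) * (- ln (1 - q))"
      using \<Lambda>2 s True by (intro mult_left_mono) auto
    ultimately show ?thesis by (simp add: mult.assoc)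
  next
    case False
    have "\<sigma>2 * ((x0 - 1) * (- \<Lambda> w)) \<le> \<sigma>2 * ((x0 - 1) * 1)"
      using \<Lambda>3 s False by (intro mult_left_mono) auto
    also have "\<dots> \<le> 2 * ((1 / 4) * 1)" using s u False by (intro mult_mono) auto
    finally show ?thesis using lq by (simp add: algebra_simps)
  qed
  have s3: "\<sigma>2 * ((x0 - Re u) * (\<Lambda> w - \<Lambda> z)) \<le> 8"
  proof -
    have "Re u \<ge> - 2" using abs_Re_le_cmod[of u] u by simp
    then have r: "0 \<le> x0 - Re u" "x0 - Re u \<le> 4" using u(2,3) by linarith+
    have "(x0 - Re u) * (\<Lambda> w - \<Lambda> z) \<le> (x0 - Re u) * 1" using r \<Lambda>1 by (intro mult_left_mono) auto
    also have "\<dots> \<le> 4" using r by simp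
    finally have "\<sigma>2 * ((x0 - Re u) * (\<Lambda> w - \<Lambda> z)) \<le> \<sigma>2 * 4" using s by (intro mult_left_mono) auto
    then show ?thesis using s by linarith
  qed
  \<comment> \<open>|u| \<le> 2 and |1-u| \<le> 3 give the 5; the 9 in the claim is 1 + 8 from the
    two estimates above.\<close>
  have err: "Re (u * E z + (1 - u) * E w) \<le> 5 * C"
  proof -
    have "norm (1 - u) \<le> 3" using norm_triangle_ineq4[of 1 u] u by simp
    have "Re (u * E z + (1 - u) * E w) \<le> norm (u * E z) + norm ((1 - u) * E w)"
      by (meson complex_Re_le_cmod norm_triangle_ineq order.trans)
    also have "\<dots> \<le> 2 * C + 3 * C"
      unfolding norm_mult using u E \<open>norm (1 - u) \<le> 3\<close> C by (intro add_mono mult_mono) auto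
    finally show ?thesis by simp
  qed
  have "u * L z + (1 - u) * L w = (u * E z + (1 - u) * E w) + (u * of_real (\<sigma>2 * \<Lambda> z) + (1 - u) * of_real (\<sigma>2 * \<Lambda> w))"
    by (simp add: E_def algebra_simps)
  then have "Re (u * L z + (1 - u) * L w) = Re (u * E z + (1 - u) * E w) + (Re u * (\<sigma>2 * \<Lambda> z) + (1 - Re u) * (\<sigma>2 * \<Lambda> w))"
    by simp
  also have "Re u * (\<sigma>2 * \<Lambda> z) + (1 - Re u) * (\<sigma>2 * \<Lambda> w) =
      \<sigma>2 * x0 * \<Lambda> z + \<sigma>2 * ((1 - x0) * \<Lambda> w) + \<sigma>2 * ((x0 - Re u) * (\<Lambda> w - \<Lambda> z))"
    by (simp add: algebra_simps)
  finally have "Re (u * L z + (1 - u) * L w) \<le> (5 * C + 9) + \<sigma>2 * x0 * \<Lambda> z + 1 / 2 * (- ln (1 - q))"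
    using err s1 s3 by linarith
  then have "exp (Re (u * L z + (1 - u) * L w)) \<le> exp ((5 * C + 9) + \<sigma>2 * x0 * \<Lambda> z + 1 / 2 * (- ln (1 - q)))"
    by simp
  also have "\<dots> = exp (5 * C + 9) * norm (1 - z) powr (- (\<sigma>2 * x0)) * (1 - q) powr (- (1 / 2))"
    unfolding exp_add powr_def using n1 q by (simp add: \<Lambda>_def)
  finally show ?thesis by (simp only: exp_add[symmetric] norm_exp_eq_Re w_def)
qed

text \<open>The recursion and \<open>m 0 = 0\<close> determine \<open>m\<close>; the Taylor
  coefficients of the explicit solution N satisfy both and so coincide with it. The condition |x0 -
  1| \<le> \<alpha>/4 keeps the singular exponent \<open>\<sigma>2 * x0\<close> at least 1 +
  \<alpha>/2, hence above 1.\<close>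

lemma level_coeff_bound:
  "\<exists>K\<ge>0. \<forall>u x0 m. norm u \<le> 2 \<longrightarrow> Re u \<le> x0 \<longrightarrow> \<bar>x0 - 1\<bar> \<le> \<alpha> / 4 \<longrightarrow> m 0 = 0 \<longrightarrow>
    (\<forall>n. of_nat (Suc n) * m (Suc n) = fps_nth (poly_fps \<phi> T + fps_const u * (poly_fps (pderiv \<phi>) T * Abs_fps m)) n) \<longrightarrow>
    (\<forall>n\<ge>1. norm (m n) \<le> K * n powr (\<sigma>2 * x0 - 1))"
proof -
  obtain C where C: "C \<ge> 0" "\<And>z. z \<in> sector \<Longrightarrow> norm (L z + of_real (\<sigma>2 * ln (norm (1 - z)))) \<le> C"
    using L_sector by blast
  define B where "B = 2 * exp (5 * C + 9)"
  define K where "K = B * (per * exp 2 * 4 powr 3 / (pi * (\<alpha> / 2))) + coeff \<phi> 0"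
  have B: "B \<ge> 0" by (simp add: B_def)
  show ?thesis
  proof (intro exI[of _ K] conjI allI impI)
    show "K \<ge> 0" using B \<alpha>_pos coeff_0 by (simp add: K_def)
    fix u x0 m n
    assume u: "norm u \<le> 2" "Re u \<le> x0" "\<bar>x0 - 1\<bar> \<le> \<alpha> / 4" and m0: "m 0 = 0"
      and rec: "\<forall>n. of_nat (Suc n) * m (Suc n) = fps_nth (poly_fps \<phi> T + fps_const u * (poly_fps (pderiv \<phi>) T * Abs_fps m)) n"
      and n: "n \<ge> (1::nat)"
    have x0: "\<bar>x0 - 1\<bar> \<le> 1 / 4" using u \<alpha>_le_1 by simp
    have s: "\<sigma>2 * x0 \<ge> 1 + \<alpha> / 2" "\<sigma>2 * x0 \<le> 3"
    proof -
      have "1 - \<alpha> / 4 \<le> x0" "x0 \<le> 5 / 4" using u(3) \<alpha>_le_1 by linarith+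
      then have "\<sigma>2 * (1 - \<alpha> / 4) \<le> \<sigma>2 * x0" "\<sigma>2 * x0 \<le> 2 * (5 / 4)"
        using \<alpha>_pos \<alpha>_le_1 unfolding \<sigma>2_def by (intro mult_left_mono mult_mono; linarith)+
      moreover have "\<alpha> * \<alpha> \<le> \<alpha>" using \<alpha>_pos \<alpha>_le_1 mult_left_le[of \<alpha> \<alpha>] by simp
      moreover have "\<sigma>2 * (1 - \<alpha> / 4) = 1 + \<alpha> - \<alpha> / 4 - \<alpha> * \<alpha> / 4" by (simp add: \<sigma>2_def field_simps)
      ultimately show "\<sigma>2 * x0 \<ge> 1 + \<alpha> / 2" "\<sigma>2 * x0 \<le> 3" by linarith+
    qed
    have Lhol: "L holomorphic_on ball 0 1"
      by (rule holomorphic_on_disk_if_deriv[OF L_deriv])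
    have "(\<lambda>z. exp ((1 - u) * L z)) holomorphic_on ball 0 1" by (intro holomorphic_intros Lhol)
    then obtain J0 where "\<And>x. x \<in> ball 0 1 \<Longrightarrow> (J0 has_field_derivative exp ((1 - u) * L x)) (at x within ball 0 1)"
      using holomorphic_convex_primitive'[of "ball 0 1"] by auto
    then have J0: "(J0 has_field_derivative exp ((1 - u) * L z)) (at z)" if "norm z < 1" for z
      using that by (simp add: at_within_open[of _ "ball 0 1"])
    define J where "J z = J0 z - J0 0" for z
    have J: "(J has_field_derivative exp ((1 - u) * L z)) (at z)" "J 0 = 0" if "norm z < 1" for z
      unfolding J_def using J0[OF that] by (auto intro!: derivative_eq_intros)
    define N where "N z = exp (u * L z) * J z" for z
    have N_deriv: "(N has_field_derivative u * cpoly (pderiv \<phi>) (\<tau> z) * N z + cpoly \<phi> (\<tau> z)) (at z)"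
      if "norm z < 1" for z
    proof -
      have e: "exp (u * L z) * exp ((1 - u) * L z) = cpoly \<phi> (\<tau> z)"
        unfolding exp_L[OF that, symmetric] by (simp add: algebra_simps flip: exp_add)
      have "(N has_field_derivative exp (u * L z) * (u * cpoly (pderiv \<phi>) (\<tau> z)) * J z + exp ((1 - u) * L z) * exp (u * L z)) (at z)"
        unfolding N_def by (auto intro!: derivative_eq_intros L_deriv[OF that] J(1)[OF that])
      then show ?thesis unfolding e[symmetric] by (simp add: N_def mult_ac)
    qed
    define f where "f = fps_expansion N 0"
    have "N holomorphic_on eball 0 1"
      using holomorphic_on_disk_if_deriv[OF N_deriv] by (simp add: one_ereal_def)
    then have f: "fps_conv_radius f \<ge> 1" "\<And>z. norm z < 1 \<Longrightarrow> eval_fps f z = N z"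
      using conv_radius_fps_expansion[of N 0 1] eval_fps_expansion'[of N 0 1] by (auto simp: f_def one_ereal_def)
    have pr: "fps_conv_radius (poly_fps (pderiv \<phi>) T * f) \<ge> 1"
      using order.trans[OF _ fps_conv_radius_mult[of "poly_fps (pderiv \<phi>) T" f]] conv_radius_poly_T[of "pderiv \<phi>"] f(1) by simp
    have pr2: "fps_conv_radius (fps_const u * (poly_fps (pderiv \<phi>) T * f)) \<ge> 1"
      using order.trans[OF _ fps_conv_radius_mult[of "fps_const u" "poly_fps (pderiv \<phi>) T * f"]] pr by simp
    have "fps_deriv f = poly_fps \<phi> T + fps_const u * (poly_fps (pderiv \<phi>) T * f)"
    proof (rule eval_fps_eqD)
      have pos: "0 < fps_conv_radius g" if "fps_conv_radius g \<ge> 1" for g :: "complex fps"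
        using that less_le_trans[of 0 "1::ereal"] by simp
      show "0 < fps_conv_radius (fps_deriv f)"
        by (intro pos order.trans[OF f(1)] fps_conv_radius_deriv)
      have "1 \<le> fps_conv_radius (poly_fps \<phi> T + fps_const u * (poly_fps (pderiv \<phi>) T * f))"
        by (rule order.trans[OF _ fps_conv_radius_add]) (use conv_radius_poly_T[of \<phi>] pr2 in simp)
      then show "0 < fps_conv_radius (poly_fps \<phi> T + fps_const u * (poly_fps (pderiv \<phi>) T * f))" by (rule pos)
      have "eval_fps (fps_deriv f) z = eval_fps (poly_fps \<phi> T + fps_const u * (poly_fps (pderiv \<phi>) T * f)) z"
        if z: "z \<in> ball 0 1" for z
      proof -
        have z1: "norm z < 1" using z by simp
        have "(eval_fps f has_field_derivative eval_fps (fps_deriv f) z) (at z)"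
          by (intro has_field_derivative_eval_fps less_conv_radius z1 f)
        moreover have "(eval_fps f has_field_derivative u * cpoly (pderiv \<phi>) (\<tau> z) * N z + cpoly \<phi> (\<tau> z)) (at z)"
          by (rule has_field_derivative_transform_within_open[OF N_deriv[OF z1] open_ball z]) (simp add: f)
        ultimately have "eval_fps (fps_deriv f) z = u * cpoly (pderiv \<phi>) (\<tau> z) * N z + cpoly \<phi> (\<tau> z)"
          by (rule DERIV_unique)
        also have "\<dots> = eval_fps (poly_fps \<phi> T + fps_const u * (poly_fps (pderiv \<phi>) T * f)) z"
          using z1 pr pr2 f
          by (simp add: eval_fps_add eval_fps_mult less_conv_radius conv_radius_poly_T eval_poly_T)
        finally show ?thesis .
      qed
      then show "\<forall>\<^sub>F z in nhds 0. eval_fps (fps_deriv f) z = eval_fps (poly_fps \<phi> T + fps_const u * (poly_fps (pderiv \<phi>) T * f)) z"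
        by (intro eventually_nhds[THEN iffD2] exI[of _ "ball 0 1"]) auto
    qed
    then have frec: "of_nat (Suc k) * fps_nth f (Suc k) = fps_nth (poly_fps \<phi> T + fps_const u * (poly_fps (pderiv \<phi>) T * f)) k" for k
      by (metis Suc_eq_plus1 fps_deriv_nth)
    have fm: "fps_nth f k = m k" for k
    proof (induction k rule: less_induct)
      case (less k)
      show ?case
      proof (cases k)
        case 0
        have "fps_nth f 0 = N 0" using f(2)[of 0] by (simp add: eval_fps_at_0)
        then show ?thesis using 0 m0 J(2)[of 0] by (simp add: N_def)
      next
        case (Suc j)
        have "fps_nth (poly_fps (pderiv \<phi>) T * f) j = fps_nth (poly_fps (pderiv \<phi>) T * Abs_fps m) j"
          unfolding fps_mult_nth using less Suc by (intro sum.cong refl) auto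
        then have "of_nat (Suc j) * fps_nth f (Suc j) = of_nat (Suc j) * m (Suc j)"
          unfolding frec using rec by simp
        then show ?thesis using Suc by (simp del: of_nat_Suc)
      qed
    qed
    have N_bound: "norm (N z) \<le> B * norm (1 - z) powr (- (\<sigma>2 * x0))" if z: "z \<in> sector" for z
    proof -
      let ?D = "exp (5 * C + 9) * norm (1 - z) powr (- (\<sigma>2 * x0))"
      have z1: "norm z < 1" using sector_norm[OF z] .
      have q1: "norm (of_real q * z) < 1" if "0 \<le> q" "q \<le> 1" for q
        using that z by (intro sector_norm sector_scale) auto
      have vd: "((\<lambda>q. exp (u * L z) * J (of_real q * z)) has_vector_derivative
          exp (u * L z) * (exp ((1 - u) * L (of_real q * z)) * z)) (at q within S)" if "0 \<le> q" "q \<le> 1" for q S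
      proof -
        have "((\<lambda>q. exp (u * L z) * J (q * z)) has_field_derivative
          exp (u * L z) * (exp ((1 - u) * L (of_real q * z)) * z)) (at (of_real q))"
          by (intro DERIV_cmult DERIV_chain2[where f = J and g = "\<lambda>q. q * z" and x = "of_real q", OF J(1)[OF q1[OF that]]])
             (auto intro!: derivative_eq_intros)
        then show ?thesis by (rule has_vector_derivative_real_field)
      qed
      \<comment> \<open>Integration along the ray: -2 (1-q)^(1/2) is the primitive of (1-q)^(-1/2),
        which accounts for the 2 in \<open>B\<close>.\<close>
      have "norm (exp (u * L z) * J (of_real 1 * z) - exp (u * L z) * J (of_real 0 * z)) \<le>
          - 2 * ?D * (1 - 1) powr (1 / 2) - - 2 * ?D * (1 - 0) powr (1 / 2)"
      proof (rule differentiable_bound_general[where a = 0 and b = "1::real" and f = "\<lambda>q. exp (u * L z) * J (of_real q * z)" and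
            \<phi> = "\<lambda>q. - 2 * ?D * (1 - q) powr (1 / 2)" and \<phi>' = "\<lambda>q. ?D * (1 - q) powr (- (1 / 2))"
            and f' = "\<lambda>q. exp (u * L z) * (exp ((1 - u) * L (of_real q * z)) * z)"])
        show "continuous_on {0..1} (\<lambda>q. exp (u * L z) * J (of_real q * z))"
          using vd has_vector_derivative_continuous by (fastforce simp: continuous_on_eq_continuous_within)
        show "continuous_on {0..1} (\<lambda>q. - 2 * ?D * (1 - q) powr (1 / 2))"
          by (intro continuous_on_mult continuous_on_const continuous_on_powr' continuous_on_diff continuous_on_id) auto
        fix q :: real assume q: "0 < q" "q < 1"
        show "((\<lambda>q. exp (u * L z) * J (of_real q * z)) has_vector_derivative
          exp (u * L z) * (exp ((1 - u) * L (of_real q * z)) * z)) (at q)" using q by (intro vd) auto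
        have "((\<lambda>q. - 2 * ?D * (1 - q) powr (1 / 2)) has_real_derivative - 2 * ?D * (- (1 / 2) * (1 - q) powr (1 / 2 - 1))) (at q)"
          using q by (intro DERIV_cmult) (auto intro!: derivative_eq_intros)
        then show "((\<lambda>q. - 2 * ?D * (1 - q) powr (1 / 2)) has_vector_derivative ?D * (1 - q) powr (- (1 / 2))) (at q)"
          by (simp add: has_real_derivative_iff_has_vector_derivative mult.assoc)
        have "norm (exp (u * L z) * (exp ((1 - u) * L (of_real q * z)) * z)) =
            norm (exp (u * L z) * exp ((1 - u) * L (of_real q * z))) * norm z" by (simp add: norm_mult)
        also have "\<dots> \<le> norm (exp (u * L z) * exp ((1 - u) * L (of_real q * z)))"
          using z1 by (intro mult_left_le) auto
        also have "\<dots> \<le> ?D * (1 - q) powr (- (1 / 2))"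
          using q by (intro pairing_bound C u(1,2) x0 z) auto
        finally show "norm (exp (u * L z) * (exp ((1 - u) * L (of_real q * z)) * z)) \<le> ?D * (1 - q) powr (- (1 / 2))" .
      qed simp
      then show ?thesis using J(2)[of 0] by (simp add: N_def B_def mult_ac)
    qed
    show "norm (m n) \<le> K * n powr (\<sigma>2 * x0 - 1)"
    proof (cases "n = 1")
      case True
      have "fps_nth (poly_fps \<phi> T) 0 = of_real (real (Suc 0) * p (Suc 0))"
        unfolding T_def fps_nth_poly_fps_of_real p_rec ..
      then have "m 1 = of_real (p 1)" using rec[rule_format, of 0] m0 by simp
      then show ?thesis using True p_1 coeff_0 B \<alpha>_pos by (simp add: K_def)
    next
      case False
      then have n2: "n \<ge> 2" using n by simp
      show ?thesis
      proof (cases "m n = 0")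
        case True
        then show ?thesis using \<open>K \<ge> 0\<close> by simp
      next
        case mn: False
        \<comment> \<open>The coefficient formula on one sector needs the support of
          \<open>m\<close> in a single class; it is that of \<tau>, 1 modulo
          \<open>per\<close>.\<close>
        have mcls: "m k \<noteq> 0 \<Longrightarrow> int per dvd int k - 1" for k
        proof (induction k rule: less_induct)
          case (less k)
          then obtain j where j: "k = Suc j" using m0 by (cases k) auto
          have "fps_nth (poly_fps \<phi> T + fps_const u * (poly_fps (pderiv \<phi>) T * Abs_fps m)) j \<noteq> 0"
            unfolding rec[rule_format, symmetric] using less.prems j by (simp del: of_nat_Suc)
          then consider "fps_nth (poly_fps \<phi> T) j \<noteq> 0" | "fps_nth (poly_fps (pderiv \<phi>) T * Abs_fps m) j \<noteq> 0" by fastforce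
          then show ?case
          proof cases
            case 1
            then show ?thesis using poly_class[OF \<phi>_class 1] by (simp add: j)
          next
            case 2
            then obtain i where i: "i \<le> j" "fps_nth (poly_fps (pderiv \<phi>) T) i \<noteq> 0" "m (j - i) \<noteq> 0"
              by (auto simp: fps_mult_nth elim!: sum.not_neutral_contains_not_neutral)
            have "int per dvd (int i + int (j - i)) - (- 1 + 1)"
              using i j by (intro int_dvd_add_cancel poly_class[OF \<phi>'_class] less.IH) auto
            then show ?thesis using i j by (simp add: of_nat_diff)
          qed
        qed
        have "norm (fps_nth f n) \<le> B * coeff_const per (\<sigma>2 * x0) * n powr (\<sigma>2 * x0 - 1)"
        proof (rule coeff_upper[OF per_pos _ f(1) n2 _ B])
          show "int per dvd int j - int n" if "fps_nth f j \<noteq> 0" for j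
            using mcls[of j] mcls[OF mn] that unfolding fm by (intro class_diff)
          fix \<theta> :: real assume th: "\<bar>\<theta>\<bar> \<le> pi / per"
          have z: "of_real (1 - 1 / n) * cis \<theta> \<in> sector" using n2 th by (intro sectorI) auto
          show "norm (eval_fps f (of_real (1 - 1 / n) * cis \<theta>)) \<le> B * norm (1 - of_real (1 - 1 / n) * cis \<theta>) powr (- (\<sigma>2 * x0))"
            unfolding f(2)[OF sector_norm[OF z]] by (rule N_bound[OF z])
        qed (use s \<alpha>_pos in auto)
        also have "\<dots> \<le> K * n powr (\<sigma>2 * x0 - 1)"
        proof (intro mult_right_mono)
          have "coeff_const per (\<sigma>2 * x0) \<le> per * exp 2 * 4 powr 3 / (pi * (\<alpha> / 2))"
            unfolding coeff_const_def using s \<alpha>_pos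
            by (intro frac_le mult_left_mono powr_mono mult_pos_pos) auto
          then have "B * coeff_const per (\<sigma>2 * x0) \<le> B * (per * exp 2 * 4 powr 3 / (pi * (\<alpha> / 2)))"
            using B by (intro mult_left_mono)
          then show "B * coeff_const per (\<sigma>2 * x0) \<le> K" using coeff_0 by (simp add: K_def)
        qed simp
        finally show ?thesis by (simp add: fm)
      qed
    qed
  qed
qed

end

section \<open>Moments of the level polynomial\<close>

lemma fps_mult_nth_mono:
  fixes A B :: "real fps"
  assumes "\<And>k. fps_nth A k \<ge> 0" "\<And>k. k \<le> n \<Longrightarrow> fps_nth B k \<le> fps_nth B' k"
  shows "fps_nth (A * B) n \<le> fps_nth (A * B') n"
  unfolding fps_mult_nth using assms by (intro sum_mono mult_left_mono) auto

lemma norm_fps_mult_nth_le: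
  fixes A B :: "complex fps"
  assumes "\<And>k. k \<le> n \<Longrightarrow> norm (fps_nth A k) \<le> fps_nth A' k" "\<And>k. k \<le> n \<Longrightarrow> norm (fps_nth B k) \<le> fps_nth B' k"
  shows "norm (fps_nth (A * B) n) \<le> fps_nth (A' * B') n"
proof -
  have nn: "0 \<le> fps_nth A' k" if "k \<le> n" for k using assms(1)[OF that] norm_ge_zero order.trans by blast
  have "norm (fps_nth (A * B) n) \<le> (\<Sum>i=0..n. norm (fps_nth A i * fps_nth B (n - i)))"
    unfolding fps_mult_nth by (rule norm_sum)
  also have "\<dots> \<le> (\<Sum>i=0..n. fps_nth A' i * fps_nth B' (n - i))"
  proof (rule sum_mono)
    fix i assume "i \<in> {0..n}"
    then show "norm (fps_nth A i * fps_nth B (n - i)) \<le> fps_nth A' i * fps_nth B' (n - i)"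
      unfolding norm_mult by (intro mult_mono assms nn norm_ge_zero) auto
  qed
  finally show ?thesis by (simp add: fps_mult_nth)
qed

lemma fps_nth_poly_nonneg:
  fixes A :: "real fps"
  assumes "\<And>j. coeff P j \<ge> 0" "\<And>n. fps_nth A n \<ge> 0"
  shows "fps_nth (poly_fps P A) n \<ge> 0"
  unfolding poly_fps_def fps_sum_nth using assms
  by (auto intro!: sum_nonneg mult_nonneg_nonneg fps_nth_power_nonneg)

text \<open>A P'(A) turns each power A^j into j A^j with j at most the degree. Thus all error terms
  can be measured by \<phi>(\<tau>), that is, by (n+1) p_(n+1).\<close>

lemma fps_nth_pderiv_times_le:
  fixes A :: "real fps"
  assumes "\<And>j. coeff P j \<ge> 0" "\<And>n. fps_nth A n \<ge> 0"
  shows "fps_nth (poly_fps (pderiv P) A * A) n \<le> real (degree P) * fps_nth (poly_fps P A) n"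
proof -
  have "poly_fps (pderiv P) A * A = (\<Sum>j\<le>degree P. fps_const (real j * coeff P j) * A ^ j)"
    unfolding poly_fps_pderiv sum_distrib_right
  proof (intro sum.cong refl)
    fix j
    show "fps_const (of_real (coeff P j)) * (of_nat j * A ^ (j - 1)) * A = fps_const (real j * coeff P j) * A ^ j"
      by (cases j) (simp_all add: fps_of_nat[symmetric] mult_ac del: of_nat_Suc flip: fps_const_mult)
  qed
  then have "fps_nth (poly_fps (pderiv P) A * A) n = (\<Sum>j\<le>degree P. real j * coeff P j * fps_nth (A ^ j) n)"
    by (simp add: fps_sum_nth)
  also have "\<dots> \<le> (\<Sum>j\<le>degree P. real (degree P) * (coeff P j * fps_nth (A ^ j) n))"
    unfolding mult.assoc using assms
    by (intro sum_mono mult_right_mono mult_nonneg_nonneg fps_nth_power_nonneg) auto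
  also have "\<dots> = real (degree P) * fps_nth (poly_fps P A) n"
    by (simp add: poly_fps_def fps_sum_nth sum_distrib_left)
  finally show ?thesis .
qed

lemma fps_nth_pderiv2_times_le:
  fixes A :: "real fps"
  assumes "\<And>j. coeff P j \<ge> 0" "\<And>n. fps_nth A n \<ge> 0"
  shows "fps_nth (poly_fps (pderiv (pderiv P)) A * (A * A)) n \<le> (real (degree P))\<^sup>2 * fps_nth (poly_fps P A) n"
proof -
  have "poly_fps (pderiv (pderiv P)) A * (A * A) = (\<Sum>j\<le>degree P. fps_const (real (j * (j - 1)) * coeff P j) * A ^ j)"
    unfolding poly_fps_pderiv2 sum_distrib_right
  proof (intro sum.cong refl)
    fix j
    consider "j = 0" | "j = 1" | i where "j = Suc (Suc i)" by (metis One_nat_def not0_implies_Suc)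
    then show "fps_const (of_real (coeff P j)) * (of_nat (j * (j - 1)) * A ^ (j - 2)) * (A * A) = fps_const (real (j * (j - 1)) * coeff P j) * A ^ j"
      by cases (simp_all add: fps_of_nat[symmetric] mult_ac del: of_nat_Suc of_nat_mult flip: fps_const_mult)
  qed
  then have "fps_nth (poly_fps (pderiv (pderiv P)) A * (A * A)) n = (\<Sum>j\<le>degree P. real (j * (j - 1)) * coeff P j * fps_nth (A ^ j) n)"
    by (simp add: fps_sum_nth del: of_nat_mult)
  also have "\<dots> \<le> (\<Sum>j\<le>degree P. (real (degree P))\<^sup>2 * (coeff P j * fps_nth (A ^ j) n))"
    unfolding mult.assoc
  proof (intro sum_mono mult_right_mono)
    fix j assume "j \<in> {..degree P}"
    then have "real j * real (j - 1) \<le> real (degree P) * real (degree P)" by (intro mult_mono) auto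
    then show "real (j * (j - 1)) \<le> (real (degree P))\<^sup>2" by (simp add: power2_eq_square)
  qed (use assms in \<open>auto intro!: mult_nonneg_nonneg fps_nth_power_nonneg\<close>)
  also have "\<dots> = (real (degree P))\<^sup>2 * fps_nth (poly_fps P A) n"
    by (simp add: poly_fps_def fps_sum_nth sum_distrib_left)
  finally show ?thesis .
qed

lemma inc_trees_0: "inc_trees 0 = {}"
proof -
  have "labels t \<noteq> []" for t by (cases t) auto
  then show ?thesis by (auto simp: inc_trees_def)
qed

lemma length_labels_inc_trees: "t \<in> inc_trees n \<Longrightarrow> length (labels t) = n"
  by (auto simp: inc_trees_def simp flip: distinct_card)

lemma norm_level_poly_le:
  assumes "t \<in> inc_trees n" "norm u \<le> 2"
  shows "norm (level_poly u t) \<le> real n * 2 ^ n"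
proof -
  have len: "length (labels t) \<le> n" using assms by (simp add: length_labels_inc_trees)
  have "norm (level_poly u t) \<le> (\<Sum>k<n. norm (of_nat (level_size t k) * u ^ k))"
    unfolding level_poly_eq[OF len] by (rule norm_sum)
  also have "\<dots> \<le> (\<Sum>k<n. real (level_size t k) * 2 ^ n)"
  proof (intro sum_mono)
    fix k assume k: "k \<in> {..<n}"
    have "norm u ^ k \<le> 2 ^ k" using assms by (intro power_mono) auto
    also have "\<dots> \<le> 2 ^ n" using k by (intro power_increasing) auto
    finally show "norm (of_nat (level_size t k) * u ^ k) \<le> real (level_size t k) * 2 ^ n"
      by (simp add: norm_mult norm_power mult_left_mono)
  qed
  also have "\<dots> = real n * 2 ^ n"
  proof -
    have "complex_of_real (\<Sum>k<n. real (level_size t k)) = of_real (real n)"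
      using level_poly_eq[OF len, of 1] level_poly_one[of t] assms by (simp add: length_labels_inc_trees)
    then have "(\<Sum>k<n. real (level_size t k)) = real n" by (simp only: of_real_eq_iff)
    then show ?thesis by (simp flip: sum_distrib_right)
  qed
  finally show ?thesis .
qed

text \<open>The analytic setting applied to the tree weights: p_n is the total weight divided by
  n!.\<close>

locale inc_variety = inc_series \<phi> "\<lambda>n. fps_nth (egf \<phi> (\<lambda>t. 1)) n" d F for \<phi> d F
begin

abbreviation P :: "real fps" where "P \<equiv> egf \<phi> (\<lambda>t. 1)"

lemma T_eq: "T = egf \<phi> (\<lambda>t. 1)"
  unfolding T_def by (rule fps_ext) (simp add: egf_def)

lemma tree_weight_ge_0: "tree_weight \<phi> a \<ge> 0"
  by (rule tree_weight_nonneg) (rule coeff_nonneg)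

lemma egf_mono:
  fixes h h' :: "otree \<Rightarrow> real"
  assumes "\<And>t. t \<in> inc_trees n \<Longrightarrow> h t \<le> h' t"
  shows "fps_nth (egf \<phi> h) n \<le> fps_nth (egf \<phi> h') n"
  unfolding egf_def using assms by (auto intro!: divide_right_mono sum_mono mult_left_mono tree_weight_ge_0)

lemma egf_nonneg: "(\<And>t. f t \<ge> (0::real)) \<Longrightarrow> fps_nth (egf \<phi> f) n \<ge> 0"
  using egf_mono[of n "\<lambda>t. 0" f] by (simp add: egf_def)

lemma egf_cmult_one: "fps_nth (egf \<phi> (\<lambda>t. K :: real)) n = K * fps_nth P n"
  by (simp add: egf_def sum_distrib_left mult_ac)

lemma egf_eq_0:
  fixes h :: "otree \<Rightarrow> 'a::real_normed_field"
  assumes "fps_nth P n = 0" shows "fps_nth (egf \<phi> h) n = 0"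
proof -
  have "(\<Sum>t\<in>inc_trees n. tree_weight \<phi> t) = 0" using assms by (simp add: egf_def)
  then have "tree_weight \<phi> t = 0" if "t \<in> inc_trees n" for t
    using that finite_inc_trees tree_weight_ge_0 by (simp add: sum_nonneg_eq_0_iff)
  then show ?thesis by (simp add: egf_def)
qed

lemma egf_zero: "fps_nth (egf \<phi> f) 0 = 0"
  by (simp add: egf_def inc_trees_0)

lemma poly_nth: "fps_nth (poly_fps \<phi> P) n = real (Suc n) * fps_nth P (Suc n)"
  using p_rec[of n] by (simp add: fps_nth_inverse)

lemma P_nonneg: "fps_nth P n \<ge> 0"
  by (rule p_nonneg)

lemma c_eq: "c k = fps_nth (poly_fps (pderiv \<phi>) P) k"
  by (simp add: c_def fps_nth_inverse)

text \<open>For Re u \<le> x the expected size of S(u) is n exp(lam(x-1)) with lam =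
  \<open>\<sigma>2\<close> log n, which is n to this power.\<close>

definition expo :: "real \<Rightarrow> real" where "expo x = 1 + \<sigma>2 * (x - 1)"

text \<open>The coefficient bound is divided by p_n, which is at least of order n^(\<alpha>-1) where
  it does not vanish; at the other sizes both sides are 0.\<close>

lemma level_mean_bound:
  "\<exists>K\<ge>0. \<forall>u x0 n. norm u \<le> 2 \<longrightarrow> Re u \<le> x0 \<longrightarrow> \<bar>x0 - 1\<bar> \<le> \<alpha> / 4 \<longrightarrow>
    norm (fps_nth (egf \<phi> (level_poly u)) n) \<le> K * fps_nth P n * n powr expo x0"
proof -
  obtain K where K: "K \<ge> 0" "\<And>u x0 m n. norm u \<le> 2 \<Longrightarrow> Re u \<le> x0 \<Longrightarrow> \<bar>x0 - 1\<bar> \<le> \<alpha> / 4 \<Longrightarrow> m 0 = 0 \<Longrightarrow>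
    (\<And>n. of_nat (Suc n) * m (Suc n) = fps_nth (poly_fps \<phi> T + fps_const u * (poly_fps (pderiv \<phi>) T * Abs_fps m)) n) \<Longrightarrow>
    n \<ge> 1 \<Longrightarrow> norm (m n) \<le> K * n powr (\<sigma>2 * x0 - 1)"
    using level_coeff_bound by blast
  obtain c' where c': "c' > 0" "\<And>n. fps_nth P n > 0 \<Longrightarrow> fps_nth P n \<ge> c' * n powr (\<alpha> - 1)"
    using p_lower_pos by blast
  show ?thesis
  proof (intro exI[of _ "K / c'"] conjI allI impI)
    fix u x0 n assume u: "norm u \<le> 2" "Re u \<le> x0" "\<bar>x0 - 1\<bar> \<le> \<alpha> / 4"
    let ?m = "\<lambda>n. fps_nth (egf \<phi> (level_poly u)) n"
    show "norm (?m n) \<le> K / c' * fps_nth P n * n powr expo x0"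
    proof (cases "fps_nth P n = 0")
      case True
      then show ?thesis by (simp add: egf_eq_0)
    next
      case False
      then have P: "fps_nth P n > 0" using P_nonneg[of n] by linarith
      then have n: "n \<ge> 1" using p_0 by (cases n) auto
      have "norm (?m n) \<le> K * n powr (\<sigma>2 * x0 - 1)"
        by (rule K(2)[OF u _ _ n]) (simp_all only: fps_nth_inverse egf_level_poly_rec T_eq egf_zero)
      also have "\<sigma>2 * x0 - 1 = (\<alpha> - 1) + expo x0" by (simp add: expo_def \<sigma>2_def algebra_simps)
      also have "K * n powr ((\<alpha> - 1) + expo x0) = K / c' * (c' * n powr (\<alpha> - 1)) * n powr expo x0"
        using c' by (simp add: powr_add)
      also have "\<dots> \<le> K / c' * fps_nth P n * n powr expo x0"
        using c' K P by (intro mult_right_mono mult_left_mono) auto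
      finally show ?thesis .
    qed
  qed (use K c' in auto)
qed

text \<open>Coefficient form of z (\<phi>(\<tau>))' = \<phi>'(\<tau>) z \<tau>': the exact balance
  at exponent 1, reflecting S(1) = n.\<close>

lemma sum_split_eq: "(\<Sum>k\<le>n. c (n - k) * (fps_nth P k * real k)) = real n * (real (Suc n) * fps_nth P (Suc n))"
proof -
  have "complex_of_real (\<Sum>k\<le>n. c (n - k) * (fps_nth P k * real k)) = of_real (real n * fps_nth (poly_fps \<phi> P) n)"
  proof -
    have d: "fps_deriv (poly_fps \<phi> T) = poly_fps (pderiv \<phi>) T * fps_deriv T"
    proof -
      have "fps_deriv (poly_fps \<phi> T) = (\<Sum>j\<le>degree \<phi>. fps_const (of_real (coeff \<phi> j)) * (of_nat j * T ^ (j - 1) * fps_deriv T))"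
        by (simp add: poly_fps_def fps_deriv_sum fps_deriv_power mult_ac fps_of_nat)
      also have "\<dots> = poly_fps (pderiv \<phi>) T * fps_deriv T"
        unfolding poly_fps_pderiv sum_distrib_right by (intro sum.cong refl) (simp add: mult_ac)
      finally show ?thesis .
    qed
    have "fps_X * fps_deriv (poly_fps \<phi> T) = (fps_X * fps_deriv T) * poly_fps (pderiv \<phi>) T"
      unfolding d by (simp only: mult_ac)
    then have "fps_nth (fps_X * fps_deriv (poly_fps \<phi> T)) n = fps_nth ((fps_X * fps_deriv T) * poly_fps (pderiv \<phi>) T) n"
      by (simp only:)
    moreover have X: "fps_nth (fps_X * fps_deriv f) k = of_nat k * fps_nth f k" for f :: "complex fps" and k
      by (cases k) (simp_all del: of_nat_Suc)
    ultimately have "of_nat n * fps_nth (poly_fps \<phi> T) n =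
        (\<Sum>k=0..n. of_nat k * fps_nth T k * fps_nth (poly_fps (pderiv \<phi>) T) (n - k))"
      by (simp only: fps_mult_nth[of "fps_X * fps_deriv T"] X)
    moreover have "fps_nth (poly_fps (pderiv \<phi>) T) k = of_real (c k)" for k
      unfolding T_def fps_nth_poly_fps_of_real c_def ..
    moreover have "fps_nth (poly_fps \<phi> T) n = of_real (fps_nth (poly_fps \<phi> P) n)"
      unfolding T_def fps_nth_poly_fps_of_real by (simp add: fps_nth_inverse)
    moreover have "fps_nth T k = of_real (fps_nth P k)" for k by (simp add: T_def)
    ultimately show ?thesis by (simp add: atLeast0AtMost mult_ac)
  qed
  then show ?thesis unfolding poly_nth by (simp only: of_real_eq_iff)
qed

text \<open>At least n/(16q) indices k of the right class lie between n/4 and 3n/4, and for each of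
  them c_(n-k) k p_k is at least a constant times n^\<alpha>. Together this has order
  n^(1+\<alpha>), an upper bound for the order of the full sum.\<close>

lemma middle_sum_lower: "\<exists>\<delta>>0. \<exists>n1. \<forall>n\<ge>n1.
    \<delta> * (real n * (real (Suc n) * fps_nth P (Suc n))) \<le>
      (\<Sum>k\<in>{k. k \<le> n \<and> 4 * k \<le> 3 * n}. c (n - k) * (fps_nth P k * real k))"
proof -
  obtain C where C: "C > 0" "\<And>n. n \<ge> 1 \<Longrightarrow> fps_nth P n \<le> C * n powr (\<alpha> - 1)" using p_upper by blast
  obtain cp np where cp: "cp > 0" "\<And>n. n \<ge> np \<Longrightarrow> int per dvd int n - 1 \<Longrightarrow> fps_nth P n \<ge> cp * n powr (\<alpha> - 1)"
    using p_lower by blast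
  obtain cc nc where cc: "cc > 0" "\<And>k. k \<ge> nc \<Longrightarrow> int per dvd int k + 1 \<Longrightarrow> c k \<ge> cc" using c_lower by blast
  define q where "q = per"
  have q: "q > 0" using per_pos by (simp add: q_def)
  define \<delta> where "\<delta> = cc * cp / (4 powr \<alpha> * (16 * q) * (2 * C))"
  \<comment> \<open>Large enough for n/(16q) indices to fit in, and for \<open>k\<close> and
    \<open>n - k\<close> to pass the thresholds \<open>np\<close> and \<open>nc\<close>.\<close>
  define n1 where "n1 = 16 * q + 4 * np + 4 * nc + 16"
  have nonneg: "c (n - k) * (fps_nth P k * real k) \<ge> 0" for n k
    using c_nonneg P_nonneg by auto
  show ?thesis
  proof (intro exI[of _ \<delta>] exI[of _ n1] conjI allI impI)
    show "\<delta> > 0" using cc cp C q by (simp add: \<delta>_def)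
    fix n assume n: "n \<ge> n1"
    show "\<delta> * (real n * (real (Suc n) * fps_nth P (Suc n))) \<le>
      (\<Sum>k\<in>{k. k \<le> n \<and> 4 * k \<le> 3 * n}. c (n - k) * (fps_nth P k * real k))"
    proof (cases "fps_nth P (Suc n) = 0")
      case True
      have "0 \<le> (\<Sum>k\<in>{k. k \<le> n \<and> 4 * k \<le> 3 * n}. c (n - k) * (fps_nth P k * real k))"
        by (intro sum_nonneg nonneg)
      then show ?thesis using True by simp
    next
      case False
      then have cls: "int q dvd int n" using p_class[of "Suc n"] by (simp add: q_def)
      \<comment> \<open>Numbers congruent to 1 modulo \<open>q\<close>, starting just above n/4;
        there are at most n/(8q) of them, so they end below 3n/4.\<close>
      define I where "I = (\<lambda>i. q * (n div (4 * q) + 1 + i) + 1) ` {..<n div (8 * q)}"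
      have div1: "q * (4 * (n div (4 * q))) \<le> n" "n < q * (4 * (n div (4 * q))) + 4 * q"
        using div_times_less_eq_dividend[of n "4 * q"] dividend_less_div_times[of "4 * q" n] q
        by (simp_all add: mult_ac)
      have div2: "q * (8 * (n div (8 * q))) \<le> n" "n < q * (8 * (n div (8 * q))) + 8 * q"
        using div_times_less_eq_dividend[of n "8 * q"] dividend_less_div_times[of "8 * q" n] q
        by (simp_all add: mult_ac)
      have I: "4 * k \<ge> n \<and> 4 * k \<le> 3 * n \<and> int q dvd int k - 1" if kI: "k \<in> I" for k
      proof -
        obtain i where i: "i < n div (8 * q)" "k = q * (n div (4 * q) + 1 + i) + 1" using kI by (auto simp: I_def)
        have k: "4 * k = q * (4 * (n div (4 * q))) + 4 * q + 4 * (q * i) + 4"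
          unfolding i(2) by (simp add: algebra_simps)
        have "q * (i + 1) \<le> q * (n div (8 * q))" using i by (intro mult_le_mono) auto
        then have "8 * (q * i) + 8 * q \<le> q * (8 * (n div (8 * q)))" by (simp add: algebra_simps)
        then have "8 * (q * i) + 8 * q \<le> n" using div2 by linarith
        then have "4 * k \<le> 3 * n" "4 * k \<ge> n" using k div1 n by (auto simp: n1_def)
        moreover have "int k - 1 = int q * int (n div (4 * q) + 1 + i)" unfolding i(2) by (simp add: algebra_simps)
        then have "int q dvd int k - 1" by simp
        ultimately show ?thesis by simp
      qed
      have cardI: "card I = n div (8 * q)"
        unfolding I_def using q by (subst card_image) (auto simp: inj_on_def)
      have card_ge: "real n / (16 * q) \<le> real (card I)"
      proof -
        have "real n < real (q * (8 * (n div (8 * q))) + 8 * q)" using div2(2) by (simp only: of_nat_less_iff)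
        then have "real n < 8 * q * real (n div (8 * q)) + 8 * q" by (simp add: mult_ac)
        moreover have "16 * real q \<le> real n" using n by (simp add: n1_def)
        ultimately have "real n < 8 * q * real (n div (8 * q)) + real n / 2" by linarith
        then show ?thesis unfolding cardI using q by (simp add: field_simps)
      qed
      have summand: "cc * cp * (n / 4) powr \<alpha> \<le> c (n - k) * (fps_nth P k * real k)" if "k \<in> I" for k
      proof -
        have k: "4 * k \<ge> n" "4 * k \<le> 3 * n" "int q dvd int k - 1" using I[OF that] by auto
        have k1: "k \<ge> np" "k \<ge> 1" "n - k \<ge> nc" "k \<le> n" using k n by (auto simp: n1_def)
        have "int q dvd int n - (int k - 1)" using cls k(3) by (rule dvd_diff)
        then have "int per dvd int (n - k) + 1" using k1 by (simp add: q_def of_nat_diff algebra_simps)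
        then have 1: "c (n - k) \<ge> cc" using k1 by (intro cc)
        have "(n / 4) powr \<alpha> \<le> real k powr \<alpha>" using k \<alpha>_pos by (intro powr_mono2) auto
        then have "cp * (n / 4) powr \<alpha> \<le> cp * real k powr \<alpha>" using cp by (intro mult_left_mono) auto
        also have "\<dots> = (cp * real k powr (\<alpha> - 1)) * real k" using k1 by (simp add: powr_diff)
        also have "\<dots> \<le> fps_nth P k * real k" using k1 k(3) by (intro mult_right_mono cp) (auto simp: q_def)
        finally have "cp * (n / 4) powr \<alpha> \<le> fps_nth P k * real k" .
        then have "cc * (cp * (n / 4) powr \<alpha>) \<le> c (n - k) * (fps_nth P k * real k)"
          by (rule mult_mono[OF 1]) (use cp(1) c_nonneg in auto)
        then show ?thesis by simp
      qed
      have n0: "real n > 0" using n by (simp add: n1_def)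
      have "real (Suc n) * fps_nth P (Suc n) \<le> real (Suc n) * (C * real (Suc n) powr (\<alpha> - 1))"
        by (intro mult_left_mono C) auto
      also have "\<dots> = C * real (Suc n) powr \<alpha>" by (simp add: powr_diff del: of_nat_Suc)
      also have "\<dots> \<le> C * (2 * real n powr \<alpha>)"
      proof -
        have "real (Suc n) powr \<alpha> \<le> (2 * real n) powr \<alpha>" using n0 \<alpha>_pos by (intro powr_mono2) auto
        also have "\<dots> = 2 powr \<alpha> * real n powr \<alpha>" by (rule powr_mult)
        also have "\<dots> \<le> 2 powr 1 * real n powr \<alpha>" using \<alpha>_le_1 by (intro mult_right_mono powr_mono) auto
        finally show ?thesis using C by (intro mult_left_mono) auto
      qed
      finally have "\<delta> * (real n * (real (Suc n) * fps_nth P (Suc n))) \<le> \<delta> * (real n * (C * (2 * real n powr \<alpha>)))"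
        using cc cp C q by (intro mult_left_mono) (auto simp: \<delta>_def)
      also have "\<dots> = real n / (16 * q) * (cc * cp * (n / 4) powr \<alpha>)"
        using C q by (simp add: \<delta>_def powr_divide field_simps)
      finally have upper: "\<delta> * (real n * (real (Suc n) * fps_nth P (Suc n))) \<le> real n / (16 * q) * (cc * cp * (n / 4) powr \<alpha>)" .
      have "real n / (16 * q) * (cc * cp * (n / 4) powr \<alpha>) \<le> real (card I) * (cc * cp * (n / 4) powr \<alpha>)"
        using card_ge cc cp by (intro mult_right_mono) auto
      also have "\<dots> = (\<Sum>k\<in>I. cc * cp * (n / 4) powr \<alpha>)" by simp
      also have "\<dots> \<le> (\<Sum>k\<in>I. c (n - k) * (fps_nth P k * real k))" by (intro sum_mono summand)
      also have "\<dots> \<le> (\<Sum>k\<in>{k. k \<le> n \<and> 4 * k \<le> 3 * n}. c (n - k) * (fps_nth P k * real k))"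
        using I by (intro sum_mono2 nonneg) fastforce+
      finally show ?thesis using upper by simp
    qed
  qed
qed

end

section \<open>Contraction and induction over the moments\<close>

context inc_variety
begin

text \<open>Against the exact balance at exponent 1, the k-th term gets a factor (k/n)^(\<beta>-1),
  which is at most 1, and at most (3/4)^(1/2) on the range k \<le> 3n/4 that carries a positive
  share. One \<delta> serves all \<beta> \<ge> 3/2, hence all x0 near 1 simultaneously.\<close>

lemma contraction: "\<exists>\<delta>>0. \<delta> \<le> 1 / 2 \<and> (\<exists>n1. \<forall>n\<ge>n1. \<forall>\<beta>\<ge>3/2.
    (\<Sum>k\<le>n. c (n - k) * (fps_nth P k * k powr \<beta>)) \<le> (1 - \<delta>) * (n powr \<beta> * (real (Suc n) * fps_nth P (Suc n))))"
proof -
  obtain \<delta>0 n1 where m: "\<delta>0 > 0" "\<And>n. n \<ge> n1 \<Longrightarrow> \<delta>0 * (real n * (real (Suc n) * fps_nth P (Suc n))) \<le>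
      (\<Sum>k\<in>{k. k \<le> n \<and> 4 * k \<le> 3 * n}. c (n - k) * (fps_nth P k * real k))"
    using middle_sum_lower by blast
  define \<theta> :: real where "\<theta> = (3 / 4) powr (1 / 2)"
  have \<theta>: "\<theta> < 1" unfolding \<theta>_def using powr_less_mono2[of "1/2" "3/4" "1::real"] by simp
  define \<delta> where "\<delta> = min (1 / 2) ((1 - \<theta>) * \<delta>0)"
  have \<delta>: "\<delta> > 0" "\<delta> \<le> 1 / 2" "\<delta> \<le> (1 - \<theta>) * \<delta>0" using \<theta> m by (auto simp: \<delta>_def)
  show ?thesis
  proof (intro exI[of _ \<delta>] conjI \<delta> exI[of _ "max n1 1"] allI impI)
    fix n and \<beta> :: real assume n: "n \<ge> max n1 1" and \<beta>: "\<beta> \<ge> 3 / 2"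
    define a where "a k = c (n - k) * (fps_nth P k * real k)" for k
    define Q where "Q = real (Suc n) * fps_nth P (Suc n)"
    have a: "a k \<ge> 0" for k using c_nonneg P_nonneg by (simp add: a_def)
    have Q: "Q \<ge> 0" using P_nonneg by (simp add: Q_def)
    let ?mid = "{k. k \<le> n \<and> 4 * k \<le> 3 * n}" and ?y = "real n powr (\<beta> - 1)"
    have main: "c (n - k) * (fps_nth P k * k powr \<beta>) \<le> ?y * (a k - (if k \<in> ?mid then (1 - \<theta>) * a k else 0))"
      if k: "k \<le> n" for k
    proof -
      have e: "c (n - k) * (fps_nth P k * k powr \<beta>) = a k * k powr (\<beta> - 1)"
        by (cases "k = 0") (simp_all add: a_def powr_diff)
      show ?thesis
      proof (cases "4 * k \<le> 3 * n")
        case True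
        then have "real (4 * k) \<le> real (3 * n)" by (simp only: of_nat_le_iff)
        then have "real k powr (\<beta> - 1) \<le> (3 / 4 * real n) powr (\<beta> - 1)" using \<beta> by (intro powr_mono2) auto
        also have "\<dots> = (3 / 4) powr (\<beta> - 1) * ?y" by (rule powr_mult)
        also have "\<dots> \<le> \<theta> * ?y" unfolding \<theta>_def using \<beta> by (intro mult_right_mono powr_mono') auto
        finally have "a k * k powr (\<beta> - 1) \<le> a k * (\<theta> * ?y)" by (intro mult_left_mono a)
        then show ?thesis unfolding e using True k by (simp add: algebra_simps)
      next
        case False
        have "real k powr (\<beta> - 1) \<le> ?y" using k \<beta> by (intro powr_mono2) auto
        then have "a k * k powr (\<beta> - 1) \<le> a k * ?y" by (intro mult_left_mono a)
        then show ?thesis unfolding e using False by (simp add: mult.commute)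
      qed
    qed
    have "(\<Sum>k\<le>n. c (n - k) * (fps_nth P k * k powr \<beta>)) \<le> (\<Sum>k\<le>n. ?y * (a k - (if k \<in> ?mid then (1 - \<theta>) * a k else 0)))"
      by (intro sum_mono main) auto
    also have "\<dots> = ?y * ((\<Sum>k\<le>n. a k) - (\<Sum>k\<le>n. if k \<in> ?mid then (1 - \<theta>) * a k else 0))"
      by (simp only: sum_distrib_left[symmetric] sum_subtractf)
    also have "(\<Sum>k\<le>n. a k) = real n * Q" unfolding a_def Q_def by (rule sum_split_eq)
    also have "(\<Sum>k\<le>n. if k \<in> ?mid then (1 - \<theta>) * a k else 0) = (1 - \<theta>) * (\<Sum>k\<in>?mid. a k)"
    proof -
      have "{..n} \<inter> ?mid = ?mid" by auto
      then have "(\<Sum>k\<in>?mid. (1 - \<theta>) * a k) = (\<Sum>k\<le>n. if k \<in> ?mid then (1 - \<theta>) * a k else 0)"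
        using sum.inter_restrict[of "{..n}" "\<lambda>k. (1 - \<theta>) * a k" ?mid] by simp
      then show ?thesis by (simp only: sum_distrib_left)
    qed
    also have "?y * (real n * Q - (1 - \<theta>) * (\<Sum>k\<in>?mid. a k)) \<le> ?y * (real n * Q - \<delta> * (real n * Q))"
    proof (intro mult_left_mono diff_left_mono)
      have "\<delta> * (real n * Q) \<le> (1 - \<theta>) * \<delta>0 * (real n * Q)" using \<delta> Q by (intro mult_right_mono) auto
      also have "\<dots> \<le> (1 - \<theta>) * (\<Sum>k\<in>?mid. a k)"
        using m(2)[of n] n \<theta> unfolding a_def Q_def mult.assoc by (intro mult_left_mono) auto
      finally show "\<delta> * (real n * Q) \<le> (1 - \<theta>) * (\<Sum>k\<in>?mid. a k)" .
    qed simp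
    also have "\<dots> = (1 - \<delta>) * ((?y * real n) * Q)" by (simp add: algebra_simps)
    also have "?y * real n = n powr \<beta>" using n by (simp add: powr_diff)
    finally show "(\<Sum>k\<le>n. c (n - k) * (fps_nth P k * k powr \<beta>)) \<le> (1 - \<delta>) * (n powr \<beta> * (real (Suc n) * fps_nth P (Suc n)))"
      by (simp add: Q_def)
  qed
qed

text \<open>With the guess K p_n n^\<beta> the recursion returns at most the share 1 - \<delta>/2 of
  it; the remaining \<delta>/2 pays for the inhomogeneous term once K \<ge> 2C/\<delta>.\<close>

lemma moment_induct:
  assumes contr: "\<And>n. n \<ge> n1 \<Longrightarrow> (\<Sum>k\<le>n. c (n - k) * (fps_nth P k * k powr \<beta>)) \<le>
      (1 - \<delta>) * (n powr \<beta> * (real (Suc n) * fps_nth P (Suc n)))"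
    and rec: "\<And>n. n \<ge> n1 \<Longrightarrow> real (Suc n) * v (Suc n) \<le> a * (\<Sum>k\<le>n. c (n - k) * v k) + C * (n powr \<beta> * (real (Suc n) * fps_nth P (Suc n)))"
    and init: "\<And>k. k \<le> n1 \<Longrightarrow> v k \<le> K * fps_nth P k"
    and a: "a \<ge> 0" "a * (1 - \<delta>) \<le> 1 - \<delta> / 2" and K: "K \<ge> 0" "C \<le> K * \<delta> / 2" and \<beta>: "\<beta> \<ge> 0"
  shows "v n \<le> K * (fps_nth P n * n powr \<beta>)"
proof (induction n rule: less_induct)
  case (less n)
  show ?case
  proof (cases "n \<le> n1")
    case True
    show ?thesis
    proof (cases "n = 0")
      case True
      then show ?thesis using init[of 0] by (simp add: egf_zero)
    next
      case False
      then have "n powr \<beta> \<ge> 1" using \<beta> by (intro ge_one_powr_ge_zero) auto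
      then have "fps_nth P n * 1 \<le> fps_nth P n * n powr \<beta>" using P_nonneg by (intro mult_left_mono)
      then have "K * fps_nth P n \<le> K * (fps_nth P n * n powr \<beta>)" using K by (intro mult_left_mono) auto
      then show ?thesis using init[OF True] by linarith
    qed
  next
    case False
    then obtain m where m: "n = Suc m" "m \<ge> n1" by (cases n) auto
    define Q where "Q = real (Suc m) * fps_nth P (Suc m)"
    have Q: "Q \<ge> 0" using P_nonneg by (simp add: Q_def)
    have "(\<Sum>k\<le>m. c (m - k) * v k) \<le> (\<Sum>k\<le>m. c (m - k) * (K * (fps_nth P k * k powr \<beta>)))"
      using less m by (intro sum_mono mult_left_mono c_nonneg) auto
    also have "\<dots> = K * (\<Sum>k\<le>m. c (m - k) * (fps_nth P k * k powr \<beta>))"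
      by (simp add: sum_distrib_left mult_ac)
    also have "\<dots> \<le> K * ((1 - \<delta>) * (m powr \<beta> * Q))" unfolding Q_def using contr[OF m(2)] K by (intro mult_left_mono) auto
    finally have "a * (\<Sum>k\<le>m. c (m - k) * v k) \<le> a * (K * ((1 - \<delta>) * (m powr \<beta> * Q)))" using a by (intro mult_left_mono)
    also have "\<dots> = a * (1 - \<delta>) * (K * (m powr \<beta> * Q))" by simp
    also have "\<dots> \<le> (1 - \<delta> / 2) * (K * (m powr \<beta> * Q))" using a K Q by (intro mult_right_mono) auto
    finally have 1: "a * (\<Sum>k\<le>m. c (m - k) * v k) \<le> (1 - \<delta> / 2) * (K * (m powr \<beta> * Q))" .
    have "C * (m powr \<beta> * Q) \<le> (K * \<delta> / 2) * (m powr \<beta> * Q)" using K Q by (intro mult_right_mono) auto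
    then have "real (Suc m) * v (Suc m) \<le> (1 - \<delta> / 2) * (K * (m powr \<beta> * Q)) + (K * \<delta> / 2) * (m powr \<beta> * Q)"
      using rec[OF m(2)] 1 unfolding Q_def by linarith
    also have "\<dots> = K * (m powr \<beta> * Q)" by (simp add: algebra_simps)
    also have "\<dots> \<le> K * (n powr \<beta> * Q)" using K Q m \<beta> by (intro mult_left_mono mult_right_mono powr_mono2) auto
    also have "\<dots> = real (Suc m) * (K * (fps_nth P n * n powr \<beta>))" by (simp add: Q_def m)
    finally have "real (Suc m) * v (Suc m) \<le> real (Suc m) * (K * (fps_nth P n * n powr \<beta>))" .
    then show ?thesis unfolding m by (simp only: mult_le_cancel_left_pos of_nat_0_less_iff zero_less_Suc)
  qed
qed

lemma pderiv_nonneg: "coeff (pderiv \<phi>) j \<ge> 0" "coeff (pderiv (pderiv \<phi>)) j \<ge> 0"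
  using coeff_nonneg by (simp_all add: coeff_pderiv)

lemma \<phi>'_times_le:
  assumes "\<And>k. k \<le> n \<Longrightarrow> fps_nth B k \<le> b * fps_nth P k" "b \<ge> 0"
  shows "fps_nth (poly_fps (pderiv \<phi>) P * B) n \<le> b * (d * (real (Suc n) * fps_nth P (Suc n)))"
proof -
  have "fps_nth (poly_fps (pderiv \<phi>) P * B) n \<le> fps_nth (poly_fps (pderiv \<phi>) P * (fps_const b * P)) n"
    using assms by (intro fps_mult_nth_mono fps_nth_poly_nonneg pderiv_nonneg P_nonneg) auto
  also have "poly_fps (pderiv \<phi>) P * (fps_const b * P) = fps_const b * (poly_fps (pderiv \<phi>) P * P)" by (simp only: mult_ac)
  also have "fps_nth (fps_const b * (poly_fps (pderiv \<phi>) P * P)) n \<le> b * (d * fps_nth (poly_fps \<phi> P) n)"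
    using fps_nth_pderiv_times_le[of \<phi> P n] coeff_nonneg P_nonneg assms(2) unfolding deg
    by (simp add: mult_left_mono)
  finally show ?thesis by (simp only: poly_nth)
qed

lemma \<phi>''_times_le:
  assumes "\<And>k. k \<le> n \<Longrightarrow> fps_nth B k \<le> b * fps_nth P k" "b \<ge> 0"
    and "\<And>k. k \<le> n \<Longrightarrow> fps_nth B' k \<le> b' * fps_nth P k" "b' \<ge> 0" and B: "\<And>k. fps_nth B k \<ge> 0"
  shows "fps_nth (poly_fps (pderiv (pderiv \<phi>)) P * (B * B')) n \<le> b * b' * (real d ^ 2 * (real (Suc n) * fps_nth P (Suc n)))"
proof -
  have "fps_nth (poly_fps (pderiv (pderiv \<phi>)) P * (B * B')) n \<le>
      fps_nth (poly_fps (pderiv (pderiv \<phi>)) P * ((fps_const b * P) * (fps_const b' * P))) n"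
  proof (intro fps_mult_nth_mono fps_nth_poly_nonneg pderiv_nonneg P_nonneg)
    fix k assume k: "k \<le> n"
    have "fps_nth (B * B') k \<le> fps_nth (B * (fps_const b' * P)) k"
      using assms k by (intro fps_mult_nth_mono) auto
    also have "\<dots> = fps_nth ((fps_const b' * P) * B) k" by (simp only: mult.commute)
    also have "\<dots> \<le> fps_nth ((fps_const b' * P) * (fps_const b * P)) k"
      using assms k P_nonneg by (intro fps_mult_nth_mono) auto
    finally show "fps_nth (B * B') k \<le> fps_nth ((fps_const b * P) * (fps_const b' * P)) k"
      by (simp only: mult.commute)
  qed
  also have "poly_fps (pderiv (pderiv \<phi>)) P * ((fps_const b * P) * (fps_const b' * P)) =
      fps_const (b * b') * (poly_fps (pderiv (pderiv \<phi>)) P * (P * P))"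
    by (simp only: mult_ac flip: fps_const_mult)
  also have "fps_nth \<dots> n \<le> b * b' * (real d ^ 2 * fps_nth (poly_fps \<phi> P) n)"
    using fps_nth_pderiv2_times_le[of \<phi> P n] coeff_nonneg P_nonneg assms(2,4) unfolding deg
    by (simp add: mult_left_mono del: fps_const_mult)
  finally show ?thesis by (simp only: poly_nth)
qed

definition Mom :: "nat \<Rightarrow> complex \<Rightarrow> real fps" where "Mom m u = egf \<phi> (\<lambda>t. norm (level_poly u t) ^ m)"

lemma Mom_nonneg: "fps_nth (Mom m u) n \<ge> 0"
  unfolding Mom_def by (rule egf_nonneg) simp

lemma Mom_init: "norm u \<le> 2 \<Longrightarrow> k \<le> n \<Longrightarrow> fps_nth (Mom m u) k \<le> (real n * 2 ^ n) ^ m * fps_nth P k"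
proof -
  assume u: "norm u \<le> 2" and k: "k \<le> n"
  have "fps_nth (Mom m u) k \<le> fps_nth (egf \<phi> (\<lambda>t. (real n * 2 ^ n) ^ m)) k"
    unfolding Mom_def
  proof (intro egf_mono power_mono)
    fix t assume t: "t \<in> inc_trees k"
    have "norm (level_poly u t) \<le> real k * 2 ^ k" by (rule norm_level_poly_le[OF t u])
    also have "\<dots> \<le> real n * 2 ^ n" using k by (intro mult_mono power_increasing) auto
    finally show "norm (level_poly u t) \<le> real n * 2 ^ n" .
  qed simp
  also have "\<dots> = (real n * 2 ^ n) ^ m * fps_nth P k" by (rule egf_cmult_one)
  finally show ?thesis .
qed

lemma expo_bounds:
  assumes "\<bar>x0 - 1\<bar> \<le> 1 / 8" shows "3 / 4 \<le> expo x0" "expo x0 \<le> 5 / 4"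
proof -
  have "\<bar>\<sigma>2 * (x0 - 1)\<bar> \<le> 2 * (1 / 8)"
    unfolding abs_mult using assms \<alpha>_pos \<alpha>_le_1 by (intro mult_mono) (auto simp: \<sigma>2_def)
  then show "3 / 4 \<le> expo x0" "expo x0 \<le> 5 / 4" unfolding expo_def by linarith+
qed

lemma powr_le_one_max: "1 \<le> n \<Longrightarrow> 0 \<le> x \<Longrightarrow> x \<le> y \<Longrightarrow> real n powr x \<le> real n powr y"
  by (intro powr_mono) auto

text \<open>The radius is chosen after \<open>m\<close>: the factor |u|^m \<le> (1+r)^m may consume
  only half of the gain \<delta>.\<close>

lemma growth_choice:
  assumes "\<delta> > 0" "m \<ge> 1"
  shows "\<exists>r>0. r \<le> 1 / 8 \<and> (1 + r) ^ m \<le> 1 + \<delta> / (2::real)"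
proof -
  have "((\<lambda>r. (1 + r) ^ m) \<longlongrightarrow> (1 + 0) ^ m) (at_right (0::real))" by (intro tendsto_intros)
  then have "\<forall>\<^sub>F r in at_right 0. (1 + r) ^ m < 1 + \<delta> / 2" using assms by (intro order_tendstoD(2)) auto
  moreover have "\<forall>\<^sub>F r in at_right (0::real). r \<in> {0<..<1/8}" by (rule eventually_at_right_real) simp
  ultimately have "\<forall>\<^sub>F r in at_right (0::real). r > 0 \<and> r \<le> 1 / 8 \<and> (1 + r) ^ m \<le> 1 + \<delta> / 2"
    by eventually_elim auto
  then show ?thesis using eventually_happens'[of "at_right (0::real)"] by fastforce
qed

text \<open>In the exact identity the mixed term, \<open>M\<close> times its conjugate, is of order
  n^(2x) and the linear ones of order n^x, so the hypothesis on the complex mean is enough; no bound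
  for E|S| is involved.\<close>

lemma second_moment_rec:
  fixes K x :: real and n :: nat
  assumes K: "K \<ge> 0" "\<And>k. norm (fps_nth (egf \<phi> (level_poly u)) k) \<le> K * fps_nth P k * k powr x"
    and u: "norm u \<le> 2" and x: "x \<ge> 0" and n: "n \<ge> 1"
  shows "real (Suc n) * fps_nth (Mom 2 u) (Suc n) \<le> (norm u)\<^sup>2 * (\<Sum>k\<le>n. c (n - k) * fps_nth (Mom 2 u) k) +
    (1 + 4 * K * d + 4 * K\<^sup>2 * d\<^sup>2) * (n powr (2 * x) * (real (Suc n) * fps_nth P (Suc n)))"
proof -
  define M where "M = egf \<phi> (level_poly u)"
  define M' where "M' = egf \<phi> (\<lambda>t. cnj (level_poly u t))"
  define W where "W = egf \<phi> (\<lambda>t. complex_of_real ((norm (level_poly u t))\<^sup>2))"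
  define A where "A = Abs_fps (\<lambda>k. norm (fps_nth M k))"
  define Q where "Q = real (Suc n) * fps_nth P (Suc n)"
  let ?b = "K * n powr x"
  have Q: "Q \<ge> 0" using P_nonneg by (simp add: Q_def)
  have b: "?b \<ge> 0" using K by simp
  have W: "fps_nth W k = of_real (fps_nth (Mom 2 u) k)" for k by (simp add: W_def Mom_def egf_def)
  have "fps_nth M' k = cnj (fps_nth M k)" for k by (simp add: M_def M'_def egf_def)
  then have MA: "norm (fps_nth M k) \<le> fps_nth A k" "norm (fps_nth M' k) \<le> fps_nth A k" for k
    by (simp_all add: A_def)
  have A0: "fps_nth A k \<ge> 0" for k by (simp add: A_def)
  have A: "fps_nth A k \<le> ?b * fps_nth P k" if "k \<le> n" for k
  proof -
    have "K * fps_nth P k * k powr x \<le> K * fps_nth P k * n powr x"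
      using that x K P_nonneg by (intro mult_left_mono powr_mono2) auto
    then show ?thesis using K(2)[of k] by (simp add: A_def M_def mult_ac)
  qed
  have pf: "norm (fps_nth (poly_fps R T) k) \<le> fps_nth (poly_fps R P) k" if "\<And>j. coeff R j \<ge> 0" for R k
    unfolding T_def fps_nth_poly_fps_of_real using fps_nth_poly_nonneg[OF that P_nonneg] by (simp add: fps_nth_inverse)
  have 0: "norm (fps_nth (poly_fps \<phi> T) n) \<le> Q"
    using pf[of \<phi> n] coeff_nonneg by (simp only: poly_nth Q_def)
  have 1: "norm (fps_nth (poly_fps (pderiv \<phi>) T * M) n) \<le> ?b * (d * Q)"
    "norm (fps_nth (poly_fps (pderiv \<phi>) T * M') n) \<le> ?b * (d * Q)"
    unfolding Q_def
    by (rule order.trans[OF norm_fps_mult_nth_le[OF pf MA(1)] \<phi>'_times_le[OF A b]]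
             order.trans[OF norm_fps_mult_nth_le[OF pf MA(2)] \<phi>'_times_le[OF A b]]; simp add: pderiv_nonneg)+
  have 2: "norm (fps_nth (poly_fps (pderiv (pderiv \<phi>)) T * (M * M')) n) \<le> ?b * ?b * (real d ^ 2 * Q)"
    unfolding Q_def
    by (rule order.trans[OF norm_fps_mult_nth_le[OF pf norm_fps_mult_nth_le[OF MA]] \<phi>''_times_le[OF A b A b A0]])
       (simp_all add: pderiv_nonneg)
  have 3: "norm (fps_nth (poly_fps (pderiv \<phi>) T * W) n) \<le> (\<Sum>k\<le>n. c (n - k) * fps_nth (Mom 2 u) k)"
  proof -
    have "norm (fps_nth (poly_fps (pderiv \<phi>) T * W) n) \<le> fps_nth (poly_fps (pderiv \<phi>) P * Mom 2 u) n"
      using Mom_nonneg by (intro norm_fps_mult_nth_le pf) (auto simp: W pderiv_nonneg)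
    also have "\<dots> = fps_nth (Mom 2 u * poly_fps (pderiv \<phi>) P) n" by (simp only: mult.commute)
    finally show ?thesis by (simp add: fps_mult_nth atLeast0AtMost c_eq mult.commute)
  qed
  define D1 where "D1 = fps_nth (poly_fps (pderiv \<phi>) T * M) n"
  define D2 where "D2 = fps_nth (poly_fps (pderiv \<phi>) T * M') n"
  define D3 where "D3 = fps_nth (poly_fps (pderiv \<phi>) T * W) n"
  define D4 where "D4 = fps_nth (poly_fps (pderiv (pderiv \<phi>)) T * (M * M')) n"
  have "of_nat (Suc n) * fps_nth W (Suc n) = fps_nth (poly_fps \<phi> T) n + u * D1 + cnj u * D2 + of_real ((norm u)\<^sup>2) * (D3 + D4)"
    unfolding W_def M_def M'_def T_eq egf_square_rec D1_def D2_def D3_def D4_def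
    by (simp only: fps_add_nth fps_mult_left_const_nth)
  then have "real (Suc n) * fps_nth (Mom 2 u) (Suc n) =
      norm (fps_nth (poly_fps \<phi> T) n + u * D1 + cnj u * D2 + of_real ((norm u)\<^sup>2) * (D3 + D4))"
    using Mom_nonneg[of 2 u "Suc n"] unfolding W by (metis abs_of_nonneg mult_nonneg_nonneg norm_of_real of_nat_0_le_iff of_real_mult of_real_of_nat_eq)
  also have "\<dots> \<le> norm (fps_nth (poly_fps \<phi> T) n) + norm (u * D1) + norm (cnj u * D2) + norm (of_real ((norm u)\<^sup>2) * (D3 + D4))"
    by (intro order.trans[OF norm_triangle_ineq] add_mono order.refl)
  also have "\<dots> \<le> Q + 2 * (?b * (d * Q)) + 2 * (?b * (d * Q)) +
      ((norm u)\<^sup>2 * (\<Sum>k\<le>n. c (n - k) * fps_nth (Mom 2 u) k) + 4 * (?b * ?b * (real d ^ 2 * Q)))"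
  proof (intro add_mono 0)
    show "norm (u * D1) \<le> 2 * (?b * (d * Q))" "norm (cnj u * D2) \<le> 2 * (?b * (d * Q))"
      unfolding norm_mult D1_def D2_def using 1 u by (auto intro!: mult_mono)
    have "norm (of_real ((norm u)\<^sup>2) * (D3 + D4)) = (norm u)\<^sup>2 * norm (D3 + D4)" by (simp add: norm_mult norm_power)
    also have "\<dots> \<le> (norm u)\<^sup>2 * norm D3 + (norm u)\<^sup>2 * norm D4"
      using mult_left_mono[OF norm_triangle_ineq[of D3 D4], of "(norm u)\<^sup>2"] by (simp add: distrib_left)
    also have "\<dots> \<le> (norm u)\<^sup>2 * (\<Sum>k\<le>n. c (n - k) * fps_nth (Mom 2 u) k) + 4 * (?b * ?b * (real d ^ 2 * Q))"
    proof (intro add_mono mult_mono)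
      show "(norm u)\<^sup>2 \<le> 4" using power_mono[OF u, of 2] by simp
    qed (use 2 3 in \<open>auto simp: D3_def D4_def\<close>)
    finally show "norm (of_real ((norm u)\<^sup>2) * (D3 + D4)) \<le>
      (norm u)\<^sup>2 * (\<Sum>k\<le>n. c (n - k) * fps_nth (Mom 2 u) k) + 4 * (?b * ?b * (real d ^ 2 * Q))" .
  qed
  also have "\<dots> = (norm u)\<^sup>2 * (\<Sum>k\<le>n. c (n - k) * fps_nth (Mom 2 u) k) +
      (1 + 4 * K * d * n powr x + 4 * K\<^sup>2 * d\<^sup>2 * n powr (2 * x)) * Q"
    using powr_add[of "real n" x x] by (simp add: algebra_simps power2_eq_square)
  also have "(1 + 4 * K * d * n powr x + 4 * K\<^sup>2 * d\<^sup>2 * n powr (2 * x)) * Q \<le>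
      ((1 + 4 * K * d + 4 * K\<^sup>2 * d\<^sup>2) * n powr (2 * x)) * Q"
  proof (intro mult_right_mono Q)
    have "n powr 0 \<le> n powr (2 * x)" "n powr x \<le> n powr (2 * x)" using n x by (intro powr_le_one_max; simp)+
    then have "1 \<le> 1 * n powr (2 * x)" "4 * K * d * n powr x \<le> 4 * K * d * n powr (2 * x)"
      using n K by (simp, intro mult_left_mono, auto)
    then show "1 + 4 * K * d * n powr x + 4 * K\<^sup>2 * d\<^sup>2 * n powr (2 * x) \<le> (1 + 4 * K * d + 4 * K\<^sup>2 * d\<^sup>2) * n powr (2 * x)"
      unfolding distrib_right by linarith
  qed
  finally show ?thesis by (simp add: Q_def)
qed

text \<open>\<open>x0\<close> is an upper bound for \<open>Re u\<close> rather than
  \<open>Re u\<close> itself, because on the unit circle \<open>Re u\<close> goes down to -1 while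
  the estimates are proved for exponents with x0 near 1. The radius may depend on \<open>m\<close>;
  \<open>K\<close> is uniform in \<open>u\<close>, \<open>x0\<close> and \<open>n\<close>.\<close>

definition moment_bound :: "nat \<Rightarrow> bool" where
  "moment_bound m \<longleftrightarrow> (\<exists>r::real>0. \<exists>K::real\<ge>0. \<forall>u x0 n. norm u \<le> 1 + r \<longrightarrow> Re u \<le> x0 \<longrightarrow> \<bar>x0 - 1\<bar> \<le> r \<longrightarrow>
     fps_nth (Mom m u) n \<le> K * (fps_nth P n * n powr (m * expo x0)))"

text \<open>The closing argument common to all m \<ge> 2: for |x0 - 1| \<le> 1/8 the exponent m
  \<open>expo x0\<close> is at least 2 times 3/4, which is the threshold of the contraction.\<close>

lemma moment_step:
  assumes m: "m \<ge> 2" and r1: "r1 > 0"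
    and rec: "\<And>u x0 n. norm u \<le> 1 + r1 \<Longrightarrow> norm u \<le> 2 \<Longrightarrow> Re u \<le> x0 \<Longrightarrow> \<bar>x0 - 1\<bar> \<le> r1 \<Longrightarrow> \<bar>x0 - 1\<bar> \<le> 1 / 8 \<Longrightarrow> n \<ge> 1 \<Longrightarrow>
      real (Suc n) * fps_nth (Mom m u) (Suc n) \<le> norm u ^ m * (\<Sum>k\<le>n. c (n - k) * fps_nth (Mom m u) k) +
        C * (n powr (m * expo x0) * (real (Suc n) * fps_nth P (Suc n)))"
  shows "moment_bound m"
proof -
  obtain \<delta> n1 where \<delta>: "\<delta> > 0" "\<delta> \<le> 1 / 2" "\<And>n \<beta>. n \<ge> n1 \<Longrightarrow> \<beta> \<ge> 3/2 \<Longrightarrow>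
    (\<Sum>k\<le>n. c (n - k) * (fps_nth P k * k powr \<beta>)) \<le> (1 - \<delta>) * (n powr \<beta> * (real (Suc n) * fps_nth P (Suc n)))"
    using contraction by blast
  obtain r2 where r2: "r2 > 0" "r2 \<le> 1 / 8" "(1 + r2) ^ m \<le> 1 + \<delta> / 2" using growth_choice[OF \<delta>(1), of m] m by auto
  define r where "r = min r1 r2"
  have r: "r > 0" "r \<le> r1" "r \<le> r2" "r \<le> 1 / 8" using r1 r2 by (auto simp: r_def)
  define N where "N = max n1 1"
  \<comment> \<open>The first entry covers the sizes up to \<open>N\<close> by the crude bound for
    S(u), the second leaves room for \<open>C\<close> in the induction.\<close>
  define K where "K = max ((real N * 2 ^ N) ^ m) (2 * C / \<delta>)"
  have K: "K \<ge> (real N * 2 ^ N) ^ m" "2 * C / \<delta> \<le> K" by (auto simp: K_def)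
  have K0: "K \<ge> 0" by (rule order.trans[OF _ K(1)]) simp
  show ?thesis unfolding moment_bound_def
  proof (rule exI[of _ r], rule conjI[OF r(1)], rule exI[of _ K], rule conjI[OF K0], intro allI impI)
    fix u :: complex and x0 :: real and n :: nat assume u: "norm u \<le> 1 + r" "Re u \<le> x0" "\<bar>x0 - 1\<bar> \<le> r"
    have u2: "norm u \<le> 2" "norm u \<le> 1 + r1" "\<bar>x0 - 1\<bar> \<le> r1" "\<bar>x0 - 1\<bar> \<le> 1 / 8" using u r by auto
    have ex: "3 / 4 \<le> expo x0" using expo_bounds[OF u2(4)] by simp
    have "2 * (3 / 4) \<le> real m * expo x0" using m ex by (intro mult_mono) auto
    then have \<beta>: "3 / 2 \<le> real m * expo x0" by simp
    show "fps_nth (Mom m u) n \<le> K * (fps_nth P n * n powr (m * expo x0))"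
    proof (rule moment_induct[where v = "fps_nth (Mom m u)" and a = "norm u ^ m" and ?n1.0 = N and \<delta> = \<delta> and C = C])
      fix n assume "n \<ge> N"
      then have n: "n \<ge> n1" "n \<ge> 1" by (auto simp: N_def)
      show "(\<Sum>k\<le>n. c (n - k) * (fps_nth P k * k powr (m * expo x0))) \<le>
        (1 - \<delta>) * (n powr (m * expo x0) * (real (Suc n) * fps_nth P (Suc n)))"
        by (rule \<delta>(3)[OF n(1) \<beta>])
      show "real (Suc n) * fps_nth (Mom m u) (Suc n) \<le> norm u ^ m * (\<Sum>k\<le>n. c (n - k) * fps_nth (Mom m u) k) +
        C * (n powr (m * expo x0) * (real (Suc n) * fps_nth P (Suc n)))"
        by (rule rec[OF u2(2,1) u(2) u2(3,4) n(2)])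
    next
      fix k assume "k \<le> N"
      then have "fps_nth (Mom m u) k \<le> (real N * 2 ^ N) ^ m * fps_nth P k" by (rule Mom_init[OF u2(1)])
      also have "\<dots> \<le> K * fps_nth P k" using K(1) P_nonneg by (rule mult_right_mono)
      finally show "fps_nth (Mom m u) k \<le> K * fps_nth P k" .
    next
      have "norm u ^ m \<le> (1 + r2) ^ m" using u r by (intro power_mono) auto
      then have "norm u ^ m * (1 - \<delta>) \<le> (1 + \<delta> / 2) * (1 - \<delta>)" using r2 \<delta> by (intro mult_right_mono) auto
      also have "\<dots> \<le> 1 - \<delta> / 2" using \<delta> by (simp add: algebra_simps)
      finally show "norm u ^ m * (1 - \<delta>) \<le> 1 - \<delta> / 2" .
      show "C \<le> K * \<delta> / 2" using K(2) \<delta> by (simp add: field_simps)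
    qed (use K0 \<beta> in auto)
  qed
qed

lemma moment_bound_2: "moment_bound 2"
proof -
  obtain K where K: "K \<ge> 0" "\<And>u x0 n. norm u \<le> 2 \<Longrightarrow> Re u \<le> x0 \<Longrightarrow> \<bar>x0 - 1\<bar> \<le> \<alpha> / 4 \<Longrightarrow>
    norm (fps_nth (egf \<phi> (level_poly u)) n) \<le> K * fps_nth P n * n powr expo x0"
    using level_mean_bound by blast
  show ?thesis
  proof (rule moment_step[where ?r1.0 = "\<alpha> / 4" and C = "1 + 4 * K * d + 4 * K\<^sup>2 * d\<^sup>2"])
    fix u :: complex and x0 :: real and n :: nat assume u: "norm u \<le> 2" "Re u \<le> x0" "\<bar>x0 - 1\<bar> \<le> \<alpha> / 4" "\<bar>x0 - 1\<bar> \<le> 1 / 8" "n \<ge> (1 :: nat)"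
    have "expo x0 \<ge> 0" using expo_bounds[OF u(4)] by simp
    then show "real (Suc n) * fps_nth (Mom 2 u) (Suc n) \<le> norm u ^ 2 * (\<Sum>k\<le>n. c (n - k) * fps_nth (Mom 2 u) k) +
        (1 + 4 * K * d + 4 * K\<^sup>2 * d\<^sup>2) * (n powr (real 2 * expo x0) * (real (Suc n) * fps_nth P (Suc n)))"
      using second_moment_rec[OF K(1) K(2)[OF u(1,2,3)] u(1) _ u(5)] by simp
  qed (use \<alpha>_pos in auto)
qed

text \<open>For x0 near 1 the exponent \<open>expo x0\<close> is below the threshold 3/2 of the
  contraction, so the first absolute moment is deduced from the second and not from a recursion of
  its own.\<close>

lemma moment_bound_1: "moment_bound 1"
proof -
  obtain r K where rK: "r > 0" "K \<ge> 0" "\<And>u x0 n. norm u \<le> 1 + r \<Longrightarrow> Re u \<le> x0 \<Longrightarrow> \<bar>x0 - 1\<bar> \<le> r \<Longrightarrow>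
     fps_nth (Mom 2 u) n \<le> K * (fps_nth P n * n powr (real 2 * expo x0))"
    using moment_bound_2 unfolding moment_bound_def by blast
  show ?thesis unfolding moment_bound_def
  proof (rule exI[of _ r], rule conjI[OF rK(1)], rule exI[of _ "1 + K"], rule conjI, (use rK in simp), intro allI impI)
    fix u :: complex and x0 :: real and n :: nat assume u: "norm u \<le> 1 + r" "Re u \<le> x0" "\<bar>x0 - 1\<bar> \<le> r"
    let ?y = "n powr expo x0"
    show "fps_nth (Mom 1 u) n \<le> (1 + K) * (fps_nth P n * n powr (real 1 * expo x0))"
    proof (cases "n = 0")
      case True
      then show ?thesis by (simp add: Mom_def egf_zero)
    next
      case False
      then have y: "?y > 0" by simp
      text \<open>\<open>|S| \<le> y + |S|\<^sup>2 / y\<close> with \<open>y\<close> the expected order of \<open>|S|\<close>\<close>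
      have "fps_nth (Mom 1 u) n \<le> fps_nth (egf \<phi> (\<lambda>t. ?y + norm (level_poly u t) ^ 2 / ?y)) n"
        unfolding Mom_def
      proof (intro egf_mono)
        fix s :: otree
        define a where "a = norm (level_poly u s)"
        have "0 \<le> a * ?y" by (simp add: a_def)
        then have "a * ?y \<le> ?y * ?y + a\<^sup>2" using sum_squares_bound[of a ?y] unfolding power2_eq_square by linarith
        then show "norm (level_poly u s) ^ 1 \<le> ?y + norm (level_poly u s) ^ 2 / ?y"
          using y by (simp add: a_def field_simps)
      qed
      also have "\<dots> = ?y * fps_nth P n + fps_nth (Mom 2 u) n / ?y"
        by (simp add: egf_def Mom_def distrib_left sum.distrib add_divide_distrib sum_distrib_left sum_divide_distrib mult_ac)
      also have "\<dots> \<le> ?y * fps_nth P n + K * (fps_nth P n * ?y)"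
      proof -
        have "fps_nth (Mom 2 u) n / ?y \<le> K * (fps_nth P n * n powr (real 2 * expo x0)) / ?y"
          using rK(3)[OF u, of n] by (intro divide_right_mono) auto
        also have "\<dots> = K * (fps_nth P n * ?y)"
          using y powr_add[of "real n" "expo x0" "expo x0"] by simp
        finally show ?thesis by simp
      qed
      finally show ?thesis by (simp add: algebra_simps)
    qed
  qed
qed

text \<open>The product of the moments of orders m and 1 has exactly the order n^((m+1)
  \<open>expo x0\<close>) of the claim, and the other error terms are smaller. The 3 in the constant
  bounds 1 + |u|.\<close>

lemma moment_bound_Suc:
  assumes "moment_bound m" "m \<ge> 2"
  shows "moment_bound (Suc m)"
proof -
  obtain r1 K1 where 1: "r1 > 0" "K1 \<ge> 0" "\<And>u x0 n. norm u \<le> 1 + r1 \<Longrightarrow> Re u \<le> x0 \<Longrightarrow> \<bar>x0 - 1\<bar> \<le> r1 \<Longrightarrow>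
     fps_nth (Mom 1 u) n \<le> K1 * (fps_nth P n * n powr (real 1 * expo x0))"
    using moment_bound_1 unfolding moment_bound_def by blast
  obtain r2 K2 where 2: "r2 > 0" "K2 \<ge> 0" "\<And>u x0 n. norm u \<le> 1 + r2 \<Longrightarrow> Re u \<le> x0 \<Longrightarrow> \<bar>x0 - 1\<bar> \<le> r2 \<Longrightarrow>
     fps_nth (Mom m u) n \<le> K2 * (fps_nth P n * n powr (m * expo x0))"
    using assms(1) unfolding moment_bound_def by blast
  define A where "A = real (Suc m) * real (Suc d) ^ m * 3 ^ Suc m"
  define C where "C = A * (1 + K1 * d + K2 * d + K2 * K1 * d\<^sup>2)"
  have A: "A \<ge> 0" by (simp add: A_def)
  show ?thesis
  proof (rule moment_step[where ?r1.0 = "min r1 r2" and C = C])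
    fix u :: complex and x0 :: real and n :: nat assume u: "norm u \<le> 1 + min r1 r2" "norm u \<le> 2" "Re u \<le> x0" "\<bar>x0 - 1\<bar> \<le> min r1 r2" "\<bar>x0 - 1\<bar> \<le> 1 / 8" "n \<ge> (1 :: nat)"
    define x where "x = expo x0"
    have x: "x \<ge> 0" using expo_bounds[OF u(5)] by (simp add: x_def)
    define Q where "Q = real (Suc n) * fps_nth P (Suc n)"
    have Q: "Q \<ge> 0" using P_nonneg by (simp add: Q_def)
    have V1: "fps_nth (Mom 1 u) k \<le> K1 * n powr x * fps_nth P k" if "k \<le> n" for k
    proof -
      have "fps_nth (Mom 1 u) k \<le> K1 * (fps_nth P k * k powr x)" using 1(3)[of u x0 k] u by (simp add: x_def)
      also have "\<dots> \<le> K1 * (fps_nth P k * n powr x)"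
        using that x 1 P_nonneg by (intro mult_left_mono powr_mono2) auto
      finally show ?thesis by (simp add: mult_ac)
    qed
    have Vm: "fps_nth (Mom m u) k \<le> K2 * n powr (m * x) * fps_nth P k" if "k \<le> n" for k
    proof -
      have "fps_nth (Mom m u) k \<le> K2 * (fps_nth P k * k powr (m * x))" using 2(3)[of u x0 k] u by (simp add: x_def)
      also have "\<dots> \<le> K2 * (fps_nth P k * n powr (m * x))"
        using that x 2 P_nonneg by (intro mult_left_mono powr_mono2) auto
      finally show ?thesis by (simp add: mult_ac)
    qed
    define S where "S = (\<Sum>k\<le>n. c (n - k) * fps_nth (Mom (Suc m) u) k)"
    define y where "y = n powr (Suc m * x)"
    have y1: "n powr x \<le> y" "n powr (m * x) \<le> y" "1 \<le> y"
    proof -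
      have "1 * x \<le> real (Suc m) * x" "real m * x \<le> real (Suc m) * x" using x by (intro mult_right_mono; simp)+
      then show "n powr x \<le> y" "n powr (m * x) \<le> y" unfolding y_def using u x by (intro powr_le_one_max; simp)+
      show "1 \<le> y" unfolding y_def using u x by (intro ge_one_powr_ge_zero) auto
    qed
    have yy: "n powr (m * x) * n powr x = y" by (simp add: y_def distrib_right add.commute flip: powr_add)
    have rec: "real (Suc n) * fps_nth (Mom (Suc m) u) (Suc n) \<le>
       norm u ^ Suc m * fps_nth (poly_fps (pderiv \<phi>) P * Mom (Suc m) u) n +
       real (Suc m) * real (Suc d) ^ m * (1 + norm u) ^ Suc m *
       (fps_nth (poly_fps \<phi> P) n + fps_nth (poly_fps (pderiv \<phi>) P * Mom 1 u) n + fps_nth (poly_fps (pderiv \<phi>) P * Mom m u) n +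
         fps_nth (poly_fps (pderiv (pderiv \<phi>)) P * (Mom m u * Mom 1 u)) n)"
      using egf_power_rec[where m = "Suc m" and \<phi> = \<phi> and u = u and n = n] coeff_nonneg
      unfolding Mom_def[symmetric] by (simp only: fps_add_nth fps_mult_left_const_nth diff_Suc_1 deg le_add1 plus_1_eq_Suc simp_thms)
    have S: "fps_nth (poly_fps (pderiv \<phi>) P * Mom (Suc m) u) n = S"
      unfolding S_def mult.commute[of "poly_fps _ _"] by (simp add: fps_mult_nth atLeast0AtMost c_eq mult.commute)
    have E: "fps_nth (poly_fps \<phi> P) n + fps_nth (poly_fps (pderiv \<phi>) P * Mom 1 u) n + fps_nth (poly_fps (pderiv \<phi>) P * Mom m u) n +
         fps_nth (poly_fps (pderiv (pderiv \<phi>)) P * (Mom m u * Mom 1 u)) n \<le>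
       y * Q + K1 * y * (d * Q) + K2 * y * (d * Q) + K2 * K1 * y * (real d ^ 2 * Q)"
    proof (intro add_mono)
      show "fps_nth (poly_fps \<phi> P) n \<le> y * Q" unfolding poly_nth Q_def[symmetric] using y1 Q mult_right_mono[of 1 y Q] by simp
      have "fps_nth (poly_fps (pderiv \<phi>) P * Mom 1 u) n \<le> K1 * n powr x * (d * Q)"
        unfolding Q_def using 1 by (intro \<phi>'_times_le V1) auto
      also have "\<dots> \<le> K1 * y * (d * Q)" using y1 1 Q by (intro mult_right_mono mult_left_mono) auto
      finally show "fps_nth (poly_fps (pderiv \<phi>) P * Mom 1 u) n \<le> K1 * y * (d * Q)" .
      have "fps_nth (poly_fps (pderiv \<phi>) P * Mom m u) n \<le> K2 * n powr (m * x) * (d * Q)"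
        unfolding Q_def using 2 by (intro \<phi>'_times_le Vm) auto
      also have "\<dots> \<le> K2 * y * (d * Q)" using y1 2 Q by (intro mult_right_mono mult_left_mono) auto
      finally show "fps_nth (poly_fps (pderiv \<phi>) P * Mom m u) n \<le> K2 * y * (d * Q)" .
      have "fps_nth (poly_fps (pderiv (pderiv \<phi>)) P * (Mom m u * Mom 1 u)) n \<le>
          (K2 * n powr (m * x)) * (K1 * n powr x) * (real d ^ 2 * Q)"
        unfolding Q_def using 1 2 by (intro \<phi>''_times_le Vm V1 Mom_nonneg) auto
      also have "\<dots> = K2 * K1 * (n powr (m * x) * n powr x) * (real d ^ 2 * Q)" by (simp only: mult_ac)
      finally show "fps_nth (poly_fps (pderiv (pderiv \<phi>)) P * (Mom m u * Mom 1 u)) n \<le> K2 * K1 * y * (real d ^ 2 * Q)"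
        unfolding yy .
    qed
    have coef: "real (Suc m) * real (Suc d) ^ m * (1 + norm u) ^ Suc m \<le> A"
      unfolding A_def using u by (intro mult_left_mono power_mono) auto
    have "real (Suc n) * fps_nth (Mom (Suc m) u) (Suc n) \<le> norm u ^ Suc m * S +
      A * (y * Q + K1 * y * (d * Q) + K2 * y * (d * Q) + K2 * K1 * y * (real d ^ 2 * Q))"
      using rec unfolding S
      by (rule order.trans, intro add_left_mono mult_mono coef E A add_nonneg_nonneg)
         (auto intro!: fps_nth_poly_nonneg coeff_nonneg P_nonneg
           simp: fps_mult_nth intro!: sum_nonneg mult_nonneg_nonneg Mom_nonneg pderiv_nonneg)
    also have "A * (y * Q + K1 * y * (d * Q) + K2 * y * (d * Q) + K2 * K1 * y * (real d ^ 2 * Q)) = C * (y * Q)"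
      by (simp add: C_def algebra_simps)
    finally show "real (Suc n) * fps_nth (Mom (Suc m) u) (Suc n) \<le> norm u ^ Suc m * (\<Sum>k\<le>n. c (n - k) * fps_nth (Mom (Suc m) u) k) +
        C * (n powr (Suc m * expo x0) * (real (Suc n) * fps_nth P (Suc n)))"
      unfolding S_def y_def x_def Q_def .
  qed (use 1 2 assms in auto)
qed

lemma moment_bounds: "m \<ge> 1 \<Longrightarrow> moment_bound m"
proof (induction m rule: nat_induct_at_least)
  case base
  then show ?case by (rule moment_bound_1)
next
  case (Suc m)
  then show ?case using moment_bound_2 moment_bound_Suc[of m] by (cases "m = 1") (auto simp: numeral_2_eq_2)
qed

end

section \<open>Poisson probabilities\<close>

text \<open>Correct through second order at 0, like the upper bound below; a first-order inequality
  would not make the Stirling increments summable.\<close>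

lemma ln_one_plus_lower: "0 \<le> x \<Longrightarrow> 2 * x / (2 + x) \<le> ln (1 + x)" for x :: real
proof -
  assume x: "0 \<le> x"
  have "ln (1 + 0) - 2 * 0 / (2 + 0) \<le> ln (1 + x) - 2 * x / (2 + x)"
  proof (rule DERIV_nonneg_imp_nondecreasing[OF x])
    fix y :: real assume y: "0 \<le> y" "y \<le> x"
    have "1 / (1 + y) - (2 * (2 + y) - 2 * y) / ((2 + y) * (2 + y)) = y\<^sup>2 / ((1 + y) * (2 + y)\<^sup>2)"
      using y by (simp add: divide_simps add_eq_0_iff) (simp add: algebra_simps power2_eq_square)
    moreover have "((\<lambda>x. ln (1 + x) - 2 * x / (2 + x)) has_real_derivative
        (1 / (1 + y) - (2 * (2 + y) - 2 * y) / ((2 + y) * (2 + y)))) (at y)"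
      using y by (auto intro!: derivative_eq_intros)
    ultimately show "\<exists>D. ((\<lambda>x. ln (1 + x) - 2 * x / (2 + x)) has_real_derivative D) (at y) \<and> D \<ge> 0"
      using y by (intro exI[of _ "y\<^sup>2 / ((1 + y) * (2 + y)\<^sup>2)"]) simp
  qed
  then show ?thesis by simp
qed

lemma ln_one_plus_upper: "0 \<le> x \<Longrightarrow> ln (1 + x) \<le> x * (2 + x) / (2 * (1 + x))" for x :: real
proof -
  assume x: "0 \<le> x"
  have "0 * (2 + 0) / (2 * (1 + 0)) - ln (1 + 0) \<le> x * (2 + x) / (2 * (1 + x)) - ln (1 + x)"
  proof (rule DERIV_nonneg_imp_nondecreasing[OF x])
    fix y :: real assume y: "0 \<le> y" "y \<le> x"
    have "((2 + 2 * y) * (2 * (1 + y)) - y * (2 + y) * 2) / ((2 * (1 + y)) * (2 * (1 + y))) - 1 / (1 + y) =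
        y\<^sup>2 / (2 * (1 + y)\<^sup>2)"
      using y by (simp add: divide_simps add_eq_0_iff) (simp add: algebra_simps power2_eq_square)
    moreover have "((\<lambda>x. x * (2 + x) / (2 * (1 + x)) - ln (1 + x)) has_real_derivative
        (((2 + 2 * y) * (2 * (1 + y)) - y * (2 + y) * 2) / ((2 * (1 + y)) * (2 * (1 + y))) - 1 / (1 + y))) (at y)"
      using y by (auto intro!: derivative_eq_intros simp: algebra_simps)
    ultimately show "\<exists>D. ((\<lambda>x. x * (2 + x) / (2 * (1 + x)) - ln (1 + x)) has_real_derivative D) (at y) \<and> D \<ge> 0"
      using y by (intro exI[of _ "y\<^sup>2 / (2 * (1 + y)\<^sup>2)"]) simp
  qed
  then show ?thesis by simp
qed

text \<open>The logarithm of k! e^k / (k^k sqrt k), whose limit is log sqrt(2 pi).\<close>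

definition stirling_ln :: "nat \<Rightarrow> real" where
  "stirling_ln k = ln (fact k) + real k - (real k + 1 / 2) * ln (real k)"

text \<open>A decreasing sequence that becomes increasing after subtraction of 1/(4k) encloses its
  limit with that error.\<close>

lemma stirling_ln_step:
  assumes "k \<ge> 1"
  shows "stirling_ln (Suc k) \<le> stirling_ln k"
    and "stirling_ln k - 1 / (4 * real k) \<le> stirling_ln (Suc k) - 1 / (4 * real (Suc k))"
proof -
  define x where "x = real k"
  have x: "x \<ge> 1" using assms by (simp add: x_def)
  have "1 + x = x * (1 + 1 / x)" "1 + 1 / x > 0" using x by (auto simp: field_simps add_pos_pos)
  then have "ln (1 + x) = ln x + ln (1 + 1 / x)" using x ln_mult_pos[of x "1 + 1 / x"] by simp
  moreover have "ln (fact (Suc k)) = ln (1 + x) + ln (fact k)"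
    unfolding fact_Suc x_def by (subst ln_mult) auto
  ultimately have eq: "stirling_ln k - stirling_ln (Suc k) = (x + 1 / 2) * ln (1 + 1 / x) - 1"
    by (simp add: stirling_ln_def x_def algebra_simps)
  have "(x + 1 / 2) * (2 * (1 / x) / (2 + 1 / x)) \<le> (x + 1 / 2) * ln (1 + 1 / x)"
    using x by (intro mult_left_mono ln_one_plus_lower) auto
  moreover have "(x + 1 / 2) * (2 * (1 / x) / (2 + 1 / x)) = 1" using x by (simp add: divide_simps add_eq_0_iff)
  ultimately show "stirling_ln (Suc k) \<le> stirling_ln k" using eq by linarith
  have "(x + 1 / 2) * ln (1 + 1 / x) \<le> (x + 1 / 2) * (1 / x * (2 + 1 / x) / (2 * (1 + 1 / x)))"
    using x by (intro mult_left_mono ln_one_plus_upper) auto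
  also have "\<dots> = 1 + (1 / (4 * x) - 1 / (4 * (x + 1)))"
    using x by (simp add: divide_simps add_eq_0_iff) (simp add: algebra_simps)
  finally show "stirling_ln k - 1 / (4 * real k) \<le> stirling_ln (Suc k) - 1 / (4 * real (Suc k))"
    using eq by (simp add: x_def add.commute)
qed

lemma wallis_product: "(\<Prod>k=1..n. (4*real k^2) / (4*real k^2 - 1)) = 2 ^ (4 * n) * fact n ^ 4 / (fact (2 * n) ^ 2 * (2 * real n + 1))"
proof (induction n)
  case (Suc n)
  define a where "a = (fact n :: real)"
  define b where "b = (fact (2 * n) :: real)"
  define z where "z = real n"
  have z: "z \<ge> 0" by (simp add: z_def)
  have f1: "fact (Suc n) = (z + 1) * a" by (simp add: a_def z_def)
  have "fact (2 * Suc n) = real (2 * n + 2) * (real (2 * n + 1) * fact (2 * n))" by (simp add: algebra_simps)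
  then have f2: "fact (2 * Suc n) = (2 * z + 2) * ((2 * z + 1) * b)" by (simp add: b_def z_def add.commute)
  have b: "b > 0" by (simp add: b_def)
  have e: "4 * (z + 1)\<^sup>2 - 1 = (2 * z + 1) * (2 * z + 3)" by (simp add: power2_eq_square algebra_simps)
  have "(\<Prod>k=1..Suc n. (4*real k^2) / (4*real k^2 - 1)) = 2 ^ (4 * n) * a ^ 4 / (b ^ 2 * (2 * z + 1)) * ((4 * (z + 1)\<^sup>2) / (4 * (z + 1)\<^sup>2 - 1))"
    using Suc.IH by (simp add: a_def b_def z_def add.commute)
  also have "\<dots> = 16 * 2 ^ (4 * n) * ((z + 1) * a) ^ 4 / (((2 * z + 2) * ((2 * z + 1) * b)) ^ 2 * (2 * z + 3))"
    unfolding e using z b by (simp add: divide_simps) algebra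
  also have "\<dots> = 2 ^ (4 * Suc n) * fact (Suc n) ^ 4 / (fact (2 * Suc n) ^ 2 * (2 * real (Suc n) + 1))"
    unfolding f1 f2 by (simp add: z_def power_add add.commute)
  finally show ?case .
qed simp

text \<open>In 2 \<open>stirling_ln k\<close> - \<open>stirling_ln (2 * k)\<close> the powers k^k
  and e^k cancel and (k!)^2/(2k)! remains, so Wallis' product evaluates its limit, which is the
  limit of \<open>stirling_ln\<close> itself.\<close>

lemma stirling_ln_bounds:
  assumes "k \<ge> 1"
  shows "ln (2 * pi) / 2 \<le> stirling_ln k" "stirling_ln k \<le> ln (2 * pi) / 2 + 1 / (4 * real k)"
proof -
  define f where "f k = stirling_ln (Suc k)" for k
  have dec: "decseq f" unfolding decseq_Suc_iff f_def using stirling_ln_step(1) by simp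
  have inc: "incseq (\<lambda>k. f k - 1 / (4 * real (Suc k)))"
    unfolding incseq_Suc_iff f_def by (intro allI) (rule stirling_ln_step(2), simp)
  have "f 0 - 1 / 4 \<le> f k" for k
  proof -
    have "f 0 - 1 / 4 \<le> f k - 1 / (4 * real (Suc k))" using incseqD[OF inc, of 0 k] by simp
    also have "\<dots> \<le> f k" by simp
    finally show ?thesis .
  qed
  then obtain l where l: "f \<longlonglongrightarrow> l" using decseq_convergent[OF dec] by blast
  have "(\<lambda>k. f k - 1 / (4 * real (Suc k))) \<longlonglongrightarrow> l - 0"
    by (intro tendsto_diff l) real_asymp
  then have up: "f k - 1 / (4 * real (Suc k)) \<le> l" for k using incseq_le[OF inc, of l k] by simp
  have lo: "l \<le> f k" for k by (rule decseq_ge[OF dec l])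
  have sl: "stirling_ln \<longlonglongrightarrow> l" using l unfolding f_def by (rule LIMSEQ_imp_Suc)
  have "(\<lambda>k. stirling_ln (2 * k)) \<longlonglongrightarrow> l"
    by (rule filterlim_compose[OF sl]) (simp add: filterlim_at_top_mult_tendsto_pos mult_nat_left_at_top)
  then have "(\<lambda>k. 2 * (2 * stirling_ln k - stirling_ln (2 * k))) \<longlonglongrightarrow> 2 * (2 * l - l)"
    by (intro tendsto_intros sl)
  moreover have "(\<lambda>k. 2 * (2 * stirling_ln k - stirling_ln (2 * k))) \<longlonglongrightarrow> ln (pi / 2) + ln 4"
  proof (rule Lim_transform_eventually)
    show "(\<lambda>n. ln (\<Prod>k=1..n. (4*real k^2) / (4*real k^2 - 1)) + (ln (2 * real n + 1) + ln 2 - ln n)) \<longlonglongrightarrow> ln (pi / 2) + ln 4"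
    proof (intro tendsto_add tendsto_ln wallis)
      have "(\<lambda>n. ln (2 * real n + 1) + ln 2 - ln n) \<longlonglongrightarrow> ln 2 + ln 2" by real_asymp
      moreover have "ln (4::real) = ln 2 + ln 2" using ln_mult[of 2 "2::real"] by simp
      ultimately show "(\<lambda>n. ln (2 * real n + 1) + ln 2 - ln n) \<longlonglongrightarrow> ln 4" by simp
    qed simp
    show "\<forall>\<^sub>F n in sequentially. ln (\<Prod>k=1..n. (4*real k^2) / (4*real k^2 - 1)) + (ln (2 * real n + 1) + ln 2 - ln n) =
        2 * (2 * stirling_ln n - stirling_ln (2 * n))"
    proof (rule eventually_mono[OF eventually_gt_at_top[of 0]])
      fix n :: nat assume n: "n > 0"
      have "ln (2 ^ (4 * n) * fact n ^ 4 / (fact (2 * n) ^ 2 * (2 * real n + 1))) =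
        4 * n * ln 2 + 4 * ln (fact n) - (2 * ln (fact (2 * n)) + ln (2 * real n + 1))"
        by (simp add: ln_div ln_mult ln_realpow add_pos_nonneg)
      then show "ln (\<Prod>k=1..n. (4*real k^2) / (4*real k^2 - 1)) + (ln (2 * real n + 1) + ln 2 - ln n) =
        2 * (2 * stirling_ln n - stirling_ln (2 * n))"
        unfolding wallis_product using n by (simp add: stirling_ln_def ln_mult algebra_simps)
    qed
  qed
  ultimately have "2 * (2 * l - l) = ln (pi / 2) + ln 4" by (rule LIMSEQ_unique)
  also have "ln (pi / 2) + ln 4 = ln (2 * pi)" by (simp flip: ln_mult_pos)
  finally have "l = ln (2 * pi) / 2" by simp
  then show "ln (2 * pi) / 2 \<le> stirling_ln k" "stirling_ln k \<le> ln (2 * pi) / 2 + 1 / (4 * real k)"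
    using lo[of "k - 1"] up[of "k - 1"] assms by (simp_all add: f_def)
qed

section \<open>Size at the mode, quadratic decay, and the maximum of a perturbed profile\<close>

definition pois :: "real \<Rightarrow> nat \<Rightarrow> real" where "pois x k = exp (- x) * x ^ k / fact k"

lemma pois_nonneg: "x \<ge> 0 \<Longrightarrow> pois x k \<ge> 0"
  by (simp add: pois_def)

abbreviation mode :: "real \<Rightarrow> nat" where "mode x \<equiv> nat \<lfloor>x\<rfloor>"

text \<open>Stirling's formula at k = floor(x). With x = k(1+y) and 0 \<le> y \<le> 1/k the
  corrections k log(1+y) - k y, log(1+y)/2 and the Stirling error are all O(1/k), and k \<ge>
  x/2.\<close>

lemma pois_mode:
  assumes "x \<ge> 1"
  shows "\<exists>q. \<bar>q\<bar> \<le> 5 / (2 * x) \<and> pois x (mode x) * sqrt (2 * pi * x) = exp q"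
proof -
  define k where "k = mode x"
  have k: "k \<ge> 1" "real k \<le> x" "x < real k + 1" using assms unfolding k_def by (auto simp: le_nat_iff)
  have k2: "x / 2 \<le> real k" "real k > 0" using k by auto
  define y where "y = x / k - 1"
  have xy: "x = real k * (1 + y)" using k by (simp add: y_def)
  have y: "0 \<le> y" "y \<le> 1 / k"
    using k divide_right_mono[of x "real k + 1" "real k"] by (auto simp: y_def add_divide_distrib)
  have y1: "y \<le> 1" using y k by (auto intro: order.trans[OF y(2)])
  have lnx: "ln x = ln k + ln (1 + y)" unfolding xy using k y by (simp add: ln_mult)
  define q where "q = (k * ln (1 + y) - k * y) + ln (1 + y) / 2 + (ln (2 * pi) / 2 - stirling_ln k)"
  have "pois x k * sqrt (2 * pi * x) = exp q"
  proof -
    have "ln (pois x k * sqrt (2 * pi * x)) = - x + k * ln x - ln (fact k) + (ln (2 * pi) + ln x) / 2"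
      unfolding pois_def using assms by (simp add: ln_mult ln_div ln_realpow ln_sqrt)
    also have "\<dots> = q" unfolding q_def stirling_ln_def lnx by (subst xy) (simp add: algebra_simps add_divide_distrib)
    finally show ?thesis using assms by (metis exp_ln mult_pos_pos pois_def divide_pos_pos exp_gt_zero fact_gt_zero less_le_trans
      real_sqrt_gt_zero pi_gt_zero zero_less_power zero_less_one zero_less_numeral)
  qed
  moreover have "\<bar>q\<bar> \<le> 5 / (2 * x)"
  proof -
    have l: "ln (1 + y) \<le> y" "y - y\<^sup>2 \<le> ln (1 + y)" "ln (1 + y) \<ge> 0"
      using y y1 ln_add_one_self_le_self[of y] ln_one_plus_pos_lower_bound[of y] by auto
    have "k * ln (1 + y) \<le> k * y" "k * y - k * y\<^sup>2 \<le> k * ln (1 + y)"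
      using l mult_left_mono[OF l(2), of "real k"] by (auto intro: mult_left_mono simp: right_diff_distrib)
    moreover have "k * y\<^sup>2 \<le> 1 / k"
    proof -
      have "k * y\<^sup>2 \<le> k * (1 / k)\<^sup>2" using y by (intro mult_left_mono power_mono) auto
      then show ?thesis using k by (simp add: power2_eq_square)
    qed
    moreover have "1 / (4 * real k) \<ge> 0" "1 / real k = 4 * (1 / (4 * real k))" by auto
    ultimately have "\<bar>q\<bar> \<le> 5 * (1 / (4 * real k))"
      using stirling_ln_bounds[OF k(1)] l y unfolding q_def abs_le_iff by linarith
    also have "\<dots> \<le> 5 * (1 / (2 * x))" using k2 assms by (intro mult_left_mono divide_left_mono) auto
    finally show ?thesis by simp
  qed
  ultimately show ?thesis unfolding k_def by blast
qed

text \<open>14 bounds e^(5/2), 40 exceeds 14 times 5/2, and 100 exceeds 14 times 4, where 4 bounds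
  sqrt(2 pi).\<close>

lemma pois_mode_estimate:
  assumes "x \<ge> 1"
  shows "\<bar>pois x (mode x) * sqrt (2 * pi * x) - 1\<bar> \<le> 40 / x"
    and "pois x (mode x) \<le> 14 / sqrt x" and "1 / (100 * sqrt x) \<le> pois x (mode x)"
proof -
  obtain q where q: "\<bar>q\<bar> \<le> 5 / (2 * x)" "pois x (mode x) * sqrt (2 * pi * x) = exp q" using pois_mode[OF assms] by blast
  have "5 / (2 * x) \<le> 5 / 2" using assms by (simp add: divide_simps)
  then have q1: "\<bar>q\<bar> \<le> 5 / 2" using q by linarith
  have e1: "exp (1::real) < 2.72" using e_less_272 by simp
  have e52: "exp (5 / 2 :: real) \<le> 14"
  proof -
    have "exp (5 / 2 :: real) ^ 2 = exp 1 ^ 5" by (simp add: exp_of_nat_mult[symmetric])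
    also have "\<dots> \<le> 2.72 ^ 5" using e1 by (intro power_mono) auto
    also have "\<dots> \<le> 14\<^sup>2" by (simp add: power_divide)
    finally show ?thesis by (rule power2_le_imp_le) simp
  qed
  have "\<bar>exp q - 1\<bar> \<le> \<bar>q\<bar> * exp \<bar>q\<bar>"
  proof (cases "q \<ge> 0")
    case True
    have "1 - q \<le> exp (- q)" using exp_ge_add_one_self[of "- q"] by simp
    then have "exp q * (1 - q) \<le> exp q * exp (- q)" by (intro mult_left_mono) auto
    then have "exp q - 1 \<le> q * exp q" by (simp add: exp_minus algebra_simps)
    then show ?thesis using True by simp
  next
    case False
    then have "1 - exp q \<le> \<bar>q\<bar>" "exp q < 1" using exp_ge_add_one_self[of q] by (auto simp: abs_if simp del: exp_ge_add_one_self)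
    moreover have "\<bar>q\<bar> * 1 \<le> \<bar>q\<bar> * exp \<bar>q\<bar>" by (intro mult_left_mono) auto
    ultimately show ?thesis by linarith
  qed
  also have "\<dots> \<le> 5 / (2 * x) * 14"
    using q q1 e52 assms order.trans[of "exp \<bar>q\<bar>" "exp (5 / 2)" 14] by (intro mult_mono) auto
  also have "\<dots> \<le> 40 / x" using assms by (simp add: field_simps)
  finally show "\<bar>pois x (mode x) * sqrt (2 * pi * x) - 1\<bar> \<le> 40 / x" using q by simp
  have s: "sqrt (2 * pi * x) = sqrt (2 * pi) * sqrt x" by (rule real_sqrt_mult)
  have p: "1 \<le> sqrt (2 * pi)" "sqrt (2 * pi) \<le> 4" using pi_gt3 pi_less_4 by (auto intro!: real_le_lsqrt simp: real_le_rsqrt)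
  have nn: "0 \<le> pois x (mode x)" using pois_nonneg[of x] assms by simp
  have eq: "pois x (mode x) * sqrt x * sqrt (2 * pi) = exp q" using q s by (simp add: mult_ac)
  have "pois x (mode x) * sqrt x * 1 \<le> pois x (mode x) * sqrt x * sqrt (2 * pi)" using nn p assms by (intro mult_left_mono) auto
  also have "\<dots> \<le> exp (5 / 2)" unfolding eq using q1 by simp
  finally show "pois x (mode x) \<le> 14 / sqrt x" using e52 assms by (simp add: pos_le_divide_eq)
  have "1 / 14 \<le> exp (- (5 / 2 :: real))" using e52 by (simp add: exp_minus field_simps)
  also have "\<dots> \<le> exp q" using q1 by simp
  also have "\<dots> \<le> pois x (mode x) * sqrt x * 4" unfolding eq[symmetric] using nn p assms by (intro mult_left_mono) auto
  finally show "1 / (100 * sqrt x) \<le> pois x (mode x)" using assms by (simp add: field_simps)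
qed

text \<open>At distance j from the mode the next step divides the probability by at least 1 + j/x,
  in both directions; multiplied up this gives at least 1 + (0 + 1 + ... + (j-1))/x. The first step
  counts nothing because the mode agrees with x only up to 1.\<close>

lemma pois_le_mode:
  assumes x: "x \<ge> 1" and D: "D = \<bar>real k - real (mode x)\<bar>"
  shows "pois x k * (1 + D * (D - 1) / (2 * x)) \<le> pois x (mode x)"
proof -
  define k0 where "k0 = mode x"
  have k0: "real k0 \<le> x" "x < real k0 + 1" using x unfolding k0_def by (auto simp: le_nat_iff)
  have x0: "x > 0" using x by simp
  have up: "pois x (k0 + j) * (1 + real j * (real j - 1) / (2 * x)) \<le> pois x k0" for j
  proof (induction j)
    case (Suc j)
    define s where "s = real j * (real j - 1) / (2 * x)"
    have s: "s \<ge> 0" by (cases j) (use x in \<open>auto simp: s_def\<close>)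
    have st: "real (Suc j) * (real (Suc j) - 1) / (2 * x) = s + j / x" using x by (simp add: s_def field_simps)
    have "pois x (k0 + Suc j) = pois x (k0 + j) * (x / (k0 + Suc j))" by (simp add: pois_def mult_ac add_ac)
    moreover have "x / (k0 + Suc j) * (1 + (s + j / x)) \<le> 1 + s"
    proof -
      have "s * (j / x) \<ge> 0" using s x by simp
      then have "1 + (s + j / x) \<le> (1 + s) * (1 + j / x)" by (simp only: distrib_left distrib_right mult_1_left mult_1_right)
      also have "\<dots> \<le> (1 + s) * ((k0 + Suc j) / x)"
        using s x k0 divide_right_mono[of "x + j" "real (k0 + Suc j)" x]
        by (intro mult_left_mono) (auto simp: add_divide_distrib)
      finally have "x / (k0 + Suc j) * (1 + (s + j / x)) \<le> x / (k0 + Suc j) * ((1 + s) * ((k0 + Suc j) / x))"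
        using x by (intro mult_left_mono) auto
      also have "\<dots> = 1 + s" using x by (simp del: of_nat_Suc of_nat_add)
      finally show ?thesis .
    qed
    then have "pois x (k0 + j) * (x / (k0 + Suc j) * (1 + (s + j / x))) \<le> pois x (k0 + j) * (1 + s)"
      using x pois_nonneg by (intro mult_left_mono) auto
    ultimately show ?case using Suc.IH unfolding st s_def[symmetric] by (simp add: mult.assoc)
  qed simp
  have down: "pois x (k0 - j) * (1 + real j * (real j - 1) / (2 * x)) \<le> pois x k0" if "j \<le> k0" for j
    using that
  proof (induction j)
    case (Suc j)
    define s where "s = real j * (real j - 1) / (2 * x)"
    have s: "s \<ge> 0" by (cases j) (use x in \<open>auto simp: s_def\<close>)
    have st: "real (Suc j) * (real (Suc j) - 1) / (2 * x) = s + j / x" using x by (simp add: s_def field_simps)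
    define m where "m = k0 - Suc j"
    have m: "k0 - j = Suc m" "real k0 = real (Suc m) + real j" using Suc.prems by (auto simp: m_def)
    have "pois x m = pois x (Suc m) * (Suc m / x)" using x by (simp add: pois_def field_simps del: of_nat_Suc)
    moreover have "s * (j / x) \<ge> 0" using s x by simp
    then have "1 + (s + j / x) \<le> (1 + s) * (1 + j / x)" by (simp only: distrib_left distrib_right mult_1_left mult_1_right)
    moreover have "Suc m / x * (1 + (s + j / x)) \<le> 1 + s"
    proof -
      have "Suc m / x * (1 + (s + j / x)) \<le> (1 - j / x) * ((1 + s) * (1 + j / x))"
        using s x k0 m \<open>1 + (s + j / x) \<le> (1 + s) * (1 + j / x)\<close> divide_right_mono[of "real (Suc m)" "x - j" x]
        by (intro mult_mono) (auto simp: diff_divide_distrib)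
      also have "\<dots> = (1 + s) * ((1 - j / x) * (1 + j / x))" by (simp only: mult_ac)
      also have "(1 - j / x) * (1 + j / x) = 1 - (j / x)\<^sup>2" using square_diff_one_factored[of "j / x"] by (simp add: power2_eq_square algebra_simps)
      also have "(1 + s) * (1 - (j / x)\<^sup>2) \<le> (1 + s) * 1" using s by (intro mult_left_mono) auto
      finally show ?thesis by simp
    qed
    then have "pois x (Suc m) * (Suc m / x * (1 + (s + j / x))) \<le> pois x (Suc m) * (1 + s)"
      using x pois_nonneg by (intro mult_left_mono) auto
    ultimately show ?case using Suc unfolding st s_def[symmetric] m_def[symmetric] by (simp add: m mult.assoc)
  qed simp
  show ?thesis
  proof (cases "k \<ge> k0")
    case True
    then show ?thesis using up[of "k - k0"] D by (simp add: k0_def of_nat_diff)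
  next
    case False
    then show ?thesis using down[of "k0 - k"] D by (simp add: k0_def of_nat_diff)
  qed
qed

text \<open>As pois(k-1) - pois(k) = pois(k)(k-x)/x, the hypothesis is the two-term expansion of the
  profile. At distance D from the mode the linear term gains at most A(D+1)/x and the probability
  loses D(D-1)/(2x): the net gain is O(A^2/x), and negative once D exceeds a multiple of A.\<close>

lemma poisson_profile_max:
  fixes y :: "nat \<Rightarrow> real"
  assumes x: "x \<ge> 1" and A: "A \<ge> 1" "\<bar>\<xi>\<bar> \<le> A"
    and y: "\<And>k. \<bar>y k - pois x k * (1 + \<xi> * (real k - x) / x)\<bar> \<le> A / (x * sqrt x)"
    and W: "\<And>k. y k \<le> W" "y ks = W"
  shows "\<bar>W - pois x (mode x)\<bar> \<le> 43 * A\<^sup>2 / (x * sqrt x)"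
    and "x \<le> 4001 * A \<or> \<bar>real ks - x\<bar> \<le> 4001 * A"
proof -
  define k0 where "k0 = mode x"
  define M where "M = pois x k0"
  define H where "H = 1 / (x * sqrt x)"
  have k0: "real k0 \<le> x" "x < real k0 + 1" using x unfolding k0_def by (auto simp: le_nat_iff)
  have H: "H \<ge> 0" using x by (simp add: H_def)
  have y': "\<bar>y k - pois x k * (1 + \<xi> * (real k - x) / x)\<bar> \<le> A * H" for k using y[of k] by (simp add: H_def)
  have M: "M / x \<le> 14 * H" "H \<le> 100 * (M / x)" "M > 0"
  proof -
    have M1: "M \<le> 14 / sqrt x" "1 / (100 * sqrt x) \<le> M" using pois_mode_estimate[OF x] by (simp_all add: M_def k0_def)
    have "M / x \<le> (14 / sqrt x) / x" using M1 x by (intro divide_right_mono) auto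
    then show "M / x \<le> 14 * H" by (simp add: H_def mult.commute)
    have "(1 / (100 * sqrt x)) / x \<le> M / x" using M1 x by (intro divide_right_mono) auto
    then have "100 * ((1 / (100 * sqrt x)) / x) \<le> 100 * (M / x)" by (rule mult_left_mono) simp
    moreover have "100 * ((1 / (100 * sqrt x)) / x) = H" using x by (simp add: H_def)
    ultimately show "H \<le> 100 * (M / x)" by simp
    have "0 < 1 / (100 * sqrt x)" using x by simp
    then show "M > 0" using M1 by linarith
  qed
  have AA: "A \<le> A\<^sup>2" using A by (simp add: power2_eq_square)
  have low: "M - 15 * A * H \<le> W"
  proof -
    have "\<bar>\<xi> * (real k0 - x)\<bar> \<le> A * 1" unfolding abs_mult using A k0 by (intro mult_mono) auto
    then have "\<bar>\<xi> * (real k0 - x) / x\<bar> \<le> A / x" using x by (simp add: abs_mult divide_right_mono)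
    then have "- (A / x) \<le> \<xi> * (real k0 - x) / x" by linarith
    then have "M * (1 - A / x) \<le> M * (1 + \<xi> * (real k0 - x) / x)" using M by (intro mult_left_mono) auto
    moreover have "M * (1 - A / x) = M - A * (M / x)" by (simp add: algebra_simps)
    moreover have "A * (M / x) \<le> A * (14 * H)" using M A by (intro mult_left_mono) auto
    moreover have "pois x k0 * (1 + \<xi> * (real k0 - x) / x) - A * H \<le> y k0" using y'[of k0] by linarith
    ultimately show ?thesis using W(1)[of k0] unfolding M_def by linarith
  qed
  define D where "D k = \<bar>real k - real k0\<bar>" for k
  define s where "s k = D k * (D k - 1) / (2 * x)" for k
  have s: "s k \<ge> 0" for k
  proof -
    have "D k = 0 \<or> D k \<ge> 1" by (auto simp: D_def)
    then show ?thesis using x by (auto simp: s_def)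
  qed
  have pm: "pois x k * (1 + s k) \<le> M" for k
    using pois_le_mode[OF x, of "D k" k] by (simp add: s_def D_def M_def k0_def)
  have p0: "pois x k \<ge> 0" for k using x by (simp add: pois_nonneg)
  have up: "y k \<le> pois x k * (1 + A * (D k + 1) / x) + A * H" for k
  proof -
    have "\<bar>\<xi> * (real k - x)\<bar> \<le> A * (D k + 1)" unfolding abs_mult using A k0 by (intro mult_mono) (auto simp: D_def)
    then have "\<bar>\<xi> * (real k - x) / x\<bar> \<le> A * (D k + 1) / x" using x by (simp add: abs_mult divide_right_mono)
    then have "\<xi> * (real k - x) / x \<le> A * (D k + 1) / x" by linarith
    then have "pois x k * (1 + \<xi> * (real k - x) / x) \<le> pois x k * (1 + A * (D k + 1) / x)"
      using p0 by (intro mult_left_mono) auto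
    then show ?thesis using y'[of k] by linarith
  qed
  have pM: "pois x k \<le> M" for k
    using pm[of k] mult_left_mono[of 1 "1 + s k" "pois x k"] s[of k] p0[of k] by simp
  have "W \<le> M + 43 * A\<^sup>2 * H"
  proof -
    let ?D = "D ks"
    \<comment> \<open>The quadratic is maximal at D = A + 1/2. With M/x \<le> 14 H the bound 3 A^2
      becomes 42 A^2 H, and the error A H of the profile makes it 43.\<close>
    have "A * (?D + 1) - ?D * (?D - 1) / 2 \<le> 3 * A\<^sup>2"
    proof -
      have "(?D - (A + 1 / 2))\<^sup>2 \<ge> 0" by simp
      then have "A * (?D + 1) - ?D * (?D - 1) / 2 \<le> (A + 1 / 2)\<^sup>2 / 2 + A"
        by (simp add: power2_eq_square algebra_simps add_divide_distrib diff_divide_distrib)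
      also have "\<dots> = A\<^sup>2 / 2 + 3 / 2 * A + 1 / 8" by (simp add: power2_eq_square algebra_simps add_divide_distrib)
      also have "\<dots> \<le> 3 * A\<^sup>2" using AA A by linarith
      finally show ?thesis .
    qed
    then have "(A * (?D + 1) - ?D * (?D - 1) / 2) / x \<le> 3 * A\<^sup>2 / x" using x by (intro divide_right_mono) auto
    then have "A * (?D + 1) / x - s ks \<le> 3 * A\<^sup>2 / x" by (simp add: s_def diff_divide_distrib)
    then have "pois x ks * (A * (?D + 1) / x - s ks) \<le> pois x ks * (3 * A\<^sup>2 / x)" using p0 by (intro mult_left_mono)
    also have "\<dots> \<le> M * (3 * A\<^sup>2 / x)" using pM x by (intro mult_right_mono) auto
    also have "\<dots> = 3 * A\<^sup>2 * (M / x)" by simp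
    also have "\<dots> \<le> 3 * A\<^sup>2 * (14 * H)" using M by (intro mult_left_mono) auto
    finally have "pois x ks * (A * (?D + 1) / x - s ks) \<le> 42 * A\<^sup>2 * H" by simp
    moreover have "pois x ks * (1 + A * (?D + 1) / x) = pois x ks * (1 + s ks) + pois x ks * (A * (?D + 1) / x - s ks)"
      by (simp add: algebra_simps)
    moreover have "A * H \<le> A\<^sup>2 * H" using AA H by (rule mult_right_mono)
    ultimately show ?thesis using up[of ks] pm[of ks] W(2) by linarith
  qed
  moreover have "15 * A * H \<le> 43 * A\<^sup>2 * H" using AA A H by (intro mult_right_mono) auto
  ultimately have "\<bar>W - M\<bar> \<le> 43 * A\<^sup>2 * H" using low by linarith
  then show "\<bar>W - pois x (mode x)\<bar> \<le> 43 * A\<^sup>2 / (x * sqrt x)" by (simp add: M_def k0_def H_def)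
  show "x \<le> 4001 * A \<or> \<bar>real ks - x\<bar> \<le> 4001 * A"
  proof (cases "x \<le> 4001 * A")
    case False
    let ?D = "D ks"
    have D0: "?D \<ge> 0" by (simp add: D_def)
    \<comment> \<open>The total loss is 16 A H, namely 15 from the lower bound for \<open>W\<close>
      and 1 from the error at \<open>ks\<close>; relative to M it is at most 1600 A/x.\<close>
    have ax: "1600 * A / x \<le> 1 / 2" using False x by (simp add: field_simps)
    have "A * H \<le> A * (100 * (M / x))" using M A by (intro mult_left_mono) auto
    moreover have "M * (1600 * A / x) = 16 * (A * (100 * (M / x)))" by simp
    ultimately have "16 * A * H \<le> M * (1600 * A / x)" by linarith
    then have "M * (1 - 1600 * A / x) \<le> pois x ks * (1 + A * (?D + 1) / x)"
      using low up[of ks] W(2) by (simp only: right_diff_distrib mult_1_right)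
    then have "M * (1 - 1600 * A / x) * (1 + s ks) \<le> pois x ks * (1 + A * (?D + 1) / x) * (1 + s ks)"
      using s[of ks] by (intro mult_right_mono) auto
    also have "\<dots> = pois x ks * (1 + s ks) * (1 + A * (?D + 1) / x)" by simp
    also have "\<dots> \<le> M * (1 + A * (?D + 1) / x)" using x A D0 by (intro mult_right_mono pm) auto
    finally have "M * ((1 - 1600 * A / x) * (1 + s ks)) \<le> M * (1 + A * (?D + 1) / x)" by simp
    then have "(1 - 1600 * A / x) * (1 + s ks) \<le> 1 + A * (?D + 1) / x" using M by simp
    moreover have "1600 * A / x * s ks \<le> 1 / 2 * s ks" using ax s by (rule mult_right_mono)
    moreover have "(1 - q) * (1 + s ks) = 1 + s ks - q - q * s ks" for q by (simp add: algebra_simps)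
    ultimately have "s ks / 2 \<le> 1600 * A / x + A * (?D + 1) / x" by (simp only:)
    also have "\<dots> = (1600 * A + A * (?D + 1)) / x" by (simp add: add_divide_distrib)
    finally have "(?D * (?D - 1) / 4) / x \<le> (1600 * A + A * (?D + 1)) / x" by (simp add: s_def)
    then have "?D * (?D - 1) / 4 \<le> 1600 * A + A * (?D + 1)" using x by (simp only: divide_le_cancel)
    then have D2: "?D * ?D \<le> ?D + 6404 * A + 4 * A * ?D" by (simp add: algebra_simps diff_divide_distrib)
    have "?D \<le> 4000 * A"
    proof (rule ccontr)
      assume "\<not> ?D \<le> 4000 * A"
      then have "?D > 4000 * A" by simp
      then have D: "4000 * A * ?D \<le> ?D * ?D" using D0 by (intro mult_right_mono) auto
      have "1 * ?D \<le> A * ?D" using A D0 by (intro mult_right_mono) auto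
      moreover have "A * 4000 \<le> A * ?D" using \<open>?D > 4000 * A\<close> A by (intro mult_left_mono) auto
      moreover have "0 < A * ?D" using A \<open>?D > 4000 * A\<close> by simp
      ultimately show False using D D2 by linarith
    qed
    then show ?thesis using k0 A by (auto simp: D_def)
  qed simp
qed

section \<open>From averages over two circles to the coefficients of a polynomial\<close>

lemma gauss_second_moment_bound:
  fixes x :: real
  assumes "x \<ge> 1"
  shows "integral {-pi..pi} (\<lambda>\<theta>. \<theta>\<^sup>2 * exp (- x * \<theta>\<^sup>2 / 8)) \<le> 64 * pi / (x * sqrt x)"
proof -
  define s where "s = sqrt x / 4"
  have s: "s > 0" using assms by (simp add: s_def)
  have ss: "s\<^sup>2 = x / 16" using assms by (simp add: s_def power_divide)
  have D: "((\<lambda>\<theta>. 16 / x / s * arctan (s * \<theta>)) has_real_derivative 16 / x * (1 / (1 + (s * \<theta>)\<^sup>2))) (at \<theta>)" for \<theta> :: real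
  proof -
    have "((\<lambda>\<theta>. arctan (s * \<theta>)) has_real_derivative (s / (1 + (s * \<theta>)\<^sup>2))) (at \<theta>)"
      by (auto intro!: derivative_eq_intros simp: divide_inverse)
    from DERIV_cmult[OF this, of "16 / x / s"] show ?thesis using s by simp
  qed
  have I: "((\<lambda>\<theta>. 16 / x * (1 / (1 + (s * \<theta>)\<^sup>2))) has_integral (16 / x / s * arctan (s * pi) - 16 / x / s * arctan (s * (- pi)))) {-pi..pi}"
    by (rule fundamental_theorem_of_calculus)
       (use D in \<open>auto simp: has_real_derivative_iff_has_vector_derivative[symmetric] intro: has_field_derivative_at_within\<close>)
  \<comment> \<open>The Gaussian is replaced by a rational majorant, from z(1+z) \<le> e^(2z) at z =
    x \<theta>^2/16, whose integral is an arctangent; the order x^(-3/2) is preserved.\<close>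
  have "integral {-pi..pi} (\<lambda>\<theta>. \<theta>\<^sup>2 * exp (- x * \<theta>\<^sup>2 / 8)) \<le> integral {-pi..pi} (\<lambda>\<theta>. 16 / x * (1 / (1 + (s * \<theta>)\<^sup>2)))"
  proof (intro integral_le integrable_continuous_real)
    fix \<theta> :: real
    define z where "z = x * \<theta>\<^sup>2 / 16"
    have z: "z \<ge> 0" using assms by (simp add: z_def)
    have "(1 + z)\<^sup>2 \<le> exp z ^ 2" using z by (intro power_mono) auto
    also have "\<dots> = exp (2 * z)" by (simp add: exp_of_nat_mult[symmetric])
    finally have "z * (1 + z) \<le> exp (2 * z)" using z by (auto simp: power2_eq_square algebra_simps)
    then have "z * exp (- (2 * z)) \<le> 1 / (1 + z)" using z by (simp add: exp_minus field_simps)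
    then have "16 / x * (z * exp (- (2 * z))) \<le> 16 / x * (1 / (1 + z))" using assms by (intro mult_left_mono) auto
    moreover have "(s * \<theta>)\<^sup>2 = z" unfolding power_mult_distrib ss by (simp add: z_def)
    moreover have "16 / x * (z * e) = \<theta>\<^sup>2 * e" for e using assms by (simp add: z_def)
    moreover have "- (2 * z) = - x * \<theta>\<^sup>2 / 8" by (simp add: z_def)
    ultimately show "\<theta>\<^sup>2 * exp (- x * \<theta>\<^sup>2 / 8) \<le> 16 / x * (1 / (1 + (s * \<theta>)\<^sup>2))"
      by simp
  qed (use assms in \<open>auto intro!: continuous_intros simp: add_nonneg_eq_0_iff\<close>)
  also have "\<dots> = 16 / x / s * arctan (s * pi) - 16 / x / s * arctan (s * (- pi))"
    using I by (rule integral_unique)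
  also have "\<dots> = 128 / (x * sqrt x) * arctan (s * pi)" using assms by (simp add: arctan_minus s_def)
  also have "\<dots> \<le> 128 / (x * sqrt x) * (pi / 2)" using arctan_ubound[of "s * pi"] assms by (intro mult_left_mono) auto
  finally show ?thesis by simp
qed

lemma fps_coeff_le_circle_average:
  fixes f :: "complex fps"
  assumes "0 < r" "fps_conv_radius f = \<infinity>"
  shows "2 * pi * r ^ n * norm (fps_nth f n) \<le> integral {-pi..pi} (\<lambda>\<theta>. norm (eval_fps f (of_real r * cis \<theta>)))"
proof -
  have "((\<lambda>\<theta>. eval_fps f (of_real r * cis \<theta>) * cis (- (n * \<theta>))) has_integral
    of_real (2 * pi / real 1 * r ^ n) * fps_nth f n) {- pi / real 1..pi / real 1}"
    by (rule sector_coeff) (use assms in auto)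
  then have i: "((\<lambda>\<theta>. eval_fps f (of_real r * cis \<theta>) * cis (- (n * \<theta>))) has_integral
    of_real (2 * pi * r ^ n) * fps_nth f n) {- pi..pi}" by simp
  have "continuous_on {-pi..pi} (\<lambda>\<theta>. eval_fps f (of_real r * cis \<theta>))"
    by (intro continuous_intros) (auto simp: assms eball_def)
  then have "(\<lambda>\<theta>. norm (eval_fps f (of_real r * cis \<theta>))) integrable_on {-pi..pi}"
    by (intro integrable_continuous_real continuous_on_norm)
  then have "norm (integral {- pi..pi} (\<lambda>\<theta>. eval_fps f (of_real r * cis \<theta>) * cis (- (n * \<theta>)))) \<le>
      integral {-pi..pi} (\<lambda>\<theta>. norm (eval_fps f (of_real r * cis \<theta>)))"
    using i by (intro integral_norm_bound_integral) (auto simp: has_integral_integrable norm_mult intro: has_integral_integrable)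
  moreover have "integral {- pi..pi} (\<lambda>\<theta>. eval_fps f (of_real r * cis \<theta>) * cis (- (n * \<theta>))) = of_real (2 * pi * r ^ n) * fps_nth f n"
    using i by (rule integral_unique)
  ultimately show ?thesis using assms by (simp add: norm_mult norm_power)
qed

lemma fps_conv_radius_mult_infinity:
  fixes f g :: "complex fps"
  assumes "fps_conv_radius f = \<infinity>" "fps_conv_radius g = \<infinity>"
  shows "fps_conv_radius (f * g) = \<infinity>"
  using fps_conv_radius_mult[of f g] assms by simp

lemma fps_conv_radius_diff_infinity:
  fixes f g :: "complex fps"
  assumes "fps_conv_radius f = \<infinity>" "fps_conv_radius g = \<infinity>"
  shows "fps_conv_radius (f - g) = \<infinity>"
  using fps_conv_radius_diff[of f g] assms by simp

text \<open>The coefficients obey Cauchy's inequality on radius r, so within half that radius the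
  tail from the second term on is dominated by a geometric series of ratio 1/2.\<close>

lemma eval_fps_second_order:
  fixes f :: "complex fps"
  assumes a: "\<And>j. norm (fps_nth f j) * r ^ j \<le> A" and r: "r > 0" and w: "norm w \<le> r / 2" "ereal (norm w) < fps_conv_radius f"
  shows "norm (eval_fps f w - fps_nth f 0 - fps_nth f 1 * w) \<le> 2 * A * (norm w)\<^sup>2 / r\<^sup>2"
proof -
  define y where "y = norm w / r"
  have y: "0 \<le> y" "y \<le> 1 / 2" using w r by (auto simp: y_def field_simps)
  have A: "A \<ge> 0" using a[of 0] by (auto intro: order.trans[OF norm_ge_zero])
  have "(\<lambda>n. fps_nth f n * w ^ n) sums eval_fps f w" by (rule sums_eval_fps[OF w(2)])
  then have "(\<lambda>n. fps_nth f (n + 2) * w ^ (n + 2)) sums (eval_fps f w - (\<Sum>n<2. fps_nth f n * w ^ n))"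
    by (rule sums_split_initial_segment)
  then have s: "(\<lambda>n. fps_nth f (n + 2) * w ^ (n + 2)) sums (eval_fps f w - fps_nth f 0 - fps_nth f 1 * w)"
    by (simp add: numeral_2_eq_2 algebra_simps)
  have g: "(\<lambda>n. A * y\<^sup>2 * (1 / 2) ^ n) sums (A * y\<^sup>2 * (1 / (1 - 1 / 2)))" by (intro sums_mult geometric_sums) simp
  have "norm (fps_nth f (n + 2) * w ^ (n + 2)) \<le> A * y\<^sup>2 * (1 / 2) ^ n" for n
  proof -
    have "norm (fps_nth f (n + 2) * w ^ (n + 2)) = (norm (fps_nth f (n + 2)) * r ^ (n + 2)) * y ^ (n + 2)"
      using r by (simp add: y_def norm_mult norm_power power_divide)
    also have "\<dots> \<le> A * y ^ (n + 2)" using y by (intro mult_right_mono a) auto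
    also have "\<dots> = A * y\<^sup>2 * y ^ n" by (simp add: power_add power2_eq_square)
    also have "\<dots> \<le> A * y\<^sup>2 * (1 / 2) ^ n" using y A by (intro mult_left_mono power_mono) auto
    finally show ?thesis .
  qed
  then have "norm (suminf (\<lambda>n. fps_nth f (n + 2) * w ^ (n + 2))) \<le> suminf (\<lambda>n. A * y\<^sup>2 * (1 / 2) ^ n)"
    by (rule norm_suminf_le) (use g in \<open>simp add: sums_iff\<close>)
  then have "norm (eval_fps f w - fps_nth f 0 - fps_nth f 1 * w) \<le> A * y\<^sup>2 * (1 / (1 - 1 / 2))"
    using s g by (simp add: sums_iff)
  then show ?thesis by (simp add: y_def power_divide mult_ac)
qed

lemma exp_minus_le_cube:
  fixes x r :: real
  assumes "x \<ge> 1" "0 < r"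
  shows "exp (- (x * r\<^sup>2 / 8)) \<le> 256 / r ^ 4 / (x * sqrt x)"
proof -
  define z where "z = x * r\<^sup>2 / 16"
  have z: "z > 0" using assms by (simp add: z_def)
  have "z\<^sup>2 \<le> exp z ^ 2" using z order.trans[OF _ exp_ge_add_one_self[of z], of z] by (intro power_mono) auto
  also have "\<dots> = exp (2 * z)" by (simp add: exp_of_nat_mult[symmetric])
  finally have "exp (- (2 * z)) \<le> 1 / z\<^sup>2" using z by (simp add: exp_minus field_simps)
  also have "\<dots> = 256 / r ^ 4 / (x * x)" using assms by (simp add: z_def power_divide power_mult_distrib power2_eq_square power4_eq_xxxx)
  also have "\<dots> \<le> 256 / r ^ 4 / (x * sqrt x)"
  proof -
    have "sqrt x \<le> x" using assms by (simp add: real_le_lsqrt power2_eq_square)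
    then show ?thesis using assms by (intro divide_left_mono mult_left_mono) auto
  qed
  finally show ?thesis by (simp add: z_def)
qed

text \<open>Let X(u) = p(u) exp(-x(u-1))/N. \<open>A\<close> integrates |X| over the circle of
  radius r about 1 and bounds the Taylor coefficients of X there. \<open>G\<close> integrates |p|/N
  over the unit circle with a weight capped at exp(x r), to suit moment bounds that reach only
  exponents near 1. The series \<open>h\<close> is p/N minus the Poisson part with its first-order
  correction, so its coefficients are the errors to be bounded.\<close>

lemma poly_poisson_profile:
  fixes p :: "complex poly" and x r N :: real
  assumes x: "x \<ge> 1" and r: "0 < r" "r \<le> 1" and N: "poly p 1 = of_real N" "N > 0"
  defines "A \<equiv> integral {-pi..pi} (\<lambda>\<theta>. norm (poly p (1 + of_real r * cis \<theta>)) / N * exp (- x * (r * cos \<theta>)))"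
    and "G \<equiv> integral {-pi..pi} (\<lambda>\<theta>. norm (poly p (cis \<theta>)) / N * exp (x * min (1 - cos \<theta>) r))"
  shows "\<exists>\<xi>. \<bar>\<xi>\<bar> \<le> A / r \<and>
    (\<forall>k. \<bar>Re (coeff p k) / N - pois x k * (1 + \<xi> * (real k - x) / x)\<bar> \<le> 640 / r ^ 5 * (A + G + 1) / (x * sqrt x))"
proof -
  define f :: "complex fps" where "f = fps_const (1 / N) * (fps_of_poly (pcompose p [:1, 1:]) * fps_exp (- x))"
  have rf: "fps_conv_radius f = \<infinity>" unfolding f_def by (intro fps_conv_radius_mult_infinity) simp_all
  have ef: "eval_fps f w = poly p (1 + w) * exp (- x * w) / N" for w :: complex
    unfolding f_def
    by (subst eval_fps_mult eval_fps_mult | simp add: fps_conv_radius_mult_infinity poly_pcompose)+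
  define a where "a = fps_nth f 1"
  have a0: "fps_nth f 0 = 1" using ef[of 0] N by (simp add: eval_fps_at_0)
  have A: "norm (fps_nth f j) * r ^ j \<le> A" for j
  proof -
    have "2 * pi * r ^ j * norm (fps_nth f j) \<le> A"
      using fps_coeff_le_circle_average[OF r(1) rf, of j] N unfolding A_def ef
      by (simp add: norm_mult norm_divide)
    moreover have "1 * (r ^ j * norm (fps_nth f j)) \<le> 2 * pi * (r ^ j * norm (fps_nth f j))"
      using r pi_gt3 by (intro mult_right_mono) auto
    ultimately show ?thesis by (simp add: mult_ac)
  qed
  have A0: "A \<ge> 0" by (rule order.trans[OF _ A[of 0]]) simp
  have na: "norm a \<le> A / r" using A[of 1] r by (simp add: a_def field_simps)
  define h :: "complex fps" where "h = fps_const (1 / N) * fps_of_poly p -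
      (fps_const (1 - a) + fps_const a * fps_X) * (fps_const (exp (- x)) * fps_exp x)"
  have rl: "fps_conv_radius (fps_const (1 - a) + fps_const a * fps_X :: complex fps) = \<infinity>"
    using fps_conv_radius_add[of "fps_const (1 - a)" "fps_const a * fps_X"]
    by (simp add: fps_conv_radius_mult_infinity)
  have rh: "fps_conv_radius h = \<infinity>" unfolding h_def
    by (intro fps_conv_radius_diff_infinity fps_conv_radius_mult_infinity rl) simp_all
  have eh: "eval_fps h z = poly p z / N - (1 + (z - 1) * a) * exp (x * (z - 1))" for z :: complex
  proof -
    have "eval_fps h z = poly p z / N - ((1 - a) + a * z) * (exp (- x) * exp (x * z))"
      unfolding h_def
      by (simp add: eval_fps_diff eval_fps_mult eval_fps_add rl fps_conv_radius_mult_infinity exp_of_real)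
    also have "exp (- x) * exp (x * z) = exp (x * (z - 1))" by (simp add: exp_of_real[symmetric] algebra_simps flip: exp_add)
    finally show ?thesis by (simp add: algebra_simps)
  qed
  have hk: "fps_nth h k = coeff p k / N - of_real (pois x k) * (1 + a * (of_nat k - x) / x)" for k
  proof -
    have "fps_nth h k = coeff p k / N - ((1 - a) * (exp (- x) * (x ^ k / fact k)) +
        a * (if k = 0 then 0 else exp (- x) * (x ^ (k - 1) / fact (k - 1))))"
      unfolding h_def by (simp add: distrib_right mult.assoc)
    also have "\<dots> = coeff p k / N - of_real (pois x k) * (1 + a * (of_nat k - x) / x)"
    proof -
      have "1 + complex_of_nat m \<noteq> 0" for m using of_nat_neq_0[of m, where ?'a = complex] by simp
      then show ?thesis using x by (cases k) (simp_all add: pois_def divide_simps, simp_all add: algebra_simps)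
    qed
    finally show ?thesis .
  qed
  define B where "B = 1 + 2 * (A / r)"
  \<comment> \<open>Close to 1 the Taylor remainder of X is quadratic in \<theta> and the Poisson
    factor is at most Gaussian. Farther out no cancellation is used: every term carries a factor
    exp(-x r^2/8), of smaller order than x^(-3/2), once |p|/N is written with the weight of
    \<open>G\<close>.\<close>
  have near: "norm (eval_fps h (cis \<theta>)) \<le> 2 * A / r\<^sup>2 * (\<theta>\<^sup>2 * exp (- x * \<theta>\<^sup>2 / 8)) +
      256 / r ^ 4 / (x * sqrt x) * (norm (poly p (cis \<theta>)) / N * exp (x * min (1 - cos \<theta>) r) + B)"
    if \<theta>: "\<theta> \<in> {-pi..pi}" for \<theta> :: real
  proof -
    define w where "w = cis \<theta> - 1"
    have w2: "(norm w)\<^sup>2 = 2 * (1 - cos \<theta>)"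
    proof -
      have "(norm w)\<^sup>2 = (cos \<theta> - 1)\<^sup>2 + (sin \<theta>)\<^sup>2" by (simp add: w_def cmod_power2)
      also have "\<dots> = ((sin \<theta>)\<^sup>2 + (cos \<theta>)\<^sup>2) + 1 - 2 * cos \<theta>" by (simp add: power2_eq_square algebra_simps)
      finally show ?thesis by (simp add: algebra_simps)
    qed
    have c8: "cos \<theta> \<le> 1 - \<theta>\<^sup>2 / 8" by (rule cos_le_quadratic) (use \<theta> in auto)
    have wle: "(norm w)\<^sup>2 \<le> \<theta>\<^sup>2"
    proof -
      have "(sin (\<theta> / 2))\<^sup>2 \<le> (\<theta> / 2)\<^sup>2" using abs_sin_x_le_abs_x[of "\<theta> / 2"] by (simp only: abs_le_square_iff)
      then show ?thesis unfolding w2 using cos_double_sin[of "\<theta> / 2"] by (simp add: power_divide)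
    qed
    have e: "norm (exp (of_real x * w)) = exp (- x * (1 - cos \<theta>))" by (simp add: norm_exp_eq_Re w_def algebra_simps)
    have hw: "eval_fps h (cis \<theta>) = poly p (cis \<theta>) / N - (1 + w * a) * exp (x * w)" unfolding eh w_def ..
    have g0: "0 \<le> norm (poly p (cis \<theta>)) / N * exp (x * min (1 - cos \<theta>) r)" using N by simp
    have B0: "B \<ge> 0" using A0 r by (simp add: B_def)
    show ?thesis
    proof (cases "norm w \<le> r / 2")
      case True
      have "exp (- x * w) * exp (x * w) = 1" by (simp flip: exp_add)
      then have "eval_fps h (cis \<theta>) = (eval_fps f w - fps_nth f 0 - fps_nth f 1 * w) * exp (x * w)"
        unfolding hw ef a0 a_def[symmetric] by (simp add: w_def algebra_simps)
      then have "norm (eval_fps h (cis \<theta>)) = norm (eval_fps f w - fps_nth f 0 - fps_nth f 1 * w) * exp (- x * (1 - cos \<theta>))"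
        by (simp only: norm_mult e)
      also have "\<dots> \<le> (2 * A * \<theta>\<^sup>2 / r\<^sup>2) * exp (- x * \<theta>\<^sup>2 / 8)"
      proof (intro mult_mono)
        have "norm (eval_fps f w - fps_nth f 0 - fps_nth f 1 * w) \<le> 2 * A * (norm w)\<^sup>2 / r\<^sup>2"
          by (rule eval_fps_second_order[OF A r(1) True]) (simp add: rf)
        also have "\<dots> \<le> 2 * A * \<theta>\<^sup>2 / r\<^sup>2" using wle A0 by (intro divide_right_mono mult_left_mono) auto
        finally show "norm (eval_fps f w - fps_nth f 0 - fps_nth f 1 * w) \<le> 2 * A * \<theta>\<^sup>2 / r\<^sup>2" .
        have "x * (\<theta>\<^sup>2 / 8) \<le> x * (1 - cos \<theta>)" using c8 x by (intro mult_left_mono) auto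
        then show "exp (- x * (1 - cos \<theta>)) \<le> exp (- x * \<theta>\<^sup>2 / 8)" by simp
      qed (use A0 in auto)
      finally have "norm (eval_fps h (cis \<theta>)) \<le> 2 * A / r\<^sup>2 * (\<theta>\<^sup>2 * exp (- x * \<theta>\<^sup>2 / 8))" by simp
      moreover have "0 \<le> 256 / r ^ 4 / (x * sqrt x) * (norm (poly p (cis \<theta>)) / N * exp (x * min (1 - cos \<theta>) r) + B)"
        using g0 B0 x r N by (intro mult_nonneg_nonneg add_nonneg_nonneg) auto
      ultimately show ?thesis by linarith
    next
      case False
      then have "(r / 2)\<^sup>2 \<le> (norm w)\<^sup>2" using r by (intro power_mono) auto
      then have c: "r\<^sup>2 / 8 \<le> 1 - cos \<theta>" using w2 by (simp add: power_divide)
      have "r\<^sup>2 / 8 \<le> r" using r mult_mono[of r 1 r r] by (simp add: power2_eq_square)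
      then have m: "r\<^sup>2 / 8 \<le> min (1 - cos \<theta>) r" using c by simp
      have nw: "norm w \<le> 2" unfolding w_def using norm_triangle_ineq4[of "cis \<theta>" 1] by simp
      have "norm (eval_fps h (cis \<theta>)) \<le> norm (poly p (cis \<theta>) / N) + norm ((1 + w * a) * exp (x * w))"
        unfolding hw by (rule norm_triangle_ineq4)
      also have "norm ((1 + w * a) * exp (x * w)) \<le> B * exp (- (x * r\<^sup>2 / 8))"
      proof -
        have "norm (1 + w * a) \<le> 1 + norm w * norm a" using norm_triangle_ineq[of 1 "w * a"] by (simp add: norm_mult)
        also have "norm w * norm a \<le> 2 * (A / r)" using nw na by (intro mult_mono) auto
        finally have "norm (1 + w * a) \<le> B" by (simp add: B_def)
        moreover have "x * (r\<^sup>2 / 8) \<le> x * (1 - cos \<theta>)" using c x by (intro mult_left_mono) auto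
        ultimately show ?thesis unfolding norm_mult e using B0 by (intro mult_mono) auto
      qed
      also have "norm (poly p (cis \<theta>) / N) \<le> norm (poly p (cis \<theta>)) / N * exp (x * min (1 - cos \<theta>) r) * exp (- (x * r\<^sup>2 / 8))"
      proof -
        have "x * (r\<^sup>2 / 8) \<le> x * min (1 - cos \<theta>) r" using m x by (intro mult_left_mono) auto
        then have "1 \<le> exp (x * min (1 - cos \<theta>) r) * exp (- (x * r\<^sup>2 / 8))" by (simp flip: exp_add)
        then have "norm (poly p (cis \<theta>)) / N * 1 \<le> norm (poly p (cis \<theta>)) / N * (exp (x * min (1 - cos \<theta>) r) * exp (- (x * r\<^sup>2 / 8)))"
          using N by (intro mult_left_mono) auto
        then show ?thesis using N by (simp add: norm_divide)
      qed
      finally have "norm (eval_fps h (cis \<theta>)) \<le> (norm (poly p (cis \<theta>)) / N * exp (x * min (1 - cos \<theta>) r) + B) * exp (- (x * r\<^sup>2 / 8))"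
        by (simp add: distrib_right)
      also have "\<dots> \<le> (norm (poly p (cis \<theta>)) / N * exp (x * min (1 - cos \<theta>) r) + B) * (256 / r ^ 4 / (x * sqrt x))"
        using g0 B0 x r by (intro mult_left_mono exp_minus_le_cube) auto
      finally have "norm (eval_fps h (cis \<theta>)) \<le> 256 / r ^ 4 / (x * sqrt x) * (norm (poly p (cis \<theta>)) / N * exp (x * min (1 - cos \<theta>) r) + B)"
        by (simp add: mult.commute)
      moreover have "0 \<le> 2 * A / r\<^sup>2 * (\<theta>\<^sup>2 * exp (- x * \<theta>\<^sup>2 / 8))" using A0 by simp
      ultimately show ?thesis by linarith
    qed
  qed
  define g where "g \<theta> = norm (poly p (cis \<theta>)) / N * exp (x * min (1 - cos \<theta>) r)" for \<theta>
  define e where "e \<theta> = \<theta>\<^sup>2 * exp (- x * \<theta>\<^sup>2 / 8)" for \<theta> :: real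
  have ig: "g integrable_on {-pi..pi}" unfolding g_def
    by (intro integrable_continuous_real continuous_intros) (use N in auto)
  have ie: "e integrable_on {-pi..pi}" unfolding e_def
    by (intro integrable_continuous_real continuous_intros) auto
  let ?C = "256 / r ^ 4 / (x * sqrt x)"
  have G: "G = integral {-pi..pi} g" unfolding G_def g_def ..
  have G0: "G \<ge> 0" unfolding G using N by (intro integral_nonneg ig) (auto simp: g_def)
  have intB: "integral {-pi..pi} (\<lambda>\<theta>. 2 * A / r\<^sup>2 * e \<theta> + ?C * (g \<theta> + B)) =
      2 * A / r\<^sup>2 * integral {-pi..pi} e + ?C * (G + 2 * pi * B)"
  proof (rule integral_unique)
    have "((\<lambda>\<theta>. B) has_integral (2 * pi * B)) {-pi..pi}" using has_integral_const_real[of B "- pi" pi] by simp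
    then show "((\<lambda>\<theta>. 2 * A / r\<^sup>2 * e \<theta> + ?C * (g \<theta> + B)) has_integral
        2 * A / r\<^sup>2 * integral {-pi..pi} e + ?C * (G + 2 * pi * B)) {-pi..pi}"
      unfolding G by (intro has_integral_add has_integral_mult_right integrable_integral ig ie)
  qed
  have bound: "norm (fps_nth h k) \<le> 640 / r ^ 5 * (A + G + 1) / (x * sqrt x)" for k
  proof -
    have "2 * pi * norm (fps_nth h k) \<le> integral {-pi..pi} (\<lambda>\<theta>. norm (eval_fps h (cis \<theta>)))"
      using fps_coeff_le_circle_average[of 1 h k] rh by simp
    also have "\<dots> \<le> integral {-pi..pi} (\<lambda>\<theta>. 2 * A / r\<^sup>2 * e \<theta> + ?C * (g \<theta> + B))"
    proof (rule integral_le)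
      show "(\<lambda>\<theta>. norm (eval_fps h (cis \<theta>))) integrable_on {-pi..pi}"
        by (intro integrable_continuous_real continuous_intros) (auto simp: rh eball_def)
      show "(\<lambda>\<theta>. 2 * A / r\<^sup>2 * e \<theta> + ?C * (g \<theta> + B)) integrable_on {-pi..pi}"
        by (intro integrable_add integrable_on_mult_right ig ie integrable_const_ivl)
    qed (use near in \<open>auto simp: e_def g_def\<close>)
    also have "\<dots> = 2 * A / r\<^sup>2 * integral {-pi..pi} e + ?C * (G + 2 * pi * B)" by (rule intB)
    also have "\<dots> \<le> 2 * A / r\<^sup>2 * (64 * pi / (x * sqrt x)) + ?C * (G + 2 * pi * B)"
      using gauss_second_moment_bound[OF x] A0 unfolding e_def by (intro add_right_mono mult_left_mono) auto
    also have "\<dots> = (128 * pi * A / r\<^sup>2 + 256 / r ^ 4 * (G + 2 * pi * B)) / (x * sqrt x)"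
      by (simp add: add_divide_distrib)
    \<comment> \<open>640 is half of 1280, which bounds the coefficients 1152, 256/pi and 512 that
      come up, after a factor pi is taken out.\<close>
    also have "\<dots> \<le> (2 * pi * (640 / r ^ 5 * (A + G + 1))) / (x * sqrt x)"
    proof (intro divide_right_mono)
      have r5: "1 / r\<^sup>2 \<le> 1 / r ^ 5" "1 / r ^ 4 \<le> 1 / r ^ 5"
        using r by (auto intro!: divide_left_mono power_decreasing)
      have "128 * pi * A / r\<^sup>2 = 128 * pi * A * (1 / r\<^sup>2)" by simp
      also have "\<dots> \<le> 128 * pi * A * (1 / r ^ 5)" using r5 A0 by (intro mult_left_mono) auto
      finally have 1: "128 * pi * A / r\<^sup>2 \<le> 128 * pi * A * (1 / r ^ 5)" .
      have "256 / r ^ 4 * (G + 2 * pi * B) = 256 * (G + 2 * pi) * (1 / r ^ 4) + 1024 * pi * A * (1 / r ^ 5)"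
        using r by (simp add: B_def field_simps eval_nat_numeral)
      also have "\<dots> \<le> 256 * (G + 2 * pi) * (1 / r ^ 5) + 1024 * pi * A * (1 / r ^ 5)"
        using r5 G0 by (intro add_right_mono mult_left_mono) auto
      finally have 2: "256 / r ^ 4 * (G + 2 * pi * B) \<le> 256 * (G + 2 * pi) * (1 / r ^ 5) + 1024 * pi * A * (1 / r ^ 5)" .
      have "128 * pi * A * z + (256 * (G + 2 * pi) * z + 1024 * pi * A * z) = (1152 * pi * A + 256 * G + 512 * pi) * z" for z
        by (simp add: algebra_simps)
      from add_mono[OF 1 2, unfolded this]
      have "128 * pi * A / r\<^sup>2 + 256 / r ^ 4 * (G + 2 * pi * B) \<le> (1152 * pi * A + 256 * G + 512 * pi) * (1 / r ^ 5)" .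
      also have "\<dots> \<le> (1280 * pi * (A + G + 1)) * (1 / r ^ 5)"
      proof (intro mult_right_mono)
        have "256 * G \<le> 1280 * pi * G" using G0 pi_gt3 by (intro mult_right_mono) auto
        moreover have "0 \<le> pi * A" using A0 by simp
        moreover have "1280 * pi * (A + G + 1) = 1280 * (pi * A) + 1280 * pi * G + 1280 * pi" by (simp add: algebra_simps)
        moreover have "1152 * pi * A = 1152 * (pi * A)" by simp
        ultimately show "1152 * pi * A + 256 * G + 512 * pi \<le> 1280 * pi * (A + G + 1)"
          using pi_gt_zero by linarith
      qed (use r in auto)
      also have "\<dots> = 2 * pi * (640 / r ^ 5 * (A + G + 1))" by simp
      finally show "128 * pi * A / r\<^sup>2 + 256 / r ^ 4 * (G + 2 * pi * B) \<le> 2 * pi * (640 / r ^ 5 * (A + G + 1))" .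
    qed (use x in auto)
    also have "\<dots> = 2 * pi * (640 / r ^ 5 * (A + G + 1) / (x * sqrt x))" by simp
    finally show ?thesis by (rule mult_left_le_imp_le) (simp add: pi_gt_zero)
  qed
  show ?thesis
  proof (intro exI[of _ "Re a"] conjI allI)
    show "\<bar>Re a\<bar> \<le> A / r" using abs_Re_le_cmod[of a] na by linarith
    fix k
    have "Re (fps_nth h k) = Re (coeff p k) / N - pois x k * (1 + Re a * (real k - x) / x)"
    proof -
      have "fps_nth h k = coeff p k / N - of_real (pois x k) * (1 + a * of_real ((real k - x) / x))" by (simp add: hk)
      then show ?thesis by simp
    qed
    then show "\<bar>Re (coeff p k) / N - pois x k * (1 + Re a * (real k - x) / x)\<bar> \<le> 640 / r ^ 5 * (A + G + 1) / (x * sqrt x)"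
      using abs_Re_le_cmod[of "fps_nth h k"] bound[of k] by linarith
  qed
qed

section \<open>The width\<close>

lemma power_tangent_le:
  fixes a q :: real
  assumes "a \<ge> 0" "q \<ge> 0"
  shows "q ^ Suc m + real (Suc m) * q ^ m * (a - q) \<le> a ^ Suc m"
proof (induction m)
  case (Suc m)
  have "q ^ Suc (Suc m) + real (Suc (Suc m)) * q ^ Suc m * (a - q) + real (Suc m) * q ^ m * (a - q)\<^sup>2 =
      a * (q ^ Suc m + real (Suc m) * q ^ m * (a - q))"
    by (simp add: power2_eq_square algebra_simps)
  also have "\<dots> \<le> a * a ^ Suc m" using Suc.IH assms by (intro mult_left_mono)
  also have "\<dots> = a ^ Suc (Suc m)" by simp
  finally have "q ^ Suc (Suc m) + real (Suc (Suc m)) * q ^ Suc m * (a - q) + real (Suc m) * q ^ m * (a - q)\<^sup>2 \<le> a ^ Suc (Suc m)" .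
  moreover have "0 \<le> real (Suc m) * q ^ m * (a - q)\<^sup>2" using assms by simp
  ultimately show ?case by linarith
qed simp

text \<open>The tangent bound at the mean value \<open>q\<close> of f is integrated; its linear term
  integrates to 0.\<close>

lemma integral_power_Jensen:
  fixes f :: "real \<Rightarrow> real"
  assumes f: "continuous_on {-pi..pi} f" "\<And>\<theta>. \<theta> \<in> {-pi..pi} \<Longrightarrow> f \<theta> \<ge> 0"
  shows "(integral {-pi..pi} f) ^ Suc m \<le> (2 * pi) ^ m * integral {-pi..pi} (\<lambda>\<theta>. f \<theta> ^ Suc m)"
proof -
  define I where "I = integral {-pi..pi} f"
  define q where "q = I / (2 * pi)"
  have fi: "f integrable_on {-pi..pi}" using f by (intro integrable_continuous_real)
  have I: "I \<ge> 0" unfolding I_def by (intro integral_nonneg fi f)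
  have q: "q \<ge> 0" using I by (simp add: q_def)
  have "((\<lambda>\<theta>. q ^ Suc m + real (Suc m) * q ^ m * (f \<theta> - q)) has_integral
      (2 * pi * q ^ Suc m + real (Suc m) * q ^ m * (I - 2 * pi * q))) {-pi..pi}"
    unfolding I_def using has_integral_const_real[of "q ^ Suc m" "-pi" pi] has_integral_const_real[of q "-pi" pi]
    by (intro has_integral_add has_integral_mult_right has_integral_diff integrable_integral fi) simp_all
  then have "2 * pi * q ^ Suc m = integral {-pi..pi} (\<lambda>\<theta>. q ^ Suc m + real (Suc m) * q ^ m * (f \<theta> - q))"
    by (subst integral_unique) (auto simp: q_def)
  also have "\<dots> \<le> integral {-pi..pi} (\<lambda>\<theta>. f \<theta> ^ Suc m)"
    by (intro integral_le power_tangent_le q f integrable_continuous_real continuous_intros) auto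
  finally have "(2 * pi) ^ m * (2 * pi * q ^ Suc m) \<le> (2 * pi) ^ m * integral {-pi..pi} (\<lambda>\<theta>. f \<theta> ^ Suc m)"
    by (intro mult_left_mono) auto
  also have "(2 * pi) ^ m * (2 * pi * q ^ Suc m) = I ^ Suc m" by (simp add: q_def power_divide)
  finally show ?thesis by (simp only: I_def)
qed

lemma power_sum3_le:
  fixes a b c :: real
  assumes "a \<ge> 0" "b \<ge> 0" "c \<ge> 0"
  shows "(a + b + c) ^ m \<le> 3 ^ m * (a ^ m + b ^ m + c ^ m)"
proof -
  have "a + b + c \<le> 3 * max a (max b c)" by linarith
  then have "(a + b + c) ^ m \<le> (3 * max a (max b c)) ^ m" using assms by (intro power_mono) auto
  also have "\<dots> = 3 ^ m * (max a (max b c)) ^ m" by (rule power_mult_distrib)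
  also have "(max a (max b c)) ^ m \<le> a ^ m + b ^ m + c ^ m" using assms by (auto simp: max_def)
  finally show ?thesis by simp
qed

lemma level_size_le_width: "level_size t k \<le> width t"
  unfolding width_def by (rule Max_ge[OF finite_range_level_size]) simp

lemma level_size_eq_width: "\<exists>k. level_size t k = width t"
  using Max_in[OF finite_range_level_size[of t]] unfolding width_def by auto

section \<open>Expectations and the random profile\<close>

context inc_variety
begin

text \<open>Expectation over the random tree of n nodes as a quotient of coefficients; where the
  total weight is 0 its value is 0.\<close>

definition mean :: "nat \<Rightarrow> (otree \<Rightarrow> real) \<Rightarrow> real" where
  "mean n f = fps_nth (egf \<phi> f) n / fps_nth P n"

lemma mean_mono: "(\<And>t. t \<in> inc_trees n \<Longrightarrow> f t \<le> g t) \<Longrightarrow> mean n f \<le> mean n g"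
  unfolding mean_def by (intro divide_right_mono egf_mono P_nonneg)

lemma mean_cmult: "mean n (\<lambda>t. a * f t) = a * mean n f"
  by (simp add: mean_def egf_def sum_distrib_left mult_ac)

lemma mean_add: "mean n (\<lambda>t. f t + g t) = mean n f + mean n g"
proof -
  have "fps_nth (egf \<phi> (\<lambda>t. f t + g t)) n = fps_nth (egf \<phi> f) n + fps_nth (egf \<phi> g) n"
    by (simp add: egf_def distrib_left sum.distrib add_divide_distrib)
  then show ?thesis by (simp add: mean_def add_divide_distrib)
qed

lemma mean_const: "fps_nth P n > 0 \<Longrightarrow> mean n (\<lambda>t. a) = a"
  using egf_cmult_one[of a n] by (simp add: mean_def)

lemma mean_nonneg: "(\<And>t. t \<in> inc_trees n \<Longrightarrow> f t \<ge> 0) \<Longrightarrow> mean n f \<ge> 0"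
proof -
  assume f: "\<And>t. t \<in> inc_trees n \<Longrightarrow> f t \<ge> 0"
  have "mean n (\<lambda>t. 0) \<le> mean n f" by (rule mean_mono) (rule f)
  then show ?thesis by (simp add: mean_def egf_def)
qed

lemma mean_integral:
  assumes "\<And>t. t \<in> inc_trees n \<Longrightarrow> f t integrable_on {a..b}"
  shows "((\<lambda>\<theta>. mean n (\<lambda>t. f t \<theta>)) has_integral mean n (\<lambda>t. integral {a..b} (f t))) {a..b :: real}"
  unfolding mean_def egf_def fps_nth_Abs_fps
  by (rule has_integral_divide, rule has_integral_divide, rule has_integral_sum[OF finite_inc_trees],
      rule has_integral_mult_right, rule integrable_integral, rule assms)

text \<open>Jensen's inequality moves the power under the integral over \<theta>, and expectation
  and integral are exchanged. Thus moment bounds at fixed \<theta> control the random circle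
  averages.\<close>

lemma mean_integral_power_le:
  assumes P: "fps_nth P n > 0" and m: "m \<ge> 1"
    and f: "\<And>t. t \<in> inc_trees n \<Longrightarrow> continuous_on {-pi..pi} (f t)"
      "\<And>t \<theta>. t \<in> inc_trees n \<Longrightarrow> \<theta> \<in> {-pi..pi} \<Longrightarrow> f t \<theta> \<ge> (0::real)"
    and K: "\<And>\<theta>. \<theta> \<in> {-pi..pi} \<Longrightarrow> mean n (\<lambda>t. f t \<theta> ^ m) \<le> K"
  shows "mean n (\<lambda>t. integral {-pi..pi} (f t) ^ m) \<le> (2 * pi) ^ m * K"
proof -
  obtain j where j: "m = Suc j" using m by (cases m) auto
  have "mean n (\<lambda>t. integral {-pi..pi} (f t) ^ m) \<le> mean n (\<lambda>t. (2 * pi) ^ j * integral {-pi..pi} (\<lambda>\<theta>. f t \<theta> ^ m))"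
    unfolding j by (intro mean_mono integral_power_Jensen f) auto
  also have "\<dots> = (2 * pi) ^ j * mean n (\<lambda>t. integral {-pi..pi} (\<lambda>\<theta>. f t \<theta> ^ m))" by (rule mean_cmult)
  also have "mean n (\<lambda>t. integral {-pi..pi} (\<lambda>\<theta>. f t \<theta> ^ m)) \<le> 2 * pi * K"
  proof (rule has_integral_le)
    show "((\<lambda>\<theta>. mean n (\<lambda>t. f t \<theta> ^ m)) has_integral mean n (\<lambda>t. integral {-pi..pi} (\<lambda>\<theta>. f t \<theta> ^ m))) {-pi..pi}"
      by (intro mean_integral integrable_continuous_real continuous_on_power f)
    show "((\<lambda>\<theta>. K) has_integral 2 * pi * K) {-pi..pi}" using has_integral_const_real[of K "-pi" pi] by simp
  qed (rule K)
  finally show ?thesis by (simp add: j mult_ac)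
qed

text \<open>The scaling exp(-lam(x0-1))/n with lam = \<open>\<sigma>2 * ln n\<close> is the
  reciprocal of n to the power \<open>expo x0\<close>, so the normalized moments are bounded by
  constants.\<close>

lemma mean_scaled_power_le:
  assumes K: "fps_nth (Mom m u) n \<le> K * (fps_nth P n * n powr (m * expo x0))" and P: "fps_nth P n > 0" and n: "n \<ge> 1"
  shows "mean n (\<lambda>t. (norm (level_poly u t) / n * exp (- (\<sigma>2 * ln n) * (x0 - 1))) ^ m) \<le> K"
proof -
  define e where "e = exp (- (\<sigma>2 * ln n) * (x0 - 1)) / real n"
  have "n powr expo x0 = n * exp (\<sigma>2 * ln n * (x0 - 1))"
    using n by (simp add: expo_def powr_add) (simp add: powr_def mult_ac)
  then have e: "e * n powr expo x0 = 1"
    using n by (simp add: e_def exp_minus)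
  have "mean n (\<lambda>t. (norm (level_poly u t) / n * exp (- (\<sigma>2 * ln n) * (x0 - 1))) ^ m) =
      mean n (\<lambda>t. e ^ m * norm (level_poly u t) ^ m)"
    by (simp add: e_def power_mult_distrib power_divide mult.commute)
  also have "\<dots> = e ^ m * (fps_nth (Mom m u) n / fps_nth P n)" unfolding mean_cmult by (simp add: mean_def Mom_def)
  also have "\<dots> \<le> e ^ m * (K * n powr (m * expo x0))"
    using K P by (intro mult_left_mono) (auto simp: e_def divide_simps mult_ac)
  also have "\<dots> = K * (e * n powr expo x0) ^ m" using n by (simp add: power_mult_distrib powr_power mult_ac)
  finally show ?thesis by (simp add: e)
qed

text \<open>The random variable is built from the two circle averages of the deterministic profile
  bound, so a single one serves all levels k and bounds \<xi> as well.\<close>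

lemma level_profile:
  assumes m: "m \<ge> 1"
  shows "\<exists>K. \<forall>n. \<sigma>2 * ln (real n) \<ge> 1 \<longrightarrow> fps_nth P n > 0 \<longrightarrow> (\<exists>A. (\<forall>t. A t \<ge> 1) \<and> mean n (\<lambda>t. A t ^ m) \<le> K \<and>
    (\<forall>t\<in>inc_trees n. \<exists>\<xi>. \<bar>\<xi>\<bar> \<le> A t \<and> (\<forall>k. \<bar>real (level_size t k) / n - pois (\<sigma>2 * ln n) k * (1 + \<xi> * (real k - \<sigma>2 * ln n) / (\<sigma>2 * ln n))\<bar>
      \<le> A t / (\<sigma>2 * ln n * sqrt (\<sigma>2 * ln n)))))"
proof -
  obtain r0 K where r0: "r0 > 0" "K \<ge> 0" and K: "\<And>u x0 n. norm u \<le> 1 + r0 \<Longrightarrow> Re u \<le> x0 \<Longrightarrow> \<bar>x0 - 1\<bar> \<le> r0 \<Longrightarrow>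
      fps_nth (Mom m u) n \<le> K * (fps_nth P n * n powr (m * expo x0))"
    using moment_bounds[OF m] unfolding moment_bound_def by blast
  define r where "r = min r0 1"
  have r: "0 < r" "r \<le> 1" "r \<le> r0" using r0 by (auto simp: r_def)
  define C where "C = 640 / r ^ 5"
  have C: "C \<ge> 1 / r" "C \<ge> 1"
  proof -
    have "r ^ 5 \<le> r" "r ^ 5 \<le> 1" using r power_decreasing[of 1 5 r] by (auto simp: power_le_one)
    then have "1 / r \<le> 1 / r ^ 5" "1 / 1 \<le> 1 / r ^ 5" using r by (auto intro!: divide_left_mono)
    moreover have "1 / r ^ 5 \<le> C" using r by (simp add: C_def divide_right_mono)
    ultimately show "C \<ge> 1 / r" "C \<ge> 1" by linarith+
  qed
  show ?thesis
  proof (intro exI[of _ "C ^ m * (3 ^ m * ((2 * pi) ^ m * K + (2 * pi) ^ m * K + 1))"] allI impI)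
    fix n :: nat assume x: "\<sigma>2 * ln (real n) \<ge> 1" and P: "fps_nth P n > 0"
    define x where "x = \<sigma>2 * ln (real n)"
    have n: "n \<ge> 1" using P p_0 by (cases n) auto
    have x1: "x \<ge> 1" using x by (simp add: x_def)
    define f where "f s \<theta> = norm (level_poly (1 + of_real r * cis \<theta>) s) / n * exp (- x * (r * cos \<theta>))" for s \<theta>
    \<comment> \<open>min(1 - cos \<theta>, r) equals 1 - x0 for x0 = max(cos \<theta>, 1-r), an
      admissible exponent for u = \<open>cis \<theta>\<close>.\<close>
    define g where "g s \<theta> = norm (level_poly (cis \<theta>) s) / n * exp (x * min (1 - cos \<theta>) r)" for s \<theta>
    define A where "A s = C * (integral {-pi..pi} (f s) + integral {-pi..pi} (g s) + 1)" for s
    define pl where "pl s = (\<Sum>k<n. monom (of_nat (level_size s k)) k :: complex poly)" for s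
    have pl: "level_poly u s = poly (pl s) u" if "s \<in> inc_trees n" for u s
      using level_poly_eq[of s n u] length_labels_inc_trees[OF that] by (simp add: pl_def poly_sum poly_monom)
    have cf: "continuous_on {-pi..pi} (f s)" if "s \<in> inc_trees n" for s
      unfolding f_def pl[OF that] by (intro continuous_intros) (use n in auto)
    have cg: "continuous_on {-pi..pi} (g s)" if "s \<in> inc_trees n" for s
      unfolding g_def pl[OF that] by (intro continuous_intros) (use n in auto)
    have f0: "integral {-pi..pi} (f s) \<ge> 0" for s
      by (cases "f s integrable_on {-pi..pi}") (auto intro!: integral_nonneg simp: f_def not_integrable_integral)
    have g0: "integral {-pi..pi} (g s) \<ge> 0" for s
      by (cases "g s integrable_on {-pi..pi}") (auto intro!: integral_nonneg simp: g_def not_integrable_integral)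
    show "\<exists>A. (\<forall>t. A t \<ge> 1) \<and> mean n (\<lambda>t. A t ^ m) \<le> C ^ m * (3 ^ m * ((2 * pi) ^ m * K + (2 * pi) ^ m * K + 1)) \<and>
      (\<forall>t\<in>inc_trees n. \<exists>\<xi>. \<bar>\<xi>\<bar> \<le> A t \<and> (\<forall>k. \<bar>real (level_size t k) / n - pois (\<sigma>2 * ln n) k * (1 + \<xi> * (real k - \<sigma>2 * ln n) / (\<sigma>2 * ln n))\<bar>
      \<le> A t / (\<sigma>2 * ln n * sqrt (\<sigma>2 * ln n))))"
      unfolding x_def[symmetric]
    proof (intro exI[of _ A] conjI allI ballI)
      show "A s \<ge> 1" for s
        using mult_mono[of 1 C 1 "integral {-pi..pi} (f s) + integral {-pi..pi} (g s) + 1"] C f0[of s] g0[of s]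
        by (simp add: A_def)
      have mf: "mean n (\<lambda>s. integral {-pi..pi} (f s) ^ m) \<le> (2 * pi) ^ m * K"
      proof (rule mean_integral_power_le[OF P m cf])
        fix \<theta> :: real
        have "norm (1 + of_real r * cis \<theta>) \<le> 1 + r" using norm_triangle_ineq[of 1 "of_real r * cis \<theta>"] r by (simp add: norm_mult)
        moreover have "\<bar>r * cos \<theta>\<bar> \<le> r0" using mult_mono[of r r0 "\<bar>cos \<theta>\<bar>" 1] r by (simp add: abs_mult)
        ultimately have "fps_nth (Mom m (1 + of_real r * cis \<theta>)) n \<le> K * (fps_nth P n * n powr (m * expo (1 + r * cos \<theta>)))"
          using r by (intro K) auto
        from mean_scaled_power_le[OF this P n] show "mean n (\<lambda>s. f s \<theta> ^ m) \<le> K" by (simp add: f_def x_def)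
      qed (auto simp: f_def)
      have mg: "mean n (\<lambda>s. integral {-pi..pi} (g s) ^ m) \<le> (2 * pi) ^ m * K"
      proof (rule mean_integral_power_le[OF P m cg])
        fix \<theta> :: real
        have "\<bar>(1 - min (1 - cos \<theta>) r) - 1\<bar> \<le> r0" using r by (auto simp: min_def)
        then have "fps_nth (Mom m (cis \<theta>)) n \<le> K * (fps_nth P n * n powr (m * expo (1 - min (1 - cos \<theta>) r)))"
          using r by (intro K) auto
        from mean_scaled_power_le[OF this P n] show "mean n (\<lambda>s. g s \<theta> ^ m) \<le> K" by (simp add: g_def x_def)
      qed (auto simp: g_def)
      have "mean n (\<lambda>s. A s ^ m) = C ^ m * mean n (\<lambda>s. (integral {-pi..pi} (f s) + integral {-pi..pi} (g s) + 1) ^ m)"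
        unfolding A_def power_mult_distrib mean_cmult ..
      also have "\<dots> \<le> C ^ m * mean n (\<lambda>s. 3 ^ m * (integral {-pi..pi} (f s) ^ m + integral {-pi..pi} (g s) ^ m + 1 ^ m))"
        using C f0 g0 by (intro mult_left_mono mean_mono power_sum3_le) auto
      also have "mean n (\<lambda>s. 3 ^ m * (integral {-pi..pi} (f s) ^ m + integral {-pi..pi} (g s) ^ m + 1 ^ m)) =
          3 ^ m * (mean n (\<lambda>s. integral {-pi..pi} (f s) ^ m) + mean n (\<lambda>s. integral {-pi..pi} (g s) ^ m) + 1)"
        unfolding mean_cmult mean_add mean_const[OF P] by simp
      also have "C ^ m * \<dots> \<le> C ^ m * (3 ^ m * ((2 * pi) ^ m * K + (2 * pi) ^ m * K + 1))"
        using C by (intro mult_left_mono add_mono mf mg) auto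
      finally show "mean n (\<lambda>s. A s ^ m) \<le> C ^ m * (3 ^ m * ((2 * pi) ^ m * K + (2 * pi) ^ m * K + 1))" .
    next
      fix s assume s: "s \<in> inc_trees n"
      have "poly (pl s) 1 = of_real (real n)" using pl[OF s, of 1] length_labels_inc_trees[OF s] by (simp add: level_poly_one)
      note prof = poly_poisson_profile[OF x1 r(1,2) this]
      have fs: "f s = (\<lambda>\<theta>. norm (poly (pl s) (1 + of_real r * cis \<theta>)) / n * exp (- x * (r * cos \<theta>)))"
        "g s = (\<lambda>\<theta>. norm (poly (pl s) (cis \<theta>)) / n * exp (x * min (1 - cos \<theta>) r))"
        by (simp_all only: fun_eq_iff f_def g_def pl[OF s]) simp_all
      obtain \<xi> where \<xi>: "\<bar>\<xi>\<bar> \<le> integral {-pi..pi} (f s) / r"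
        "\<And>k. \<bar>Re (coeff (pl s) k) / n - pois x k * (1 + \<xi> * (real k - x) / x)\<bar> \<le>
          640 / r ^ 5 * (integral {-pi..pi} (f s) + integral {-pi..pi} (g s) + 1) / (x * sqrt x)"
        using prof n unfolding fs[symmetric] by auto
      have c: "Re (coeff (pl s) k) = real (level_size s k)" for k
      proof -
        have "coeff (pl s) k = (\<Sum>i<n. if i = k then of_nat (level_size s i) else 0)" by (simp add: pl_def coeff_sum)
        also have "\<dots> = of_nat (level_size s k)"
          using level_size_ge[of s k] length_labels_inc_trees[OF s] by (simp add: not_less)
        finally show ?thesis by simp
      qed
      show "\<exists>\<xi>. \<bar>\<xi>\<bar> \<le> A s \<and> (\<forall>k. \<bar>real (level_size s k) / n - pois x k * (1 + \<xi> * (real k - x) / x)\<bar> \<le> A s / (x * sqrt x))"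
      proof (intro exI[of _ \<xi>] conjI allI)
        have "integral {-pi..pi} (f s) * (1 / r) \<le> (integral {-pi..pi} (f s) + integral {-pi..pi} (g s) + 1) * C"
          using C f0[of s] g0[of s] r by (intro mult_mono) auto
        then show "\<bar>\<xi>\<bar> \<le> A s" using \<xi>(1) by (simp add: A_def mult.commute)
        show "\<bar>real (level_size s k) / n - pois x k * (1 + \<xi> * (real k - x) / x)\<bar> \<le> A s / (x * sqrt x)" for k
          using \<xi>(2)[of k] unfolding c A_def C_def .
      qed
    qed
  qed
qed

text \<open>From n = 3 on log n \<ge> 1, so \<open>Lg n\<close> is the plain logarithm and the
  Poisson parameter is at least 1.\<close>

lemma width_profile:
  assumes m: "m \<ge> 1"
  shows "\<exists>K\<ge>1. \<forall>n\<ge>3. fps_nth P n > 0 \<longrightarrow> (\<exists>A. (\<forall>t. A t \<ge> 1) \<and> mean n (\<lambda>t. A t ^ m) \<le> K \<and>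
    (\<forall>t\<in>inc_trees n. \<bar>real (width t) / n - pois (\<sigma>2 * Lg n) (mode (\<sigma>2 * Lg n))\<bar> \<le> 43 * (A t)\<^sup>2 / (\<sigma>2 * Lg n * sqrt (\<sigma>2 * Lg n)) \<and>
      (\<forall>k. level_size t k = width t \<longrightarrow> \<sigma>2 * Lg n \<le> 4001 * A t \<or> \<bar>real k - \<sigma>2 * Lg n\<bar> \<le> 4001 * A t)))"
proof -
  obtain K where K: "\<And>n. \<sigma>2 * ln (real n) \<ge> 1 \<Longrightarrow> fps_nth P n > 0 \<Longrightarrow> (\<exists>A. (\<forall>t. A t \<ge> 1) \<and> mean n (\<lambda>t. A t ^ m) \<le> K \<and>
    (\<forall>t\<in>inc_trees n. \<exists>\<xi>. \<bar>\<xi>\<bar> \<le> A t \<and> (\<forall>k. \<bar>real (level_size t k) / n - pois (\<sigma>2 * ln n) k * (1 + \<xi> * (real k - \<sigma>2 * ln n) / (\<sigma>2 * ln n))\<bar>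
      \<le> A t / (\<sigma>2 * ln n * sqrt (\<sigma>2 * ln n)))))"
    using level_profile[OF m] by blast
  show ?thesis
  proof (intro exI[of _ "max K 1"] conjI allI impI)
    fix n :: nat assume n: "n \<ge> 3" and P: "fps_nth P n > 0"
    have l: "ln (real n) \<ge> 1" using n exp_le ln_ge_iff[of "real n" 1] by force
    then have Lg: "Lg n = ln (real n)" by (simp add: Lg_def)
    have "1 * 1 \<le> \<sigma>2 * ln (real n)" using l \<alpha>_pos by (intro mult_mono) (auto simp: \<sigma>2_def)
    then have x: "\<sigma>2 * ln (real n) \<ge> 1" by simp
    obtain A where A: "\<And>t. A t \<ge> 1" "mean n (\<lambda>t. A t ^ m) \<le> K"
      "\<And>t. t \<in> inc_trees n \<Longrightarrow> \<exists>\<xi>. \<bar>\<xi>\<bar> \<le> A t \<and> (\<forall>k. \<bar>real (level_size t k) / n - pois (\<sigma>2 * ln n) k * (1 + \<xi> * (real k - \<sigma>2 * ln n) / (\<sigma>2 * ln n))\<bar>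
      \<le> A t / (\<sigma>2 * ln n * sqrt (\<sigma>2 * ln n)))"
      using K[OF x P] by blast
    show "\<exists>A. (\<forall>t. A t \<ge> 1) \<and> mean n (\<lambda>t. A t ^ m) \<le> max K 1 \<and>
    (\<forall>t\<in>inc_trees n. \<bar>real (width t) / n - pois (\<sigma>2 * Lg n) (mode (\<sigma>2 * Lg n))\<bar> \<le> 43 * (A t)\<^sup>2 / (\<sigma>2 * Lg n * sqrt (\<sigma>2 * Lg n)) \<and>
      (\<forall>k. level_size t k = width t \<longrightarrow> \<sigma>2 * Lg n \<le> 4001 * A t \<or> \<bar>real k - \<sigma>2 * Lg n\<bar> \<le> 4001 * A t))"
      unfolding Lg
    proof (intro exI[of _ A] conjI allI ballI impI A(1))
      show "mean n (\<lambda>t. A t ^ m) \<le> max K 1" using A(2) by simp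
      fix s assume s: "s \<in> inc_trees n"
      obtain \<xi> where \<xi>: "\<bar>\<xi>\<bar> \<le> A s" "\<And>k. \<bar>real (level_size s k) / n - pois (\<sigma>2 * ln n) k * (1 + \<xi> * (real k - \<sigma>2 * ln n) / (\<sigma>2 * ln n))\<bar>
          \<le> A s / (\<sigma>2 * ln n * sqrt (\<sigma>2 * ln n))" using A(3)[OF s] by blast
      have W: "real (level_size s k) / n \<le> real (width s) / n" for k
        using level_size_le_width by (intro divide_right_mono) auto
      obtain k0 where k0: "level_size s k0 = width s" using level_size_eq_width by blast
      show "\<bar>real (width s) / n - pois (\<sigma>2 * ln n) (mode (\<sigma>2 * ln n))\<bar> \<le> 43 * (A s)\<^sup>2 / (\<sigma>2 * ln n * sqrt (\<sigma>2 * ln n))"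
        by (rule poisson_profile_max(1)[OF x A(1) \<xi> W, of k0]) (simp add: k0)
      fix k assume "level_size s k = width s"
      then show "\<sigma>2 * ln n \<le> 4001 * A s \<or> \<bar>real k - \<sigma>2 * ln n\<bar> \<le> 4001 * A s"
        by (intro poisson_profile_max(2)[OF x A(1) \<xi> W]) simp
    qed
  qed simp
qed

end

section \<open>The three assertions for a normalized variety\<close>

context inc_variety
begin

text \<open>Chooses the random variables for all n at once, with the constant 1 where the profile
  bound says nothing, so that the lower bound 1 holds unconditionally.\<close>

lemma width_profileE:
  assumes m: "m \<ge> 1"
  obtains K A where "K \<ge> 1" "\<And>n t. A n t \<ge> (1::real)"
    "\<And>n. n \<ge> 3 \<Longrightarrow> fps_nth P n > 0 \<Longrightarrow> mean n (\<lambda>t. A n t ^ m) \<le> K"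
    "\<And>n t. n \<ge> 3 \<Longrightarrow> fps_nth P n > 0 \<Longrightarrow> t \<in> inc_trees n \<Longrightarrow>
      \<bar>real (width t) / n - pois (\<sigma>2 * Lg n) (mode (\<sigma>2 * Lg n))\<bar> \<le> 43 * (A n t)\<^sup>2 / (\<sigma>2 * Lg n * sqrt (\<sigma>2 * Lg n))"
    "\<And>n t k. n \<ge> 3 \<Longrightarrow> fps_nth P n > 0 \<Longrightarrow> t \<in> inc_trees n \<Longrightarrow> level_size t k = width t \<Longrightarrow>
      \<sigma>2 * Lg n \<le> 4001 * A n t \<or> \<bar>real k - \<sigma>2 * Lg n\<bar> \<le> 4001 * A n t"
proof -
  define Q where "Q K n A \<longleftrightarrow> (\<forall>t. A t \<ge> 1) \<and> mean n (\<lambda>t. A t ^ m) \<le> K \<and>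
    (\<forall>t\<in>inc_trees n. \<bar>real (width t) / n - pois (\<sigma>2 * Lg n) (mode (\<sigma>2 * Lg n))\<bar> \<le> 43 * (A t)\<^sup>2 / (\<sigma>2 * Lg n * sqrt (\<sigma>2 * Lg n)) \<and>
      (\<forall>k. level_size t k = width t \<longrightarrow> \<sigma>2 * Lg n \<le> 4001 * A t \<or> \<bar>real k - \<sigma>2 * Lg n\<bar> \<le> 4001 * A t))" for K n A
  obtain K where K: "K \<ge> 1" "\<And>n. n \<ge> 3 \<Longrightarrow> fps_nth P n > 0 \<Longrightarrow> \<exists>A. Q K n A"
    using width_profile[OF m] unfolding Q_def by blast
  define A where "A n = (if n \<ge> 3 \<and> fps_nth P n > 0 then SOME A. Q K n A else (\<lambda>_. 1))" for n
  have A: "Q K n (A n)" if "n \<ge> 3" "fps_nth P n > 0" for n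
    using someI_ex[OF K(2)[OF that]] that by (simp add: A_def)
  show ?thesis
  proof (rule that[OF K(1)])
    show "A n s \<ge> 1" for n s
    proof (cases "n \<ge> 3 \<and> fps_nth P n > 0")
      case True
      then show ?thesis using A[of n] by (auto simp: Q_def)
    next
      case False
      then have "A n = (\<lambda>_. 1)" unfolding A_def by (rule if_not_P)
      then show ?thesis by simp
    qed
  qed (use A in \<open>auto simp: Q_def\<close>)
qed

lemma \<sigma>2_bounds: "1 \<le> \<sigma>2" "\<sigma>2 \<le> 2"
  using \<alpha>_pos \<alpha>_le_1 by (auto simp: \<sigma>2_def)

lemma Lg_ge_1: "Lg n \<ge> 1"
  by (simp add: Lg_def)

lemma mean_power_mono:
  assumes "\<And>t. A t \<ge> (1::real)" "i \<le> m" shows "mean n (\<lambda>t. A t ^ i) \<le> mean n (\<lambda>t. A t ^ m)"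
  using assms by (intro mean_mono power_increasing) auto

lemma mean_width_near:
  assumes "fps_nth P n > 0" "n \<ge> 1" and A: "\<And>t. A t \<ge> 1" "mean n (\<lambda>t. (A t)\<^sup>2) \<le> K"
    and W: "\<And>t. t \<in> inc_trees n \<Longrightarrow> \<bar>real (width t) / n - M\<bar> \<le> 43 * (A t)\<^sup>2 * H"
    and H: "H \<ge> 0"
  shows "\<bar>mean n (\<lambda>t. real (width t)) / n - M\<bar> \<le> 43 * K * H"
proof -
  have e: "mean n (\<lambda>t. real (width t) / n) = mean n (\<lambda>t. real (width t)) / n"
    using mean_cmult[of n "1 / real n" "\<lambda>t. real (width t)"] by simp
  have "mean n (\<lambda>t. real (width t) / n) \<le> mean n (\<lambda>t. M + 43 * H * (A t)\<^sup>2)"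
    using W by (intro mean_mono) (force simp: mult_ac)
  also have "\<dots> = M + 43 * H * mean n (\<lambda>t. (A t)\<^sup>2)" unfolding mean_add mean_cmult mean_const[OF assms(1)] ..
  also have "\<dots> \<le> M + 43 * H * K" using A H by (intro add_left_mono mult_left_mono) auto
  finally have 1: "mean n (\<lambda>t. real (width t) / n) \<le> M + 43 * H * K" .
  have "M + - (43 * H) * K \<le> M + - (43 * H) * mean n (\<lambda>t. (A t)\<^sup>2)"
    using A H by (intro add_left_mono mult_left_mono_neg) auto
  also have "\<dots> = mean n (\<lambda>t. M + - (43 * H) * (A t)\<^sup>2)" unfolding mean_add mean_cmult mean_const[OF assms(1)] ..
  also have "\<dots> \<le> mean n (\<lambda>t. real (width t) / n)"
    using W by (intro mean_mono) (force simp: mult_ac)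
  finally show ?thesis using 1 unfolding e by (simp add: abs_le_iff mult_ac)
qed

text \<open>The deviation of W/n from the mode has mean O(x^(-3/2)), which relative to 1/sqrt(2 pi
  x) is O(1/x), the order of the Stirling error.\<close>

lemma mean_width_estimate:
  "\<exists>C\<ge>0. \<forall>n\<ge>3. fps_nth P n > 0 \<longrightarrow>
    \<bar>mean n (\<lambda>t. real (width t)) * sqrt (2 * pi * \<sigma>2 * Lg n) / n - 1\<bar> \<le> C / Lg n"
proof -
  obtain K A0 where K: "K \<ge> 1" and A0: "\<And>n t. A0 n t \<ge> (1::real)"
    "\<And>n. n \<ge> 3 \<Longrightarrow> fps_nth P n > 0 \<Longrightarrow> mean n (\<lambda>t. (A0 n t)\<^sup>2) \<le> K"
    "\<And>n t. n \<ge> 3 \<Longrightarrow> fps_nth P n > 0 \<Longrightarrow> t \<in> inc_trees n \<Longrightarrow>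
      \<bar>real (width t) / n - pois (\<sigma>2 * Lg n) (mode (\<sigma>2 * Lg n))\<bar> \<le> 43 * (A0 n t)\<^sup>2 / (\<sigma>2 * Lg n * sqrt (\<sigma>2 * Lg n))"
    by (rule width_profileE[of 2]) auto
  show ?thesis
  proof (intro exI[of _ "172 * K + 40"] conjI allI impI)
    fix n :: nat assume n: "n \<ge> 3" and P: "fps_nth P n > 0"
    define x where "x = \<sigma>2 * Lg n"
    have "1 * Lg n \<le> \<sigma>2 * Lg n" using \<sigma>2_bounds Lg_ge_1[of n] by (intro mult_right_mono) auto
    then have x: "x \<ge> Lg n" "x \<ge> 1" using Lg_ge_1[of n] unfolding x_def by linarith+
    define M where "M = pois x (mode x)"
    define A where "A = A0 n"
    have A: "\<And>t. A t \<ge> 1" "mean n (\<lambda>t. (A t)\<^sup>2) \<le> K"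
      "\<And>t. t \<in> inc_trees n \<Longrightarrow> \<bar>real (width t) / n - M\<bar> \<le> 43 * (A t)\<^sup>2 * (1 / (x * sqrt x))"
      using A0(1) A0(2,3)[OF n P] by (auto simp: x_def M_def A_def)
    let ?W = "mean n (\<lambda>t. real (width t)) / n" and ?q = "sqrt (2 * pi * x)"
    have near: "\<bar>?W - M\<bar> \<le> 43 * K * (1 / (x * sqrt x))"
      by (rule mean_width_near[OF P _ A]) (use n x in auto)
    have q: "?q = sqrt (2 * pi) * sqrt x" by (rule real_sqrt_mult)
    have q4: "sqrt (2 * pi) \<le> 4" using pi_less_4 by (auto intro!: real_le_lsqrt)
    have "\<bar>?W - M\<bar> * ?q \<le> 43 * K * (1 / (x * sqrt x)) * ?q" using near x by (intro mult_right_mono) auto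
    also have "\<dots> = 43 * K * sqrt (2 * pi) / x" unfolding q using x by simp
    also have "\<dots> \<le> 43 * K * 4 / x" using q4 K x by (intro divide_right_mono mult_left_mono) auto
    finally have "\<bar>?W - M\<bar> * ?q \<le> 172 * K / x" by simp
    moreover have "\<bar>?W * ?q - M * ?q\<bar> = \<bar>?W - M\<bar> * ?q" using x by (simp only: left_diff_distrib[symmetric] abs_mult) simp
    ultimately have 1: "\<bar>?W * ?q - M * ?q\<bar> \<le> 172 * K / x" by linarith
    have 2: "\<bar>M * ?q - 1\<bar> \<le> 40 / x" unfolding M_def by (rule pois_mode_estimate(1)[OF x(2)])
    have "\<bar>?W * ?q - 1\<bar> \<le> 172 * K / x + 40 / x" using 1 2 by linarith
    also have "\<dots> = (172 * K + 40) / x" by (simp add: add_divide_distrib)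
    also have "\<dots> \<le> (172 * K + 40) / Lg n" using x K Lg_ge_1[of n] by (intro divide_left_mono) auto
    finally show "\<bar>mean n (\<lambda>t. real (width t)) * sqrt (2 * pi * \<sigma>2 * Lg n) / n - 1\<bar> \<le> (172 * K + 40) / Lg n"
      by (simp add: x_def mult.assoc)
  qed (use K in auto)
qed

lemma width_central_moment:
  assumes s: "s \<ge> 0"
  shows "\<exists>C\<ge>0. \<forall>n\<ge>3. fps_nth P n > 0 \<longrightarrow>
    mean n (\<lambda>t. \<bar>real (width t) - mean n (\<lambda>t. real (width t))\<bar> powr s) \<le> C * (real n powr s * Lg n powr (- 3 * s / 2))"
proof -
  \<comment> \<open>The deviation is quadratic in A, so the s-th moment calls for order 2s; the
    added 2 also secures E A^2, used for the mean.\<close>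
  define m where "m = nat \<lceil>2 * s\<rceil> + 2"
  have m: "m \<ge> 2" "real m \<ge> 2 * s" by (auto simp: m_def) linarith
  obtain K A0 where K: "K \<ge> 1" and A0: "\<And>n t. A0 n t \<ge> (1::real)"
    "\<And>n. n \<ge> 3 \<Longrightarrow> fps_nth P n > 0 \<Longrightarrow> mean n (\<lambda>t. A0 n t ^ m) \<le> K"
    "\<And>n t. n \<ge> 3 \<Longrightarrow> fps_nth P n > 0 \<Longrightarrow> t \<in> inc_trees n \<Longrightarrow>
      \<bar>real (width t) / n - pois (\<sigma>2 * Lg n) (mode (\<sigma>2 * Lg n))\<bar> \<le> 43 * (A0 n t)\<^sup>2 / (\<sigma>2 * Lg n * sqrt (\<sigma>2 * Lg n))"
    by (rule width_profileE[of m]) (use m in auto)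
  define c0 where "c0 = 43 * (1 + K)"
  have c0: "c0 \<ge> 0" using K by (simp add: c0_def)
  show ?thesis
  proof (intro exI[of _ "c0 powr s * K"] conjI allI impI)
    fix n :: nat assume n: "n \<ge> 3" and P: "fps_nth P n > 0"
    define x where "x = \<sigma>2 * Lg n"
    have "1 * Lg n \<le> \<sigma>2 * Lg n" using \<sigma>2_bounds Lg_ge_1[of n] by (intro mult_right_mono) auto
    then have x: "x \<ge> Lg n" "x \<ge> 1" using Lg_ge_1[of n] unfolding x_def by linarith+
    define M where "M = pois x (mode x)"
    define H where "H = 1 / (x * sqrt x)"
    have H: "H \<ge> 0" using x by (simp add: H_def)
    define A where "A = A0 n"
    have A: "\<And>t. A t \<ge> 1" "mean n (\<lambda>t. A t ^ m) \<le> K"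
      and W: "\<And>t. t \<in> inc_trees n \<Longrightarrow> \<bar>real (width t) / n - M\<bar> \<le> 43 * (A t)\<^sup>2 * H"
      using A0(1) A0(2,3)[OF n P] by (auto simp: x_def M_def H_def A_def)
    have A2: "mean n (\<lambda>t. (A t)\<^sup>2) \<le> K"
      by (rule order.trans[OF mean_power_mono[of A 2 m n, OF A(1) m(1)] A(2)])
    define w where "w = mean n (\<lambda>t. real (width t))"
    have near: "\<bar>w / n - M\<bar> \<le> 43 * K * H" unfolding w_def
      by (rule mean_width_near[OF P _ A(1) A2 W H]) (use n in auto)
    have "\<bar>real (width t) - w\<bar> powr s \<le> (n * (c0 * H)) powr s * A t ^ m" if t: "t \<in> inc_trees n" for t
    proof -
      have A1: "1 \<le> (A t)\<^sup>2" using A(1)[of t] by simp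
      then have "43 * K * H * 1 \<le> 43 * K * H * (A t)\<^sup>2" using K H by (intro mult_left_mono) auto
      then have "\<bar>real (width t) / n - w / n\<bar> \<le> c0 * H * (A t)\<^sup>2"
        using W[OF t] near by (simp add: c0_def algebra_simps)
      then have "n * \<bar>real (width t) / n - w / n\<bar> \<le> n * (c0 * H * (A t)\<^sup>2)" by (intro mult_left_mono) auto
      moreover have "n * \<bar>real (width t) / n - w / n\<bar> = \<bar>real (width t) - w\<bar>" using n by (simp add: diff_divide_distrib[symmetric])
      ultimately have "\<bar>real (width t) - w\<bar> powr s \<le> (n * (c0 * H) * (A t)\<^sup>2) powr s"
        using s by (intro powr_mono2) (auto simp: mult_ac)
      also have "\<dots> = (n * (c0 * H)) powr s * (A t)\<^sup>2 powr s" by (rule powr_mult)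
      also have "(A t)\<^sup>2 powr s = A t powr (2 * s)" using A(1)[of t] by (simp add: powr_powr[symmetric] powr_numeral)
      also have "A t powr (2 * s) \<le> A t powr (real m)" using A(1)[of t] m by (intro powr_mono) auto
      also have "A t powr (real m) = A t ^ m" using A(1)[of t] by (intro powr_realpow) linarith
      finally show ?thesis by (simp add: mult_left_mono)
    qed
    then have "mean n (\<lambda>t. \<bar>real (width t) - w\<bar> powr s) \<le> mean n (\<lambda>t. (n * (c0 * H)) powr s * A t ^ m)"
      by (rule mean_mono)
    also have "\<dots> = (n * (c0 * H)) powr s * mean n (\<lambda>t. A t ^ m)" by (rule mean_cmult)
    also have "\<dots> \<le> (n * (c0 * H)) powr s * K" using A(2) by (intro mult_left_mono) auto
    also have "\<dots> = c0 powr s * K * (n powr s * H powr s)" by (simp add: powr_mult)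
    also have "\<dots> \<le> c0 powr s * K * (n powr s * Lg n powr (- 3 * s / 2))"
    proof (intro mult_left_mono)
      have l: "Lg n > 0" using Lg_ge_1[of n] by linarith
      have "Lg n * sqrt (Lg n) \<le> x * sqrt x" using x l by (intro mult_mono) auto
      then have "H \<le> 1 / (Lg n * sqrt (Lg n))" unfolding H_def using l x by (intro divide_left_mono) auto
      also have "\<dots> = Lg n powr (- (3 / 2))"
      proof -
        have "Lg n * sqrt (Lg n) = Lg n powr (1 + 1 / 2)" using l by (simp only: powr_add powr_half_sqrt) simp
        then show ?thesis by (simp add: powr_minus_divide)
      qed
      finally have "H powr s \<le> (Lg n powr (- (3 / 2))) powr s" using H s by (intro powr_mono2) auto
      then show "H powr s \<le> Lg n powr (- 3 * s / 2)" by (simp add: powr_powr)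
    qed (use K in auto)
    finally show "mean n (\<lambda>t. \<bar>real (width t) - mean n (\<lambda>t. real (width t))\<bar> powr s) \<le> c0 powr s * K * (real n powr s * Lg n powr (- 3 * s / 2))"
      unfolding w_def .
  qed (use K in auto)
qed

lemma exp_le_powr:
  assumes "a > (0::real)"
  shows "\<exists>C\<ge>0. \<forall>T>1. exp (- (a * T)) \<le> C * T powr (- B)"
proof -
  define j where "j = nat \<lceil>B\<rceil> + 1"
  have j: "real j \<ge> B" "j \<ge> 1" by (auto simp: j_def) linarith
  show ?thesis
  proof (intro exI[of _ "(real j / a) ^ j"] conjI allI impI)
    fix T :: real assume T: "T > 1"
    define z where "z = a * T / j"
    have z: "z > 0" using assms T j by (simp add: z_def)
    have "z ^ j \<le> exp z ^ j" using z order.trans[OF _ exp_ge_add_one_self[of z], of z] by (intro power_mono) auto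
    also have "\<dots> = exp (a * T)" using j by (simp add: z_def exp_of_nat_mult[symmetric])
    finally have "1 / exp (a * T) \<le> 1 / z ^ j" using z by (intro divide_left_mono) auto
    then have "exp (- (a * T)) \<le> 1 / z ^ j" by (simp add: exp_minus divide_inverse)
    also have "\<dots> = (real j / a) ^ j * T powr (- real j)"
      using assms T j by (simp add: z_def powr_minus powr_realpow power_divide power_mult_distrib divide_simps)
    also have "\<dots> \<le> (real j / a) ^ j * T powr (- B)" using assms T j by (intro mult_left_mono powr_mono) auto
    finally show "exp (- (a * T)) \<le> (real j / a) ^ j * T powr (- B)" .
  qed (use assms in auto)
qed

text \<open>Markov's inequality at u = 1 + r: an occupied level k \<ge> T contributes at least
  (1+r)^T to S(1+r), whose mean is O(n^3) because \<open>\<sigma>2 * r\<close> \<le> 2.\<close>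

lemma level_tail:
  "\<exists>r>0. \<exists>K\<ge>0. \<forall>n T. n \<ge> 1 \<longrightarrow> fps_nth P n > 0 \<longrightarrow>
    mean n (\<lambda>t. if \<exists>k. real k \<ge> T \<and> level_size t k \<ge> 1 then 1 else 0) \<le> K * real n powr 3 * (1 + r) powr (- T)"
proof -
  obtain r0 K where r0: "r0 > 0" "K \<ge> 0" and K: "\<And>u x0 n. norm u \<le> 1 + r0 \<Longrightarrow> Re u \<le> x0 \<Longrightarrow> \<bar>x0 - 1\<bar> \<le> r0 \<Longrightarrow>
      fps_nth (Mom 1 u) n \<le> K * (fps_nth P n * n powr (real 1 * expo x0))"
    using moment_bound_1 unfolding moment_bound_def by blast
  define r where "r = min r0 1"
  have r: "0 < r" "r \<le> 1" "r \<le> r0" using r0 by (auto simp: r_def)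
  show ?thesis
  proof (rule exI[of _ r], rule conjI[OF r(1)], rule exI[of _ K], rule conjI[OF r0(2)], intro allI impI)
    fix n :: nat and T :: real assume n: "n \<ge> 1" and P: "fps_nth P n > 0"
    let ?u = "complex_of_real (1 + r)"
    have "mean n (\<lambda>t. if \<exists>k. real k \<ge> T \<and> level_size t k \<ge> 1 then 1 else 0) \<le>
        mean n (\<lambda>t. (1 + r) powr (- T) * norm (level_poly ?u t) ^ 1)"
    proof (rule mean_mono)
      fix s assume s: "s \<in> inc_trees n"
      show "(if \<exists>k. real k \<ge> T \<and> level_size s k \<ge> 1 then 1 else 0) \<le> (1 + r) powr (- T) * norm (level_poly ?u s) ^ 1"
      proof (cases "\<exists>k. real k \<ge> T \<and> level_size s k \<ge> 1")
        case True
        then obtain k where k: "real k \<ge> T" "level_size s k \<ge> 1" by blast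
        have kn: "k < n" using level_size_ge[of s k] k length_labels_inc_trees[OF s] by (cases "n \<le> k") auto
        have "1 * (1 + r) ^ k \<le> real (level_size s k) * (1 + r) ^ k" using k r by (intro mult_right_mono) auto
        also have "\<dots> \<le> (\<Sum>i<n. real (level_size s i) * (1 + r) ^ i)"
          using kn r by (intro member_le_sum) auto
        also have "\<dots> = norm (of_real (\<Sum>i<n. real (level_size s i) * (1 + r) ^ i) :: complex)"
          unfolding norm_of_real using r by (subst abs_of_nonneg) (auto intro!: sum_nonneg)
        also have "(of_real (\<Sum>i<n. real (level_size s i) * (1 + r) ^ i) :: complex) = level_poly ?u s"
          using level_poly_eq[of s n ?u] length_labels_inc_trees[OF s] by simp
        finally have "(1 + r) ^ k \<le> norm (level_poly ?u s)" by simp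
        moreover have "(1 + r) powr T \<le> (1 + r) powr real k" using k r by (intro powr_mono) auto
        ultimately have "(1 + r) powr T \<le> norm (level_poly ?u s)" using r by (simp add: powr_realpow)
        then have "(1 + r) powr (- T) * (1 + r) powr T \<le> (1 + r) powr (- T) * norm (level_poly ?u s)"
          by (intro mult_left_mono) auto
        then show ?thesis using True r by (simp flip: powr_add)
      qed auto
    qed
    also have "\<dots> = (1 + r) powr (- T) * (fps_nth (Mom 1 ?u) n / fps_nth P n)" unfolding mean_cmult by (simp add: mean_def Mom_def)
    also have "\<dots> \<le> (1 + r) powr (- T) * (K * n powr 3)"
    proof (intro mult_left_mono)
      have "fps_nth (Mom 1 ?u) n \<le> K * (fps_nth P n * n powr (real 1 * expo (1 + r)))"
        using r by (intro K) (auto simp del: of_real_add)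
      then have "fps_nth (Mom 1 ?u) n / fps_nth P n \<le> K * n powr expo (1 + r)" using P by (simp add: pos_divide_le_eq mult_ac)
      also have "\<dots> \<le> K * n powr 3"
      proof (intro mult_left_mono powr_mono)
        have "\<sigma>2 * r \<le> 2 * 1" using \<sigma>2_bounds r by (intro mult_mono) auto
        then show "expo (1 + r) \<le> 3" by (simp add: expo_def)
      qed (use n r0 in auto)
      finally show "fps_nth (Mom 1 ?u) n / fps_nth P n \<le> K * n powr 3" .
    qed simp
    finally show "mean n (\<lambda>t. if \<exists>k. real k \<ge> T \<and> level_size t k \<ge> 1 then 1 else 0) \<le> K * real n powr 3 * (1 + r) powr (- T)"
      by (simp only: mult_ac)
  qed
qed

lemma width_pos: "width s \<ge> 1"
proof -
  have "level_size s 0 = 1" by (cases s) simp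
  then show ?thesis using level_size_le_width[of s 0] by simp
qed

text \<open>Two regimes. For T up to a multiple of L_n the profile forces A to be at least a
  constant times T, and Markov's inequality with the m-th moment applies; the alternative that A is
  of order L_n fits in since then T = O(A). For larger T a level at distance T from the mean has
  number at least T, where occupied levels are exponentially rare.\<close>

lemma widest_level_tail:
  assumes B: "B > (0::real)" and ks: "\<And>n t. t \<in> inc_trees n \<Longrightarrow> level_size t (ks t) = width t"
  shows "\<exists>T0>1. \<exists>C. \<forall>T>T0. \<forall>n. fps_nth P n > 0 \<longrightarrow>
    mean n (\<lambda>t. if \<bar>real (ks t) - \<sigma>2 * Lg n\<bar> \<ge> T then 1 else 0) \<le> C * T powr (- B)"
proof -
  define m where "m = nat \<lceil>B\<rceil> + 1"
  have m: "m \<ge> 1" "real m \<ge> B" by (auto simp: m_def) linarith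
  obtain K A0 where K: "K \<ge> 1" and A0: "\<And>n t. A0 n t \<ge> (1::real)"
    "\<And>n. n \<ge> 3 \<Longrightarrow> fps_nth P n > 0 \<Longrightarrow> mean n (\<lambda>t. A0 n t ^ m) \<le> K"
    "\<And>n t k. n \<ge> 3 \<Longrightarrow> fps_nth P n > 0 \<Longrightarrow> t \<in> inc_trees n \<Longrightarrow> level_size t k = width t \<Longrightarrow>
      \<sigma>2 * Lg n \<le> 4001 * A0 n t \<or> \<bar>real k - \<sigma>2 * Lg n\<bar> \<le> 4001 * A0 n t"
    by (rule width_profileE[OF m(1)], rule that; assumption)
  obtain r K' where r: "r > 0" "K' \<ge> 0" "\<And>n T. n \<ge> 1 \<Longrightarrow> fps_nth P n > 0 \<Longrightarrow>
    mean n (\<lambda>t. if \<exists>k. real k \<ge> T \<and> level_size t k \<ge> 1 then 1 else 0) \<le> K' * real n powr 3 * (1 + r) powr (- T)"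
    using level_tail by blast
  define a where "a = ln (1 + r) / 2"
  have a: "a > 0" using r by (simp add: a_def)
  \<comment> \<open>2 bounds \<open>\<sigma>2\<close>, so in the second regime no level below the
    mean is at distance T; 3/a gives n^3 \<le> exp(a T), which takes half of the decay (1+r)^(-T) =
    exp(-2 a T).\<close>
  define \<kappa>0 where "\<kappa>0 = max 2 (3 / a)"
  have \<kappa>0: "\<kappa>0 \<ge> 2" "3 / \<kappa>0 \<le> a" using a by (auto simp: \<kappa>0_def max_def field_simps)
  obtain C0 where C0: "C0 \<ge> 0" "\<And>T. T > 1 \<Longrightarrow> exp (- (a * T)) \<le> C0 * T powr (- B)" using exp_le_powr[OF a] by blast
  define c1 where "c1 = 4001 * \<kappa>0"
  have c1: "c1 \<ge> 4001" using \<kappa>0 by (simp add: c1_def)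
  define C where "C = K * c1 ^ m + K' * C0"
  show ?thesis
  proof (rule exI[of _ "\<kappa>0 + 1"], rule conjI, use \<kappa>0 in simp, rule exI[of _ C], intro allI impI)
    fix T :: real and n :: nat assume T: "T > \<kappa>0 + 1" and P: "fps_nth P n > 0"
    have T1: "T > 1" using T \<kappa>0 by linarith
    have n: "n \<ge> 1" using P p_0 by (cases n) auto
    let ?I = "\<lambda>t. if \<bar>real (ks t) - \<sigma>2 * Lg n\<bar> \<ge> T then 1 else (0 :: real)"
    have Tp: "T powr (- B) > 0" using T1 by simp
    show "mean n ?I \<le> C * T powr (- B)"
    proof (cases "T \<le> \<kappa>0 * Lg n")
      case True
      \<comment> \<open>For n \<le> 2 one has L_n = 1, and T would be at most
        \<open>\<kappa>0\<close>, against the choice of T0.\<close>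
      have n3: "n \<ge> 3"
      proof (rule ccontr)
        assume "\<not> n \<ge> 3"
        then have "n \<le> 2" by simp
        then have "ln (real n) \<le> ln 2" using n by (subst ln_le_cancel_iff) auto
        then have "Lg n = 1" using ln_2_less_1 by (simp add: Lg_def)
        then show False using True T by simp
      qed
      define A where "A = A0 n"
      have A: "\<And>t. A t \<ge> 1" "mean n (\<lambda>t. A t ^ m) \<le> K"
        "\<And>t k. t \<in> inc_trees n \<Longrightarrow> level_size t k = width t \<Longrightarrow> \<sigma>2 * Lg n \<le> 4001 * A t \<or> \<bar>real k - \<sigma>2 * Lg n\<bar> \<le> 4001 * A t"
        using A0(1) A0(2,3)[OF n3 P] by (simp_all add: A_def)
      have "mean n ?I \<le> mean n (\<lambda>t. (c1 / T) ^ m * A t ^ m)"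
      proof (rule mean_mono)
        fix s assume s: "s \<in> inc_trees n"
        show "?I s \<le> (c1 / T) ^ m * A s ^ m"
        proof (cases "\<bar>real (ks s) - \<sigma>2 * Lg n\<bar> \<ge> T")
          case far: True
          have "T \<le> c1 * A s"
            using A(3)[OF s ks[OF s]]
          proof
            assume "\<sigma>2 * Lg n \<le> 4001 * A s"
            moreover have "1 * Lg n \<le> \<sigma>2 * Lg n" using \<sigma>2_bounds Lg_ge_1[of n] by (intro mult_right_mono) auto
            ultimately have "\<kappa>0 * Lg n \<le> \<kappa>0 * (4001 * A s)" using \<kappa>0 by (intro mult_left_mono) auto
            then show ?thesis using True by (simp add: c1_def mult_ac)
          next
            assume "\<bar>real (ks s) - \<sigma>2 * Lg n\<bar> \<le> 4001 * A s"
            moreover have "4001 * A s \<le> c1 * A s" using c1 A(1)[of s] by (intro mult_right_mono) auto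
            ultimately show ?thesis using far by linarith
          qed
          then have "1 \<le> c1 / T * A s" using T1 by (simp add: field_simps)
          then have "1 \<le> (c1 / T * A s) ^ m" by (rule one_le_power)
          then show ?thesis using far unfolding power_mult_distrib by simp
        next
          case False
          then show ?thesis using A(1)[of s] c1 T1 by simp
        qed
      qed
      also have "\<dots> = (c1 / T) ^ m * mean n (\<lambda>t. A t ^ m)" by (rule mean_cmult)
      also have "\<dots> \<le> (c1 / T) ^ m * K" using A(2) c1 T1 by (intro mult_left_mono) auto
      also have "\<dots> = K * c1 ^ m * T powr (- real m)" using T1 by (simp add: power_mult_distrib power_inverse powr_minus powr_realpow divide_inverse)
      also have "\<dots> \<le> K * c1 ^ m * T powr (- B)" using K c1 T1 m by (intro mult_left_mono powr_mono) auto
      also have "\<dots> \<le> C * T powr (- B)" unfolding C_def using r C0 by (intro mult_right_mono) auto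
      finally show ?thesis .
    next
      case False
      then have L: "Lg n < T / \<kappa>0" using \<kappa>0 by (simp add: field_simps)
      have "mean n ?I \<le> mean n (\<lambda>t. if \<exists>k. real k \<ge> T \<and> level_size t k \<ge> 1 then 1 else 0)"
      proof (rule mean_mono)
        fix s assume s: "s \<in> inc_trees n"
        have lk: "level_size s (ks s) \<ge> 1" using ks[OF s] width_pos[of s] by simp
        have sL: "\<sigma>2 * Lg n \<le> \<kappa>0 * Lg n" "0 * Lg n \<le> \<sigma>2 * Lg n"
          using \<sigma>2_bounds \<kappa>0 Lg_ge_1[of n] by (intro mult_right_mono; linarith)+
        have "\<sigma>2 * Lg n < T" "\<sigma>2 * Lg n \<ge> 0" using False sL by linarith+
        then have "real (ks s) \<ge> T" if "\<bar>real (ks s) - \<sigma>2 * Lg n\<bar> \<ge> T" using that by linarith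
        then show "?I s \<le> (if \<exists>k. real k \<ge> T \<and> level_size s k \<ge> 1 then 1 else 0)" using lk by auto
      qed
      also have "\<dots> \<le> K' * real n powr 3 * (1 + r) powr (- T)" by (rule r(3)[OF n P])
      also have "\<dots> \<le> K' * exp (a * T) * (1 + r) powr (- T)"
      proof (intro mult_right_mono mult_left_mono)
        have "ln (real n) \<le> Lg n" by (simp add: Lg_def)
        moreover have "3 * (T / \<kappa>0) = T * (3 / \<kappa>0)" by simp
        ultimately have "3 * ln (real n) \<le> T * (3 / \<kappa>0)" using L by linarith
        also have "\<dots> \<le> T * a" using \<kappa>0 T1 by (intro mult_left_mono) auto
        finally show "real n powr 3 \<le> exp (a * T)" using n by (simp add: powr_def mult.commute)
      qed (use r in auto)
      also have "\<dots> = K' * exp (- (a * T))"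
        using r by (simp add: powr_def a_def mult.assoc flip: exp_add)
      also have "\<dots> \<le> K' * (C0 * T powr (- B))" using r by (intro mult_left_mono C0 T1) auto
      also have "\<dots> \<le> C * T powr (- B)" unfolding C_def using K c1 Tp by (simp add: distrib_right)
      finally show ?thesis .
    qed
  qed
qed

end

section \<open>Normalization\<close>

lemma tree_weight_smult: "tree_weight (smult \<rho> \<phi>) t = \<rho> ^ length (labels t) * tree_weight \<phi> t"
proof (induction t)
  case (Node a ts)
  have "prod_list (map (tree_weight (smult \<rho> \<phi>)) ts) = \<rho> ^ length (concat (map labels ts)) * prod_list (map (tree_weight \<phi>) ts)"
    using Node by (induction ts) (simp_all add: power_add mult_ac)
  then show ?case by (simp add: mult_ac)
qed

lemma egf_smult: "fps_nth (egf (smult \<rho> \<phi>) f) n = of_real (\<rho> ^ n) * fps_nth (egf \<phi> f) n"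
proof -
  have "(\<Sum>t\<in>inc_trees n. of_real (tree_weight (smult \<rho> \<phi>) t) * f t) = (\<Sum>t\<in>inc_trees n. of_real (\<rho> ^ n) * (of_real (tree_weight \<phi> t) * f t))"
    by (intro sum.cong refl) (simp add: tree_weight_smult length_labels_inc_trees mult_ac)
  then show ?thesis by (simp add: egf_def sum_distrib_left)
qed

lemma expectation_random_inc_tree:
  fixes f :: "otree \<Rightarrow> real"
  assumes "\<And>j. coeff \<phi> j \<ge> 0" "total_weight \<phi> n > 0"
  shows "measure_pmf.expectation (random_inc_tree \<phi> n) f = fps_nth (egf \<phi> f) n / fps_nth (egf \<phi> (\<lambda>t. 1)) n"
proof -
  have "measure_pmf.expectation (random_inc_tree \<phi> n) f = (\<Sum>t\<in>inc_trees n. f t * pmf (random_inc_tree \<phi> n) t)"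
    using assms by (intro integral_measure_pmf_real finite_inc_trees) (auto simp: set_pmf_eq pmf_random_inc_tree split: if_splits)
  also have "\<dots> = (\<Sum>t\<in>inc_trees n. tree_weight \<phi> t * f t / total_weight \<phi> n)"
    using assms by (intro sum.cong refl) (simp add: pmf_random_inc_tree)
  also have "\<dots> = (\<Sum>t\<in>inc_trees n. tree_weight \<phi> t * f t) / total_weight \<phi> n" by (rule sum_divide_distrib[symmetric])
  finally show ?thesis by (simp add: egf_def total_weight_def)
qed

text \<open>\<rho> is the supremum of an increasing primitive of 1/\<phi>. It is finite because
  \<phi>(v) is at least a constant times 1 + v^2, from d \<ge> 2 and the positive end coefficients,
  so an arctangent dominates.\<close>

lemma exists_inc_variety:
  fixes \<phi> :: "real poly"
  assumes d: "d \<ge> 2" "degree \<phi> = d" and nonneg: "\<And>j. coeff \<phi> j \<ge> 0" and pos: "coeff \<phi> 0 > 0" "coeff \<phi> d > 0"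
  shows "\<exists>\<rho>>0. \<exists>F. inc_variety (smult \<rho> \<phi>) d F"
proof -
  define c where "c = min (coeff \<phi> 0) (coeff \<phi> d)"
  have c: "c > 0" using pos by (simp add: c_def)
  have lower: "c / 2 * (1 + v\<^sup>2) \<le> poly \<phi> v" if v: "v \<ge> 0" for v
  proof -
    have "coeff \<phi> 0 * v ^ 0 + coeff \<phi> d * v ^ d = (\<Sum>j\<in>{0, d}. coeff \<phi> j * v ^ j)" using d by simp
    also have "\<dots> \<le> (\<Sum>j\<le>degree \<phi>. coeff \<phi> j * v ^ j)"
      using v nonneg d by (intro sum_mono2) auto
    finally have 1: "coeff \<phi> 0 + coeff \<phi> d * v ^ d \<le> poly \<phi> v" by (simp add: poly_altdef)
    have "c * 1 + c * v ^ d \<le> coeff \<phi> 0 * 1 + coeff \<phi> d * v ^ d"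
      using v by (intro add_mono mult_right_mono) (auto simp: c_def)
    then have 2: "c * (1 + v ^ d) \<le> poly \<phi> v" using 1 by (simp add: algebra_simps)
    have "(1 + v\<^sup>2) / 2 \<le> 1 + v ^ d"
    proof (cases "v \<le> 1")
      case True
      then have "v\<^sup>2 \<le> 1" using v by (simp add: power_le_one)
      then show ?thesis using v by (auto intro: order.trans[of _ 1])
    next
      case False
      then have "v\<^sup>2 \<le> v ^ d" using d by (intro power_increasing) auto
      moreover have "0 \<le> v\<^sup>2" "(1 + v\<^sup>2) / 2 = 1 / 2 + v\<^sup>2 / 2" by (auto simp: add_divide_distrib)
      ultimately show ?thesis by linarith
    qed
    then have "c * ((1 + v\<^sup>2) / 2) \<le> c * (1 + v ^ d)" using c by (intro mult_left_mono) auto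
    then show ?thesis using 2 by simp
  qed
  have ppos: "poly \<phi> v > 0" if "v \<ge> 0" for v
  proof -
    have "0 < c / 2 * (1 + v\<^sup>2)" using c by (simp add: add_pos_nonneg)
    then show ?thesis using lower[OF that] by linarith
  qed
  \<comment> \<open>The integrand is continued constantly to the left of 0 and integrated from -1,
    which gives \<open>G\<close> a two-sided derivative also at 0.\<close>
  define g where "g v = 1 / poly \<phi> (max v 0)" for v
  define G where "G w = integral {-1..w} g" for w
  have cg: "continuous_on A g" for A
    unfolding g_def by (intro continuous_intros) (use ppos[of "max v 0" for v] in \<open>force simp: less_le\<close>)
  have dG: "(G has_real_derivative 1 / poly \<phi> w) (at w)" if w: "w \<ge> 0" for w
  proof -
    have "((\<lambda>u. integral {-1..u} g) has_vector_derivative g w) (at w within {-1..w + 1})"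
      by (rule integral_has_vector_derivative[OF cg]) (use w in auto)
    then have "(G has_vector_derivative g w) (at w)"
      unfolding G_def[abs_def] using w at_within_Icc_at[of "-1" w "w + 1"] by simp
    then show ?thesis using w by (simp add: g_def has_real_derivative_iff_has_vector_derivative max_def)
  qed
  have mono: "G v \<le> G w" if "0 \<le> v" "v \<le> w" for v w
    using that(2)
  proof (rule DERIV_nonneg_imp_nondecreasing)
    fix u assume "v \<le> u" "u \<le> w"
    then show "\<exists>D. (G has_real_derivative D) (at u) \<and> 0 \<le> D" using dG[of u] ppos[of u] that
      by (intro exI[of _ "1 / poly \<phi> u"]) auto
  qed
  have bounded: "G w - G 0 \<le> pi / c" if w: "w \<ge> 0" for w
  proof -
    have "2 / c * arctan 0 - G 0 \<le> 2 / c * arctan w - G w"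
    proof (rule DERIV_nonneg_imp_nondecreasing[OF w])
      fix v :: real assume v: "0 \<le> v" "v \<le> w"
      have "((\<lambda>v. 2 / c * arctan v - G v) has_real_derivative 2 / c * inverse (1 + v\<^sup>2) - 1 / poly \<phi> v) (at v)"
        using v by (intro DERIV_diff DERIV_cmult DERIV_arctan dG)
      moreover have "1 / poly \<phi> v \<le> 1 / (c / 2 * (1 + v\<^sup>2))"
        using lower[of v] c v ppos[of v] by (intro divide_left_mono) (auto intro!: mult_pos_pos add_pos_nonneg)
      moreover have "1 / (c / 2 * (1 + v\<^sup>2)) = 2 / c * inverse (1 + v\<^sup>2)"
        by (simp only: divide_inverse inverse_mult_distrib inverse_inverse_eq mult_1_left mult_ac)
      ultimately have "0 \<le> 2 / c * inverse (1 + v\<^sup>2) - 1 / poly \<phi> v" by linarith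
      moreover note \<open>((\<lambda>v. 2 / c * arctan v - G v) has_real_derivative 2 / c * inverse (1 + v\<^sup>2) - 1 / poly \<phi> v) (at v)\<close>
      ultimately show "\<exists>D. ((\<lambda>v. 2 / c * arctan v - G v) has_real_derivative D) (at v) \<and> 0 \<le> D" by blast
    qed
    moreover have "2 / c * arctan w \<le> 2 / c * (pi / 2)" using arctan_ubound[of w] c by (intro mult_left_mono) auto
    ultimately show ?thesis by simp
  qed
  define \<rho> where "\<rho> = (SUP w\<in>{0..}. G w - G 0)"
  have bdd: "bdd_above ((\<lambda>w. G w - G 0) ` {0..})" using bounded by (intro bdd_aboveI2[of _ _ "pi / c"]) auto
  have up: "G w - G 0 \<le> \<rho>" if "w \<ge> 0" for w
    unfolding \<rho>_def using that by (intro cSUP_upper bdd) auto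
  have "G 0 < G 1" by (rule DERIV_pos_imp_increasing) (use dG ppos in force)+
  then have \<rho>: "\<rho> > 0" using up[of 1] by linarith
  have lim: "((\<lambda>w. G w - G 0) \<longlongrightarrow> \<rho>) at_top"
  proof (rule increasing_tendsto)
    show "\<forall>\<^sub>F w in at_top. G w - G 0 \<le> \<rho>" using eventually_ge_at_top[of 0] by eventually_elim (rule up)
    fix x assume "x < \<rho>"
    then obtain w where w: "w \<ge> 0" "x < G w - G 0" unfolding \<rho>_def using less_cSUP_iff[OF _ bdd] by auto
    show "\<forall>\<^sub>F w in at_top. x < G w - G 0"
      using eventually_ge_at_top[of w]
    proof eventually_elim
      case (elim v)
      then show ?case using mono[of w v] w by linarith
    qed
  qed
  define F where "F w = (G w - G 0) / \<rho>" for w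
  have "inc_variety (smult \<rho> \<phi>) d F"
    unfolding inc_variety_def
  proof unfold_locales
    show "2 \<le> d" "degree (smult \<rho> \<phi>) = d" "coeff (smult \<rho> \<phi>) 0 > 0" using d \<rho> pos by auto
    show "coeff (smult \<rho> \<phi>) j \<ge> 0" for j using \<rho> nonneg by simp
    show "fps_nth (egf (smult \<rho> \<phi>) (\<lambda>t. 1 :: real)) 0 = 0" by (simp add: egf_def inc_trees_0)
    show "real (Suc n) * fps_nth (egf (smult \<rho> \<phi>) (\<lambda>t. 1)) (Suc n) =
        fps_nth (poly_fps (smult \<rho> \<phi>) (Abs_fps (\<lambda>n. fps_nth (egf (smult \<rho> \<phi>) (\<lambda>t. 1)) n))) n" for n
      unfolding fps_nth_inverse by (rule egf_one_rec)
    show "(F has_real_derivative 1 / poly (smult \<rho> \<phi>) w) (at w)" if "w \<ge> 0" for w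
    proof -
      have "(F has_real_derivative (1 / poly \<phi> w - 0) / \<rho>) (at w)"
        unfolding F_def by (intro DERIV_cdivide DERIV_diff dG that DERIV_const)
      then show ?thesis by (simp add: mult.commute)
    qed
    show "F 0 = 0" by (simp add: F_def)
    show "(F \<longlongrightarrow> 1) at_top" using tendsto_divide[OF lim tendsto_const[of \<rho>]] \<rho> by (simp add: F_def[abs_def])
  qed
  then show ?thesis using \<rho> by blast
qed

theorem mainTheorem7:
  fixes d :: nat and \<phi> :: "real poly" and kstar :: "otree \<Rightarrow> nat"
  assumes "d \<ge> 2"
    and "degree \<phi> = d"
    and "\<And>j. j \<le> d \<Longrightarrow> coeff \<phi> j \<ge> 0"
    and "coeff \<phi> 0 > 0" and "coeff \<phi> d > 0"
    and "\<And>n t. t \<in> inc_trees n \<Longrightarrow> level_size t (kstar t) = width t"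
  shows "let \<sigma>2 = real d / (real d - 1); F = sizes_to_infinity \<phi> in
     (\<exists>\<epsilon>\<in>O[F](\<lambda>n. 1 / Lg n).
        \<forall>\<^sub>F n in F. expected_width \<phi> n = real n / sqrt (2 * pi * \<sigma>2 * Lg n) * (1 + \<epsilon> n)) \<and>
     (\<forall>s::real. s \<ge> 0 \<longrightarrow>
        (\<lambda>n. measure_pmf.expectation (random_inc_tree \<phi> n)
               (\<lambda>t. \<bar>real (width t) - expected_width \<phi> n\<bar> powr s))
          \<in> O[F](\<lambda>n. real n powr s * Lg n powr (- 3 * s / 2))) \<and>
     (\<forall>B::real. B > 0 \<longrightarrow>
        (\<exists>T0>1. \<exists>C. \<forall>T>T0. \<forall>n. total_weight \<phi> n > 0 \<longrightarrow>
           measure_pmf.prob (random_inc_tree \<phi> n)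
             {t. \<bar>real (kstar t) - real d / (real d - 1) * Lg n\<bar> \<ge> T}
             \<le> C * T powr (- B)))"
proof -
  have nonneg: "coeff \<phi> j \<ge> 0" for j
    using assms(2,3) by (cases "j \<le> d") (auto simp: coeff_eq_0)
  obtain \<rho> G where \<rho>: "\<rho> > 0" and V: "inc_variety (smult \<rho> \<phi>) d G"
    using exists_inc_variety[OF assms(1,2) nonneg assms(4,5)] by blast
  interpret V: inc_variety "smult \<rho> \<phi>" d G by (rule V)
  have pos: "fps_nth V.P n > 0" if "total_weight \<phi> n > 0" for n
    unfolding egf_smult using that \<rho> by (simp add: egf_def total_weight_def)
  have mean: "measure_pmf.expectation (random_inc_tree \<phi> n) f = V.mean n f" if "total_weight \<phi> n > 0" for n f
    unfolding expectation_random_inc_tree[OF nonneg that] V.mean_def egf_smult using \<rho> by simp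
  define \<sigma>2 where "\<sigma>2 = real d / (real d - 1)"
  have s2: "V.\<sigma>2 = \<sigma>2" using assms(1) by (simp add: V.\<sigma>2_eq \<sigma>2_def of_nat_diff)
  have s2pos: "\<sigma>2 > 0" using assms(1) by (simp add: \<sigma>2_def)
  let ?F = "sizes_to_infinity \<phi>"
  \<comment> \<open>Eventually along this filter means for all large n with positive total weight;
    the estimates hold from n = 3 on.\<close>
  have ev: "\<forall>\<^sub>F n in ?F. Q n" if "\<And>n. n \<ge> 3 \<Longrightarrow> total_weight \<phi> n > 0 \<Longrightarrow> Q n" for Q
    unfolding sizes_to_infinity_def eventually_inf_principal
    using eventually_ge_at_top[of "3::nat"] by eventually_elim (use that in auto)
  have Lg: "Lg n > 0" for n using V.Lg_ge_1[of n] by linarith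
  have W: "expected_width \<phi> n = V.mean n (\<lambda>t. real (width t))" if "total_weight \<phi> n > 0" for n
    unfolding expected_width_def by (rule mean[OF that])
  have part1: "\<exists>\<epsilon>\<in>O[?F](\<lambda>n. 1 / Lg n).
        \<forall>\<^sub>F n in ?F. expected_width \<phi> n = real n / sqrt (2 * pi * \<sigma>2 * Lg n) * (1 + \<epsilon> n)"
  proof -
    obtain C where C: "C \<ge> 0" "\<And>n. n \<ge> 3 \<Longrightarrow> fps_nth V.P n > 0 \<Longrightarrow>
        \<bar>V.mean n (\<lambda>t. real (width t)) * sqrt (2 * pi * \<sigma>2 * Lg n) / n - 1\<bar> \<le> C / Lg n"
      using V.mean_width_estimate unfolding s2 by blast
    let ?\<epsilon> = "\<lambda>n. expected_width \<phi> n * sqrt (2 * pi * \<sigma>2 * Lg n) / n - 1"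
    show ?thesis
    proof (intro bexI[of _ ?\<epsilon>] bigoI[where c = C] ev)
      fix n :: nat assume n: "n \<ge> 3" "total_weight \<phi> n > 0"
      show "norm (?\<epsilon> n) \<le> C * norm (1 / Lg n)" using C(2)[OF n(1) pos[OF n(2)]] W[OF n(2)] Lg[of n] by simp
      show "expected_width \<phi> n = real n / sqrt (2 * pi * \<sigma>2 * Lg n) * (1 + ?\<epsilon> n)"
        using n(1) s2pos Lg[of n] by simp
    qed
  qed
  have part2: "(\<lambda>n. measure_pmf.expectation (random_inc_tree \<phi> n) (\<lambda>t. \<bar>real (width t) - expected_width \<phi> n\<bar> powr s))
          \<in> O[?F](\<lambda>n. real n powr s * Lg n powr (- 3 * s / 2))" if s: "s \<ge> 0" for s
  proof -
    obtain C where C: "C \<ge> 0" "\<And>n. n \<ge> 3 \<Longrightarrow> fps_nth V.P n > 0 \<Longrightarrow>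
        V.mean n (\<lambda>t. \<bar>real (width t) - V.mean n (\<lambda>t. real (width t))\<bar> powr s) \<le> C * (real n powr s * Lg n powr (- 3 * s / 2))"
      using V.width_central_moment[OF s] by blast
    show ?thesis
    proof (intro bigoI[where c = C] ev)
      fix n :: nat assume n: "n \<ge> 3" "total_weight \<phi> n > 0"
      have "V.mean n (\<lambda>t. \<bar>real (width t) - V.mean n (\<lambda>t. real (width t))\<bar> powr s) \<ge> 0"
        by (rule V.mean_nonneg) simp
      then show "norm (measure_pmf.expectation (random_inc_tree \<phi> n) (\<lambda>t. \<bar>real (width t) - expected_width \<phi> n\<bar> powr s)) \<le>
          C * norm (real n powr s * Lg n powr (- 3 * s / 2))"
        using C(2)[OF n(1) pos[OF n(2)]] unfolding mean[OF n(2)] W[OF n(2)] by simp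
    qed
  qed
  have part3: "\<exists>T0>1. \<exists>C. \<forall>T>T0. \<forall>n. total_weight \<phi> n > 0 \<longrightarrow>
      measure_pmf.prob (random_inc_tree \<phi> n) {t. \<bar>real (kstar t) - \<sigma>2 * Lg n\<bar> \<ge> T} \<le> C * T powr (- B)" if B: "B > 0" for B
  proof -
    have "measure_pmf.prob (random_inc_tree \<phi> n) {t. \<bar>real (kstar t) - \<sigma>2 * Lg n\<bar> \<ge> T} =
        V.mean n (\<lambda>t. if \<bar>real (kstar t) - \<sigma>2 * Lg n\<bar> \<ge> T then 1 else 0)" if "total_weight \<phi> n > 0" for n T
    proof -
      have "measure_pmf.prob (random_inc_tree \<phi> n) {t. \<bar>real (kstar t) - \<sigma>2 * Lg n\<bar> \<ge> T} =
          measure_pmf.expectation (random_inc_tree \<phi> n) (indicator {t. \<bar>real (kstar t) - \<sigma>2 * Lg n\<bar> \<ge> T})" by simp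
      also have "\<dots> = V.mean n (indicator {t. \<bar>real (kstar t) - \<sigma>2 * Lg n\<bar> \<ge> T})" by (rule mean[OF that])
      also have "indicator {t. \<bar>real (kstar t) - \<sigma>2 * Lg n\<bar> \<ge> T} = (\<lambda>t. if \<bar>real (kstar t) - \<sigma>2 * Lg n\<bar> \<ge> T then 1 else (0::real))"
        by (auto simp: fun_eq_iff indicator_def)
      finally show ?thesis .
    qed
    moreover obtain T0 C where "T0 > 1" "\<And>T n. T > T0 \<Longrightarrow> fps_nth V.P n > 0 \<Longrightarrow>
        V.mean n (\<lambda>t. if \<bar>real (kstar t) - \<sigma>2 * Lg n\<bar> \<ge> T then 1 else 0) \<le> C * T powr (- B)"
    proof -
      have "\<exists>T0>1. \<exists>C. \<forall>T>T0. \<forall>n. fps_nth V.P n > 0 \<longrightarrow>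
          V.mean n (\<lambda>t. if \<bar>real (kstar t) - V.\<sigma>2 * Lg n\<bar> \<ge> T then 1 else 0) \<le> C * T powr (- B)"
        by (rule V.widest_level_tail[OF B]) (rule assms(6))
      then show ?thesis using that unfolding s2 by blast
    qed
    ultimately show ?thesis using pos by (intro exI[of _ T0] conjI exI[of _ C]) auto
  qed
  show ?thesis unfolding Let_def \<sigma>2_def[symmetric] using part1 part2 part3 by blast
qed

end
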